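(* (a) For any unimodular second-countable locally compact groups with fixed Haar measures $G^\circ,H^\circ$, the convergence of sequences in $\operatorname{Polh}(G^\circ,H^\circ)$ defined in the context is metrizable, and the set $\operatorname{Polh}(G^\circ,H^\circ)$ is compact. (b) The product of polyhomomorphisms $\operatorname{Polh}(G^\circ,H^\circ)\times\operatorname{Polh}(H^\circ,K^\circ)\to\operatorname{Polh}(G^\circ,K^\circ)$, $(R^\circ,T^\circ)\mapsto T^\circ R^\circ$, is separately continuous, for any unimodular second-countable locally compact groups with fixed Haar measures $G^\circ,H^\circ,K^\circ$.
   Context: All locally compact groups are second countable. $G^\circ=(G,\gamma)$, $H^\circ=(H,\eta)$, etc. denote unimodular groups with fixed Haar measures. The set $\operatorname{Polh}(G^\circ,H^\circ)$ of polyhomomorphisms consists of: the zero measure $0_{G,H}$ on $G\times H$; and all pairs $R^\circ=(R,\rho)$ where $R\subset G\times H$ is a closed subgroup and $\rho$ is a Haar measure on $R$ whose image under the projection to $G$ is dominated by $\gamma$ (i.e. the $\rho$-measure of $R\cap(A\times H)$ is $\le\gamma(A)$ for all Borel $A$) and whose image under the projection to $H$ is dominated by $\eta$. For a subgroup $R\subset G\times H$: $\operatorname{dom}R$, $\operatorname{im}R$ are its projections to $G$ and $H$; $\ker R=\{g:(g,1)\in R\}$; $\operatorname{indef}R=\{h:(1,h)\in R\}$. For nonzero $R^\circ$ the image of $\rho$ in $G$ equals $\alpha(R^\circ)\gamma|_{\operatorname{dom}R}$ and the image in $H$ equals $\beta(R^\circ)\eta|_{\operatorname{im}R}$, with constants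 $0<\alpha(R^\circ),\beta(R^\circ)\le1$. Product: for nonzero $R^\circ\in\operatorname{Polh}(G^\circ,H^\circ)$, $T^\circ\in\operatorname{Polh}(H^\circ,K^\circ)$ the product $S^\circ=T^\circ R^\circ$ has underlying subgroup $S=TR=\{(g,k): \exists h\in H,\ (g,h)\in R,\ (h,k)\in T\}\subset G\times K$, with Haar measure normalized by $$\alpha(S^\circ)=\frac{\alpha(R^\circ)\alpha(T^\circ)}{[\operatorname{indef}R:(\operatorname{indef}R\cap\operatorname{dom}T)]},\qquad \beta(S^\circ)=\frac{\beta(R^\circ)\beta(T^\circ)}{[\ker T:(\ker T\cap\operatorname{im}R)]}.$$ A product with a zero factor is zero. Convergence: regard each polyhomomorphism as a measure on $G\times H$ (the measure $\rho$ supported by $R$, or the zero measure). A sequence $R_j^\circ=(R_j,\rho_j)$ converges to $R^\circ=(R,\rho)$ if for all $\varphi\in C_c(G)$, $\psi\in C_c(H)$ (continuous functions with compact support) $\int\varphi(g)\psi(h)\,d\rho_j(g,h)\to\int\varphi(g)\psi(h)\,d\rho(g,h)$; equivalently, $\int\theta\,d\rho_j\to\int\theta\,d\rho$ for every $\theta\in C_c(G\times H)$. Convergence to $0_{G,H}$ means that all these integrals tend to $0$. *)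

theory Defs
  imports "HOL-Analysis.Analysis"
begin

text \<open>
  Groups are written additively, so that the library classes \<^class>\<open>group_add\<close> and
  \<^class>\<open>topological_group_add\<close> apply; these classes do not assume commutativity.  On a product
  type the group operation is componentwise and the topology is the product topology.
\<close>

definition add_subgroup :: "'a::group_add set \<Rightarrow> bool" where
  "add_subgroup S \<longleftrightarrow> 0 \<in> S \<and> (\<forall>x\<in>S. \<forall>y\<in>S. x + y \<in> S) \<and> (\<forall>x\<in>S. - x \<in> S)"

text \<open>
  A (left) Haar measure on a closed subgroup \<open>S\<close> is a measure whose underlying space is \<open>S\<close>.  In a
  second countable locally compact Hausdorff group, finiteness on compact sets already implies
  regularity.
\<close>

definition haar_measure_on :: "'a::{group_add, topological_space} set \<Rightarrow> 'a measure \<Rightarrow> bool" where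
  "haar_measure_on S M \<longleftrightarrow>
     sets M = sets (restrict_space borel S) \<and>
     emeasure M S \<noteq> 0 \<and>
     (\<forall>C. compact C \<and> C \<subseteq> S \<longrightarrow> emeasure M C < \<infinity>) \<and>
     (\<forall>x\<in>S. \<forall>A\<in>sets M. emeasure M ((\<lambda>y. x + y) ` A) = emeasure M A)"

definition unimodular_haar_measure :: "'a::{group_add, topological_space} measure \<Rightarrow> bool" where
  "unimodular_haar_measure M \<longleftrightarrow>
     haar_measure_on UNIV M \<and>
     (\<forall>x. \<forall>A\<in>sets M. emeasure M ((\<lambda>y. y + x) ` A) = emeasure M A)"

datatype ('g, 'h) polyhom =
  Zero
| Poly "('g \<times> 'h) set" "('g \<times> 'h) measure"

definition Polh ::
  "'g::{group_add, topological_space} measure \<Rightarrow> 'h::{group_add, topological_space} measure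
    \<Rightarrow> ('g, 'h) polyhom set" where
  "Polh \<gamma> \<eta> =
     insert Zero {Poly R \<rho> | R \<rho>.
       closed R \<and> add_subgroup R \<and> haar_measure_on R \<rho> \<and>
       (\<forall>A\<in>sets borel. emeasure \<rho> (R \<inter> (A \<times> UNIV)) \<le> emeasure \<gamma> A) \<and>
       (\<forall>B\<in>sets borel. emeasure \<rho> (R \<inter> (UNIV \<times> B)) \<le> emeasure \<eta> B)}"

definition ker_rel :: "('g \<times> 'h::zero) set \<Rightarrow> 'g set" where
  "ker_rel R = {g. (g, 0) \<in> R}"

definition indef_rel :: "('g::zero \<times> 'h) set \<Rightarrow> 'h set" where
  "indef_rel R = {h. (0, h) \<in> R}"

text \<open>
  The domain and image of \<open>R\<close> are \<open>Domain R\<close> and \<open>Range R\<close>.  The measure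
  \<open>density \<gamma> (indicator D)\<close> is the restriction of \<open>\<gamma>\<close> to \<open>D\<close>, viewed as a measure on the
  whole group.
\<close>

definition alpha ::
  "'g::topological_space measure \<Rightarrow> ('g \<times> 'h) set \<Rightarrow> ('g \<times> 'h) measure \<Rightarrow> real" where
  "alpha \<gamma> R \<rho> =
     (THE a. 0 < a \<and>
        distr \<rho> borel fst = scale_measure (ennreal a) (density \<gamma> (indicator (Domain R))))"

definition beta ::
  "'h::topological_space measure \<Rightarrow> ('g \<times> 'h) set \<Rightarrow> ('g \<times> 'h) measure \<Rightarrow> real" where
  "beta \<eta> R \<rho> =
     (THE b. 0 < b \<and>
        distr \<rho> borel snd = scale_measure (ennreal b) (density \<eta> (indicator (Range R))))"

text \<open>
  The index of a subgroup \<open>B\<close> of \<open>A\<close>.  An infinite index would be \<open>0\<close> here, but the indices in the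
  product below are finite: \<open>indef R\<close> and \<open>ker T\<close> are compact, \<open>dom T\<close> and \<open>im R\<close> are open.
\<close>

definition subgroup_index :: "'a::group_add set \<Rightarrow> 'a set \<Rightarrow> nat" where
  "subgroup_index A B = card ((\<lambda>x. (\<lambda>y. x + y) ` B) ` A)"

text \<open>
  \<open>polyhom_prod \<gamma> \<eta> \<kappa> T R\<close> is the product \<open>TR\<close>, in this order.  The underlying subgroup is
  \<open>R O T\<close>, as the library writes composition of relations from left to right.
\<close>

fun polyhom_prod ::
  "'g::{group_add, topological_space} measure \<Rightarrow> 'h::{group_add, topological_space} measure
    \<Rightarrow> 'k::{group_add, topological_space} measure
    \<Rightarrow> ('h, 'k) polyhom \<Rightarrow> ('g, 'h) polyhom \<Rightarrow> ('g, 'k) polyhom" where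
  "polyhom_prod \<gamma> \<eta> \<kappa> (Poly T \<tau>) (Poly R \<rho>) =
     Poly (R O T) (THE \<sigma>.
       haar_measure_on (R O T) \<sigma> \<and>
       alpha \<gamma> (R O T) \<sigma> =
         alpha \<gamma> R \<rho> * alpha \<eta> T \<tau> / real (subgroup_index (indef_rel R) (indef_rel R \<inter> Domain T)) \<and>
       beta \<kappa> (R O T) \<sigma> =
         beta \<eta> R \<rho> * beta \<kappa> T \<tau> / real (subgroup_index (ker_rel T) (ker_rel T \<inter> Range R)))"
| "polyhom_prod \<gamma> \<eta> \<kappa> Zero _ = Zero"
| "polyhom_prod \<gamma> \<eta> \<kappa> _ Zero = Zero"

text \<open>A polyhomomorphism regarded as a measure on the product of the two groups.\<close>

fun polyhom_measure ::
  "('g::topological_space, 'h::topological_space) polyhom \<Rightarrow> ('g \<times> 'h) measure" where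
  "polyhom_measure Zero = null_measure borel"
| "polyhom_measure (Poly R \<rho>) = distr \<rho> borel (\<lambda>z. z)"

definition Cc :: "('a::topological_space \<Rightarrow> real) set" where
  "Cc = {f. continuous_on UNIV f \<and> compact (closure {x. f x \<noteq> 0})}"

definition polyhom_converges ::
  "(nat \<Rightarrow> ('g::topological_space, 'h::topological_space) polyhom) \<Rightarrow> ('g, 'h) polyhom \<Rightarrow> bool" where
  "polyhom_converges X L \<longleftrightarrow>
     (\<forall>\<phi>\<in>Cc. \<forall>\<psi>\<in>Cc.
        (\<lambda>j. \<integral>z. \<phi> (fst z) * \<psi> (snd z) \<partial>polyhom_measure (X j))
          \<longlonglongrightarrow> (\<integral>z. \<phi> (fst z) * \<psi> (snd z) \<partial>polyhom_measure L))"

end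

theory Submission imports Defs
begin

text \<open>
  A polyhomomorphism is identified with its measure on the product group: a Borel measure with
  dominated marginals that is zero or the Haar measure of a closed subgroup, which is then its
  support.  Domination makes the masses of rectangles equicontinuous in \<open>L\<^sup>1\<close> of either factor,
  so vague convergence is convergence of the masses of countably many rectangles, and every
  sequence clusters at a measure with dominated marginals.  A nonzero cluster point is invariant
  under each point of its support, hence is again a Haar measure; this gives compactness.

  For the product, let \<open>v\<^sub>A\<close> be the density of \<open>\<rho>(A \<times> \<cdot>)\<close> and \<open>u\<^sub>B\<close> that of \<open>\<tau>(\<cdot> \<times> B)\<close>, both
  with respect to the Haar measure of the middle group.  The Haar measure \<open>\<sigma>\<close> of \<open>TR\<close> with the
  prescribed constants is the one with \<open>\<sigma>(A \<times> B) = \<integral> v\<^sub>A u\<^sub>B\<close>; it arises as a limit of measures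
  that match the middle coordinates up to a small neighbourhood of zero.  The right-hand side
  equals the integral of \<open>1\<^sub>A \<otimes> u\<^sub>B\<close> against \<open>\<rho>\<close> and that of \<open>v\<^sub>A \<otimes> 1\<^sub>B\<close> against \<open>\<tau>\<close>, which makes
  separate continuity evident.
\<close>


section \<open>Locally compact second countable Hausdorff spaces\<close>

text \<open>Two obstacles shape the treatment of the product. A Haar measure on \<open>R O T\<close>
  has one free factor, but the definition prescribes both \<alpha> and \<beta>, and the agreement of
  the two prescriptions has to be proved. It holds because the integral of
  \<open>v\<^sub>A u\<^sub>B\<close> is symmetric under passing to converses and interchanging the
  factors, so the computation of the first marginal also yields the second. In that computation the
  index appears because the part of \<open>R\<close> with middle coordinate in
  \<open>Domain T\<close> has finitely many translates by elements of \<open>indef R\<close>, all of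
  equal mass, which fill the part of \<open>R\<close> over \<open>Domain (R O T)\<close>. The other
  obstacle is existence: matching equal middle coordinates means integrating over a set that is in
  general null for the product of \<rho> and \<tau>; hence the thickening by a neighbourhood
  \<open>U\<close> and the division by its mass. Unimodularity of the middle group bounds both
  marginals of the thickened measures, and compactness supplies their limit.\<close>

lemma compact_closed_subset:
  assumes "compact K" "closed S" "S \<subseteq> K"
  shows "compact S"
  using compact_Int_closed[OF assms(1,2)] assms(3) by (simp add: inf.absorb2)

lemma closure_finite_Union: "finite F \<Longrightarrow> closure (\<Union>F) = (\<Union>A\<in>F. closure A)"
  by (induction F rule: finite_induct) auto

lemma lc_nbhd:
  fixes x :: "'a::topological_space"
  assumes "locally compact (UNIV :: 'a set)" "open U" "x \<in> U"
  obtains V C where "open V" "compact C" "x \<in> V" "V \<subseteq> C" "C \<subseteq> U"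
  using assms unfolding locally_def by (metis open_openin subtopology_UNIV)

lemma lc_compact_between:
  fixes K :: "'a::t2_space set"
  assumes "locally compact (UNIV :: 'a set)" "compact K" "open U" "K \<subseteq> U"
  obtains V C where "open V" "compact C" "K \<subseteq> V" "V \<subseteq> C" "C \<subseteq> U"
proof -
  have "\<exists>V C. open V \<and> compact C \<and> x \<in> V \<and> V \<subseteq> C \<and> C \<subseteq> U" if "x \<in> K" for x
    using lc_nbhd[OF assms(1,3)] that assms(4) by (metis subsetD)
  then obtain V C where VC: "\<And>x. x \<in> K \<Longrightarrow> open (V x) \<and> compact (C x) \<and> x \<in> V x \<and> V x \<subseteq> C x \<and> C x \<subseteq> U"
    by metis
  obtain F where F: "F \<subseteq> K" "finite F" "K \<subseteq> (\<Union>x\<in>F. V x)"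
    using compactE_image[OF assms(2), of K V] VC by blast
  show ?thesis
  proof (rule that[of "\<Union>x\<in>F. V x" "\<Union>x\<in>F. C x"])
    show "open (\<Union>x\<in>F. V x)" using VC F by blast
    show "compact (\<Union>x\<in>F. C x)" using VC F by blast
  qed (use VC F in blast)+
qed

lemma lc_prod:
  assumes "locally compact (UNIV :: 'a::topological_space set)"
    and "locally compact (UNIV :: 'b::topological_space set)"
  shows "locally compact (UNIV :: ('a \<times> 'b) set)"
  unfolding locally_def
proof (intro allI impI, elim conjE)
  fix W :: "('a \<times> 'b) set" and z assume W: "openin (top_of_set UNIV) W" "z \<in> W"
  then obtain A B where AB: "open A" "open B" "z \<in> A \<times> B" "A \<times> B \<subseteq> W"
    by (metis open_openin open_prod_elim subtopology_UNIV)
  obtain V C where 1: "open V" "compact C" "fst z \<in> V" "V \<subseteq> C" "C \<subseteq> A"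
    using lc_nbhd[OF assms(1) AB(1), of "fst z"] AB(3) by (metis mem_Times_iff)
  obtain V' C' where 2: "open V'" "compact C'" "snd z \<in> V'" "V' \<subseteq> C'" "C' \<subseteq> B"
    using lc_nbhd[OF assms(2) AB(2), of "snd z"] AB(3) by (metis mem_Times_iff)
  show "\<exists>u v. openin (top_of_set UNIV) u \<and> compact v \<and> z \<in> u \<and> u \<subseteq> v \<and> v \<subseteq> W"
    by (rule exI[of _ "V \<times> V'"], rule exI[of _ "C \<times> C'"])
      (use 1 2 AB in \<open>auto simp: open_Times compact_Times mem_Times_iff\<close>)
qed

text \<open>Separation of compact sets, rather than of points, from open neighbourhoods is what
  makes one \<open>B n\<close> enough: squeezed between the inner compact and the outer open set of
  a regular approximation, it approximates a set of finite measure in the mean.\<close>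

definition base_sequence :: "(nat \<Rightarrow> 'a::topological_space set) \<Rightarrow> bool" where
  "base_sequence B \<longleftrightarrow> (\<forall>n. open (B n)) \<and> (\<forall>n. compact (closure (B n))) \<and>
     (\<forall>K U. compact K \<and> open U \<and> K \<subseteq> U \<longrightarrow> (\<exists>n. K \<subseteq> B n \<and> closure (B n) \<subseteq> U))"

lemma base_sequenceD:
  assumes "base_sequence B"
  shows "open (B n)" "compact (closure (B n))"
    "compact K \<Longrightarrow> open U \<Longrightarrow> K \<subseteq> U \<Longrightarrow> \<exists>n. K \<subseteq> B n \<and> closure (B n) \<subseteq> U"
  using assms by (auto simp: base_sequence_def)

text \<open>The members are finite unions of relatively compact sets from a countable basis. Closing
  under finite unions lets a finite subcover of a compact set count as a single member.\<close>

lemma lc_base_sequence: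
  assumes "locally compact (UNIV :: 'a::{t2_space, second_countable_topology} set)"
  obtains B :: "nat \<Rightarrow> 'a::{t2_space, second_countable_topology} set"
  where "base_sequence B"
proof -
  obtain \<U> :: "'a set set" where \<U>: "countable \<U>" "topological_basis \<U>"
    using ex_countable_basis by blast
  define \<V> where "\<V> = {V \<in> \<U>. compact (closure V)}"
  define \<W> where "\<W> = Union ` {F. finite F \<and> F \<subseteq> \<V>}"
  have "countable \<V>" unfolding \<V>_def using \<U> by auto
  then have c: "countable \<W>" unfolding \<W>_def by (intro countable_image countable_Collect_finite_subset)
  have ne: "{} \<in> \<W>" unfolding \<W>_def by (rule image_eqI[of _ _ "{}"]) auto
  define B where "B = from_nat_into \<W>"
  have r: "range B = \<W>" unfolding B_def using c ne by (intro range_from_nat_into) auto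
  have W: "open V \<and> compact (closure V)" if V: "V \<in> \<W>" for V
  proof -
    obtain F where F: "finite F" "F \<subseteq> \<V>" "V = \<Union>F" using V unfolding \<W>_def by auto
    have "open V" using F \<U> unfolding \<V>_def by (auto intro!: open_Union topological_basis_open)
    moreover have "closure V = (\<Union>V\<in>F. closure V)"
      using F by (simp add: closure_finite_Union)
    moreover have "compact (\<Union>V\<in>F. closure V)" using F unfolding \<V>_def by (intro compact_UN) auto
    ultimately show ?thesis by simp
  qed
  show ?thesis
  proof (rule that[of B], unfold base_sequence_def, intro conjI allI impI; (elim conjE)?)
    show "open (B n)" for n using W r by blast
    show "compact (closure (B n))" for n using W r by blast
    fix K U :: "'a set" assume K: "compact K" "open U" "K \<subseteq> U"
    have "\<exists>V. V \<in> \<V> \<and> x \<in> V \<and> closure V \<subseteq> U" if x: "x \<in> K" for x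
    proof -
      have xU: "x \<in> U" using x K by blast
      obtain V C where VC: "open V" "compact C" "x \<in> V" "V \<subseteq> C" "C \<subseteq> U"
        using lc_nbhd[OF assms K(2) xU] by metis
      obtain V' where V': "V' \<in> \<U>" "x \<in> V'" "V' \<subseteq> V"
        using topological_basisE[OF \<U>(2) VC(1,3)] by metis
      have cl: "closure V' \<subseteq> C" using V' VC by (meson closure_minimal compact_imp_closed subset_trans)
      then have "compact (closure V')" using compact_closed_subset[OF VC(2) closed_closure] by blast
      then show ?thesis using V' cl VC unfolding \<V>_def by blast
    qed
    then obtain V where V: "\<And>x. x \<in> K \<Longrightarrow> V x \<in> \<V> \<and> x \<in> V x \<and> closure (V x) \<subseteq> U" by metis
    obtain F where F: "F \<subseteq> K" "finite F" "K \<subseteq> (\<Union>x\<in>F. V x)"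
    proof (rule compactE_image[OF K(1), of K V])
      show "open (V x)" if "x \<in> K" for x
        using V[OF that] \<U>(2) unfolding \<V>_def by (auto intro: topological_basis_open)
    qed (use V in auto)
    have "(\<Union>x\<in>F. V x) \<in> \<W>" unfolding \<W>_def
      by (rule image_eqI[of _ _ "V ` F"]) (use F V in auto)
    then obtain n where n: "B n = (\<Union>x\<in>F. V x)" using r by blast
    have "closure (B n) = (\<Union>x\<in>F. closure (V x))" unfolding n using F by (simp add: closure_finite_Union image_image)
    then show "\<exists>n. K \<subseteq> B n \<and> closure (B n) \<subseteq> U"
      using V F n by (intro exI[of _ n]) auto
  qed
qed

lemma lc_open_exhaustion:
  assumes "locally compact (UNIV :: 'a::{t2_space, second_countable_topology} set)"
  obtains W :: "nat \<Rightarrow> 'a::{t2_space, second_countable_topology} set"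
  where "\<And>n. open (W n)" "\<And>n. compact (closure (W n))" "incseq W" "(\<Union>n. W n) = UNIV"
proof -
  obtain B :: "nat \<Rightarrow> 'a set" where "base_sequence B"
    by (rule lc_base_sequence[OF assms])
  note B = base_sequenceD[OF this]
  show ?thesis
  proof (rule that[of "\<lambda>n. \<Union>i\<le>n. B i"])
    show "compact (closure (\<Union>i\<le>n. B i))" for n
      using B(2) by (simp add: closure_finite_Union image_image compact_UN)
    show "incseq (\<lambda>n. \<Union>i\<le>n. B i)" by (force simp: incseq_def)
    have "\<exists>n. x \<in> B n" for x using B(3)[of "{x}" UNIV] by auto
    then show "(\<Union>n. \<Union>i\<le>n. B i) = UNIV" by (auto intro: exI[of _ "_::nat"])
  qed (use B in auto)
qed

lemma lc_open_sigma_compact: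
  fixes U :: "'a::{t2_space, second_countable_topology} set"
  assumes "locally compact (UNIV :: 'a set)" "open U"
  obtains K :: "nat \<Rightarrow> 'a set" where "\<And>n. compact (K n)" "(\<Union>n. K n) = U"
proof -
  obtain B :: "nat \<Rightarrow> 'a set" where "base_sequence B"
    by (rule lc_base_sequence[OF assms(1)])
  note B = base_sequenceD[OF this]
  show ?thesis
  proof (rule that[of "\<lambda>n. if closure (B n) \<subseteq> U then closure (B n) else {}"])
    have "\<exists>n. x \<in> B n \<and> closure (B n) \<subseteq> U" if "x \<in> U" for x
      using B(3)[of "{x}" U] assms(2) that by auto
    then show "(\<Union>n. if closure (B n) \<subseteq> U then closure (B n) else {}) = U"
      by (auto split: if_splits) (metis closure_subset subsetD)
  qed (use B in auto)
qed

text \<open>Local compactness gives regularity and second countability the Lindelof property,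
  together normality. Urysohn's lemma is applied to \<open>K\<close> and the complement of an open
  \<open>V\<close> inside a compact \<open>C\<close>, so that the support stays in
  \<open>C\<close>.\<close>

lemma lc_Urysohn:
  fixes K :: "'a::{t2_space, second_countable_topology} set"
  assumes lc: "locally compact (UNIV :: 'a set)" and "compact K" "open U" "K \<subseteq> U"
  obtains f where "f \<in> Cc" "\<And>x. 0 \<le> f x" "\<And>x. f x \<le> 1" "\<And>x. x \<in> K \<Longrightarrow> f x = 1" "\<And>x. x \<notin> U \<Longrightarrow> f x = 0"
proof -
  obtain V C where VC: "open V" "compact C" "K \<subseteq> V" "V \<subseteq> C" "C \<subseteq> U"
    using lc_compact_between[OF assms] .
  have "regular_space (euclidean :: 'a topology)"
    unfolding neighbourhood_base_of_closedin [symmetric] neighbourhood_base_of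
  proof clarify
    fix W :: "'a set" and x assume "openin euclidean W" "x \<in> W"
    then obtain V C where VC: "open V" "compact C" "x \<in> V" "V \<subseteq> C" "C \<subseteq> W"
      by (metis lc lc_nbhd open_openin)
    then show "\<exists>U V. openin euclidean U \<and> closedin euclidean V \<and> x \<in> U \<and> U \<subseteq> V \<and> V \<subseteq> W"
      by (metis closed_closedin compact_imp_closed open_openin)
  qed
  moreover have "second_countable (euclidean :: 'a topology)"
  proof -
    obtain B :: "'a set set" where B: "countable B" "topological_basis B" using ex_countable_basis by blast
    show ?thesis unfolding second_countable_def
    proof (intro exI[of _ B] conjI ballI allI impI)
      show "openin euclidean V" if "V \<in> B" for V
        using topological_basis_open[OF B(2) that] by (simp only: open_openin)
      show "\<exists>V\<in>B. x \<in> V \<and> V \<subseteq> U" if "openin euclidean U \<and> x \<in> U" for U x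
        using topological_basisE[OF B(2), of U x] that by (metis open_openin)
    qed (rule B)
  qed
  ultimately have n: "normal_space (euclidean :: 'a topology)"
    using regular_second_countable_imp_hereditarily_normal_space hereditarily_normal_space
      second_countable_imp_Lindelof_space regular_Lindelof_imp_normal_space by blast
  obtain f :: "'a \<Rightarrow> real" where f: "continuous_map euclidean (top_of_set {0..1}) f" "f ` (- V) \<subseteq> {0}" "f ` K \<subseteq> {1}"
    using Urysohn_lemma[OF n, of "- V" K 0 1] VC assms(2)
    by (auto simp: disjnt_iff closed_closedin[symmetric] compact_imp_closed)
  have c: "continuous_on UNIV f" and r: "f x \<in> {0..1}" for x
    using f(1) by (auto simp: continuous_map_in_subtopology)
  have "closure {x. f x \<noteq> 0} \<subseteq> C" using f(2) VC by (intro closure_minimal compact_imp_closed) auto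
  then have "compact (closure {x. f x \<noteq> 0})" using compact_closed_subset[OF VC(2) closed_closure] by blast
  then have "f \<in> Cc" using c by (simp add: Cc_def)
  then show ?thesis using r f VC by (intro that[of f]) fastforce+
qed

lemma Cc_bounded:
  assumes "f \<in> Cc"
  obtains B where "B > 0" "\<And>x. \<bar>f x\<bar> \<le> B"
proof -
  have "compact (f ` closure {x. f x \<noteq> 0})"
    using assms by (intro compact_continuous_image) (auto simp: Cc_def intro: continuous_on_subset)
  then obtain B where B: "\<forall>y \<in> f ` closure {x. f x \<noteq> 0}. norm y \<le> B"
    using compact_imp_bounded bounded_iff by metis
  show ?thesis
  proof (rule that[of "max 1 B"])
    show "\<bar>f x\<bar> \<le> max 1 B" for x
      using B closure_subset[of "{x. f x \<noteq> 0}"] by (cases "f x = 0") force+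
  qed auto
qed

lemma Cc_borel: "f \<in> Cc \<Longrightarrow> f \<in> borel_measurable borel"
  by (simp add: Cc_def borel_measurable_continuous_onI)

lemma Cc_add: 
  assumes "f \<in> Cc" "g \<in> Cc"
  shows "(\<lambda>x. f x + g x) \<in> Cc"
proof -
  have "closure {x. f x + g x \<noteq> 0} \<subseteq> closure {x. f x \<noteq> 0} \<union> closure {x. g x \<noteq> 0}"
    unfolding closure_Un[symmetric] by (intro closure_mono) auto
  moreover have "compact (closure {x. f x \<noteq> 0} \<union> closure {x. g x \<noteq> 0})"
    using assms by (auto simp: Cc_def)
  ultimately have "compact (closure {x. f x + g x \<noteq> 0})"
    using compact_closed_subset by blast
  then show ?thesis using assms by (auto simp: Cc_def intro: continuous_intros)
qed

lemma Cc_cmult: 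
  assumes "f \<in> Cc"
  shows "(\<lambda>x. c * f x) \<in> Cc"
proof -
  have "closure {x. c * f x \<noteq> 0} \<subseteq> closure {x. f x \<noteq> 0}"
    by (intro closure_mono) auto
  then have "compact (closure {x. c * f x \<noteq> 0})"
    using assms unfolding Cc_def by (auto intro: compact_closed_subset)
  then show ?thesis using assms by (auto simp: Cc_def intro: continuous_intros)
qed

section \<open>Topological groups\<close>

text \<open>With these instances the results on Haar measures of subgroups apply to subgroups of a
  product group.\<close>

instance prod :: (topological_monoid_add, topological_monoid_add) topological_monoid_add
proof
  fix a b :: "'a \<times> 'b"
  show "LIM x (nhds a \<times>\<^sub>F nhds b). fst x + snd x :> nhds (a + b)"
  proof -
    have 1: "filterlim fst (nhds a) (nhds a \<times>\<^sub>F nhds b)" "filterlim snd (nhds b) (nhds a \<times>\<^sub>F nhds b)"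
      by (rule filterlim_fst filterlim_snd)+
    have "((\<lambda>x. (fst (fst x) + fst (snd x), snd (fst x) + snd (snd x))) \<longlongrightarrow> (fst a + fst b, snd a + snd b)) (nhds a \<times>\<^sub>F nhds b)"
      by (intro tendsto_Pair tendsto_add tendsto_fst tendsto_snd 1)
    then show ?thesis by (simp add: plus_prod_def)
  qed
qed

instance prod :: (topological_group_add, topological_group_add) topological_group_add
proof
  fix a :: "'a \<times> 'b"
  have "((\<lambda>x. (- fst x, - snd x)) \<longlongrightarrow> (- fst a, - snd a)) (nhds a)"
    by (intro tendsto_Pair tendsto_minus tendsto_fst tendsto_snd tendsto_ident_at filterlim_ident)
  then show "(uminus \<longlongrightarrow> - a) (nhds a)" unfolding uminus_prod_def by (simp add: case_prod_unfold)
qed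

lemma translate_image_eq_vimage:
  fixes x :: "'a::group_add"
  shows "(\<lambda>y. x + y) ` A = (\<lambda>y. - x + y) -` A" "(\<lambda>y. y + x) ` A = (\<lambda>y. y + - x) -` A"
proof -
  show "(\<lambda>y. x + y) ` A = (\<lambda>y. - x + y) -` A"
    by (auto simp: add.assoc[symmetric] image_iff intro!: bexI[of _ "- x + _"])
  show "(\<lambda>y. y + x) ` A = (\<lambda>y. y + - x) -` A"
    by (auto simp: add.assoc image_iff intro!: bexI[of _ "_ + - x"])
qed

lemma open_translate:
  fixes A :: "'a::topological_group_add set"
  assumes "open A"
  shows "open ((\<lambda>y. x + y) ` A)" "open ((\<lambda>y. y + x) ` A)" "open (uminus -` A)"
  unfolding translate_image_eq_vimage
  by (auto intro!: open_vimage[OF assms] continuous_intros)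

text \<open>The tube lemma for the compact slice \<open>{0} \<times> K\<close> inside the preimage
  of \<open>U\<close> under addition.\<close>

lemma nbhd_translate_compact:
  fixes K :: "'a::topological_group_add set"
  assumes "compact K" "open U" "K \<subseteq> U"
  obtains W where "open W" "0 \<in> W" "\<And>w y. w \<in> W \<Longrightarrow> y \<in> K \<Longrightarrow> w + y \<in> U"
proof -
  define P where "P = (\<lambda>z::'a \<times> 'a. fst z + snd z) -` U"
  have oP: "open P" unfolding P_def by (intro open_vimage assms continuous_intros)
  have "\<exists>A B. open A \<and> open B \<and> 0 \<in> A \<and> y \<in> B \<and> A \<times> B \<subseteq> P" if "y \<in> K" for y
  proof -
    have "(0, y) \<in> P" using that assms by (auto simp: P_def)
    then show ?thesis using open_prod_elim[OF oP] by (metis SigmaE2 )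
  qed
  then obtain A B where AB: "\<And>y. y \<in> K \<Longrightarrow> open (A y) \<and> open (B y) \<and> 0 \<in> A y \<and> y \<in> B y \<and> A y \<times> B y \<subseteq> P"
    by metis
  obtain F where F: "F \<subseteq> K" "finite F" "K \<subseteq> (\<Union>y\<in>F. B y)"
    using compactE_image[OF assms(1), of K B] AB by blast
  show ?thesis
  proof (rule that[of "\<Inter>y\<in>F. A y"])
    show "open (\<Inter>y\<in>F. A y)" using F AB by (intro open_INT) auto
    show "0 \<in> (\<Inter>y\<in>F. A y)" using F AB by auto
    fix w y assume "w \<in> (\<Inter>y\<in>F. A y)" "y \<in> K"
    then obtain z where z: "z \<in> F" "y \<in> B z" "w \<in> A z" using F by blast
    then have "(w, y) \<in> P" using AB[of z] F by blast
    then show "w + y \<in> U" by (simp add: P_def)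
  qed
qed

section \<open>Regularity and approximation in the mean\<close>

text \<open>On a locally compact second countable Hausdorff space these are the Radon measures:
  inner and outer regularity follow from finiteness on compact sets, as shown below.\<close>

definition compact_finite :: "'a::topological_space measure \<Rightarrow> bool" where
  "compact_finite \<mu> \<longleftrightarrow> sets \<mu> = sets borel \<and> (\<forall>K. compact K \<longrightarrow> emeasure \<mu> K < \<infinity>)"

lemma compact_finite_sets: "compact_finite \<mu> \<Longrightarrow> sets \<mu> = sets borel"
  by (simp add: compact_finite_def)

lemma compact_finite_space: "compact_finite \<mu> \<Longrightarrow> space \<mu> = UNIV"
  using sets_eq_imp_space_eq[of \<mu> borel] by (simp add: compact_finite_def)

lemma compact_finite_subset_compact:
  assumes "compact_finite \<mu>" "compact (K :: 'a::t2_space set)" "A \<subseteq> K"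
  shows "emeasure \<mu> A < \<infinity>"
proof -
  have "emeasure \<mu> A \<le> emeasure \<mu> K"
    using assms by (intro emeasure_mono) (auto simp: compact_finite_def compact_imp_closed)
  then show ?thesis using assms by (auto simp: compact_finite_def le_less_trans)
qed

lemma compact_finite_exhaustion:
  fixes \<mu> :: "'a::{t2_space, second_countable_topology} measure"
  assumes lc: "locally compact (UNIV :: 'a set)" and \<mu>: "compact_finite \<mu>"
  obtains W :: "nat \<Rightarrow> 'a set"
  where "\<And>n. open (W n)" "\<And>n. emeasure \<mu> (W n) < \<infinity>" "incseq W" "(\<Union>n. W n) = UNIV"
proof -
  obtain W :: "nat \<Rightarrow> 'a set" where W: "\<And>n. open (W n)" "\<And>n. compact (closure (W n))" "incseq W" "(\<Union>n. W n) = UNIV"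
    by (rule lc_open_exhaustion[OF lc]) blast
  show ?thesis
    by (rule that[OF W(1) compact_finite_subset_compact[OF \<mu> W(2) closure_subset] W(3,4)])
qed

lemma compact_finite_sigma_finite:
  fixes \<mu> :: "'a::{t2_space, second_countable_topology} measure"
  assumes lc: "locally compact (UNIV :: 'a set)" and "compact_finite \<mu>"
  shows "sigma_finite_measure \<mu>"
proof -
  obtain W :: "nat \<Rightarrow> 'a set" where W: "\<And>n. open (W n)" "\<And>n. compact (closure (W n))" "incseq W" "(\<Union>n. W n) = UNIV"
    by (rule lc_open_exhaustion[OF lc]) blast
  show ?thesis
  proof
    show "\<exists>A. countable A \<and> A \<subseteq> sets \<mu> \<and> \<Union> A = space \<mu> \<and> (\<forall>a\<in>A. emeasure \<mu> a \<noteq> \<infinity>)"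
    proof (intro exI[of _ "range W"] conjI ballI)
      show "range W \<subseteq> sets \<mu>" using W(1) by (auto simp: compact_finite_sets[OF assms(2)])
      show "\<Union> (range W) = space \<mu>" using W(4) compact_finite_space[OF assms(2)] by simp
      fix a assume "a \<in> range W"
      then show "emeasure \<mu> a \<noteq> \<infinity>"
        using compact_finite_subset_compact[OF assms(2) W(2) closure_subset] by (metis imageE less_irrefl)
    qed auto
  qed
qed

text \<open>The sets that can be approximated in this way form a sigma-algebra, and it contains the
  open sets because these are sigma-compact.\<close>

lemma finite_measure_closed_open_approx:
  fixes \<nu> :: "'a::{t2_space, second_countable_topology} measure"
  assumes lc: "locally compact (UNIV :: 'a set)" and sets: "sets \<nu> = sets borel" and fin: "finite_measure \<nu>"
    and A: "A \<in> sets borel" and e: "e > 0"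
  shows "\<exists>F U. closed F \<and> open U \<and> F \<subseteq> A \<and> A \<subseteq> U \<and> measure \<nu> (U - F) < e"
proof -
  interpret finite_measure \<nu> by fact
  have b[measurable]: "\<And>A. open A \<Longrightarrow> A \<in> sets \<nu>" "\<And>A. closed A \<Longrightarrow> A \<in> sets \<nu>"
    by (auto simp: sets)
  have "A \<in> sigma_sets UNIV {S. open S}" using A by (simp add: sets_borel)
  then show ?thesis using e
  proof (induction arbitrary: e rule: sigma_sets.induct)
    case (Basic A)
    then have oA: "open A" by simp
    obtain K :: "nat \<Rightarrow> 'a set" where K: "\<And>n. compact (K n)" "(\<Union>n. K n) = A"
      by (rule lc_open_sigma_compact[OF lc oA]) blast
    define L where "L n = (\<Union>i\<le>n. K i)" for n
    have L: "closed (L n)" "L n \<subseteq> A" for n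
      using K unfolding L_def by (auto intro!: closed_UN compact_imp_closed)
    have "(\<lambda>n. measure \<nu> (L n)) \<longlonglongrightarrow> measure \<nu> (\<Union>n. L n)"
      by (rule finite_Lim_measure_incseq) (use L b in \<open>auto simp: L_def incseq_def, force\<close>)
    moreover have "(\<Union>n. L n) = A" using K unfolding L_def by auto
    ultimately have "eventually (\<lambda>n. dist (measure \<nu> (L n)) (measure \<nu> A) < e) sequentially"
      using Basic.prems by (metis tendstoD)
    then obtain n where n: "dist (measure \<nu> (L n)) (measure \<nu> A) < e"
      using eventually_happens by fastforce
    have "measure \<nu> (A - L n) = measure \<nu> A - measure \<nu> (L n)"
      using L oA by (intro finite_measure_Diff) auto
    then have "measure \<nu> (A - L n) < e" using n by (simp add: dist_real_def)
    then show ?case using oA L by blast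
  next
    case Empty
    then show ?case by (intro exI[of _ "{}"]) auto
  next
    case (Compl A)
    obtain F U where FU: "closed F" "open U" "F \<subseteq> A" "A \<subseteq> U" "measure \<nu> (U - F) < e"
      using Compl.IH[OF Compl.prems] by metis
    have "- F - (- U) = U - F" by auto
    then show ?case using FU
      by (intro exI[of _ "- U"] exI[of _ "- F"]) (auto simp: closed_Compl open_Compl)
  next
    case (Union A)
    define d where "d i = e / 2 * (1/2) ^ Suc i" for i
    have d: "d i > 0" for i using Union.prems by (simp add: d_def)
    have sd: "d sums (e/2)" unfolding d_def using sums_mult[OF power_half_series, of "e/2"] by simp
    have "\<exists>F U. closed F \<and> open U \<and> F \<subseteq> A i \<and> A i \<subseteq> U \<and> measure \<nu> (U - F) < d i" for i
      using Union.IH d by blast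
    then obtain F U where FU: "\<And>i. closed (F i)" "\<And>i. open (U i)" "\<And>i. F i \<subseteq> A i" "\<And>i. A i \<subseteq> U i"
      "\<And>i. measure \<nu> (U i - F i) < d i" by metis
    have s: "summable (\<lambda>i. measure \<nu> (U i - F i))"
      by (rule summable_comparison_test'[of d 0]) (use sd FU(5) in \<open>auto intro: less_imp_le simp: sums_iff\<close>)
    have "measure \<nu> (\<Union>i. U i - F i) \<le> (\<Sum>i. measure \<nu> (U i - F i))"
      using FU s by (intro finite_measure_subadditive_countably) auto
    also have "\<dots> \<le> e / 2"
      using suminf_le[OF less_imp_le[OF FU(5)] s] sd by (auto simp: sums_iff)
    finally have 1: "measure \<nu> (\<Union>i. U i - F i) \<le> e / 2" .
    \<comment> \<open>The union of all \<open>F i\<close> need not be closed. Finitely many are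
      kept, and the second half of \<open>e\<close> pays for the rest.\<close>
    define L where "L n = (\<Union>i\<le>n. F i)" for n
    have L: "closed (L n)" for n using FU unfolding L_def by (auto intro!: closed_UN)
    have "(\<lambda>n. measure \<nu> (L n)) \<longlonglongrightarrow> measure \<nu> (\<Union>n. L n)"
      by (rule finite_Lim_measure_incseq) (use L b in \<open>auto simp: L_def incseq_def, force\<close>)
    then have "eventually (\<lambda>n. dist (measure \<nu> (L n)) (measure \<nu> (\<Union>n. L n)) < e/2) sequentially"
      using Union.prems by (metis tendstoD half_gt_zero)
    then obtain n where n: "dist (measure \<nu> (L n)) (measure \<nu> (\<Union>n. L n)) < e/2"
      using eventually_happens by fastforce
    have mL: "(\<Union>n. L n) \<in> sets \<nu>" using L by (intro sets.countable_UN) auto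
    have "measure \<nu> ((\<Union>n. L n) - L n) = measure \<nu> (\<Union>n. L n) - measure \<nu> (L n)"
      using L mL by (intro finite_measure_Diff) auto
    then have 2: "measure \<nu> ((\<Union>n. L n) - L n) < e/2" using n unfolding dist_real_def by linarith
    have mU: "(\<Union>i. U i - F i) \<in> sets \<nu>" using FU by (intro sets.countable_UN) auto
    have sub: "(\<Union>i. U i) - L n \<subseteq> (\<Union>i. U i - F i) \<union> ((\<Union>n. L n) - L n)"
    proof
      fix x assume x: "x \<in> (\<Union>i. U i) - L n"
      then obtain i where "x \<in> U i" by blast
      then have "x \<in> U i - F i \<or> x \<in> L i" by (auto simp: L_def)
      then show "x \<in> (\<Union>i. U i - F i) \<union> ((\<Union>n. L n) - L n)" using x by blast
    qed
    have "measure \<nu> ((\<Union>i. U i) - L n) \<le> measure \<nu> ((\<Union>i. U i - F i) \<union> ((\<Union>n. L n) - L n))"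
      using mL mU L sub by (intro finite_measure_mono) auto
    also have "\<dots> \<le> measure \<nu> (\<Union>i. U i - F i) + measure \<nu> ((\<Union>n. L n) - L n)"
      using mL mU L by (intro measure_Un_le) auto
    also have "\<dots> < e" using 1 2 by simp
    finally have "measure \<nu> ((\<Union>i. U i) - L n) < e" .
    moreover have "L n \<subseteq> (\<Union>i. A i)" using FU unfolding L_def by blast
    ultimately show ?case using FU L
      by (intro exI[of _ "L n"] exI[of _ "\<Union>i. U i"]) blast
  qed
qed

text \<open>The finite case is applied to the restrictions of \<open>\<gamma>\<close> to an
  exhaustion \<open>W n\<close> by relatively compact open sets. The open set is assembled inside
  the \<open>W n\<close>, with errors forming a geometric series of sum \<open>e\<close>.\<close>

lemma compact_finite_outer_regular:
  fixes \<gamma> :: "'a::{t2_space, second_countable_topology} measure"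
  assumes lc: "locally compact (UNIV :: 'a set)" and \<gamma>: "compact_finite \<gamma>"
    and A: "A \<in> sets borel" and e: "e > 0"
  shows "\<exists>U. open U \<and> A \<subseteq> U \<and> emeasure \<gamma> (U - A) \<le> ennreal e"
proof -
  obtain W :: "nat \<Rightarrow> 'a set" where W: "\<And>n. open (W n)" "\<And>n. compact (closure (W n))" "incseq W" "(\<Union>n. W n) = UNIV"
    by (rule lc_open_exhaustion[OF lc]) blast
  note s = compact_finite_sets[OF \<gamma>]
  define d where "d i = e * (1/2) ^ Suc i" for i
  have d: "d i > 0" for i using e by (simp add: d_def)
  have sd: "d sums e" unfolding d_def using sums_mult[OF power_half_series, of e] by simp
  have "\<exists>U. open U \<and> A \<subseteq> U \<and> emeasure \<gamma> (W n \<inter> (U - A)) \<le> ennreal (d n)" for n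
  proof -
    have fW: "emeasure \<gamma> (W n) < \<infinity>" using compact_finite_subset_compact[OF \<gamma> W(2) closure_subset] .
    let ?\<nu> = "density \<gamma> (indicator (W n))"
    have em: "emeasure ?\<nu> B = emeasure \<gamma> (W n \<inter> B)" if "B \<in> sets borel" for B
      using that W(1) by (subst emeasure_density)
        (auto simp: s intro!: borel_measurable_indicator simp flip: indicator_inter_arith)
    have f: "finite_measure ?\<nu>"
      by (rule finite_measureI) (use em[of UNIV] fW compact_finite_space[OF \<gamma>] in simp)
    obtain F U where FU: "closed F" "open U" "F \<subseteq> A" "A \<subseteq> U" "measure ?\<nu> (U - F) < d n"
      using finite_measure_closed_open_approx[OF lc _ f A d[of n]] by (metis s sets_density)
    have "emeasure \<gamma> (W n \<inter> (U - A)) = emeasure ?\<nu> (U - A)" using FU A by (simp add: em)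
    also have "\<dots> \<le> emeasure ?\<nu> (U - F)" using FU A by (intro emeasure_mono) (auto simp: s)
    also have "\<dots> = ennreal (measure ?\<nu> (U - F))" using f by (simp add: finite_measure.emeasure_eq_measure)
    also have "\<dots> \<le> ennreal (d n)" using FU(5) by (intro ennreal_leI) simp
    finally show ?thesis using FU by blast
  qed
  then obtain U where U: "\<And>n. open (U n)" "\<And>n. A \<subseteq> U n" "\<And>n. emeasure \<gamma> (W n \<inter> (U n - A)) \<le> ennreal (d n)"
    by metis
  have "(\<Union>n. W n \<inter> U n) - A \<subseteq> (\<Union>n. W n \<inter> (U n - A))" by auto
  then have "emeasure \<gamma> ((\<Union>n. W n \<inter> U n) - A) \<le> emeasure \<gamma> (\<Union>n. W n \<inter> (U n - A))"
    using U W A by (intro emeasure_mono) (auto simp: s)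
  also have "\<dots> \<le> (\<Sum>n. emeasure \<gamma> (W n \<inter> (U n - A)))"
    using U W A by (intro emeasure_subadditive_countably) (auto simp: s)
  also have "\<dots> \<le> (\<Sum>n. ennreal (d n))" using U(3) by (intro suminf_le) auto
  also have "\<dots> = ennreal e" using sd d by (intro suminf_ennreal_eq) (auto intro: less_imp_le)
  finally have "emeasure \<gamma> ((\<Union>n. W n \<inter> U n) - A) \<le> ennreal e" .
  moreover have "A \<subseteq> (\<Union>n. W n \<inter> U n)"
  proof
    fix x assume "x \<in> A"
    then show "x \<in> (\<Union>n. W n \<inter> U n)" using W(4) U(2) by blast
  qed
  moreover have "open (\<Union>n. W n \<inter> U n)" using U(1) W(1) by auto
  ultimately show ?thesis by blast
qed

text \<open>An open set \<open>V\<close> around \<open>- A\<close> gives the closed set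
  \<open>- V\<close> inside \<open>A\<close>, and finiteness of the measure of \<open>A\<close>
  allows cutting it down to the compact closure of some \<open>W n\<close>.\<close>

lemma compact_finite_regular:
  fixes \<gamma> :: "'a::{t2_space, second_countable_topology} measure"
  assumes lc: "locally compact (UNIV :: 'a set)" and \<gamma>: "compact_finite \<gamma>"
    and A: "A \<in> sets borel" "emeasure \<gamma> A < \<infinity>" and e: "e > 0"
  obtains C U where "compact C" "open U" "C \<subseteq> A" "A \<subseteq> U" "emeasure \<gamma> (U - C) < ennreal e" "emeasure \<gamma> U < \<infinity>"
proof -
  obtain W :: "nat \<Rightarrow> 'a set" where W: "\<And>n. open (W n)" "\<And>n. compact (closure (W n))" "incseq W" "(\<Union>n. W n) = UNIV"
    by (rule lc_open_exhaustion[OF lc]) blast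
  note s = compact_finite_sets[OF \<gamma>]
  \<comment> \<open>Three errors of this size are added below; a quarter instead of a third leaves
    the final inequality strict.\<close>
  define d where "d = e / 4"
  have d: "d > 0" using e by (simp add: d_def)
  obtain U where U: "open U" "A \<subseteq> U" "emeasure \<gamma> (U - A) \<le> ennreal d"
    using compact_finite_outer_regular[OF lc \<gamma> A(1) d] by blast
  have mA: "- A \<in> sets borel" using A(1) by auto
  obtain V where V: "open V" "- A \<subseteq> V" "emeasure \<gamma> (V - (- A)) \<le> ennreal d"
    using compact_finite_outer_regular[OF lc \<gamma> mA d] by metis
  have "(\<lambda>n. emeasure \<gamma> (A - W n)) \<longlonglongrightarrow> emeasure \<gamma> (\<Inter>n. A - W n)"
  proof (rule Lim_emeasure_decseq)
    show "range (\<lambda>n. A - W n) \<subseteq> sets \<gamma>" using A W by (auto simp: s)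
    show "decseq (\<lambda>n. A - W n)" using W(3) by (force simp: decseq_def incseq_def)
    show "emeasure \<gamma> (A - W n) \<noteq> \<infinity>" for n
    proof -
      have "emeasure \<gamma> (A - W n) \<le> emeasure \<gamma> A" using A by (intro emeasure_mono) (auto simp: s)
      also have "\<dots> < \<infinity>" by (rule A)
      finally show ?thesis by simp
    qed
  qed
  moreover have e0: "(\<Inter>n. A - W n) = {}" using W(4) by auto
  ultimately have "(\<lambda>n. emeasure \<gamma> (A - W n)) \<longlonglongrightarrow> 0" unfolding e0 by simp
  then have "eventually (\<lambda>n. emeasure \<gamma> (A - W n) < ennreal d) sequentially"
    using d by (intro order_tendstoD) auto
  then obtain n where n: "emeasure \<gamma> (A - W n) < ennreal d" using eventually_happens by fastforce
  define C where "C = closure (W n) \<inter> - V"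
  have C: "compact C" "C \<subseteq> A" unfolding C_def using V W(2) by (auto intro!: compact_Int_closed)
  have "U - C \<subseteq> (U - A) \<union> ((V - (- A)) \<union> (A - W n))"
    unfolding C_def using closure_subset[of "W n"] by blast
  then have "emeasure \<gamma> (U - C) \<le> emeasure \<gamma> ((U - A) \<union> ((V - (- A)) \<union> (A - W n)))"
    using U V W A by (intro emeasure_mono) (auto simp: s)
  also have "\<dots> \<le> emeasure \<gamma> (U - A) + emeasure \<gamma> ((V - (- A)) \<union> (A - W n))"
    using U V W A by (intro emeasure_subadditive) (auto simp: s)
  also have "\<dots> \<le> emeasure \<gamma> (U - A) + (emeasure \<gamma> (V - (- A)) + emeasure \<gamma> (A - W n))"
    using U V W A by (intro add_left_mono emeasure_subadditive) (auto simp: s)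
  also have "\<dots> \<le> ennreal d + (ennreal d + ennreal d)"
    using U V n by (intro add_mono) auto
  also have "\<dots> = ennreal (3 * d)" using d by (simp flip: ennreal_plus)
  also have "\<dots> < ennreal e" using e by (intro ennreal_lessI) (auto simp: d_def)
  finally have 1: "emeasure \<gamma> (U - C) < ennreal e" .
  have "emeasure \<gamma> U \<le> emeasure \<gamma> (A \<union> (U - A))" using U A by (intro emeasure_mono) (auto simp: s)
  also have "\<dots> \<le> emeasure \<gamma> A + emeasure \<gamma> (U - A)" using U A by (intro emeasure_subadditive) (auto simp: s)
  also have "\<dots> < \<infinity>" using A U(3) by (auto simp: ennreal_add_less_top le_less_trans)
  finally have "emeasure \<gamma> U < \<infinity>" .
  then show ?thesis using that[OF C(1) U(1) C(2) U(2) 1] by blast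
qed

text \<open>Density in \<open>L\<^sup>1\<close> of a linear class \<open>D\<close> only has to be
  tested on indicators of sets of finite measure. This serves for \<open>Cc\<close>, for the span of
  a base sequence, and for the functions on which translation is continuous in the mean.\<close>

lemma integrable_L1_dense:
  fixes f :: "'a \<Rightarrow> real"
  assumes int: "\<And>d. d \<in> D \<Longrightarrow> integrable M d"
    and add: "\<And>d d'. d \<in> D \<Longrightarrow> d' \<in> D \<Longrightarrow> (\<lambda>x. d x + d' x) \<in> D"
    and cmult: "\<And>d c. d \<in> D \<Longrightarrow> (\<lambda>x. c * d x) \<in> D"
    and ind: "\<And>A e. A \<in> sets M \<Longrightarrow> emeasure M A < \<infinity> \<Longrightarrow> e > 0 \<Longrightarrow> \<exists>d\<in>D. (\<integral>x. \<bar>indicator A x - d x\<bar> \<partial>M) < e"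
    and f: "integrable M f" and e: "e > 0"
  shows "\<exists>d\<in>D. (\<integral>x. \<bar>f x - d x\<bar> \<partial>M) < e"
  using f e
proof (induction arbitrary: e rule: integrable_induct)
  case (base A c)
  \<comment> \<open>The summand 1 covers the case \<open>c = 0\<close>.\<close>
  obtain d where d: "d \<in> D" "(\<integral>x. \<bar>indicator A x - d x\<bar> \<partial>M) < e / (\<bar>c\<bar> + 1)"
    using ind[OF base(1,2), of "e / (\<bar>c\<bar> + 1)"] base(3) by auto
  have "(\<integral>x. \<bar>indicator A x *\<^sub>R c - c * d x\<bar> \<partial>M) = (\<integral>x. \<bar>c\<bar> * \<bar>indicator A x - d x\<bar> \<partial>M)"
    by (intro Bochner_Integration.integral_cong) (auto simp: algebra_simps simp flip: abs_mult)
  also have "\<dots> = \<bar>c\<bar> * (\<integral>x. \<bar>indicator A x - d x\<bar> \<partial>M)" by simp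
  also have "\<dots> \<le> \<bar>c\<bar> * (e / (\<bar>c\<bar> + 1))" using d(2) by (intro mult_left_mono) auto
  also have "\<dots> < e" using base(3) by (simp add: field_simps)
  finally show ?case using assms(3)[OF d(1), of c] by (intro bexI)
next
  case (add f g)
  obtain d d' where d: "d \<in> D" "(\<integral>x. \<bar>f x - d x\<bar> \<partial>M) < e / 2" "d' \<in> D" "(\<integral>x. \<bar>g x - d' x\<bar> \<partial>M) < e / 2"
    using add.IH[of "e/2"] add.prems by auto
  have "(\<integral>x. \<bar>f x + g x - (d x + d' x)\<bar> \<partial>M) \<le> (\<integral>x. \<bar>f x - d x\<bar> + \<bar>g x - d' x\<bar> \<partial>M)"
    using add.hyps d int by (intro integral_mono) auto
  also have "\<dots> = (\<integral>x. \<bar>f x - d x\<bar> \<partial>M) + (\<integral>x. \<bar>g x - d' x\<bar> \<partial>M)"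
    using add.hyps d int by (intro Bochner_Integration.integral_add) auto
  also have "\<dots> < e" using d by simp
  finally show ?case using assms(2)[OF d(1,3)] by (intro bexI)
next
  case (lim f s)
  have "(\<lambda>i. \<integral>x. \<bar>f x - s i x\<bar> \<partial>M) \<longlonglongrightarrow> (\<integral>x. 0 \<partial>M)"
  \<comment> \<open>The approximants \<open>s i\<close> are bounded by twice \<open>f\<close>, hence
    the factor 3 for the difference.\<close>
  proof (rule integral_dominated_convergence[where w = "\<lambda>x. 3 * \<bar>f x\<bar>"])
    show "AE x in M. (\<lambda>i. \<bar>f x - s i x\<bar>) \<longlonglongrightarrow> 0"
    proof (rule AE_I2)
      fix x assume "x \<in> space M"
      then have "(\<lambda>i. \<bar>f x - s i x\<bar>) \<longlonglongrightarrow> \<bar>f x - f x\<bar>"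
        by (intro tendsto_rabs tendsto_diff tendsto_const lim.hyps)
      then show "(\<lambda>i. \<bar>f x - s i x\<bar>) \<longlonglongrightarrow> 0" by simp
    qed
    show "AE x in M. norm \<bar>f x - s i x\<bar> \<le> 3 * \<bar>f x\<bar>" for i
    proof (rule AE_I2)
      fix x assume "x \<in> space M"
      then have "norm (s i x) \<le> 2 * norm (f x)" by (rule lim.hyps)
      then show "norm \<bar>f x - s i x\<bar> \<le> 3 * \<bar>f x\<bar>"
        using abs_triangle_ineq4[of "f x" "s i x"] by simp
    qed
  qed (use lim.hyps in auto)
  then have "eventually (\<lambda>i. (\<integral>x. \<bar>f x - s i x\<bar> \<partial>M) < e / 2) sequentially"
    using lim.prems by (intro order_tendstoD) auto
  then obtain i where i: "(\<integral>x. \<bar>f x - s i x\<bar> \<partial>M) < e / 2" using eventually_happens by fastforce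
  obtain d where d: "d \<in> D" "(\<integral>x. \<bar>s i x - d x\<bar> \<partial>M) < e / 2" using lim.IH[of "e/2"] lim.prems by auto
  have "(\<integral>x. \<bar>f x - d x\<bar> \<partial>M) \<le> (\<integral>x. \<bar>f x - s i x\<bar> + \<bar>s i x - d x\<bar> \<partial>M)"
    using lim.hyps d int by (intro integral_mono) auto
  also have "\<dots> = (\<integral>x. \<bar>f x - s i x\<bar> \<partial>M) + (\<integral>x. \<bar>s i x - d x\<bar> \<partial>M)"
    using lim.hyps d int by (intro Bochner_Integration.integral_add) auto
  also have "\<dots> < e" using i d by simp
  finally show ?case using d(1) by blast
qed

lemma Cc_integrable:
  fixes \<gamma> :: "'a::t2_space measure"
  assumes "f \<in> Cc" "compact_finite \<gamma>"
  shows "integrable \<gamma> f"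
proof -
  obtain B where B: "B > 0" "\<And>x. \<bar>f x\<bar> \<le> B" by (rule Cc_bounded[OF assms(1)]) blast
  let ?K = "closure {x. f x \<noteq> 0}"
  have K: "compact ?K" "?K \<in> sets \<gamma>" "emeasure \<gamma> ?K < \<infinity>"
    using assms by (auto simp: Cc_def compact_finite_def)
  have "integrable \<gamma> (\<lambda>x. B * indicator ?K x)" using K by auto
  then show ?thesis
  proof (rule Bochner_Integration.integrable_bound)
    show "f \<in> borel_measurable \<gamma>" using Cc_borel[OF assms(1)] compact_finite_sets[OF assms(2)]
      by (simp cong: measurable_cong_sets)
    show "AE x in \<gamma>. norm (f x) \<le> norm (B * indicator ?K x)"
    proof (rule AE_I2)
      fix x show "norm (f x) \<le> norm (B * indicator ?K x)"
        using B closure_subset[of "{x. f x \<noteq> 0}"] by (cases "f x = 0") (auto simp: subset_eq)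
    qed
  qed
qed

text \<open>A Urysohn function between the compact and the open set of a regular approximation
  differs from the indicator by at most 1, and only on \<open>U - C\<close>.\<close>

lemma Cc_dense_indicator:
  fixes \<gamma> :: "'a::{t2_space, second_countable_topology} measure"
  assumes lc: "locally compact (UNIV :: 'a set)" and \<gamma>: "compact_finite \<gamma>"
    and A: "A \<in> sets borel" "emeasure \<gamma> A < \<infinity>" and e: "e > 0"
  shows "\<exists>f\<in>Cc. (\<forall>x. 0 \<le> f x \<and> f x \<le> 1) \<and> (\<integral>x. \<bar>indicator A x - f x\<bar> \<partial>\<gamma>) < e"
proof -
  note s = compact_finite_sets[OF \<gamma>]
  obtain C U where CU: "compact C" "open U" "C \<subseteq> A" "A \<subseteq> U" "emeasure \<gamma> (U - C) < ennreal e" "emeasure \<gamma> U < \<infinity>"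
    using compact_finite_regular[OF lc \<gamma> A e] .
  obtain f where f: "f \<in> Cc" "\<And>x. 0 \<le> f x" "\<And>x. f x \<le> 1" "\<And>x. x \<in> C \<Longrightarrow> f x = 1" "\<And>x. x \<notin> U \<Longrightarrow> f x = 0"
    using lc_Urysohn[OF lc CU(1,2)] CU(3,4) by (metis subset_trans)
  have fin: "emeasure \<gamma> (U - C) < \<infinity>" using CU(5) by (auto intro: less_trans)
  have "(\<integral>x. \<bar>indicator A x - f x\<bar> \<partial>\<gamma>) \<le> (\<integral>x. indicator (U - C) x \<partial>\<gamma>)"
  proof (rule integral_mono)
    show "integrable \<gamma> (\<lambda>x. \<bar>indicator A x - f x\<bar>)"
      using Cc_integrable[OF f(1) \<gamma>] A by (auto simp: s)
    show "integrable \<gamma> (\<lambda>x. indicator (U - C) x :: real)"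
      using CU fin by (auto simp: s compact_imp_closed)
    show "\<bar>indicator A x - f x\<bar> \<le> indicator (U - C) x" for x
      using f(2-5)[of x] CU(3,4) by (cases "x \<in> U - C"; cases "x \<in> A") (auto simp: indicator_def)
  qed
  also have "\<dots> = measure \<gamma> (U - C)" using CU by (simp add: s compact_imp_closed compact_finite_space[OF \<gamma>])
  also have "\<dots> < e" using CU(5) fin e by (simp add: measure_def enn2real_less_iff)
  finally show ?thesis using f by blast
qed

lemma Cc_dense:
  fixes \<gamma> :: "'a::{t2_space, second_countable_topology} measure"
  assumes lc: "locally compact (UNIV :: 'a set)" and \<gamma>: "compact_finite \<gamma>"
    and f: "integrable \<gamma> f" and e: "e > 0"
  shows "\<exists>d\<in>Cc. (\<integral>x. \<bar>f x - d x\<bar> \<partial>\<gamma>) < e"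
proof (rule integrable_L1_dense[OF _ Cc_add Cc_cmult _ f e])
  fix A and e :: real assume "A \<in> sets \<gamma>" "emeasure \<gamma> A < \<infinity>" "e > 0"
  then show "\<exists>d\<in>Cc. (\<integral>x. \<bar>indicator A x - d x\<bar> \<partial>\<gamma>) < e"
    using Cc_dense_indicator[OF lc \<gamma>] compact_finite_sets[OF \<gamma>] by blast
qed (auto intro: Cc_integrable \<gamma>)

inductive_set lin_span :: "('a \<Rightarrow> real) set \<Rightarrow> ('a \<Rightarrow> real) set" for S where
  base: "f \<in> S \<Longrightarrow> f \<in> lin_span S"
| add: "f \<in> lin_span S \<Longrightarrow> g \<in> lin_span S \<Longrightarrow> (\<lambda>x. f x + g x) \<in> lin_span S"
| cmult: "f \<in> lin_span S \<Longrightarrow> (\<lambda>x. c * f x) \<in> lin_span S"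

lemma lin_span_base_dense:
  fixes \<gamma> :: "'a::{t2_space, second_countable_topology} measure" and B :: "nat \<Rightarrow> 'a set"
  assumes lc: "locally compact (UNIV :: 'a set)" and \<gamma>: "compact_finite \<gamma>"
    and base: "base_sequence B"
    and f: "integrable \<gamma> f" and e: "e > 0"
  shows "\<exists>d\<in>lin_span (range (\<lambda>n. indicator (B n))). (\<integral>x. \<bar>f x - d x\<bar> \<partial>\<gamma>) < e"
proof (rule integrable_L1_dense[OF _ lin_span.add lin_span.cmult _ f e])
  note B = base_sequenceD[OF base]
  note s = compact_finite_sets[OF \<gamma>]
  have i: "integrable \<gamma> (indicator (B n) :: _ \<Rightarrow> real)" for n
    using compact_finite_subset_compact[OF \<gamma> B(2) closure_subset] B(1) by (auto simp: s)
  show "integrable \<gamma> d" if "d \<in> lin_span (range (\<lambda>n. indicator (B n)))" for d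
    using that by induction (auto intro: i)
  fix A and e :: real assume A: "A \<in> sets \<gamma>" "emeasure \<gamma> A < \<infinity>" "e > 0"
  then have A': "A \<in> sets borel" by (simp add: s)
  obtain C U where CU: "compact C" "open U" "C \<subseteq> A" "A \<subseteq> U" "emeasure \<gamma> (U - C) < ennreal e" "emeasure \<gamma> U < \<infinity>"
    using compact_finite_regular[OF lc \<gamma> A' A(2,3)] .
  obtain n where n: "C \<subseteq> B n" "closure (B n) \<subseteq> U" using B(3)[OF CU(1,2)] CU(3,4) by blast
  then have nU: "B n \<subseteq> U" using closure_subset by blast
  have fin: "emeasure \<gamma> (U - C) < \<infinity>" using CU(5) by (auto intro: less_trans)
  have "(\<integral>x. \<bar>indicator A x - indicator (B n) x\<bar> \<partial>\<gamma>) \<le> (\<integral>x. (indicator (U - C) x :: real) \<partial>\<gamma>)"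
  proof (rule integral_mono)
    show "integrable \<gamma> (\<lambda>x. \<bar>indicator A x - indicator (B n) x :: real\<bar>)"
      using i A by auto
    show "integrable \<gamma> (\<lambda>x. indicator (U - C) x :: real)"
      using CU fin by (auto simp: s compact_imp_closed)
    show "\<bar>indicator A x - indicator (B n) x\<bar> \<le> (indicator (U - C) x :: real)" for x
      using n nU CU(3,4) by (auto simp: indicator_def)
  qed
  also have "\<dots> = measure \<gamma> (U - C)" using CU by (simp add: s compact_imp_closed compact_finite_space[OF \<gamma>])
  also have "\<dots> < e" using CU(5) fin A by (simp add: measure_def enn2real_less_iff)
  finally show "\<exists>d\<in>lin_span (range (\<lambda>n. indicator (B n))). (\<integral>x. \<bar>indicator A x - d x\<bar> \<partial>\<gamma>) < e"
    by (intro bexI[of _ "indicator (B n)"] lin_span.base) auto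
qed

section \<open>Measures on a product with dominated marginals\<close>

definition dominated_marginals ::
  "'g::topological_space measure \<Rightarrow> 'h::topological_space measure \<Rightarrow> ('g \<times> 'h) measure \<Rightarrow> bool" where
  "dominated_marginals \<gamma> \<eta> \<mu> \<longleftrightarrow> sets \<mu> = sets borel \<and>
     (\<forall>A\<in>sets borel. emeasure \<mu> (A \<times> UNIV) \<le> emeasure \<gamma> A) \<and>
     (\<forall>B\<in>sets borel. emeasure \<mu> (UNIV \<times> B) \<le> emeasure \<eta> B)"

lemma dominated_marginalsD:
  assumes "dominated_marginals \<gamma> \<eta> \<mu>"
  shows "sets \<mu> = sets borel" "space \<mu> = UNIV"
    "A \<in> sets borel \<Longrightarrow> emeasure \<mu> (A \<times> UNIV) \<le> emeasure \<gamma> A"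
    "B \<in> sets borel \<Longrightarrow> emeasure \<mu> (UNIV \<times> B) \<le> emeasure \<eta> B"
  using assms sets_eq_imp_space_eq[of \<mu> borel] by (auto simp: dominated_marginals_def)

lemma dominated_marginals_rect:
  fixes A :: "'g::second_countable_topology set" and B :: "'h::second_countable_topology set"
  assumes "dominated_marginals \<gamma> \<eta> \<mu>" "A \<in> sets borel" "B \<in> sets borel"
  shows "emeasure \<mu> (A \<times> B) \<le> emeasure \<gamma> A" "emeasure \<mu> (A \<times> B) \<le> emeasure \<eta> B"
proof -
  have "emeasure \<mu> (A \<times> B) \<le> emeasure \<mu> (A \<times> UNIV)"
    using assms by (intro emeasure_mono) (auto simp: dominated_marginals_def borel_Times)
  also have "\<dots> \<le> emeasure \<gamma> A" using assms by (auto simp: dominated_marginals_def)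
  finally show "emeasure \<mu> (A \<times> B) \<le> emeasure \<gamma> A" .
  have "emeasure \<mu> (A \<times> B) \<le> emeasure \<mu> (UNIV \<times> B)"
    using assms by (intro emeasure_mono) (auto simp: dominated_marginals_def borel_Times)
  also have "\<dots> \<le> emeasure \<eta> B" using assms by (auto simp: dominated_marginals_def)
  finally show "emeasure \<mu> (A \<times> B) \<le> emeasure \<eta> B" .
qed

lemma dominated_marginals_compact_finite:
  fixes \<gamma> :: "'g::{t2_space,second_countable_topology} measure" and \<eta> :: "'h::{t2_space,second_countable_topology} measure"
  assumes "dominated_marginals \<gamma> \<eta> \<mu>" "compact_finite \<gamma>"
  shows "compact_finite \<mu>"
  unfolding compact_finite_def
proof (intro conjI allI impI)
  fix K :: "('g \<times> 'h) set" assume K: "compact K"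
  have c: "compact (fst ` K)" using K by (intro compact_continuous_image continuous_intros)
  have "emeasure \<mu> K \<le> emeasure \<mu> (fst ` K \<times> UNIV)"
    using c dominated_marginalsD(1)[OF assms(1)]
    by (intro emeasure_mono) (force simp: borel_Times compact_imp_closed)+
  also have "\<dots> \<le> emeasure \<gamma> (fst ` K)"
    using c by (intro dominated_marginalsD(3)[OF assms(1)]) (auto simp: compact_imp_closed)
  also have "\<dots> < \<infinity>" using c assms(2) by (simp add: compact_finite_def)
  finally show "emeasure \<mu> K < \<infinity>" .
qed (use assms in \<open>simp add: dominated_marginals_def\<close>)

text \<open>Limits of masses are controlled only on rectangles with sides of finite measure; an
  exhaustion of both factors recovers all other rectangles as countable unions of these.\<close>

lemma borel_prod_finite_rect:
  fixes \<gamma> :: "'g::{t2_space,second_countable_topology} measure" and \<eta> :: "'h::{t2_space,second_countable_topology} measure"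
  assumes lcG: "locally compact (UNIV :: 'g set)" and lcH: "locally compact (UNIV :: 'h set)"
    and \<gamma>: "compact_finite \<gamma>" and \<eta>: "compact_finite \<eta>"
  shows "sets (borel :: ('g \<times> 'h) measure) = sigma_sets UNIV
    {A \<times> B | A B. A \<in> sets borel \<and> emeasure \<gamma> A < \<infinity> \<and> B \<in> sets borel \<and> emeasure \<eta> B < \<infinity>}"
    (is "_ = sigma_sets UNIV ?R")
proof (intro equalityI)
  obtain W :: "nat \<Rightarrow> 'g set" where W: "\<And>n. open (W n)" "\<And>n. emeasure \<gamma> (W n) < \<infinity>" "incseq W" "(\<Union>n. W n) = UNIV"
    by (rule compact_finite_exhaustion[OF lcG \<gamma>]) blast
  obtain W' :: "nat \<Rightarrow> 'h set" where W': "\<And>n. open (W' n)" "\<And>n. emeasure \<eta> (W' n) < \<infinity>" "incseq W'" "(\<Union>n. W' n) = UNIV"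
    by (rule compact_finite_exhaustion[OF lcH \<eta>]) blast
  note Wf = W(2) W'(2)
  interpret S: sigma_algebra UNIV "sigma_sets UNIV ?R" by (rule sigma_algebra_sigma_sets) auto
  have rect: "A \<times> B \<in> ?R" if "A \<in> sets borel" "emeasure \<gamma> A < \<infinity>" "B \<in> sets borel" "emeasure \<eta> B < \<infinity>" for A B
    using that by blast
  have "A \<times> B \<in> sigma_sets UNIV ?R" if AB: "A \<in> sets borel" "B \<in> sets borel" for A :: "'g set" and B :: "'h set"
  proof -
    have 1: "(A \<inter> W n) \<times> (B \<inter> W' n) \<in> sigma_sets UNIV ?R" for n
    proof (intro sigma_sets.Basic rect)
      have "emeasure \<gamma> (A \<inter> W n) \<le> emeasure \<gamma> (W n)"
        using W AB by (intro emeasure_mono) (auto simp: compact_finite_sets[OF \<gamma>])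
      then show "emeasure \<gamma> (A \<inter> W n) < \<infinity>" using Wf(1)[of n] by (rule le_less_trans)
      have "emeasure \<eta> (B \<inter> W' n) \<le> emeasure \<eta> (W' n)"
        using W' AB by (intro emeasure_mono) (auto simp: compact_finite_sets[OF \<eta>])
      then show "emeasure \<eta> (B \<inter> W' n) < \<infinity>" using Wf(2)[of n] by (rule le_less_trans)
    qed (use AB W W' in auto)
    have "A \<times> B \<subseteq> (\<Union>n. (A \<inter> W n) \<times> (B \<inter> W' n))"
    proof
      fix z assume z: "z \<in> A \<times> B"
      obtain n m where nm: "fst z \<in> W n" "snd z \<in> W' m" using W(4) W'(4) by blast
      have "W n \<subseteq> W (max n m)" "W' m \<subseteq> W' (max n m)" using W(3) W'(3) by (auto simp: incseq_def)
      then have "z \<in> (A \<inter> W (max n m)) \<times> (B \<inter> W' (max n m))" using z nm by (auto simp: mem_Times_iff)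
      then show "z \<in> (\<Union>n. (A \<inter> W n) \<times> (B \<inter> W' n))" by blast
    qed
    then have "A \<times> B = (\<Union>n. (A \<inter> W n) \<times> (B \<inter> W' n))" by blast
    moreover have "(\<Union>n. (A \<inter> W n) \<times> (B \<inter> W' n)) \<in> sigma_sets UNIV ?R"
      using 1 by (intro S.countable_nat_UN) auto
    ultimately show ?thesis by simp
  qed
  then have "{a \<times> b |a b. a \<in> sets (borel::'g measure) \<and> b \<in> sets (borel::'h measure)} \<subseteq> sigma_sets UNIV ?R" by auto
  then have "sigma_sets UNIV {a \<times> b |a b. a \<in> sets (borel::'g measure) \<and> b \<in> sets (borel::'h measure)} \<subseteq> sigma_sets UNIV ?R"
    by (rule S.sigma_sets_subset)
  moreover have "sets (borel :: ('g \<times> 'h) measure) = sigma_sets UNIV {a \<times> b |a b. a \<in> sets (borel::'g measure) \<and> b \<in> sets (borel::'h measure)}"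
    using sets_pair_measure[of "borel::'g measure" "borel::'h measure"] unfolding borel_prod by simp
  ultimately show "sets (borel :: ('g \<times> 'h) measure) \<subseteq> sigma_sets UNIV ?R" by simp
  show "sigma_sets UNIV ?R \<subseteq> sets (borel :: ('g \<times> 'h) measure)"
  proof -
    have "?R \<subseteq> sets (borel :: ('g \<times> 'h) measure)" by (auto intro: borel_Times)
    from sets.sigma_sets_subset[OF this] show ?thesis by simp
  qed
qed

text \<open>Tychonoff's theorem replaces the passage to a subsequence: it yields one filter along which
  the masses of all sets of bounded mass converge, countable or not.\<close>

lemma bounded_family_cluster:
  fixes g :: "nat \<Rightarrow> 'i \<Rightarrow> real"
  assumes "\<And>j i. 0 \<le> g j i" "\<And>j i. g j i \<le> c i"
  obtains F f where "F \<noteq> bot" "F \<le> sequentially" "\<And>i. ((\<lambda>j. g j i) \<longlongrightarrow> f i) F" "\<And>i. 0 \<le> f i"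
proof -
  let ?U = "PiE UNIV (\<lambda>i. {0..c i})"
  have "compactin (product_topology (\<lambda>i. euclidean) UNIV) ?U"
    unfolding compactin_PiE by auto
  then have "compact ?U" by (simp add: euclidean_product_topology)
  moreover have "eventually (\<lambda>x. x \<in> ?U) (filtermap g sequentially)"
    unfolding eventually_filtermap using assms by (intro always_eventually) (auto simp: PiE_iff)
  moreover have "filtermap g sequentially \<noteq> bot" by (simp add: filtermap_bot_iff)
  ultimately obtain f where f: "f \<in> ?U" "inf (nhds f) (filtermap g sequentially) \<noteq> bot"
    unfolding compact_filter by blast
  \<comment> \<open>The compact box contains a cluster point \<open>f\<close> of the sequence
    \<open>g\<close>. Being a cluster point means that the preimages of its neighbourhoods can be
    added to \<open>sequentially\<close> without making the filter improper.\<close>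
  define F where "F = inf (filtercomap g (nhds f)) sequentially"
  have "F \<noteq> bot"
  proof
    assume "F = bot"
    then have "eventually (\<lambda>x. False) F" by simp
    then obtain P Q where PQ: "eventually P (filtercomap g (nhds f))" "eventually Q sequentially" "\<And>x. P x \<Longrightarrow> Q x \<Longrightarrow> False"
      unfolding F_def eventually_inf by blast
    obtain P' where P': "eventually P' (nhds f)" "\<And>x. P' (g x) \<Longrightarrow> P x"
      using PQ(1) unfolding eventually_filtercomap by blast
    have "eventually (\<lambda>y. \<not> P' y) (filtermap g sequentially)"
      unfolding eventually_filtermap using PQ(2) by (rule eventually_mono) (use P'(2) PQ(3) in blast)
    then have "eventually (\<lambda>x. False) (inf (nhds f) (filtermap g sequentially))"
      unfolding eventually_inf using P'(1) by blast
    then show False using f(2) by (simp add: eventually_False)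
  qed
  moreover have "((\<lambda>j. g j i) \<longlongrightarrow> f i) F" for i
  proof -
    have 1: "filterlim g (nhds f) F"
      unfolding F_def by (rule filterlim_mono[OF filterlim_filtercomap]) auto
    have "((\<lambda>x. x i) \<longlongrightarrow> f i) (nhds f)"
    proof (rule topological_tendstoI)
      fix S :: "real set" assume S: "open S" "f i \<in> S"
      have "open ((\<lambda>x. x i) -` S)" using S(1) by (rule open_vimage) simp
      then show "eventually (\<lambda>x. x i \<in> S) (nhds f)"
        unfolding eventually_nhds using S(2) by (intro exI[of _ "(\<lambda>x. x i) -` S"]) auto
    qed
    from filterlim_compose[OF this 1] show ?thesis .
  qed
  moreover have "F \<le> sequentially" by (simp add: F_def)
  moreover have "0 \<le> f i" for i using f(1) by (auto simp: PiE_iff)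
  ultimately show ?thesis using that by blast
qed

text \<open>The limit \<open>f\<close> of the masses along the filter is only finitely additive. On
  the ring \<open>\<R>\<close> of sets that are squeezed between compact and open sets with an error
  uniform in \<open>j\<close>, it is continuous at the empty set, by the compactness argument of
  Alexandrov's theorem; Caratheodory's theorem then extends it. Domination by
  \<open>\<gamma>\<close> and \<open>\<eta>\<close> is what puts the rectangles with sides of finite
  measure into \<open>\<R>\<close>.\<close>

theorem dominated_marginals_cluster:
  fixes \<gamma> :: "'g::{t2_space,second_countable_topology} measure" and \<eta> :: "'h::{t2_space,second_countable_topology} measure"
  assumes lcG: "locally compact (UNIV :: 'g set)" and lcH: "locally compact (UNIV :: 'h set)"
    and \<gamma>: "compact_finite \<gamma>" and \<eta>: "compact_finite \<eta>"
    and M: "\<And>j. dominated_marginals \<gamma> \<eta> (M j)"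
  obtains F \<mu> where "F \<noteq> bot" "F \<le> sequentially" "dominated_marginals \<gamma> \<eta> \<mu>"
    "\<And>A B. A \<in> sets borel \<Longrightarrow> B \<in> sets borel \<Longrightarrow> emeasure \<gamma> A < \<infinity> \<Longrightarrow> emeasure \<eta> B < \<infinity> \<Longrightarrow>
       ((\<lambda>j. measure (M j) (A \<times> B)) \<longlongrightarrow> measure \<mu> (A \<times> B)) F"
proof -
  note s = dominated_marginalsD(1)[OF M]
  define bdd where "bdd E \<longleftrightarrow> E \<in> sets borel \<and> (\<exists>c::real. \<forall>j. emeasure (M j) E \<le> ennreal c)" for E
  define c where "c E = (if bdd E then SOME c. c \<ge> 0 \<and> (\<forall>j. emeasure (M j) E \<le> ennreal c) else 0)" for E
  \<comment> \<open>Coordinates outside \<open>bdd\<close> are set to 0, so that the family is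
    bounded in every coordinate and \<open>bounded_family_cluster\<close> applies to all sets at
    once.\<close>
  define g where "g j E = (if bdd E then measure (M j) E else 0)" for j E
  have c: "c E \<ge> 0 \<and> (\<forall>j. emeasure (M j) E \<le> ennreal (c E))" if E: "bdd E" for E
  proof -
    obtain c0 where "\<forall>j. emeasure (M j) E \<le> ennreal c0" using E unfolding bdd_def by blast
    then have "max 0 c0 \<ge> 0 \<and> (\<forall>j. emeasure (M j) E \<le> ennreal (max 0 c0))" by (auto intro: order_trans[OF _ ennreal_leI])
    from someI[of "\<lambda>c. c \<ge> 0 \<and> (\<forall>j. emeasure (M j) E \<le> ennreal c)", OF this]
    show ?thesis unfolding c_def if_P[OF E] .
  qed
  have fin: "emeasure (M j) E < \<infinity>" if "bdd E" for j E
    using c[OF that] by (auto intro: le_less_trans)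
  have em: "emeasure (M j) E = ennreal (g j E)" if "bdd E" for j E
    using fin[OF that, of j] that by (simp add: g_def emeasure_eq_ennreal_measure less_top)
  have g: "0 \<le> g j E" "g j E \<le> c E" for j E
  proof -
    show "0 \<le> g j E" by (simp add: g_def)
    show "g j E \<le> c E"
    proof (cases "bdd E")
      case True
      then show ?thesis using c[OF True] em[OF True, of j] by (metis ennreal_le_iff)
    qed (simp add: g_def c_def)
  qed
  obtain F f where F: "F \<noteq> bot" "F \<le> sequentially" and f: "\<And>E. ((\<lambda>j. g j E) \<longlongrightarrow> f E) F" "\<And>E. 0 \<le> f E"
    using bounded_family_cluster[of g c] g by blast
  have bdd_borel: "E \<in> sets borel" if "bdd E" for E using that by (simp add: bdd_def)
  have bdd_sub: "bdd E" if "bdd E'" "E \<subseteq> E'" "E \<in> sets borel" for E E'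
    unfolding bdd_def
  proof (intro conjI exI allI)
    show "emeasure (M j) E \<le> ennreal (c E')" for j
      using c[OF that(1)] emeasure_mono[OF that(2), of "M j"] bdd_borel[OF that(1)]
      by (metis order_trans s)
  qed (rule that)
  have bdd_Un: "bdd (E \<union> E')" if "bdd E" "bdd E'" for E E'
    unfolding bdd_def
  proof (intro conjI exI allI)
    fix j
    have "emeasure (M j) (E \<union> E') \<le> emeasure (M j) E + emeasure (M j) E'"
      using that by (intro emeasure_subadditive) (auto simp: s bdd_borel)
    also have "\<dots> \<le> ennreal (c E) + ennreal (c E')" using c[OF that(1)] c[OF that(2)] by (intro add_mono) auto
    also have "\<dots> = ennreal (c E + c E')" using c[OF that(1)] c[OF that(2)] by (simp add: ennreal_plus)
    finally show "emeasure (M j) (E \<union> E') \<le> ennreal (c E + c E')" .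
  qed (use that bdd_borel in auto)
  have f_le: "f E \<le> d" if "\<And>j. g j E \<le> d" for E d
    by (rule tendsto_upperbound[OF f(1) _ F(1)]) (use that in auto)
  have f_add: "f (E \<union> E') = f E + f E'" if "bdd E" "bdd E'" "E \<inter> E' = {}" for E E'
  proof (rule tendsto_unique[OF F(1) f(1)])
    have "g j (E \<union> E') = g j E + g j E'" for j
      using that fin[OF that(1), of j] fin[OF that(2), of j] bdd_Un[OF that(1,2)]
      by (auto simp: g_def s bdd_borel intro!: measure_Union)
    then show "((\<lambda>j. g j (E \<union> E')) \<longlongrightarrow> f E + f E') F" using tendsto_add[OF f(1) f(1)] by simp
  qed
  have f_mono: "f E \<le> f E'" if "bdd E'" "E \<subseteq> E'" "E \<in> sets borel" for E E'
  proof -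
    have "bdd E" "bdd (E' - E)" using that bdd_borel by (auto intro: bdd_sub)
    then have "f (E \<union> (E' - E)) = f E + f (E' - E)" by (intro f_add) auto
    then show ?thesis using f(2)[of "E' - E"] that(2) by (simp add: Un_absorb1)
  qed
  have f_Un: "f (E \<union> E') \<le> f E + f E'" if "bdd E" "bdd E'" for E E'
  proof -
    have b: "bdd (E' - E)" using that bdd_borel by (intro bdd_sub[OF that(2)]) auto
    have "f (E \<union> (E' - E)) = f E + f (E' - E)" using that b by (intro f_add) auto
    moreover have "f (E' - E) \<le> f E'" using that b bdd_borel by (intro f_mono) auto
    ultimately show ?thesis by simp
  qed
  \<comment> \<open>One pair \<open>C\<close>, \<open>U\<close> serves all \<open>j\<close>. An
    estimate in which the pair depended on \<open>j\<close> would not pass to the limit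
    \<open>f\<close>.\<close>
  define \<R> where "\<R> = {E. bdd E \<and> (\<forall>e>0. \<exists>C U. compact C \<and> open U \<and> C \<subseteq> E \<and> E \<subseteq> U \<and> bdd U \<and>
      (\<forall>j. emeasure (M j) (U - C) \<le> ennreal e))}"
  have RE: "\<exists>C U. compact C \<and> open U \<and> C \<subseteq> E \<and> E \<subseteq> U \<and> bdd U \<and> bdd (U - C) \<and> (\<forall>j. emeasure (M j) (U - C) \<le> ennreal e)"
    if R: "E \<in> \<R>" "e > 0" for E e
  proof -
    obtain C U where CU: "compact C" "open U" "C \<subseteq> E" "E \<subseteq> U" "bdd U" "\<forall>j. emeasure (M j) (U - C) \<le> ennreal e"
      using R unfolding \<R>_def mem_Collect_eq by meson
    moreover have "bdd (U - C)" by (rule bdd_sub[OF CU(5)]) (use CU in \<open>auto simp: compact_imp_closed\<close>)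
    ultimately show ?thesis by (intro exI conjI)
  qed
  have Rb: "bdd E" if "E \<in> \<R>" for E using that by (simp add: \<R>_def)
  have bdd_empty: "bdd {}" by (auto simp: bdd_def)
  have ring: "ring_of_sets UNIV \<R>"
  proof (rule ring_of_setsI)
    show "{} \<in> \<R>" unfolding \<R>_def using bdd_empty by (auto intro!: exI[of _ "{}"])
    fix E E' assume E: "E \<in> \<R>" "E' \<in> \<R>"
    have key: "\<exists>C U C' U'. compact C \<and> open U \<and> C \<subseteq> E \<and> E \<subseteq> U \<and> bdd U \<and> compact C' \<and> open U' \<and> C' \<subseteq> E' \<and> E' \<subseteq> U' \<and> bdd U'
       \<and> (\<forall>j. emeasure (M j) ((U - C) \<union> (U' - C')) \<le> ennreal e)" if e: "e > 0" for e
    proof -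
      have e2: "e / 2 > 0" using e by simp
      obtain C U where 1: "compact C" "open U" "C \<subseteq> E" "E \<subseteq> U" "bdd U" "\<And>j. emeasure (M j) (U - C) \<le> ennreal (e/2)"
        using RE[OF E(1) e2] by blast
      obtain C' U' where 2: "compact C'" "open U'" "C' \<subseteq> E'" "E' \<subseteq> U'" "bdd U'" "\<And>j. emeasure (M j) (U' - C') \<le> ennreal (e/2)"
        using RE[OF E(2) e2] by blast
      have "emeasure (M j) ((U - C) \<union> (U' - C')) \<le> ennreal e" for j
      proof -
        have "emeasure (M j) ((U - C) \<union> (U' - C')) \<le> emeasure (M j) (U - C) + emeasure (M j) (U' - C')"
          using 1 2 by (intro emeasure_subadditive) (auto simp: s compact_imp_closed)
        also have "\<dots> \<le> ennreal (e/2) + ennreal (e/2)" using 1 2 by (intro add_mono) auto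
        also have "\<dots> = ennreal e" using e by (simp flip: ennreal_plus)
        finally show ?thesis .
      qed
      then show ?thesis using 1 2 by blast
    qed
    have mono: "emeasure (M j) X \<le> ennreal e" if "emeasure (M j) Y \<le> ennreal e" "X \<subseteq> Y" "Y \<in> sets borel" for j X Y e
      using that emeasure_mono[of X Y "M j"] by (simp add: s order_trans)
    show "E \<union> E' \<in> \<R>" unfolding \<R>_def
    proof (intro CollectI conjI allI impI)
      show "bdd (E \<union> E')" using E Rb bdd_Un by blast
      fix e :: real assume "e > 0"
      then obtain C U C' U' where *: "compact C" "open U" "C \<subseteq> E" "E \<subseteq> U" "bdd U" "compact C'" "open U'" "C' \<subseteq> E'" "E' \<subseteq> U'" "bdd U'"
        "\<And>j. emeasure (M j) ((U - C) \<union> (U' - C')) \<le> ennreal e" using key by metis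
      show "\<exists>C U. compact C \<and> open U \<and> C \<subseteq> E \<union> E' \<and> E \<union> E' \<subseteq> U \<and> bdd U \<and> (\<forall>j. emeasure (M j) (U - C) \<le> ennreal e)"
      proof (rule exI[of _ "C \<union> C'"], rule exI[of _ "U \<union> U'"], intro conjI allI)
        show "emeasure (M j) ((U \<union> U') - (C \<union> C')) \<le> ennreal e" for j
          by (rule mono[OF *(11)]) (use * in \<open>auto simp: compact_imp_closed\<close>)
      qed (use * bdd_Un in auto)
    qed
    show "E - E' \<in> \<R>" unfolding \<R>_def
    proof (intro CollectI conjI allI impI)
      show "bdd (E - E')" by (rule bdd_sub[OF Rb[OF E(1)]]) (use E Rb in \<open>auto simp: bdd_borel\<close>)
      fix e :: real assume "e > 0"
      then obtain C U C' U' where *: "compact C" "open U" "C \<subseteq> E" "E \<subseteq> U" "bdd U" "compact C'" "open U'" "C' \<subseteq> E'" "E' \<subseteq> U'" "bdd U'"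
        "\<And>j. emeasure (M j) ((U - C) \<union> (U' - C')) \<le> ennreal e" using key by metis
      show "\<exists>C U. compact C \<and> open U \<and> C \<subseteq> E - E' \<and> E - E' \<subseteq> U \<and> bdd U \<and> (\<forall>j. emeasure (M j) (U - C) \<le> ennreal e)"
      proof (rule exI[of _ "C - U'"], rule exI[of _ "U - C'"], intro conjI allI)
        show "emeasure (M j) ((U - C') - (C - U')) \<le> ennreal e" for j
          by (rule mono[OF *(11)]) (use * in \<open>auto simp: compact_imp_closed\<close>)
        show "compact (C - U')" "open (U - C')"
          using * by (auto simp: compact_diff compact_imp_closed open_Diff)
        show "bdd (U - C')" by (rule bdd_sub[OF *(5)]) (use * in \<open>auto simp: compact_imp_closed\<close>)
      qed (use * in auto)
    qed
  qed auto
  interpret ring_of_sets UNIV \<R> by (rule ring)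
  have "\<exists>\<mu>0. (\<forall>E\<in>\<R>. \<mu>0 E = ennreal (f E)) \<and> measure_space UNIV (sigma_sets UNIV \<R>) \<mu>0"
  proof (rule caratheodory_empty_continuous)
    have "g j {} = 0" for j by (simp add: g_def)
    then have "f {} \<le> 0" by (intro f_le) auto
    then show "positive \<R> (\<lambda>E. ennreal (f E))" using f(2)[of "{}"] by (simp add: positive_def)
    show "additive \<R> (\<lambda>E. ennreal (f E))"
      unfolding additive_def using f_add Rb f(2) by (auto simp: ennreal_plus)
    fix A :: "nat \<Rightarrow> ('g \<times> 'h) set" assume A: "range A \<subseteq> \<R>" "decseq A" "(\<Inter>i. A i) = {}"
    have Ai: "A n \<in> \<R>" for n using A(1) by blast
    then have bA: "bdd (A n)" for n using Rb by blast
    have small: "\<exists>n. f (A n) \<le> e" if e: "e > 0" for e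
    proof -
      define d where "d i = e * (1/2) ^ Suc i" for i
      have d: "d i > 0" for i using e by (simp add: d_def)
      have sd: "d sums e" unfolding d_def using sums_mult[OF power_half_series, of e] by simp
      have "\<exists>C. compact C \<and> C \<subseteq> A i \<and> f (A i - C) \<le> d i" for i
      proof -
        obtain C U where CU: "compact C" "open U" "C \<subseteq> A i" "A i \<subseteq> U" "bdd U" "bdd (U - C)" "\<And>j. emeasure (M j) (U - C) \<le> ennreal (d i)"
          using RE[OF Ai[of i] d[of i]] by metis
        have "f (A i - C) \<le> f (U - C)"
          using CU bA bdd_borel by (intro f_mono) (auto simp: compact_imp_closed)
        also have "f (U - C) \<le> d i"
          using CU(7) d[of i] em[OF CU(6)] by (intro f_le) (simp add: ennreal_le_iff less_imp_le)
        finally show ?thesis using CU by blast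
      qed
      then obtain C where C: "\<And>i. compact (C i)" "\<And>i. C i \<subseteq> A i" "\<And>i. f (A i - C i) \<le> d i" by metis
      have bC: "bdd (A i - C i)" for i
        by (rule bdd_sub[OF bA[of i]]) (use C(1)[of i] bA[of i] in \<open>auto simp: compact_imp_closed bdd_borel\<close>)
      \<comment> \<open>As the \<open>A i\<close> have empty intersection, so have the compact sets
        \<open>C i\<close>, and finitely many of their complements already cover \<open>C 0\<close>.
        For the largest index \<open>n\<close> involved, every point of \<open>A n\<close> lies in
        one of the differences \<open>A i - C i\<close> with \<open>i \<le> n\<close>, whose limit
        masses sum to at most \<open>e\<close>.\<close>
      have "C 0 \<subseteq> (\<Union>i. - C i)"
      proof
        fix x assume "x \<in> C 0"
        have "x \<notin> (\<Inter>i. A i)" by (simp add: A(3))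
        then show "x \<in> (\<Union>i. - C i)" using C(2) by blast
      qed
      then obtain I where I: "finite I" "C 0 \<subseteq> (\<Union>i\<in>I. - C i)"
        using compactE_image[OF C(1)[of 0], of UNIV "\<lambda>i. - C i"] C(1)
        by (metis compact_imp_closed open_Compl)
      define n where "n = Max (insert 0 I)"
      have n: "i \<le> n" if "i \<in> I" for i using I that by (simp add: n_def)
      have sub: "A n \<subseteq> (\<Union>i\<le>n. A i - C i)"
      proof
        fix x assume x: "x \<in> A n"
        have xi: "x \<in> A i" if "i \<le> n" for i using A(2) x that by (auto simp: decseq_def)
        show "x \<in> (\<Union>i\<le>n. A i - C i)"
        proof (cases "x \<in> C 0")
          case True
          then obtain i where "i \<in> I" "x \<notin> C i" using I by blast
          then show ?thesis using n xi by blast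
        next
          case False
          then show ?thesis using xi by auto
        qed
      qed
      have "bdd (\<Union>i\<le>m. A i - C i) \<and> f (\<Union>i\<le>m. A i - C i) \<le> (\<Sum>i\<le>m. d i)" for m
      proof (induction m)
        case 0
        then show ?case using bC C(3) by simp
      next
        case (Suc m)
        have eq: "(\<Union>i\<le>Suc m. A i - C i) = (\<Union>i\<le>m. A i - C i) \<union> (A (Suc m) - C (Suc m))"
          by (auto simp: atMost_Suc)
        have "f (\<Union>i\<le>Suc m. A i - C i) \<le> f (\<Union>i\<le>m. A i - C i) + f (A (Suc m) - C (Suc m))"
          unfolding eq using Suc bC by (intro f_Un) auto
        then show ?case using Suc C(3)[of "Suc m"] bdd_Un[OF _ bC[of "Suc m"]] unfolding eq by auto
      qed
      then have "f (A n) \<le> (\<Sum>i\<le>n. d i)"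
        using f_mono[OF _ sub] bdd_borel[OF bA] by (meson order_trans)
      also have "\<dots> \<le> e" using sum_le_suminf[of d "{..n}"] sd d by (auto simp: sums_iff less_imp_le)
      finally show ?thesis by blast
    qed
    have "(\<lambda>i. f (A i)) \<longlonglongrightarrow> 0"
    proof (rule LIMSEQ_I)
      fix r :: real assume "r > 0"
      then obtain n where n: "f (A n) \<le> r / 2" using small[of "r/2"] by auto
      have "norm (f (A m) - 0) < r" if "m \<ge> n" for m
      proof -
        have "f (A m) \<le> f (A n)" using A(2) that bA bdd_borel by (intro f_mono) (auto simp: decseq_def)
        then show ?thesis using n f(2)[of "A m"] \<open>r > 0\<close> by simp
      qed
      then show "\<exists>no. \<forall>m\<ge>no. norm (f (A m) - 0) < r" by blast
    qed
    then show "(\<lambda>i. ennreal (f (A i))) \<longlonglongrightarrow> 0" using tendsto_ennrealI by fastforce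
  qed auto
  then obtain \<mu>0 where \<mu>0: "\<And>E. E \<in> \<R> \<Longrightarrow> \<mu>0 E = ennreal (f E)" "measure_space UNIV (sigma_sets UNIV \<R>) \<mu>0" by blast
  have rect: "A \<times> B \<in> \<R>" if A: "A \<in> sets borel" "emeasure \<gamma> A < \<infinity>" and B: "B \<in> sets borel" "emeasure \<eta> B < \<infinity>" for A B
  proof -
    have b: "bdd (A \<times> B)" if A: "A \<in> sets borel" "emeasure \<gamma> A < \<infinity>" and B: "B \<in> sets borel" for A B
      unfolding bdd_def
    proof (intro conjI exI allI)
      show "A \<times> B \<in> sets borel" using that by (simp add: borel_Times)
      show "emeasure (M j) (A \<times> B) \<le> ennreal (measure \<gamma> A)" for j
        using dominated_marginals_rect(1)[OF M A(1) B] A(2) by (simp add: emeasure_eq_ennreal_measure less_top)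
    qed
    show ?thesis unfolding \<R>_def
    proof (intro CollectI conjI allI impI)
      show "bdd (A \<times> B)" by (rule b) fact+
      fix e :: real assume "e > 0"
      then have e2: "e / 2 > 0" by simp
      obtain C U where 1: "compact C" "open U" "C \<subseteq> A" "A \<subseteq> U" "emeasure \<gamma> (U - C) < ennreal (e/2)" "emeasure \<gamma> U < \<infinity>"
        using compact_finite_regular[OF lcG \<gamma> A e2] .
      obtain C' U' where 2: "compact C'" "open U'" "C' \<subseteq> B" "B \<subseteq> U'" "emeasure \<eta> (U' - C') < ennreal (e/2)" "emeasure \<eta> U' < \<infinity>"
        using compact_finite_regular[OF lcH \<eta> B e2] .
      show "\<exists>C U. compact C \<and> open U \<and> C \<subseteq> A \<times> B \<and> A \<times> B \<subseteq> U \<and> bdd U \<and> (\<forall>j. emeasure (M j) (U - C) \<le> ennreal e)"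
      \<comment> \<open>The error set lies in the two strips over \<open>U - C\<close> and
        \<open>U' - C'\<close>, and each strip is bounded by its marginal, uniformly in
        \<open>j\<close>.\<close>
      proof (rule exI[of _ "C \<times> C'"], rule exI[of _ "U \<times> U'"], intro conjI allI)
        show "compact (C \<times> C')" "open (U \<times> U')" using 1 2 by (auto simp: compact_Times open_Times)
        show "C \<times> C' \<subseteq> A \<times> B" "A \<times> B \<subseteq> U \<times> U'" using 1 2 by auto
        show "bdd (U \<times> U')" using 1 2 by (intro b) auto
        fix j
        have m: "U - C \<in> sets borel" "U' - C' \<in> sets borel" using 1 2 by (auto simp: compact_imp_closed)
        have "emeasure (M j) (U \<times> U' - C \<times> C') \<le> emeasure (M j) ((U - C) \<times> UNIV \<union> UNIV \<times> (U' - C'))"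
          using m by (intro emeasure_mono) (auto simp: s borel_Times)
        also have "\<dots> \<le> emeasure (M j) ((U - C) \<times> UNIV) + emeasure (M j) (UNIV \<times> (U' - C'))"
          using m by (intro emeasure_subadditive) (auto simp: s borel_Times)
        also have "\<dots> \<le> emeasure \<gamma> (U - C) + emeasure \<eta> (U' - C')"
          using m by (intro add_mono dominated_marginalsD[OF M])
        also have "\<dots> \<le> ennreal (e/2) + ennreal (e/2)" using 1 2 by (intro add_mono) auto
        also have "\<dots> = ennreal e" using \<open>e > 0\<close> by (simp flip: ennreal_plus)
        finally show "emeasure (M j) (U \<times> U' - C \<times> C') \<le> ennreal e" .
      qed
    qed
  qed
  obtain W :: "nat \<Rightarrow> 'g set" where W: "\<And>n. open (W n)" "\<And>n. emeasure \<gamma> (W n) < \<infinity>" "incseq W" "(\<Union>n. W n) = UNIV"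
    by (rule compact_finite_exhaustion[OF lcG \<gamma>]) blast
  obtain W' :: "nat \<Rightarrow> 'h set" where W': "\<And>n. open (W' n)" "\<And>n. emeasure \<eta> (W' n) < \<infinity>" "incseq W'" "(\<Union>n. W' n) = UNIV"
    by (rule compact_finite_exhaustion[OF lcH \<eta>]) blast
  note Wf = W(2) W'(2)
  have sig: "sigma_sets UNIV \<R> = sets borel"
  proof (intro equalityI)
    show "sigma_sets UNIV \<R> \<subseteq> sets (borel :: ('g \<times> 'h) measure)"
      using sets.sigma_sets_subset[of \<R> "borel :: ('g \<times> 'h) measure"] Rb bdd_borel by auto
    show "sets (borel :: ('g \<times> 'h) measure) \<subseteq> sigma_sets UNIV \<R>"
      unfolding borel_prod_finite_rect[OF lcG lcH \<gamma> \<eta>]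
      by (intro sigma_sets_mono') (use rect in blast)
  qed
  define \<mu> where "\<mu> = measure_of UNIV (sets borel) \<mu>0"
  have ms: "measure_space UNIV (sets borel) \<mu>0" using \<mu>0(2) by (simp add: sig)
  have s\<mu>: "sets \<mu> = sets borel"
    using sets.sigma_sets_eq[of "borel :: ('g \<times> 'h) measure"] by (simp add: \<mu>_def)
  have em\<mu>: "emeasure \<mu> E = ennreal (f E)" if "E \<in> \<R>" for E
  proof -
    have "emeasure \<mu> E = \<mu>0 E" unfolding \<mu>_def
      using ms Rb[OF that] bdd_borel unfolding measure_space_def by (intro emeasure_measure_of_sigma) auto
    then show ?thesis using \<mu>0(1)[OF that] by simp
  qed
  have le: "emeasure \<mu> (A \<times> B) \<le> emeasure \<gamma> A" "emeasure \<mu> (A \<times> B) \<le> emeasure \<eta> B"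
    if "A \<in> sets borel" "emeasure \<gamma> A < \<infinity>" "B \<in> sets borel" "emeasure \<eta> B < \<infinity>" for A B
  proof -
    note R = rect[OF that]
    have "g j (A \<times> B) \<le> measure \<gamma> A" "g j (A \<times> B) \<le> measure \<eta> B" for j
      using dominated_marginals_rect[OF M that(1,3), of j] that(2,4) em[OF Rb[OF R], of j]
      by (auto simp: emeasure_eq_ennreal_measure less_top g(1) ennreal_le_iff)
    then show "emeasure \<mu> (A \<times> B) \<le> emeasure \<gamma> A" "emeasure \<mu> (A \<times> B) \<le> emeasure \<eta> B"
      using f_le[of "A \<times> B"] that(2,4) em\<mu>[OF R]
      by (auto simp: emeasure_eq_ennreal_measure less_top ennreal_leI)
  qed
  have "dominated_marginals \<gamma> \<eta> \<mu>"
    unfolding dominated_marginals_def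
  proof (intro conjI ballI)
    fix A :: "'g set" assume A: "A \<in> sets borel"
    show "emeasure \<mu> (A \<times> UNIV) \<le> emeasure \<gamma> A"
    proof (cases "emeasure \<gamma> A < \<infinity>")
      case True
      \<comment> \<open>The bound is known for finite rectangles only; exhausting the other factor
        gives the whole strip.\<close>
      have "(\<lambda>n. emeasure \<mu> (A \<times> W' n)) \<longlonglongrightarrow> emeasure \<mu> (\<Union>n. A \<times> W' n)"
        by (rule Lim_emeasure_incseq)
          (use A W'(1) in \<open>auto simp: s\<mu> borel_Times\<close>, use W'(3) in \<open>force simp: incseq_def\<close>)
      moreover have "(\<Union>n. A \<times> W' n) = A \<times> UNIV" using W'(4) by blast
      ultimately have "(\<lambda>n. emeasure \<mu> (A \<times> W' n)) \<longlonglongrightarrow> emeasure \<mu> (A \<times> UNIV)" by simp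
      then show ?thesis
        by (rule LIMSEQ_le_const2) (use le A True W' Wf in auto)
    qed (simp add: not_less top_unique)
  next
    fix B :: "'h set" assume B: "B \<in> sets borel"
    show "emeasure \<mu> (UNIV \<times> B) \<le> emeasure \<eta> B"
    proof (cases "emeasure \<eta> B < \<infinity>")
      case True
      have "(\<lambda>n. emeasure \<mu> (W n \<times> B)) \<longlonglongrightarrow> emeasure \<mu> (\<Union>n. W n \<times> B)"
        by (rule Lim_emeasure_incseq)
          (use B W(1) in \<open>auto simp: s\<mu> borel_Times\<close>, use W(3) in \<open>force simp: incseq_def\<close>)
      moreover have "(\<Union>n. W n \<times> B) = UNIV \<times> B" using W(4) by blast
      ultimately have "(\<lambda>n. emeasure \<mu> (W n \<times> B)) \<longlonglongrightarrow> emeasure \<mu> (UNIV \<times> B)" by simp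
      then show ?thesis
        by (rule LIMSEQ_le_const2) (use le B True W Wf in auto)
    qed (simp add: not_less top_unique)
  qed (rule s\<mu>)
  moreover have "((\<lambda>j. measure (M j) (A \<times> B)) \<longlongrightarrow> measure \<mu> (A \<times> B)) F"
    if AB: "A \<in> sets borel" "B \<in> sets borel" "emeasure \<gamma> A < \<infinity>" "emeasure \<eta> B < \<infinity>" for A B
  proof -
    note R = rect[OF AB(1,3,2,4)]
    have "measure \<mu> (A \<times> B) = f (A \<times> B)" using em\<mu>[OF R] f(2) by (simp add: measure_def)
    moreover have "measure (M j) (A \<times> B) = g j (A \<times> B)" for j using Rb[OF R] by (simp add: g_def)
    ultimately show ?thesis using f(1)[of "A \<times> B"] by simp
  qed
  ultimately show ?thesis using that F by blast
qed

section \<open>Integrals of tensor products against measures with dominated marginals\<close>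

lemma dominated_image_integrable:
  fixes f :: "'b \<Rightarrow> real"
  assumes p: "p \<in> measurable \<mu> N" and le: "\<And>A. A \<in> sets N \<Longrightarrow> emeasure \<mu> (p -` A \<inter> space \<mu>) \<le> emeasure N A"
    and f: "integrable N f"
  shows "integrable \<mu> (\<lambda>z. f (p z))" "(\<integral>z. \<bar>f (p z)\<bar> \<partial>\<mu>) \<le> (\<integral>x. \<bar>f x\<bar> \<partial>N)"
proof -
  have d: "distr \<mu> N p \<le> N"
    by (subst le_measure) (auto simp: emeasure_distr[OF p] le)
  have [measurable]: "f \<in> borel_measurable N" using f by auto
  have "(\<integral>\<^sup>+z. ennreal \<bar>f (p z)\<bar> \<partial>\<mu>) = (\<integral>\<^sup>+x. ennreal \<bar>f x\<bar> \<partial>distr \<mu> N p)"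
    using p by (simp add: nn_integral_distr)
  also have "\<dots> \<le> (\<integral>\<^sup>+x. ennreal \<bar>f x\<bar> \<partial>N)"
    by (rule nn_integral_mono_measure) (use d in auto)
  finally have le: "(\<integral>\<^sup>+z. ennreal \<bar>f (p z)\<bar> \<partial>\<mu>) \<le> (\<integral>\<^sup>+x. ennreal \<bar>f x\<bar> \<partial>N)" .
  have fin: "(\<integral>\<^sup>+x. ennreal \<bar>f x\<bar> \<partial>N) < \<infinity>" using f by (auto simp: integrable_iff_bounded)
  show int: "integrable \<mu> (\<lambda>z. f (p z))"
    unfolding integrable_iff_bounded using p le fin by (auto intro: le_less_trans measurable_compose)
  have "ennreal (\<integral>z. \<bar>f (p z)\<bar> \<partial>\<mu>) \<le> ennreal (\<integral>x. \<bar>f x\<bar> \<partial>N)"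
    using le int f by (simp add: nn_integral_eq_integral)
  then show "(\<integral>z. \<bar>f (p z)\<bar> \<partial>\<mu>) \<le> (\<integral>x. \<bar>f x\<bar> \<partial>N)"
    by (simp add: ennreal_le_iff)
qed

lemma dominated_image_integrable_mult:
  fixes f :: "'b \<Rightarrow> real"
  assumes p: "p \<in> measurable \<mu> N" and le: "\<And>A. A \<in> sets N \<Longrightarrow> emeasure \<mu> (p -` A \<inter> space \<mu>) \<le> emeasure N A"
    and f: "integrable N f" and b: "b \<in> borel_measurable \<mu>" "\<And>z. \<bar>b z\<bar> \<le> C"
  shows "integrable \<mu> (\<lambda>z. f (p z) * b z)" "\<bar>\<integral>z. f (p z) * b z \<partial>\<mu>\<bar> \<le> C * (\<integral>x. \<bar>f x\<bar> \<partial>N)"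
proof -
  note i = dominated_image_integrable[OF p le f]
  have C: "C \<ge> 0" using b(2) by (meson abs_ge_zero order_trans)
  have bC: "\<bar>b z\<bar> * \<bar>f (p z)\<bar> \<le> C * \<bar>f (p z)\<bar>" for z by (rule mult_right_mono[OF b(2)]) simp
  have "integrable \<mu> (\<lambda>z. C * f (p z))" using i(1) by simp
  then show int: "integrable \<mu> (\<lambda>z. f (p z) * b z)"
  proof (rule Bochner_Integration.integrable_bound)
    show "AE z in \<mu>. norm (f (p z) * b z) \<le> norm (C * f (p z))"
      using bC C by (intro AE_I2) (simp add: abs_mult mult.commute)
  qed (use i(1) b(1) in auto)
  have "\<bar>\<integral>z. f (p z) * b z \<partial>\<mu>\<bar> \<le> (\<integral>z. \<bar>f (p z) * b z\<bar> \<partial>\<mu>)" by (rule integral_abs_bound)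
  also have "\<dots> \<le> (\<integral>z. C * \<bar>f (p z)\<bar> \<partial>\<mu>)"
    using i(1) bC by (intro integral_mono integrable_abs[OF int]) (simp_all add: abs_mult mult.commute)
  also have "\<dots> = C * (\<integral>z. \<bar>f (p z)\<bar> \<partial>\<mu>)" by simp
  also have "\<dots> \<le> C * (\<integral>x. \<bar>f x\<bar> \<partial>N)" using i(2) C by (rule mult_left_mono)
  finally show "\<bar>\<integral>z. f (p z) * b z \<partial>\<mu>\<bar> \<le> C * (\<integral>x. \<bar>f x\<bar> \<partial>N)" .
qed

text \<open>The functionals sending \<open>f\<close> to the integral of \<open>f (p z) * b z\<close>
  have norm at most \<open>C\<close> on \<open>L\<^sup>1(N)\<close>, uniformly in \<open>j\<close>.
  Convergence on a dense class therefore extends to all integrable functions.\<close>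

lemma dominated_image_tendsto:
  fixes f :: "'b \<Rightarrow> real"
  assumes p: "\<And>j. p \<in> measurable (M j) N" "p \<in> measurable \<mu> N"
    and le: "\<And>j A. A \<in> sets N \<Longrightarrow> emeasure (M j) (p -` A \<inter> space (M j)) \<le> emeasure N A"
      "\<And>A. A \<in> sets N \<Longrightarrow> emeasure \<mu> (p -` A \<inter> space \<mu>) \<le> emeasure N A"
    and b: "\<And>j. b \<in> borel_measurable (M j)" "b \<in> borel_measurable \<mu>" "\<And>z. \<bar>b z\<bar> \<le> C"
    and D: "\<And>d. d \<in> D \<Longrightarrow> integrable N d"
      "\<And>d. d \<in> D \<Longrightarrow> ((\<lambda>j. \<integral>z. d (p z) * b z \<partial>M j) \<longlongrightarrow> (\<integral>z. d (p z) * b z \<partial>\<mu>)) F"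
      "\<And>e. e > 0 \<Longrightarrow> \<exists>d\<in>D. (\<integral>x. \<bar>f x - d x\<bar> \<partial>N) < e"
    and f: "integrable N f"
  shows "((\<lambda>j. \<integral>z. f (p z) * b z \<partial>M j) \<longlongrightarrow> (\<integral>z. f (p z) * b z \<partial>\<mu>)) F"
proof (rule tendstoI)
  fix e :: real assume e: "e > 0"
  have C: "C \<ge> 0" using b(3) by (meson abs_ge_zero order_trans)
  \<comment> \<open>The summand 1 keeps \<open>\<delta>\<close> positive when
    \<open>C = 0\<close>.\<close>
  define \<delta> where "\<delta> = e / (4 * (C + 1))"
  have \<delta>: "\<delta> > 0" "C * \<delta> < e / 3" using e C by (auto simp: \<delta>_def field_simps intro!: add_nonneg_pos)
  obtain d where d: "d \<in> D" "(\<integral>x. \<bar>f x - d x\<bar> \<partial>N) < \<delta>" using D(3)[OF \<delta>(1)] by blast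
  have diff: "\<bar>(\<integral>z. f (p z) * b z \<partial>\<nu>) - (\<integral>z. d (p z) * b z \<partial>\<nu>)\<bar> < e / 3"
    if "p \<in> measurable \<nu> N" "\<And>A. A \<in> sets N \<Longrightarrow> emeasure \<nu> (p -` A \<inter> space \<nu>) \<le> emeasure N A" "b \<in> borel_measurable \<nu>" for \<nu>
  proof -
    note * = dominated_image_integrable_mult[OF that(1,2) _ that(3) b(3)]
    have "(\<integral>z. f (p z) * b z \<partial>\<nu>) - (\<integral>z. d (p z) * b z \<partial>\<nu>) = (\<integral>z. (f (p z) - d (p z)) * b z \<partial>\<nu>)"
      using *(1)[OF _ f] *(1)[OF _ D(1)[OF d(1)]]
      by (subst Bochner_Integration.integral_diff[symmetric]) (auto simp: algebra_simps)
    also have "\<bar>\<dots>\<bar> \<le> C * (\<integral>x. \<bar>f x - d x\<bar> \<partial>N)"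
      using *(2)[of "\<lambda>x. f x - d x"] f D(1)[OF d(1)] by simp
    also have "\<dots> \<le> C * \<delta>" using d(2) C by (intro mult_left_mono) auto
    also have "\<dots> < e / 3" by (rule \<delta>)
    finally show ?thesis .
  qed
  have "eventually (\<lambda>j. dist (\<integral>z. d (p z) * b z \<partial>M j) (\<integral>z. d (p z) * b z \<partial>\<mu>) < e / 3) F"
    using D(2)[OF d(1)] e by (intro tendstoD) auto
  then show "eventually (\<lambda>j. dist (\<integral>z. f (p z) * b z \<partial>M j) (\<integral>z. f (p z) * b z \<partial>\<mu>) < e) F"
  proof (rule eventually_mono)
    fix j assume "dist (\<integral>z. d (p z) * b z \<partial>M j) (\<integral>z. d (p z) * b z \<partial>\<mu>) < e / 3"
    then show "dist (\<integral>z. f (p z) * b z \<partial>M j) (\<integral>z. f (p z) * b z \<partial>\<mu>) < e"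
      using diff[OF p(1) le(1) b(1), of j] diff[OF p(2) le(2) b(2)] unfolding dist_real_def by linarith
  qed
qed

lemma dominated_marginals_images:
  fixes \<gamma> :: "'g::{t2_space,second_countable_topology} measure" and \<eta> :: "'h::{t2_space,second_countable_topology} measure"
  assumes "dominated_marginals \<gamma> \<eta> \<mu>" "compact_finite \<gamma>" "compact_finite \<eta>"
  shows "fst \<in> measurable \<mu> \<gamma>" "snd \<in> measurable \<mu> \<eta>"
    "A \<in> sets \<gamma> \<Longrightarrow> emeasure \<mu> (fst -` A \<inter> space \<mu>) \<le> emeasure \<gamma> A"
    "B \<in> sets \<eta> \<Longrightarrow> emeasure \<mu> (snd -` B \<inter> space \<mu>) \<le> emeasure \<eta> B"
proof -
  note D = dominated_marginalsD[OF assms(1)]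
  note c = compact_finite_sets[OF assms(2)] compact_finite_sets[OF assms(3)]
  have "fst \<in> measurable borel (borel :: 'g measure)" "snd \<in> measurable borel (borel :: 'h measure)"
    by (auto intro!: borel_measurable_continuous_onI continuous_intros)
  then show "fst \<in> measurable \<mu> \<gamma>" "snd \<in> measurable \<mu> \<eta>"
    using measurable_cong_sets[OF D(1) c(1)] measurable_cong_sets[OF D(1) c(2)] by auto
  have "fst -` A = A \<times> (UNIV :: 'h set)" "snd -` B = (UNIV :: 'g set) \<times> B" by auto
  then show "A \<in> sets \<gamma> \<Longrightarrow> emeasure \<mu> (fst -` A \<inter> space \<mu>) \<le> emeasure \<gamma> A"
    "B \<in> sets \<eta> \<Longrightarrow> emeasure \<mu> (snd -` B \<inter> space \<mu>) \<le> emeasure \<eta> B"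
    using D c by auto
qed

text \<open>The extension from dense classes is made in one factor at a time, the other factor
  serving as the bounded multiplier. This is why the members of \<open>D\<close> and the function
  \<open>g\<close> have to be bounded, whereas \<open>f\<close> may be any integrable
  function.\<close>

lemma tensor_tendsto:
  fixes \<gamma> :: "'g::{t2_space,second_countable_topology} measure" and \<eta> :: "'h::{t2_space,second_countable_topology} measure"
    and f :: "'g \<Rightarrow> real" and g :: "'h \<Rightarrow> real" and D :: "('g \<Rightarrow> real) set" and E :: "('h \<Rightarrow> real) set" 
  assumes \<gamma>: "compact_finite \<gamma>" and \<eta>: "compact_finite \<eta>"
    and M: "\<And>j. dominated_marginals \<gamma> \<eta> (M j)" and \<mu>: "dominated_marginals \<gamma> \<eta> \<mu>"
    and D: "\<And>d. d \<in> D \<Longrightarrow> integrable \<gamma> d \<and> (\<exists>C. \<forall>x. \<bar>d x\<bar> \<le> C)"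
      "\<And>f e. integrable \<gamma> f \<Longrightarrow> e > 0 \<Longrightarrow> \<exists>d\<in>D. (\<integral>x. \<bar>f x - d x\<bar> \<partial>\<gamma>) < e"
    and E: "\<And>d. d \<in> E \<Longrightarrow> integrable \<eta> d"
      "\<And>f e. integrable \<eta> f \<Longrightarrow> e > 0 \<Longrightarrow> \<exists>d\<in>E. (\<integral>x. \<bar>f x - d x\<bar> \<partial>\<eta>) < e"
    and conv: "\<And>\<phi> \<psi>. \<phi> \<in> D \<Longrightarrow> \<psi> \<in> E \<Longrightarrow>
       ((\<lambda>j. \<integral>z. \<phi> (fst z) * \<psi> (snd z) \<partial>M j) \<longlongrightarrow> (\<integral>z. \<phi> (fst z) * \<psi> (snd z) \<partial>\<mu>)) F"
    and f: "integrable \<gamma> f" and g: "integrable \<eta> g" "\<And>x. \<bar>g x\<bar> \<le> C"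
  shows "((\<lambda>j. \<integral>z. f (fst z) * g (snd z) \<partial>M j) \<longlongrightarrow> (\<integral>z. f (fst z) * g (snd z) \<partial>\<mu>)) F"
proof -
  note im = dominated_marginals_images[OF M \<gamma> \<eta>] dominated_marginals_images[OF \<mu> \<gamma> \<eta>]
  have 1: "((\<lambda>j. \<integral>z. \<phi> (fst z) * g (snd z) \<partial>M j) \<longlongrightarrow> (\<integral>z. \<phi> (fst z) * g (snd z) \<partial>\<mu>)) F"
    if \<phi>: "\<phi> \<in> D" for \<phi>
  proof -
    obtain C where C: "\<And>x. \<bar>\<phi> x\<bar> \<le> C" using D(1)[OF \<phi>] by blast
    have m: "\<phi> \<in> borel_measurable \<gamma>" using D(1)[OF \<phi>] by auto
    have "((\<lambda>j. \<integral>z. g (snd z) * \<phi> (fst z) \<partial>M j) \<longlongrightarrow> (\<integral>z. g (snd z) * \<phi> (fst z) \<partial>\<mu>)) F"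
    proof (rule dominated_image_tendsto[where p = snd and N = \<eta> and D = E and C = C])
      show "((\<lambda>j. \<integral>z. d (snd z) * \<phi> (fst z) \<partial>M j) \<longlongrightarrow> (\<integral>z. d (snd z) * \<phi> (fst z) \<partial>\<mu>)) F" if "d \<in> E" for d
        using conv[OF \<phi> that] by (simp add: mult.commute)
    qed (use im C m E g in \<open>auto intro: measurable_compose\<close>)
    then show ?thesis by (simp add: mult.commute)
  qed
  show ?thesis
  proof (rule dominated_image_tendsto[where p = fst and N = \<gamma> and D = D and C = C and b = "\<lambda>z. g (snd z)"])
  qed (use im g 1 D f in \<open>auto intro: measurable_compose\<close>)
qed

lemma tensor_indicator:
  assumes "A \<in> sets borel" "B \<in> sets borel" "sets \<mu> = sets borel"
  shows "(\<integral>z. indicat_real A (fst z) * indicator B (snd z) \<partial>\<mu>) = measure \<mu> (A \<times> B)"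
proof -
  have "space \<mu> = UNIV" using sets_eq_imp_space_eq[OF assms(3)] by simp
  moreover have "(\<integral>z. indicat_real A (fst z) * indicator B (snd z) \<partial>\<mu>) = (\<integral>z. indicat_real (A \<times> B) z \<partial>\<mu>)"
    by (intro Bochner_Integration.integral_cong) (auto simp: indicator_def)
  ultimately show ?thesis using borel_Times[OF assms(1,2)] assms(3) by simp
qed

lemma finite_rect_measure_eqI:
  fixes \<gamma> :: "'g::{t2_space,second_countable_topology} measure" and \<eta> :: "'h::{t2_space,second_countable_topology} measure"
  assumes lcG: "locally compact (UNIV :: 'g set)" and lcH: "locally compact (UNIV :: 'h set)"
    and \<gamma>: "compact_finite \<gamma>" and \<eta>: "compact_finite \<eta>"
    and \<mu>: "dominated_marginals \<gamma> \<eta> \<mu>" and \<nu>: "sets \<nu> = sets borel"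
    and eq: "\<And>A B. A \<in> sets borel \<Longrightarrow> B \<in> sets borel \<Longrightarrow> emeasure \<gamma> A < \<infinity> \<Longrightarrow> emeasure \<eta> B < \<infinity> \<Longrightarrow>
       emeasure \<mu> (A \<times> B) = emeasure \<nu> (A \<times> B)"
  shows "\<mu> = \<nu>"
proof -
  obtain W :: "nat \<Rightarrow> 'g set" where W: "\<And>n. open (W n)" "\<And>n. emeasure \<gamma> (W n) < \<infinity>" "incseq W" "(\<Union>n. W n) = UNIV"
    by (rule compact_finite_exhaustion[OF lcG \<gamma>]) blast
  obtain W' :: "nat \<Rightarrow> 'h set" where W': "\<And>n. open (W' n)" "\<And>n. emeasure \<eta> (W' n) < \<infinity>" "incseq W'" "(\<Union>n. W' n) = UNIV"
    by (rule compact_finite_exhaustion[OF lcH \<eta>]) blast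
  note Wf = W(2) W'(2)
  let ?E = "{A \<times> B | A B. A \<in> sets borel \<and> emeasure \<gamma> A < \<infinity> \<and> B \<in> sets borel \<and> emeasure \<eta> B < \<infinity>}"
  show ?thesis
  proof (rule measure_eqI_generator_eq[where E = ?E and \<Omega> = UNIV and A = "\<lambda>n. W n \<times> W' n"])
    show "Int_stable ?E"
    proof (rule Int_stableI)
      fix a b assume "a \<in> ?E" "b \<in> ?E"
      then obtain A B A' B' where *: "a = A \<times> B" "b = A' \<times> B'" "A \<in> sets borel" "emeasure \<gamma> A < \<infinity>" "B \<in> sets borel" "emeasure \<eta> B < \<infinity>"
        "A' \<in> sets borel" "B' \<in> sets borel" by blast
      have "emeasure \<gamma> (A \<inter> A') \<le> emeasure \<gamma> A" "emeasure \<eta> (B \<inter> B') \<le> emeasure \<eta> B"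
        using * by (auto intro!: emeasure_mono simp: compact_finite_sets[OF \<gamma>] compact_finite_sets[OF \<eta>])
      then have "emeasure \<gamma> (A \<inter> A') < \<infinity>" "emeasure \<eta> (B \<inter> B') < \<infinity>"
        using *(4,6) by (meson le_less_trans)+
      moreover have "a \<inter> b = (A \<inter> A') \<times> (B \<inter> B')" using *(1,2) by auto
      moreover have "A \<inter> A' \<in> sets borel" "B \<inter> B' \<in> sets borel" using * by auto
      ultimately show "a \<inter> b \<in> ?E" by blast
    qed
    show "emeasure \<mu> X = emeasure \<nu> X" if "X \<in> ?E" for X using that eq by auto
    show "sets \<mu> = sigma_sets UNIV ?E" "sets \<nu> = sigma_sets UNIV ?E"
      using borel_prod_finite_rect[OF lcG lcH \<gamma> \<eta>] \<nu> dominated_marginalsD(1)[OF \<mu>] by auto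
    show "range (\<lambda>n. W n \<times> W' n) \<subseteq> ?E"
    proof (rule image_subsetI)
      show "W n \<times> W' n \<in> ?E" for n using Wf[of n] borel_open[OF W(1)] borel_open[OF W'(1)] by blast
    qed
    show "(\<Union>n. W n \<times> W' n) = UNIV"
    proof -
      have "z \<in> (\<Union>n. W n \<times> W' n)" for z
      proof -
        obtain n m where nm: "fst z \<in> W n" "snd z \<in> W' m" using W(4) W'(4) by blast
        have "W n \<subseteq> W (max n m)" "W' m \<subseteq> W' (max n m)" using W(3) W'(3) by (auto simp: incseq_def)
        then have "z \<in> W (max n m) \<times> W' (max n m)" using nm by (auto simp: mem_Times_iff)
        then show ?thesis by blast
      qed
      then show ?thesis by blast
    qed
    show "emeasure \<mu> (W n \<times> W' n) \<noteq> \<infinity>" for n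
      using dominated_marginals_rect(1)[OF \<mu>, of "W n" "W' n"] W(1) W'(1) Wf(1)[of n] by (auto simp: top_unique)
  qed auto
qed

text \<open>These are the countably many coordinates that metrize the convergence.\<close>

lemma vague_iff_rectangles:
  fixes \<gamma> :: "'g::{t2_space,second_countable_topology} measure" and \<eta> :: "'h::{t2_space,second_countable_topology} measure"
    and B1 :: "nat \<Rightarrow> 'g set" and B2 :: "nat \<Rightarrow> 'h set"
    and M :: "'j \<Rightarrow> ('g \<times> 'h) measure" and F :: "'j filter" and f :: "'g \<Rightarrow> real" and g :: "'h \<Rightarrow> real" 
  assumes lcG: "locally compact (UNIV :: 'g set)" and lcH: "locally compact (UNIV :: 'h set)"
    and \<gamma>: "compact_finite \<gamma>" and \<eta>: "compact_finite \<eta>"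
    and M: "\<And>j. dominated_marginals \<gamma> \<eta> (M j)" and \<mu>: "dominated_marginals \<gamma> \<eta> \<mu>"
    and b1: "base_sequence B1"
    and b2: "base_sequence B2"
  defines "vague \<equiv> (\<forall>\<phi>\<in>Cc. \<forall>\<psi>\<in>Cc. ((\<lambda>j. \<integral>z. \<phi> (fst z) * \<psi> (snd z) \<partial>M j) \<longlongrightarrow> (\<integral>z. \<phi> (fst z) * \<psi> (snd z) \<partial>\<mu>)) F)"
    and "rects \<equiv> (\<forall>m n. ((\<lambda>j. measure (M j) (B1 m \<times> B2 n)) \<longlongrightarrow> measure \<mu> (B1 m \<times> B2 n)) F)"
  shows "vague \<longleftrightarrow> rects"
    "vague \<or> rects \<Longrightarrow> integrable \<gamma> f \<Longrightarrow> integrable \<eta> g \<Longrightarrow> (\<And>x. \<bar>g x\<bar> \<le> C) \<Longrightarrow>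
      ((\<lambda>j. \<integral>z. f (fst z) * g (snd z) \<partial>M j) \<longlongrightarrow> (\<integral>z. f (fst z) * g (snd z) \<partial>\<mu>)) F"
proof -
  note B1 = base_sequenceD[OF b1] and B2 = base_sequenceD[OF b2]
  note im = dominated_marginals_images[OF M \<gamma> \<eta>] dominated_marginals_images[OF \<mu> \<gamma> \<eta>]
  have ind: "integrable \<gamma> (indicator (B1 n) :: _ \<Rightarrow> real)" "integrable \<eta> (indicator (B2 n) :: _ \<Rightarrow> real)" for n
    using compact_finite_subset_compact[OF \<gamma> B1(2) closure_subset] compact_finite_subset_compact[OF \<eta> B2(2) closure_subset]
      B1(1) B2(1) by (auto simp: compact_finite_sets[OF \<gamma>] compact_finite_sets[OF \<eta>])
  \<comment> \<open>Either kind of convergence is first extended to all products of an integrable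
    and a bounded integrable function. These include both the tensor products from \<open>Cc\<close>
    and the indicators of base rectangles, so each kind implies the other.\<close>
  have V: "((\<lambda>j. \<integral>z. f (fst z) * g (snd z) \<partial>M j) \<longlongrightarrow> (\<integral>z. f (fst z) * g (snd z) \<partial>\<mu>)) F"
    if "vague" and f: "integrable \<gamma> f" and g: "integrable \<eta> g" "\<And>x. \<bar>g x\<bar> \<le> C" for f :: "'g \<Rightarrow> real" and g :: "'h \<Rightarrow> real" and C
  proof (rule tensor_tendsto[where D = Cc and E = Cc, OF \<gamma> \<eta> M \<mu> _ _ _ _ _ f g])
    show "integrable \<gamma> d \<and> (\<exists>C. \<forall>x. \<bar>d x\<bar> \<le> C)" if "d \<in> Cc" for d
      using Cc_integrable[OF that \<gamma>] Cc_bounded[OF that] by metis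
  qed (use Cc_dense[OF lcG \<gamma>] Cc_dense[OF lcH \<eta>] Cc_integrable[OF _ \<eta>] \<open>vague\<close> in \<open>auto simp: vague_def\<close>)
  let ?L1 = "lin_span (range (\<lambda>n. indicator (B1 n)))" and ?L2 = "lin_span (range (\<lambda>n. indicator (B2 n)))"
  have d1: "integrable \<gamma> d \<and> (\<exists>C. \<forall>x. \<bar>d x\<bar> \<le> C)" if "d \<in> ?L1" for d
    using that
  proof induction
    case (base f)
    then show ?case using ind by (auto intro!: exI[of _ 1] simp: indicator_def)
  next
    case (add f g)
    then obtain C C' where "\<And>x. \<bar>f x\<bar> \<le> C" "\<And>x. \<bar>g x\<bar> \<le> C'" by blast
    then have "\<bar>f x + g x\<bar> \<le> C + C'" for x by (meson abs_triangle_ineq add_mono order_trans)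
    then show ?case using add by auto
  next
    case (cmult f c)
    then obtain C where "\<And>x. \<bar>f x\<bar> \<le> C" by blast
    then have "\<bar>c * f x\<bar> \<le> \<bar>c\<bar> * C" for x by (simp add: abs_mult mult_left_mono)
    then show ?case using cmult by auto
  qed
  have d2: "integrable \<eta> d" if "d \<in> ?L2" for d
    using that by induction (auto intro: ind)
  have R: "((\<lambda>j. \<integral>z. f (fst z) * g (snd z) \<partial>M j) \<longlongrightarrow> (\<integral>z. f (fst z) * g (snd z) \<partial>\<mu>)) F"
    if "rects" and f: "integrable \<gamma> f" and g: "integrable \<eta> g" "\<And>x. \<bar>g x\<bar> \<le> C" for f :: "'g \<Rightarrow> real" and g :: "'h \<Rightarrow> real" and C
  proof (rule tensor_tendsto[where D = ?L1 and E = ?L2, OF \<gamma> \<eta> M \<mu> _ _ _ _ _ f g])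
    fix \<phi> \<psi> assume \<phi>: "\<phi> \<in> ?L1" and \<psi>: "\<psi> \<in> ?L2"
    have *: "integrable \<nu> (\<lambda>z. \<psi> (snd z) * \<phi> (fst z))" if \<nu>: "dominated_marginals \<gamma> \<eta> \<nu>" and a: "\<phi> \<in> ?L1" and c: "\<psi> \<in> ?L2" for \<phi> \<psi> \<nu>
    proof -
      obtain C where C: "\<And>x. \<bar>\<phi> x\<bar> \<le> C" using d1[OF a] by blast
      note i = dominated_marginals_images[OF \<nu> \<gamma> \<eta>]
      have "\<phi> \<in> borel_measurable \<gamma>" using d1[OF a] by auto
      then have "(\<lambda>z. \<phi> (fst z)) \<in> borel_measurable \<nu>" using i(1) by (rule measurable_compose[rotated])
      then show ?thesis
        by (intro dominated_image_integrable_mult(1)[OF i(2) i(4) d2[OF c], where C = C]) (use C in auto)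
    qed
    \<comment> \<open>Bilinearity extends the convergence from rectangles to spans, by induction in
      the second factor and then in the first.\<close>
    have 1: "((\<lambda>j. \<integral>z. indicator (B1 m) (fst z) * \<psi> (snd z) \<partial>M j) \<longlongrightarrow> (\<integral>z. indicator (B1 m) (fst z) * \<psi> (snd z) \<partial>\<mu>)) F" for m
      using \<psi>
    proof induction
      case (base f)
      then obtain n where "f = indicator (B2 n)" by auto
      then show ?case using \<open>rects\<close> B1(1) B2(1) dominated_marginalsD(1)[OF M] dominated_marginalsD(1)[OF \<mu>]
        by (simp add: rects_def tensor_indicator)
    next
      case (add f g)
      have b: "indicator (B1 m) \<in> ?L1" by (rule lin_span.base) auto
      show ?case using tendsto_add[OF add.IH] *[OF M b add.hyps(1)] *[OF M b add.hyps(2)] *[OF \<mu> b add.hyps(1)] *[OF \<mu> b add.hyps(2)]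
        by (simp add: distrib_left mult.commute)
    next
      case (cmult f c)
      show ?case using tendsto_mult_left[OF cmult.IH, of c] by (simp add: mult.left_commute)
    qed
    show "((\<lambda>j. \<integral>z. \<phi> (fst z) * \<psi> (snd z) \<partial>M j) \<longlongrightarrow> (\<integral>z. \<phi> (fst z) * \<psi> (snd z) \<partial>\<mu>)) F"
      using \<phi>
    proof induction
      case (base f)
      then show ?case using 1 by auto
    next
      case (add f g)
      show ?case using tendsto_add[OF add.IH] *[OF M add.hyps(1) \<psi>] *[OF M add.hyps(2) \<psi>] *[OF \<mu> add.hyps(1) \<psi>] *[OF \<mu> add.hyps(2) \<psi>]
        by (simp add: distrib_left mult.commute)
    next
      case (cmult f c)
      show ?case using tendsto_mult_left[OF cmult.IH, of c] by (simp add: mult.assoc)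
    qed
  qed (use d1 d2 lin_span_base_dense[OF lcG \<gamma> b1] lin_span_base_dense[OF lcH \<eta> b2] in auto)
  show "vague \<or> rects \<Longrightarrow> integrable \<gamma> f \<Longrightarrow> integrable \<eta> g \<Longrightarrow> (\<And>x. \<bar>g x\<bar> \<le> C) \<Longrightarrow>
      ((\<lambda>j. \<integral>z. f (fst z) * g (snd z) \<partial>M j) \<longlongrightarrow> (\<integral>z. f (fst z) * g (snd z) \<partial>\<mu>)) F"
    using V R by blast
  show "vague \<longleftrightarrow> rects"
  proof
    assume v: "vague"
    show "rects" unfolding rects_def
    proof (intro allI)
      fix m n
      have "((\<lambda>j. \<integral>z. indicat_real (B1 m) (fst z) * indicat_real (B2 n) (snd z) \<partial>M j) \<longlongrightarrow>
          (\<integral>z. indicat_real (B1 m) (fst z) * indicat_real (B2 n) (snd z) \<partial>\<mu>)) F"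
        by (rule V[OF v ind, where C = 1]) (auto simp: indicator_def)
      then show "((\<lambda>j. measure (M j) (B1 m \<times> B2 n)) \<longlongrightarrow> measure \<mu> (B1 m \<times> B2 n)) F"
        using B1(1) B2(1) dominated_marginalsD(1)[OF M] dominated_marginalsD(1)[OF \<mu>] by (simp add: tensor_indicator)
    qed
  next
    assume r: "rects"
    show "vague" unfolding vague_def
    proof (intro ballI)
      fix \<phi> :: "'g \<Rightarrow> real" and \<psi> :: "'h \<Rightarrow> real" assume *: "\<phi> \<in> Cc" "\<psi> \<in> Cc"
      obtain C where "\<And>x. \<bar>\<psi> x\<bar> \<le> C" using Cc_bounded[OF *(2)] by metis
      then show "((\<lambda>j. \<integral>z. \<phi> (fst z) * \<psi> (snd z) \<partial>M j) \<longlongrightarrow> (\<integral>z. \<phi> (fst z) * \<psi> (snd z) \<partial>\<mu>)) F"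
        by (intro R[OF r Cc_integrable[OF *(1) \<gamma>] Cc_integrable[OF *(2) \<eta>]])
    qed
  qed
qed

section \<open>Haar measures on subgroups\<close>

text \<open>The Haar measure of a subgroup \<open>S\<close>, seen as a Borel measure on the ambient group.\<close>

definition haar_on :: "'a::{group_add, topological_space} set \<Rightarrow> 'a measure \<Rightarrow> bool" where
  "haar_on S \<mu> \<longleftrightarrow> compact_finite \<mu> \<and> emeasure \<mu> (- S) = 0 \<and> emeasure \<mu> UNIV \<noteq> 0 \<and>
     (\<forall>x\<in>S. \<forall>A\<in>sets borel. emeasure \<mu> ((\<lambda>y. x + y) -` A) = emeasure \<mu> A)"

lemma haar_onD:
  assumes "haar_on S \<mu>"
  shows "compact_finite \<mu>" "sets \<mu> = sets borel" "space \<mu> = UNIV" "emeasure \<mu> (- S) = 0" "emeasure \<mu> UNIV \<noteq> 0"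
    "x \<in> S \<Longrightarrow> A \<in> sets borel \<Longrightarrow> emeasure \<mu> ((\<lambda>y. x + y) -` A) = emeasure \<mu> A"
  using assms compact_finite_sets compact_finite_space by (auto simp: haar_on_def)

lemma add_subgroupD:
  assumes "add_subgroup S"
  shows "0 \<in> S" "x \<in> S \<Longrightarrow> y \<in> S \<Longrightarrow> x + y \<in> S" "x \<in> S \<Longrightarrow> - x \<in> S" "x \<in> S \<Longrightarrow> y \<in> S \<Longrightarrow> - x + y \<in> S"
  using assms by (auto simp: add_subgroup_def)

lemma add_subgroup_UNIV: "add_subgroup UNIV"
  by (simp add: add_subgroup_def)

lemma borel_translate:
  fixes A :: "'a::topological_group_add set"
  assumes "A \<in> sets borel"
  shows "(\<lambda>y. x + y) -` A \<in> sets borel" "(\<lambda>y. y + x) -` A \<in> sets borel" "uminus -` A \<in> sets borel"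
proof -
  have "(\<lambda>y. x + y) \<in> measurable borel borel" "(\<lambda>y. y + x) \<in> measurable borel borel"
    "(uminus :: 'a \<Rightarrow> 'a) \<in> measurable borel borel"
    by (auto intro!: borel_measurable_continuous_onI continuous_intros)
  from this[THEN measurable_sets, OF assms]
  show "(\<lambda>y. x + y) -` A \<in> sets borel" "(\<lambda>y. y + x) -` A \<in> sets borel" "uminus -` A \<in> sets borel" by auto
qed

lemma AE_notin_iff_null:
  assumes "compact_finite \<mu>" "A \<in> sets borel"
  shows "(AE y in \<mu>. y \<notin> A) \<longleftrightarrow> emeasure \<mu> A = 0"
  using AE_iff_null_sets[of A \<mu>] assms compact_finite_sets[OF assms(1)] by (auto simp: null_sets_def)

lemma AE_commute_compact_finite:
  fixes \<mu> :: "'a::{t2_space,second_countable_topology} measure" and \<nu> :: "'b::{t2_space,second_countable_topology} measure"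
  assumes "locally compact (UNIV :: 'a set)" "compact_finite \<mu>" "locally compact (UNIV :: 'b set)" "compact_finite \<nu>"
    and P: "{z. P (fst z) (snd z)} \<in> sets borel"
  shows "(AE x in \<mu>. AE y in \<nu>. P x y) \<longleftrightarrow> (AE y in \<nu>. AE x in \<mu>. P x y)"
proof -
  interpret A: sigma_finite_measure \<mu> using assms by (intro compact_finite_sigma_finite)
  interpret B: sigma_finite_measure \<nu> using assms by (intro compact_finite_sigma_finite)
  interpret pair_sigma_finite \<mu> \<nu> ..
  have "sets (\<mu> \<Otimes>\<^sub>M \<nu>) = sets borel"
    using sets_pair_measure_cong[OF compact_finite_sets compact_finite_sets, OF assms(2,4)] unfolding borel_prod .
  then show ?thesis using P assms
    by (intro AE_commute) (simp add: space_pair_measure compact_finite_space)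
qed

text \<open>The measure is nonzero and carried by \<open>S\<close>. An almost everywhere statement
  obtained from Fubini's theorem can therefore be evaluated at a point of \<open>S\<close>.\<close>

lemma haar_on_AE_ex:
  assumes "haar_on S \<mu>" "S \<in> sets borel" "AE y in \<mu>. P y"
  obtains y where "y \<in> S" "P y"
proof -
  note D = haar_onD[OF assms(1)]
  have "AE y in \<mu>. y \<notin> - S" using AE_notin_iff_null[OF D(1), of "- S"] D(4) assms(2) by simp
  with assms(3) have 1: "AE y in \<mu>. P y \<and> y \<in> S" by eventually_elim auto
  have "\<exists>y. P y \<and> y \<in> S"
  proof (rule ccontr)
    assume no: "\<not> (\<exists>y. P y \<and> y \<in> S)"
    from 1 have "AE y in \<mu>. y \<notin> (UNIV :: 'a set)" by eventually_elim (use no in blast)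
    then show False using AE_notin_iff_null[OF D(1), of UNIV] D(5) by simp
  qed
  then show ?thesis using that by blast
qed

lemma continuous_vimage_borel:
  fixes f :: "('a::{t2_space,second_countable_topology}) \<times> 'a \<Rightarrow> 'b::topological_space"
  assumes "continuous_on UNIV f" "A \<in> sets borel"
  shows "f -` A \<in> sets borel"
  using measurable_sets[OF borel_measurable_continuous_onI[OF assms(1)] assms(2)] by simp

context
  fixes S :: "'a::{topological_group_add,t2_space,second_countable_topology} set" and \<mu> :: "'a measure"
  assumes lc: "locally compact (UNIV :: 'a set)" and S: "add_subgroup S" "S \<in> sets borel" and \<mu>: "haar_on S \<mu>"
begin

text \<open>By left invariance almost all \<open>y\<close> satisfy
  \<open>- x + y \<notin> A\<close>, for each \<open>x\<close> in \<open>S\<close>. Fubini's theorem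
  exchanges the quantifiers and produces one \<open>y\<close> in \<open>S\<close> for which the set
  of \<open>x\<close> with \<open>- x + y \<in> A\<close> is null; that set is a left translate of
  the reflection of \<open>A\<close>.\<close>

lemma haar_null_uminus:
  assumes A: "A \<in> sets borel" "emeasure \<mu> A = 0"
  shows "emeasure \<mu> (uminus -` A) = 0"
proof -
  note D = haar_onD[OF \<mu>]
  have AS: "AE x in \<mu>. x \<in> S" using AE_notin_iff_null[OF D(1), of "- S"] D(4) S(2) by simp
  have a1: "AE y in \<mu>. - x + y \<notin> A" if "x \<in> S" for x
  proof -
    have "emeasure \<mu> ((\<lambda>y. - x + y) -` A) = 0" using D(6)[OF add_subgroupD(3)[OF S(1) that] A(1)] A(2) by simp
    then show ?thesis using AE_notin_iff_null[OF D(1) borel_translate(1)[OF A(1), of "- x"]] by simp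
  qed
  have "AE x in \<mu>. AE y in \<mu>. - x + y \<notin> A" using AS by (rule AE_mp) (use a1 in \<open>auto intro!: AE_I2\<close>)
  moreover have "{z. - fst z + snd z \<notin> A} \<in> sets (borel :: ('a \<times> 'a) measure)"
  proof -
    have "(\<lambda>z::'a \<times> 'a. - fst z + snd z) -` (- A) \<in> sets borel"
      using A(1) by (intro continuous_vimage_borel continuous_intros) auto
    then show ?thesis by (simp add: vimage_def)
  qed
  ultimately have "AE y in \<mu>. AE x in \<mu>. - x + y \<notin> A"
    using AE_commute_compact_finite[OF lc D(1) lc D(1), of "\<lambda>x y. - x + y \<notin> A"] by simp
  from haar_on_AE_ex[OF \<mu> S(2) this] obtain y where y: "y \<in> S" "AE x in \<mu>. - x + y \<notin> A" .
  have eq: "(\<lambda>x. - x + y) -` A = (\<lambda>x. - y + x) -` (uminus -` A)" by (auto simp: minus_add)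
  have m: "(\<lambda>x. - y + x) -` (uminus -` A) \<in> sets borel" by (intro borel_translate A)
  have "AE x in \<mu>. x \<notin> (\<lambda>x. - x + y) -` A" using y(2) by simp
  then have "emeasure \<mu> ((\<lambda>x. - y + x) -` (uminus -` A)) = 0"
    using AE_notin_iff_null[OF D(1) m] unfolding eq by simp
  then show ?thesis
    using D(6)[OF add_subgroupD(3)[OF S(1) y(1)], of "uminus -` A"] borel_translate(3)[OF A(1)] by simp
qed

text \<open>Reflection turns the right translation into a left one. Invariance is claimed for null
  sets only, since \<open>S\<close> is not assumed to be unimodular.\<close>

lemma haar_null_right:
  assumes A: "A \<in> sets borel" "emeasure \<mu> A = 0" and y: "y \<in> S"
  shows "emeasure \<mu> ((\<lambda>x. x + y) -` A) = 0"
proof -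
  note D = haar_onD[OF \<mu>]
  have eq: "(\<lambda>x. x + y) -` A = uminus -` ((\<lambda>z. - y + z) -` (uminus -` A))" by (auto simp: minus_add)
  have "emeasure \<mu> ((\<lambda>z. - y + z) -` (uminus -` A)) = emeasure \<mu> (uminus -` A)"
    using D(6)[OF add_subgroupD(3)[OF S(1) y]] borel_translate(3)[OF A(1)] by blast
  also have "\<dots> = 0" by (rule haar_null_uminus[OF A])
  finally show ?thesis unfolding eq by (intro haar_null_uminus borel_translate A)
qed

lemma haar_nn_integral_left:
  assumes "x \<in> S" "f \<in> borel_measurable borel"
  shows "(\<integral>\<^sup>+y. f (x + y) \<partial>\<mu>) = (\<integral>\<^sup>+y. f y \<partial>\<mu>)"
proof -
  note D = haar_onD[OF \<mu>]
  have m: "(\<lambda>y. x + y) \<in> measurable \<mu> borel"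
    unfolding measurable_cong_sets[OF D(2) refl] by (auto intro!: borel_measurable_continuous_onI continuous_intros)
  have "distr \<mu> borel (\<lambda>y. x + y) = \<mu>"
    by (rule measure_eqI) (use D(6)[OF assms(1)] D(2,3) in \<open>auto simp: emeasure_distr[OF m]\<close>)
  then have "(\<integral>\<^sup>+y. f y \<partial>\<mu>) = (\<integral>\<^sup>+y. f y \<partial>distr \<mu> borel (\<lambda>y. x + y))" by simp
  also have "\<dots> = (\<integral>\<^sup>+y. f (x + y) \<partial>\<mu>)" using assms(2) by (simp add: nn_integral_distr[OF m])
  finally show ?thesis ..
qed

text \<open>Fubini's theorem is applied to \<open>x + y\<close> under \<open>\<mu>\<close> in
  \<open>x\<close> and \<open>\<nu>\<close> in \<open>y\<close>: right translates of
  \<open>A\<close> are null for \<open>\<mu>\<close>, and after the exchange one left translate of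
  \<open>A\<close> is null for \<open>\<nu>\<close>.\<close>

lemma haar_abs_cont:
  assumes \<nu>: "haar_on S \<nu>" and A: "A \<in> sets borel" "emeasure \<mu> A = 0"
  shows "emeasure \<nu> A = 0"
proof -
  note D = haar_onD[OF \<mu>] and N = haar_onD[OF \<nu>]
  have AS: "AE y in \<nu>. y \<in> S" using AE_notin_iff_null[OF N(1), of "- S"] N(4) S(2) by simp
  have a1: "AE x in \<mu>. x + y \<notin> A" if "y \<in> S" for y
    using AE_notin_iff_null[OF D(1) borel_translate(2)[OF A(1), of y]] haar_null_right[OF A that] by simp
  have "AE y in \<nu>. AE x in \<mu>. x + y \<notin> A" using AS by (rule AE_mp) (use a1 in \<open>auto intro!: AE_I2\<close>)
  moreover have "{z. fst z + snd z \<notin> A} \<in> sets (borel :: ('a \<times> 'a) measure)"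
  proof -
    have "(\<lambda>z::'a \<times> 'a. fst z + snd z) -` (- A) \<in> sets borel"
      using A(1) by (intro continuous_vimage_borel continuous_intros) auto
    then show ?thesis by (simp add: vimage_def)
  qed
  ultimately have "AE x in \<mu>. AE y in \<nu>. x + y \<notin> A"
    using AE_commute_compact_finite[OF lc D(1) lc N(1), of "\<lambda>x y. x + y \<notin> A"] by simp
  from haar_on_AE_ex[OF \<mu> S(2) this] obtain x where x: "x \<in> S" "AE y in \<nu>. x + y \<notin> A" .
  then have "emeasure \<nu> ((\<lambda>y. x + y) -` A) = 0"
    using AE_notin_iff_null[OF N(1) borel_translate(1)[OF A(1), of x]] by simp
  then show ?thesis using N(6)[OF x(1) A(1)] by simp
qed

text \<open>A left-invariant Radon-Nikodym density is almost everywhere constant, by Fubini and the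
  invariance of null sets under right translations.\<close>

theorem haar_unique:
  assumes \<nu>: "haar_on S \<nu>"
  shows "\<exists>c>0. \<forall>A\<in>sets borel. emeasure \<nu> A = ennreal c * emeasure \<mu> A"
proof -
  note D = haar_onD[OF \<mu>] and N = haar_onD[OF \<nu>]
  interpret sigma_finite_measure \<mu> using compact_finite_sigma_finite[OF lc D(1)] .
  have "absolutely_continuous \<mu> \<nu>"
    unfolding absolutely_continuous_def null_sets_def using haar_abs_cont[OF \<nu>] D(2) N(2) by auto
  then obtain f where f: "f \<in> borel_measurable \<mu>" "density \<mu> f = \<nu>"
    using Radon_Nikodym D(2) N(2) by metis
  have fb[measurable]: "f \<in> borel_measurable borel" using f(1) unfolding measurable_cong_sets[OF D(2) refl] .
  have em\<nu>: "emeasure \<nu> A = (\<integral>\<^sup>+z. f z * indicator A z \<partial>\<mu>)" if "A \<in> sets borel" for A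
    using emeasure_density[OF f(1), of A] that f(2) D(2) by simp
  have tm: "(\<lambda>y. x + y) \<in> measurable borel borel" for x :: 'a
    by (auto intro!: borel_measurable_continuous_onI continuous_intros)
  have ae: "AE y in \<mu>. f (x + y) = f y" if x: "x \<in> S" for x
  proof -
    have fx: "(\<lambda>y. f (x + y)) \<in> borel_measurable \<mu>"
      using measurable_compose[OF tm[of x] fb] unfolding measurable_cong_sets[OF D(2) refl] .
    have "density \<mu> (\<lambda>y. f (x + y)) = \<nu>"
    proof (rule measure_eqI)
      show "sets (density \<mu> (\<lambda>y. f (x + y))) = sets \<nu>" using D(2) N(2) by simp
      fix A assume "A \<in> sets (density \<mu> (\<lambda>y. f (x + y)))"
      then have A: "A \<in> sets borel" using D(2) by simp
      let ?B = "(\<lambda>y. - x + y) -` A"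
      have B: "?B \<in> sets borel" by (rule borel_translate(1)[OF A])
      have "emeasure (density \<mu> (\<lambda>y. f (x + y))) A = (\<integral>\<^sup>+y. f (x + y) * indicator A y \<partial>\<mu>)"
        using emeasure_density[OF fx, of A] A D(2) by simp
      also have "\<dots> = (\<integral>\<^sup>+y. f (x + y) * indicator ?B (x + y) \<partial>\<mu>)"
        by (intro nn_integral_cong) (simp add: indicator_def add.assoc[symmetric])
      also have "\<dots> = (\<integral>\<^sup>+z. f z * indicator ?B z \<partial>\<mu>)"
        using B by (intro haar_nn_integral_left[OF x] borel_measurable_times_ennreal fb borel_measurable_indicator) simp
      also have "\<dots> = emeasure \<nu> ?B" using em\<nu>[OF B] by simp
      also have "\<dots> = emeasure \<nu> A" by (rule N(6)[OF add_subgroupD(3)[OF S(1) x] A])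
      finally show "emeasure (density \<mu> (\<lambda>y. f (x + y))) A = emeasure \<nu> A" .
    qed
    then have "density \<mu> (\<lambda>y. f (x + y)) = density \<mu> f" using f(2) by simp
    then show ?thesis by (rule density_unique[OF fx f(1)])
  qed
  have AS: "AE x in \<mu>. x \<in> S" using AE_notin_iff_null[OF D(1), of "- S"] D(4) S(2) by simp
  have "AE x in \<mu>. AE y in \<mu>. f (x + y) = f y" using AS by (rule AE_mp) (use ae in \<open>auto intro!: AE_I2\<close>)
  moreover have "{z. f (fst z + snd z) = f (snd z)} \<in> sets (borel :: ('a \<times> 'a) measure)"
  proof -
    have "(\<lambda>z::'a \<times> 'a. fst z + snd z) \<in> measurable borel borel" "(snd :: 'a \<times> 'a \<Rightarrow> 'a) \<in> measurable borel borel"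
      by (auto intro!: borel_measurable_continuous_onI continuous_intros)
    note t = this
    have [measurable]: "(\<lambda>z::'a \<times> 'a. f (fst z + snd z)) \<in> borel_measurable borel" "(\<lambda>z::'a \<times> 'a. f (snd z)) \<in> borel_measurable borel"
      using measurable_compose[OF t(1) fb] measurable_compose[OF t(2) fb] by simp_all
    have "{z \<in> space borel. f (fst z + snd z) = f (snd z)} \<in> sets (borel :: ('a \<times> 'a) measure)" by measurable
    then show ?thesis by simp
  qed
  ultimately have "AE y in \<mu>. AE x in \<mu>. f (x + y) = f y"
    using AE_commute_compact_finite[OF lc D(1) lc D(1), of "\<lambda>x y. f (x + y) = f y"] by simp
  from haar_on_AE_ex[OF \<mu> S(2) this] obtain y where y: "y \<in> S" "AE x in \<mu>. f (x + y) = f y" .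
  define c where "c = f y"
  let ?Z = "{z. f z \<noteq> c}"
  have Z: "?Z \<in> sets borel"
  proof -
    have "{z \<in> space borel. f z \<noteq> c} \<in> sets borel" by measurable
    then show ?thesis by simp
  qed
  have n: "emeasure \<mu> ((\<lambda>x. x + y) -` ?Z) = 0"
    using y(2) AE_notin_iff_null[OF D(1) borel_translate(2)[OF Z, of y]] by (simp add: c_def)
  have "?Z = (\<lambda>x. x + - y) -` ((\<lambda>x. x + y) -` ?Z)" by (auto simp: add.assoc)
  then have "emeasure \<mu> ?Z = 0"
    using haar_null_right[OF borel_translate(2)[OF Z] n add_subgroupD(3)[OF S(1) y(1)]] by simp
  then have "AE z in \<mu>. f z = c" using AE_notin_iff_null[OF D(1) Z] by simp
  then have eq: "emeasure \<nu> A = c * emeasure \<mu> A" if A: "A \<in> sets borel" for A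
  proof -
    have "emeasure \<nu> A = (\<integral>\<^sup>+z. c * indicator A z \<partial>\<mu>)"
      unfolding em\<nu>[OF A] using \<open>AE z in \<mu>. f z = c\<close> by (intro nn_integral_cong_AE) auto
    then show ?thesis using A D(2) by (simp add: nn_integral_cmult_indicator)
  qed
  have c0: "c \<noteq> 0" using eq[of UNIV] N(5) by auto
  obtain W :: "nat \<Rightarrow> 'a set" where W: "\<And>n. open (W n)" "\<And>n. compact (closure (W n))" "incseq W" "(\<Union>n. W n) = UNIV"
    by (rule lc_open_exhaustion[OF lc]) blast
  have "\<exists>n. emeasure \<mu> (W n) \<noteq> 0"
  proof (rule ccontr)
    assume "\<not> ?thesis"
    then have "emeasure \<mu> (\<Union>n. W n) = 0" using W(1) by (intro emeasure_UN_eq_0) (auto simp: D(2))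
    then show False using W(4) D(5) by simp
  qed
  then obtain n where n: "emeasure \<mu> (W n) \<noteq> 0" by blast
  \<comment> \<open>A relatively compact set of positive \<open>\<mu>\<close>-mass has finite
    \<open>\<nu>\<close>-mass.\<close>
  have "c \<noteq> \<infinity>"
  proof
    assume "c = \<infinity>"
    then have "emeasure \<nu> (W n) = \<infinity>" using eq[of "W n"] W(1) n by (simp add: ennreal_top_mult)
    then show False using compact_finite_subset_compact[OF N(1) W(2) closure_subset, of n] by simp
  qed
  then obtain r where r: "c = ennreal r" "r \<ge> 0" by (metis ennreal_cases infinity_ennreal_def)
  then show ?thesis using eq c0 by (intro exI[of _ r]) (auto simp: less_le)
qed

text \<open>If \<open>U\<close> were null, so would be its translates by elements of
  \<open>S\<close>. They cover \<open>S\<close>, and by the Lindelof property countably many of them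
  do, which would make the whole measure zero.\<close>

lemma haar_open_pos:
  assumes U: "open U" "s \<in> U" "s \<in> S"
  shows "emeasure \<mu> U > 0"
proof (rule ccontr)
  note D = haar_onD[OF \<mu>]
  assume "\<not> ?thesis"
  then have U0: "emeasure \<mu> U = 0" by simp
  let ?V = "\<lambda>x. (\<lambda>y. x + y) -` U"
  have oV: "open (?V x)" for x using U(1) by (intro open_vimage continuous_intros)
  obtain F where F: "F \<subseteq> ?V ` S" "countable F" "\<Union>F = \<Union>(?V ` S)"
    using Lindelof[of "?V ` S"] oV by blast
  have "S \<subseteq> \<Union>F"
  proof
    fix t assume t: "t \<in> S"
    then have "s + - t \<in> S" using U(3) S(1) add_subgroupD by blast
    moreover have "t \<in> ?V (s + - t)" using U(2) by (simp add: add.assoc)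
    ultimately show "t \<in> \<Union>F" unfolding F(3) by (intro UnionI[of "?V (s + - t)"] imageI)
  qed
  have "V \<in> null_sets \<mu>" if "V \<in> F" for V
    using that F(1) D(6)[of _ U] U0 U(1) oV D(2) by (auto simp: null_sets_def)
  then have "(\<Union>V\<in>F. V) \<in> null_sets \<mu>" using F(2) by (intro null_sets_UN') auto
  then have "emeasure \<mu> (\<Union>V\<in>F. V) = 0" by auto
  moreover have mF: "(\<Union>V\<in>F. V) \<in> sets \<mu>" using F(1) oV D(2) by (intro sets.countable_UN'[OF F(2)]) auto
  moreover have "- S \<in> sets \<mu>" using S(2) D(2) by auto
  moreover have "emeasure \<mu> UNIV \<le> emeasure \<mu> ((\<Union>V\<in>F. V) \<union> - S)"
    using \<open>S \<subseteq> \<Union>F\<close> \<open>- S \<in> sets \<mu>\<close> mF by (intro emeasure_mono sets.Un) auto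
  moreover have "emeasure \<mu> ((\<Union>V\<in>F. V) \<union> - S) \<le> emeasure \<mu> (\<Union>V\<in>F. V) + emeasure \<mu> (- S)"
    using \<open>- S \<in> sets \<mu>\<close> mF by (intro emeasure_subadditive)
  ultimately show False using D(4,5) by simp
qed

end

text \<open>Where \<open>A\<close> and its translate differ, the point or its translate lies in
  \<open>U - C\<close>, provided that the translation and its inverse both move \<open>C\<close>
  into \<open>U\<close>; hence the symmetric neighbourhood.\<close>

lemma haar_translation_continuous:
  fixes \<gamma> :: "'a::{topological_group_add,t2_space,second_countable_topology} measure"
  assumes lc: "locally compact (UNIV :: 'a set)" and \<gamma>: "haar_on UNIV \<gamma>"
    and A: "A \<in> sets borel" "emeasure \<gamma> A < \<infinity>" and e: "e > 0"
  shows "\<exists>W. open W \<and> 0 \<in> W \<and>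
    (\<forall>w\<in>W. emeasure \<gamma> (((\<lambda>y. w + y) -` A - A) \<union> (A - (\<lambda>y. w + y) -` A)) < ennreal e)"
proof -
  note D = haar_onD[OF \<gamma>]
  have e2: "e / 2 > 0" using e by simp
  obtain C U where CU: "compact C" "open U" "C \<subseteq> A" "A \<subseteq> U" "emeasure \<gamma> (U - C) < ennreal (e/2)" "emeasure \<gamma> U < \<infinity>"
    using compact_finite_regular[OF lc D(1) A e2] .
  obtain W where W: "open W" "0 \<in> W" "\<And>w y. w \<in> W \<Longrightarrow> y \<in> C \<Longrightarrow> w + y \<in> U"
    using nbhd_translate_compact[OF CU(1,2)] CU(3,4) by (metis subset_trans)
  show ?thesis
  proof (intro exI[of _ "W \<inter> uminus -` W"] conjI ballI)
    show "open (W \<inter> uminus -` W)" using W by (intro open_Int open_translate)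
    show "0 \<in> W \<inter> uminus -` W" using W by simp
    fix w assume w: "w \<in> W \<inter> uminus -` W"
    let ?E = "U - C" and ?F = "(\<lambda>y. w + y) -` (U - C)"
    have m: "?E \<in> sets borel" "?F \<in> sets borel" using CU by (auto intro!: borel_translate simp: compact_imp_closed)
    have "((\<lambda>y. w + y) -` A - A) \<union> (A - (\<lambda>y. w + y) -` A) \<subseteq> ?E \<union> ?F"
    proof
      fix y assume y: "y \<in> ((\<lambda>y. w + y) -` A - A) \<union> (A - (\<lambda>y. w + y) -` A)"
      have 1: "y \<in> U" if "w + y \<in> C"
      proof -
        have "- w + (w + y) \<in> U" using W(3)[of "- w" "w + y"] w that by auto
        then show ?thesis by (simp add: add.assoc[symmetric])
      qed
      have 2: "w + y \<in> U" if "y \<in> C" using W(3) w that by auto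
      show "y \<in> ?E \<union> ?F" using y 1 2 CU(3,4) by auto
    qed
    then have "emeasure \<gamma> (((\<lambda>y. w + y) -` A - A) \<union> (A - (\<lambda>y. w + y) -` A)) \<le> emeasure \<gamma> (?E \<union> ?F)"
      using m D(2) by (intro emeasure_mono) auto
    also have "\<dots> \<le> emeasure \<gamma> ?E + emeasure \<gamma> ?F" using m D(2) by (intro emeasure_subadditive) auto
    also have "emeasure \<gamma> ?F = emeasure \<gamma> ?E" using D(6) m by blast
    also have "emeasure \<gamma> ?E + emeasure \<gamma> ?E < ennreal (e/2) + ennreal (e/2)"
      using CU(5) by (intro add_strict_mono) auto
    also have "\<dots> = ennreal e" using e by (simp flip: ennreal_plus)
    finally show "emeasure \<gamma> (((\<lambda>y. w + y) -` A - A) \<union> (A - (\<lambda>y. w + y) -` A)) < ennreal e" .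
  qed
qed

lemma subgroup_open:
  fixes D :: "'a::topological_group_add set"
  assumes D: "add_subgroup D" and W: "open W" "0 \<in> W" "W \<subseteq> D"
  shows "open D"
proof -
  have "D = (\<Union>x\<in>D. (\<lambda>y. - x + y) -` W)"
  proof (intro equalityI subsetI)
    fix x assume "x \<in> D"
    then show "x \<in> (\<Union>x\<in>D. (\<lambda>y. - x + y) -` W)" using W(2) by (auto intro!: bexI[of _ x])
  next
    fix y assume "y \<in> (\<Union>x\<in>D. (\<lambda>y. - x + y) -` W)"
    then obtain x where x: "x \<in> D" "- x + y \<in> D" using W(3) by auto
    then have "x + (- x + y) \<in> D" by (rule add_subgroupD(2)[OF D])
    then show "y \<in> D" by (simp add: add.assoc[symmetric])
  qed
  moreover have "open (\<Union>x\<in>D. (\<lambda>y. - x + y) -` W)"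
    by (intro open_UN ballI open_vimage[OF W(1)] continuous_intros)
  ultimately show ?thesis by simp
qed

lemma haar_on_restrict:
  fixes \<gamma> :: "'a::{topological_group_add,t2_space,second_countable_topology} measure"
  assumes lc: "locally compact (UNIV :: 'a set)" and \<gamma>: "haar_on UNIV \<gamma>" and D: "add_subgroup D" "open D"
  shows "haar_on D (density \<gamma> (indicator D))" "\<And>A. A \<in> sets borel \<Longrightarrow> emeasure (density \<gamma> (indicator D)) A = emeasure \<gamma> (D \<inter> A)"
proof -
  note G = haar_onD[OF \<gamma>]
  show em: "emeasure (density \<gamma> (indicator D)) A = emeasure \<gamma> (D \<inter> A)" if "A \<in> sets borel" for A
    using that D(2) by (subst emeasure_density)
      (auto simp: G(2) intro!: borel_measurable_indicator simp flip: indicator_inter_arith)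
  have pos: "emeasure \<gamma> D > 0"
    by (rule haar_open_pos[OF lc add_subgroup_UNIV _ \<gamma> D(2) add_subgroupD(1)[OF D(1)]]) auto
  show "haar_on D (density \<gamma> (indicator D))"
    unfolding haar_on_def compact_finite_def
  proof (intro conjI allI impI ballI)
    fix K :: "'a set" assume K: "compact K"
    have "emeasure \<gamma> (D \<inter> K) \<le> emeasure \<gamma> K" using K D(2) by (intro emeasure_mono) (auto simp: G(2) compact_imp_closed)
    then show "emeasure (density \<gamma> (indicator D)) K < \<infinity>"
      using K G(1) em[of K] by (auto simp: compact_finite_def compact_imp_closed intro: le_less_trans)
  next
    fix x A assume x: "x \<in> D" and A: "A \<in> sets (borel :: 'a measure)"
    have "D \<inter> (\<lambda>y. x + y) -` A = (\<lambda>y. x + y) -` (D \<inter> A)"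
    proof -
      have "y \<in> D \<longleftrightarrow> x + y \<in> D" for y
        using add_subgroupD(2)[OF D(1) x] add_subgroupD(4)[OF D(1) x, of "x + y"] by (auto simp: add.assoc[symmetric])
      then show ?thesis by auto
    qed
    then show "emeasure (density \<gamma> (indicator D)) ((\<lambda>y. x + y) -` A) = emeasure (density \<gamma> (indicator D)) A"
      using em[OF A] em[OF borel_translate(1)[OF A, of x]] G(6)[of x "D \<inter> A"] A D(2) by simp
  qed (use em[of UNIV] em[of "- D"] pos D(2) in \<open>auto simp: G(2)\<close>)
qed

section \<open>Push-forwards and the exchange of the two factors\<close>

lemma emeasure_distr_borel:
  assumes "sets \<mu> = sets borel" "continuous_on UNIV f" "A \<in> sets borel"
  shows "emeasure (distr \<mu> borel f) A = emeasure \<mu> (f -` A)"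
proof -
  have "f \<in> measurable \<mu> borel"
    unfolding measurable_cong_sets[OF assms(1) refl] using assms(2) by (rule borel_measurable_continuous_onI)
  then show ?thesis using assms(3) sets_eq_imp_space_eq[OF assms(1)] by (simp add: emeasure_distr)
qed

text \<open>Statements about the second marginal are obtained from those about the first through
  this exchange.\<close>

abbreviation converse_measure :: "('g::topological_space \<times> 'h::topological_space) measure \<Rightarrow> ('h \<times> 'g) measure" where
  "converse_measure \<rho> \<equiv> distr \<rho> borel prod.swap"

lemma swap_measurable: 
  assumes "sets \<rho> = sets (borel :: ('g::topological_space \<times> 'h::topological_space) measure)"
  shows "(prod.swap :: 'g \<times> 'h \<Rightarrow> 'h \<times> 'g) \<in> measurable \<rho> borel"
  unfolding measurable_cong_sets[OF assms refl] prod.swap_def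
  by (intro borel_measurable_continuous_onI continuous_intros)

lemma emeasure_converse:
  assumes "sets \<rho> = sets borel" "A \<in> sets borel"
  shows "emeasure (converse_measure \<rho>) A = emeasure \<rho> (prod.swap -` A)"
  using swap_measurable[OF assms(1)] assms sets_eq_imp_space_eq[OF assms(1)] by (simp add: emeasure_distr)

lemma emeasure_converse_rect:
  assumes "sets \<rho> = sets borel" "A \<in> sets borel" "B \<in> sets borel"
  shows "emeasure (converse_measure \<rho>) (B \<times> A) = emeasure \<rho> (A \<times> B)"
proof -
  have "prod.swap -` (B \<times> A) = A \<times> B" by auto
  then show ?thesis using emeasure_converse[OF assms(1) borel_Times[OF assms(3,2)]] by simp
qed

lemma converse_converse:
  assumes "sets \<rho> = sets borel"
  shows "converse_measure (converse_measure \<rho>) = \<rho>"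
proof (rule measure_eqI)
  fix A assume "A \<in> sets (converse_measure (converse_measure \<rho>))"
  then have A: "A \<in> sets borel" by simp
  have "prod.swap -` A \<in> sets borel" using measurable_sets[OF swap_measurable[OF refl] A] by simp
  then have "emeasure (converse_measure (converse_measure \<rho>)) A = emeasure \<rho> (prod.swap -` (prod.swap -` A))"
    using A by (simp add: emeasure_converse assms)
  also have "prod.swap -` (prod.swap -` A) = A" by auto
  finally show "emeasure (converse_measure (converse_measure \<rho>)) A = emeasure \<rho> A" .
qed (simp add: assms)

lemma dominated_marginals_converse:
  assumes "dominated_marginals \<gamma> \<eta> \<rho>"
  shows "dominated_marginals \<eta> \<gamma> (converse_measure \<rho>)"
  using dominated_marginalsD[OF assms] emeasure_converse_rect[OF dominated_marginalsD(1)[OF assms]]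
  unfolding dominated_marginals_def by (simp add: emeasure_converse_rect)

section \<open>Polyhomomorphisms as measures\<close>

text \<open>The nonzero polyhomomorphisms, with the Haar measure of \<open>R\<close> extended by
  zero to the whole product, so that limits of measures can be taken on one fixed space.\<close>

definition poly_haar ::
  "'g::{group_add, topological_space} measure \<Rightarrow> 'h::{group_add, topological_space} measure
    \<Rightarrow> ('g \<times> 'h) set \<Rightarrow> ('g \<times> 'h) measure \<Rightarrow> bool" where
  "poly_haar \<gamma> \<eta> R \<rho> \<longleftrightarrow> closed R \<and> add_subgroup R \<and> haar_on R \<rho> \<and> dominated_marginals \<gamma> \<eta> \<rho>"

lemma poly_haar_converse:
  fixes \<gamma> :: "'a::{topological_group_add,t2_space,second_countable_topology} measure"
    and \<eta> :: "'b::{topological_group_add,t2_space,second_countable_topology} measure"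
  assumes "poly_haar \<gamma> \<eta> R \<rho>"
  shows "poly_haar \<eta> \<gamma> (R\<inverse>) (converse_measure \<rho>)"
proof -
  have R: "closed R" "add_subgroup R" "haar_on R \<rho>" "dominated_marginals \<gamma> \<eta> \<rho>"
    using assms by (auto simp: poly_haar_def)
  note D = haar_onD[OF R(3)]
  note em = emeasure_converse[OF D(2)]
  have c: "continuous_on UNIV (prod.swap :: 'a \<times> 'b \<Rightarrow> 'b \<times> 'a)" "continuous_on UNIV (prod.swap :: 'b \<times> 'a \<Rightarrow> 'a \<times> 'b)"
    by (auto simp: prod.swap_def intro!: continuous_intros)
  have sw: "R\<inverse> = prod.swap -` R" by auto
  have cl: "closed (R\<inverse>)" unfolding sw by (rule closed_vimage[OF R(1) c(2)])
  have swap_add: "prod.swap (x + y) = prod.swap x + prod.swap y" "prod.swap (- x) = - prod.swap x" "prod.swap 0 = (0 :: 'a \<times> 'b)"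
    for x y :: "'b \<times> 'a"
    by (auto simp: prod_eq_iff)
  have sub: "add_subgroup (R\<inverse>)" using R(2) unfolding sw add_subgroup_def by (simp add: swap_add)
  have "haar_on (R\<inverse>) (converse_measure \<rho>)"
    unfolding haar_on_def compact_finite_def
  proof (intro conjI allI impI ballI)
    fix K :: "('b \<times> 'a) set" assume K: "compact K"
    have "compact (prod.swap ` K)" using compact_continuous_image[OF continuous_on_subset[OF c(2)] K] by simp
    moreover have "prod.swap -` K = prod.swap ` K" by force
    ultimately show "emeasure (converse_measure \<rho>) K < \<infinity>"
      using D(1) em[OF borel_compact[OF K]] by (simp add: compact_finite_def)
  next
    have "prod.swap -` (- R\<inverse>) = - R" by auto
    then show "emeasure (converse_measure \<rho>) (- R\<inverse>) = 0" using em[of "- R\<inverse>"] cl D(4) by (auto simp: borel_open)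
    show "emeasure (converse_measure \<rho>) UNIV \<noteq> 0" using em[of UNIV] D(5) by simp
    fix x A assume x: "x \<in> R\<inverse>" and A: "A \<in> sets (borel :: ('b \<times> 'a) measure)"
    have "prod.swap -` A \<in> sets borel"
      using measurable_sets[OF borel_measurable_continuous_onI[OF c(1)] A] by simp
    moreover have "prod.swap -` ((\<lambda>y. x + y) -` A) = (\<lambda>y. prod.swap x + y) -` (prod.swap -` A)"
      by (auto simp: plus_prod_def)
    moreover have "prod.swap x \<in> R" using x by (cases x) simp
    ultimately show "emeasure (converse_measure \<rho>) ((\<lambda>y. x + y) -` A) = emeasure (converse_measure \<rho>) A"
      using em[OF A] em[OF borel_translate(1)[OF A]] D(6)[of "prod.swap x" "prod.swap -` A"] by simp
  qed simp
  then show ?thesis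
    unfolding poly_haar_def using cl sub dominated_marginals_converse[OF R(4)] by blast
qed

context
  fixes \<gamma> :: "'g::{topological_group_add,t2_space,second_countable_topology} measure"
    and \<eta> :: "'h::{topological_group_add,t2_space,second_countable_topology} measure"
    and R :: "('g \<times> 'h) set" and \<rho> :: "('g \<times> 'h) measure"
  assumes lcG: "locally compact (UNIV :: 'g set)" and lcH: "locally compact (UNIV :: 'h set)"
    and \<gamma>: "haar_on UNIV \<gamma>" and R: "poly_haar \<gamma> \<eta> R \<rho>"
begin

lemma poly_haarD:
  "closed R" "add_subgroup R" "haar_on R \<rho>" "dominated_marginals \<gamma> \<eta> \<rho>" "R \<in> sets borel"
  using R by (auto simp: poly_haar_def)

text \<open>The projection of \<open>R\<close> to the first group is proper: disjoint translates, inside \<open>R\<close>,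
  of a fixed neighbourhood of zero all have the same mass, while their total mass is at most the
  mass of a compact set.\<close>

lemma poly_haar_proper:
  assumes C: "compact C"
  shows "compact (R \<inter> (C \<times> UNIV))"
proof -
  note D = haar_onD[OF poly_haarD(3)] and G = haar_onD[OF \<gamma>]
  have lc: "locally compact (UNIV :: ('g \<times> 'h) set)" by (rule lc_prod[OF lcG lcH])
  obtain V K where VK: "open V" "compact K" "0 \<in> V" "V \<subseteq> K" "K \<subseteq> (UNIV :: ('g \<times> 'h) set)"
    by (rule lc_nbhd[OF lc open_UNIV UNIV_I])
  let ?T = "\<lambda>x. (\<lambda>y. - x + y) -` V"
  have oT: "open (?T x)" for x using VK(1) by (intro open_vimage continuous_intros)
  have Tm: "?T x \<in> sets \<rho>" for x using oT D(2) by auto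
  define c where "c = measure \<rho> V"
  have fV: "emeasure \<rho> V < \<infinity>" using compact_finite_subset_compact[OF D(1) VK(2,4)] .
  have "emeasure \<rho> V > 0"
    using haar_open_pos[OF lc poly_haarD(2,5,3) VK(1,3)] add_subgroupD(1)[OF poly_haarD(2)] by simp
  then have c: "c > 0" "emeasure \<rho> V = ennreal c"
    using fV by (auto simp: c_def measure_def enn2real_positive_iff)
  have eT: "emeasure \<rho> (?T x) = ennreal c" if "x \<in> R" for x
    using D(6)[OF add_subgroupD(3)[OF poly_haarD(2) that], of V] VK(1) c by simp
  \<comment> \<open>Translates of \<open>V\<close> centred at points of \<open>R\<close> above
    \<open>C\<close> stay above this compact set.\<close>
  define B where "B = (\<lambda>z. fst z + snd z) ` (C \<times> fst ` K)"
  have cB: "compact B" unfolding B_def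
    by (intro compact_continuous_image compact_Times C VK(2) continuous_intros)
  have fB: "emeasure \<gamma> B < \<infinity>" using G(1) cB by (simp add: compact_finite_def)
  define good where "good X \<longleftrightarrow> finite X \<and> X \<subseteq> R \<inter> (C \<times> UNIV) \<and> (\<forall>x\<in>X. \<forall>y\<in>X. x \<noteq> y \<longrightarrow> ?T x \<inter> ?T y = {})" for X
  have bound: "real (card X) * c \<le> measure \<gamma> B" if X: "good X" for X
  proof -
    have fX: "finite X" and XR: "\<And>x. x \<in> X \<Longrightarrow> x \<in> R" and XC: "\<And>x. x \<in> X \<Longrightarrow> fst x \<in> C"
      and dj: "disjoint_family_on ?T X"
      using X unfolding good_def disjoint_family_on_def by auto
    have "ennreal (real (card X) * c) = (\<Sum>x\<in>X. emeasure \<rho> (?T x))"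
      using eT XR c(1) by (simp add: ennreal_mult ennreal_of_nat_eq_real_of_nat)
    also have "\<dots> = emeasure \<rho> (\<Union>x\<in>X. ?T x)"
      using Tm by (intro sum_emeasure dj fX) blast
    also have "\<dots> \<le> emeasure \<rho> (B \<times> UNIV)"
    proof (rule emeasure_mono)
      show "(\<Union>x\<in>X. ?T x) \<subseteq> B \<times> UNIV"
      proof
        fix y assume "y \<in> (\<Union>x\<in>X. ?T x)"
        then obtain x where x: "x \<in> X" "- x + y \<in> V" by auto
        then have "fst (- x + y) \<in> fst ` K" using VK(4) by blast
        moreover have "fst y = fst x + fst (- x + y)" by (simp add: add.assoc[symmetric])
        ultimately have "fst y \<in> B" unfolding B_def using XC[OF x(1)] by force
        then show "y \<in> B \<times> UNIV" by (simp add: mem_Times_iff)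
      qed
    qed (use borel_Times[OF borel_compact[OF cB], of UNIV] D(2) in auto)
    also have "\<dots> \<le> emeasure \<gamma> B" using cB by (intro dominated_marginalsD(3)[OF poly_haarD(4)]) (simp add: borel_compact)
    also have "\<dots> = ennreal (measure \<gamma> B)" using fB by (simp add: emeasure_eq_ennreal_measure less_top)
    finally show ?thesis by (simp add: ennreal_le_iff)
  qed
  have "good {}" by (simp add: good_def)
  moreover have "card X \<le> nat \<lceil>measure \<gamma> B / c\<rceil>" if "good X" for X
  proof -
    have "real (card X) \<le> measure \<gamma> B / c" using bound[OF that] c(1) by (simp add: field_simps)
    then show ?thesis by linarith
  qed
  \<comment> \<open>Disjoint translates of mass \<open>c\<close> that all lie over \<open>B\<close>
    are bounded in number, so a largest packing exists.\<close>
  ultimately obtain X where X: "good X" "\<And>Y. good Y \<Longrightarrow> card Y \<le> card X"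
    using ex_has_greatest_nat[of good "{}" card "Suc (nat \<lceil>measure \<gamma> B / c\<rceil>)"] by (metis le_imp_less_Suc)
  have "R \<inter> (C \<times> UNIV) \<subseteq> (\<Union>x\<in>X. (\<lambda>z. x + fst z + - snd z) ` (K \<times> K))"
  proof
    fix z assume z: "z \<in> R \<inter> (C \<times> UNIV)"
    \<comment> \<open>By maximality the translate of \<open>V\<close> at \<open>z\<close> meets the
      one at some \<open>x\<close> in \<open>X\<close>, so \<open>z\<close> lies in
      \<open>x + V - V\<close>, inside one of finitely many compact sets.\<close>
    have "\<exists>x\<in>X. \<exists>v\<in>V. \<exists>w\<in>V. z = x + v + - w"
    proof (cases "z \<in> X")
      case True
      then show ?thesis using VK(3) by (intro bexI[of _ z] bexI[of _ 0]) auto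
    next
      case False
      have "\<not> good (insert z X)"
      proof
        assume "good (insert z X)"
        then have "card (insert z X) \<le> card X" by (rule X(2))
        moreover have "finite X" using X(1) by (simp add: good_def)
        ultimately show False using False by simp
      qed
      then obtain x y where xy: "x \<in> X" "y \<in> ?T x" "y \<in> ?T z"
      proof -
        have "\<exists>x\<in>X. ?T x \<inter> ?T z \<noteq> {}"
        proof (rule ccontr)
          assume no: "\<not> ?thesis"
          have "good (insert z X)" unfolding good_def
          proof (intro conjI ballI impI)
            fix x y assume xy: "x \<in> insert z X" "y \<in> insert z X" "x \<noteq> y"
            have "?T x \<inter> ?T y = {}" if "x \<in> X" "y \<in> X" using X(1) xy(3) that unfolding good_def by blast
            then show "?T x \<inter> ?T y = {}" using xy no by blast
          qed (use X(1) z in \<open>auto simp: good_def\<close>)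
          then show False using \<open>\<not> good (insert z X)\<close> by blast
        qed
        then show ?thesis using that by blast
      qed
      have "z = x + (- x + y) + - (- z + y)" by (simp add: minus_add add.assoc[symmetric])
      then show ?thesis using xy by (intro bexI[of _ x] bexI[of _ "- x + y"] bexI[of _ "- z + y"]) auto
    qed
    then obtain x v w where xvw: "x \<in> X" "v \<in> V" "w \<in> V" "z = x + v + - w" by blast
    then have "z \<in> (\<lambda>z. x + fst z + - snd z) ` (K \<times> K)"
      using VK(4) by (intro image_eqI[of _ _ "(v, w)"]) auto
    then show "z \<in> (\<Union>x\<in>X. (\<lambda>z. x + fst z + - snd z) ` (K \<times> K))" using xvw(1) by blast
  qed
  moreover have "compact (\<Union>x\<in>X. (\<lambda>z. x + fst z + - snd z) ` (K \<times> K))"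
    using X(1) VK(2) unfolding good_def
    by (intro compact_UN compact_continuous_image compact_Times continuous_intros) auto
  moreover have "closed (R \<inter> (C \<times> UNIV))"
    using poly_haarD(1) C by (intro closed_Int closed_Times) (auto simp: compact_imp_closed)
  ultimately show ?thesis by (meson compact_closed_subset)
qed

lemma poly_haar_compact_Image: "compact C \<Longrightarrow> compact (R `` C)"
proof -
  assume "compact C"
  then have "compact (snd ` (R \<inter> (C \<times> UNIV)))"
    by (intro compact_continuous_image continuous_intros poly_haar_proper)
  moreover have "snd ` (R \<inter> (C \<times> UNIV)) = R `` C" by force
  ultimately show "compact (R `` C)" by simp
qed

lemma add_subgroup_Domain: "add_subgroup (Domain R)"
  unfolding add_subgroup_def
proof (intro conjI ballI)
  note S = add_subgroupD[OF poly_haarD(2)]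
  show "0 \<in> Domain R" using S(1) by (auto simp: zero_prod_def)
  show "x + y \<in> Domain R" if "x \<in> Domain R" "y \<in> Domain R" for x y
    using that S(2) by (auto simp: Domain_iff) (metis add_Pair)
  show "- x \<in> Domain R" if "x \<in> Domain R" for x
    using that S(3) by (auto simp: Domain_iff) (metis uminus_Pair)
qed

text \<open>Steinhaus's argument. The projections of compact pieces of \<open>R\<close> cannot all
  be null, since domination would then make \<open>\<rho>\<close> vanish. A compact subset of
  \<open>Domain R\<close> of positive mass meets its small translates, so the subgroup contains a
  neighbourhood of 0.\<close>

lemma poly_haar_open_Domain: "open (Domain R)"
proof -
  note D = haar_onD[OF poly_haarD(3)] and G = haar_onD[OF \<gamma>] and M = dominated_marginalsD[OF poly_haarD(4)]
  have lc: "locally compact (UNIV :: ('g \<times> 'h) set)" by (rule lc_prod[OF lcG lcH])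
  obtain W :: "nat \<Rightarrow> ('g \<times> 'h) set" where W: "\<And>n. open (W n)" "\<And>n. compact (closure (W n))" "incseq W" "(\<Union>n. W n) = UNIV"
    by (rule lc_open_exhaustion[OF lc]) blast
  let ?C = "\<lambda>n. fst ` (R \<inter> closure (W n))"
  have cC: "compact (?C n)" for n
    using poly_haarD(1) W(2) by (intro compact_continuous_image continuous_intros closed_Int_compact)
  have mCU: "?C n \<times> UNIV \<in> sets \<rho>" for n
    unfolding D(2) by (rule borel_Times[OF borel_compact[OF cC]]) simp
  have "\<exists>n. emeasure \<gamma> (?C n) \<noteq> 0"
  proof (rule ccontr)
    assume "\<not> ?thesis"
    then have "emeasure \<rho> (?C n \<times> UNIV) = 0" for n
      using M(3)[of "?C n"] cC[of n] by (auto simp: borel_compact)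
    then have "emeasure \<rho> (\<Union>n. ?C n \<times> UNIV) = 0"
      using mCU by (intro emeasure_UN_eq_0) auto
    moreover have "emeasure \<rho> UNIV \<le> emeasure \<rho> ((\<Union>n. ?C n \<times> UNIV) \<union> - R)"
    proof (rule emeasure_mono)
      show "UNIV \<subseteq> (\<Union>n. ?C n \<times> UNIV) \<union> - R"
      proof
        fix z :: "'g \<times> 'h"
        obtain n where "z \<in> W n" using W(4) by blast
        then have "z \<in> R \<Longrightarrow> z \<in> ?C n \<times> UNIV" using closure_subset[of "W n"] by (auto simp: mem_Times_iff)
        then show "z \<in> (\<Union>n. ?C n \<times> UNIV) \<union> - R" by blast
      qed
    qed (use mCU D(2) poly_haarD(5) in \<open>auto intro!: sets.Un sets.countable_UN\<close>)
    moreover have "emeasure \<rho> ((\<Union>n. ?C n \<times> UNIV) \<union> - R) \<le> emeasure \<rho> (\<Union>n. ?C n \<times> UNIV) + emeasure \<rho> (- R)"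
      using mCU D(2) poly_haarD(5) by (intro emeasure_subadditive) (auto intro!: sets.countable_UN)
    ultimately show False using D(4,5) by simp
  qed
  then obtain n where n: "emeasure \<gamma> (?C n) \<noteq> 0" by blast
  have fin: "emeasure \<gamma> (?C n) < \<infinity>" using G(1) cC by (simp add: compact_finite_def)
  have mC: "?C n \<in> sets borel" using cC by (rule borel_compact)
  define m where "m = measure \<gamma> (?C n)"
  have m: "m > 0" "emeasure \<gamma> (?C n) = ennreal m"
    using n fin by (auto simp: m_def emeasure_eq_ennreal_measure less_top zero_less_measure_iff)
  obtain U where U: "open U" "0 \<in> U"
    "\<And>w. w \<in> U \<Longrightarrow> emeasure \<gamma> (((\<lambda>y. w + y) -` ?C n - ?C n) \<union> (?C n - (\<lambda>y. w + y) -` ?C n)) < ennreal m"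
    using haar_translation_continuous[OF lcG \<gamma> mC fin m(1)] by metis
  have "U \<subseteq> Domain R"
  proof
    fix w assume w: "w \<in> U"
    have "?C n \<inter> (\<lambda>y. w + y) -` ?C n \<noteq> {}"
    proof
      assume "?C n \<inter> (\<lambda>y. w + y) -` ?C n = {}"
      then have "?C n \<subseteq> ((\<lambda>y. w + y) -` ?C n - ?C n) \<union> (?C n - (\<lambda>y. w + y) -` ?C n)" by blast
      then have "emeasure \<gamma> (?C n) \<le> emeasure \<gamma> (((\<lambda>y. w + y) -` ?C n - ?C n) \<union> (?C n - (\<lambda>y. w + y) -` ?C n))"
        using mC G(2) borel_translate(1)[OF mC, of w] by (intro emeasure_mono) auto
      then show False using U(3)[OF w] m(2) by simp
    qed
    then obtain y where y: "y \<in> ?C n" "w + y \<in> ?C n" by blast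
    have sub: "?C n \<subseteq> Domain R" by force
    have "w + y + - y \<in> Domain R"
      using y sub add_subgroupD(2,3)[OF add_subgroup_Domain] by blast
    then show "w \<in> Domain R" by (simp add: add.assoc)
  qed
  then show ?thesis by (rule subgroup_open[OF add_subgroup_Domain U(1,2)])
qed

lemma emeasure_marginal:
  assumes "A \<in> sets borel"
  shows "emeasure (distr \<rho> borel fst) A = emeasure \<rho> (A \<times> UNIV)"
proof -
  have "emeasure (distr \<rho> borel fst) A = emeasure \<rho> (fst -` A)"
    by (rule emeasure_distr_borel[OF haar_onD(2)[OF poly_haarD(3)] _ assms]) (intro continuous_intros)
  moreover have "fst -` A = A \<times> (UNIV :: 'h set)" by auto
  ultimately show ?thesis by simp
qed

text \<open>A translation by \<open>x\<close> in \<open>Domain R\<close> lifts to the translation by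
  some \<open>(x, h)\<close> in \<open>R\<close>, under which \<open>\<rho>\<close> is
  invariant.\<close>

lemma haar_on_marginal: "haar_on (Domain R) (distr \<rho> borel fst)"
  unfolding haar_on_def compact_finite_def
proof (intro conjI allI impI ballI)
  note D = haar_onD[OF poly_haarD(3)] and G = haar_onD[OF \<gamma>] and M = dominated_marginalsD[OF poly_haarD(4)]
  show "sets (distr \<rho> borel fst) = sets borel" by simp
  fix K :: "'g set" assume K: "compact K"
  then have "emeasure \<rho> (K \<times> UNIV) \<le> emeasure \<gamma> K" by (intro M(3) borel_compact)
  also have "\<dots> < \<infinity>" using K G(1) by (simp add: compact_finite_def)
  finally show "emeasure (distr \<rho> borel fst) K < \<infinity>" using K by (simp add: emeasure_marginal borel_compact)
next
  note D = haar_onD[OF poly_haarD(3)]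
  have oD: "Domain R \<in> sets borel" using poly_haar_open_Domain by simp
  have "emeasure \<rho> ((- Domain R) \<times> UNIV) \<le> emeasure \<rho> (- R)"
    using D(2) poly_haarD(5) by (intro emeasure_mono) auto
  then show "emeasure (distr \<rho> borel fst) (- Domain R) = 0"
    using D(4) oD by (simp add: emeasure_marginal)
  show "emeasure (distr \<rho> borel fst) UNIV \<noteq> 0" using D(5) by (simp add: emeasure_marginal)
  fix x A assume x: "x \<in> Domain R" and A: "A \<in> sets (borel :: 'g measure)"
  then obtain h where h: "(x, h) \<in> R" by blast
  have "((\<lambda>y. x + y) -` A) \<times> UNIV = (\<lambda>z. (x, h) + z) -` (A \<times> UNIV)" by auto
  then show "emeasure (distr \<rho> borel fst) ((\<lambda>y. x + y) -` A) = emeasure (distr \<rho> borel fst) A"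
    using D(6)[OF h, of "A \<times> UNIV"] A borel_translate(1)[OF A, of x] by (simp add: emeasure_marginal borel_Times)
qed

text \<open>The marginal and the restriction of \<open>\<gamma>\<close> are both Haar measures of
  the open subgroup \<open>Domain R\<close>, hence proportional. The factor is the constant \<alpha>
  of the polyhomomorphism.\<close>

lemma marginal_proportional:
  "\<exists>a>0. \<forall>A\<in>sets borel. emeasure \<rho> (A \<times> UNIV) = ennreal a * emeasure \<gamma> (Domain R \<inter> A)"
proof -
  note op = add_subgroup_Domain poly_haar_open_Domain
  have "\<exists>a>0. \<forall>A\<in>sets borel. emeasure (distr \<rho> borel fst) A = ennreal a * emeasure (density \<gamma> (indicator (Domain R))) A"
    using haar_unique[OF lcG op(1) _ haar_on_restrict(1)[OF lcG \<gamma> op] haar_on_marginal] op(2) by simp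
  then show ?thesis using haar_on_restrict(2)[OF lcG \<gamma> op] by (auto simp: emeasure_marginal)
qed

end

section \<open>Limits of Haar measures of closed subgroups\<close>

lemma vimage_translate_Times:
  fixes A :: "'g::group_add set" and B :: "'h::group_add set"
  shows "(\<lambda>z. (a, b) + z) -` (A \<times> B) = ((\<lambda>y. a + y) -` A) \<times> ((\<lambda>y. b + y) -` B)"
  by auto

lemma measure_diff_le_sym_diff:
  assumes "emeasure M X < \<infinity>" "emeasure M Y < \<infinity>" "X \<in> sets M" "Y \<in> sets M"
    and "(X - Y) \<union> (Y - X) \<subseteq> Z" "Z \<in> sets M" "emeasure M Z \<le> ennreal e" "0 \<le> e"
  shows "\<bar>measure M X - measure M Y\<bar> \<le> e"
proof -
  have fm: "X \<in> fmeasurable M" "Y \<in> fmeasurable M" "Z \<in> fmeasurable M"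
    using assms by (auto simp: fmeasurable_def intro: le_less_trans)
  have Z: "measure M Z \<le> e" using assms(7,8) by (simp add: measure_def enn2real_leI)
  have "measure M X \<le> measure M (Y \<union> Z)"
    using assms fm by (intro measure_mono_fmeasurable) auto
  also have "\<dots> \<le> measure M Y + measure M Z" using assms by (intro measure_Un_le) auto
  finally have 1: "measure M X \<le> measure M Y + measure M Z" .
  have "measure M Y \<le> measure M (X \<union> Z)"
    using assms fm by (intro measure_mono_fmeasurable) auto
  also have "\<dots> \<le> measure M X + measure M Z" using assms by (intro measure_Un_le) auto
  finally show ?thesis using 1 Z by linarith
qed

definition support :: "'a::topological_space measure \<Rightarrow> 'a set" where
  "support \<mu> = {x. \<forall>U. open U \<and> x \<in> U \<longrightarrow> emeasure \<mu> U \<noteq> 0}"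

lemma closed_support: "closed (support \<mu>)"
proof -
  have "- support \<mu> = \<Union>{U. open U \<and> emeasure \<mu> U = 0}" by (auto simp: support_def)
  moreover have "open (\<Union>{U. open U \<and> emeasure \<mu> U = 0})" by (intro open_Union) auto
  ultimately show ?thesis by (simp add: closed_def)
qed

lemma null_of_locally_null:
  fixes \<mu> :: "'a::second_countable_topology measure"
  assumes s: "sets \<mu> = sets borel" and N: "\<And>x. x \<in> N \<Longrightarrow> \<exists>U. open U \<and> x \<in> U \<and> emeasure \<mu> U = 0"
    and mN: "N \<in> sets borel"
  shows "emeasure \<mu> N = 0"
proof -
  obtain F where F: "F \<subseteq> {U. open U \<and> emeasure \<mu> U = 0}" "countable F" "\<Union>F = \<Union>{U. open U \<and> emeasure \<mu> U = 0}"
    using Lindelof[of "{U. open U \<and> emeasure \<mu> U = 0}"] by blast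
  have "(\<Union>U\<in>F. U) \<in> null_sets \<mu>"
    using F by (intro null_sets_UN') (auto simp: null_sets_def s subset_iff)
  moreover have "N \<subseteq> (\<Union>U\<in>F. U)"
  proof
    fix x assume "x \<in> N"
    then have "x \<in> \<Union>{U. open U \<and> emeasure \<mu> U = 0}" using N by blast
    then show "x \<in> (\<Union>U\<in>F. U)" using F(3) by simp
  qed
  ultimately have "N \<in> null_sets \<mu>" using mN s by (metis null_sets_subset)
  then show ?thesis by auto
qed

text \<open>Every point \<open>x\<close> of the support of the limit is approximated by points \<open>x\<^sub>j\<close> of the
  subgroups carrying the \<open>M\<^sub>j\<close>, so the limit is invariant under \<open>x\<close>; this forces the support
  to be a subgroup.\<close>

theorem haar_limit:
  fixes \<gamma> :: "'g::{topological_group_add,t2_space,second_countable_topology} measure"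
    and \<eta> :: "'h::{topological_group_add,t2_space,second_countable_topology} measure"
  assumes lcG: "locally compact (UNIV :: 'g set)" and lcH: "locally compact (UNIV :: 'h set)"
    and \<gamma>: "haar_on UNIV \<gamma>" and \<eta>: "haar_on UNIV \<eta>"
    and F: "F \<noteq> bot"
    and M: "\<And>j. dominated_marginals \<gamma> \<eta> (M j)"
      "\<And>j. emeasure (M j) UNIV \<noteq> 0 \<Longrightarrow> \<exists>R. R \<in> sets borel \<and> haar_on R (M j)"
    and \<mu>: "dominated_marginals \<gamma> \<eta> \<mu>" "emeasure \<mu> UNIV \<noteq> 0"
    and conv: "\<And>A B. A \<in> sets borel \<Longrightarrow> B \<in> sets borel \<Longrightarrow> emeasure \<gamma> A < \<infinity> \<Longrightarrow> emeasure \<eta> B < \<infinity> \<Longrightarrow>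
       ((\<lambda>j. measure (M j) (A \<times> B)) \<longlongrightarrow> measure \<mu> (A \<times> B)) F"
  shows "\<exists>S. poly_haar \<gamma> \<eta> S \<mu>"
proof -
  note G = haar_onD[OF \<gamma>] and H = haar_onD[OF \<eta>] and D = dominated_marginalsD[OF M(1)] and D\<mu> = dominated_marginalsD[OF \<mu>(1)]
  have lc: "locally compact (UNIV :: ('g \<times> 'h) set)" by (rule lc_prod[OF lcG lcH])
  have cfM: "compact_finite (M j)" for j using dominated_marginals_compact_finite[OF M(1) G(1)] .
  have cf\<mu>: "compact_finite \<mu>" using dominated_marginals_compact_finite[OF \<mu>(1) G(1)] .
  define inv where "inv x \<longleftrightarrow> (\<forall>E\<in>sets borel. emeasure \<mu> ((\<lambda>y. x + y) -` E) = emeasure \<mu> E)" for x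
  have supp_inv: "inv x" if x: "x \<in> support \<mu>" for x
  proof -
    obtain a b where ab: "x = (a, b)" by (cases x)
    have rect_inv: "measure \<mu> ((\<lambda>y. x + y) -` (A \<times> B)) = measure \<mu> (A \<times> B)"
      if A: "A \<in> sets borel" "emeasure \<gamma> A < \<infinity>" and B: "B \<in> sets borel" "emeasure \<eta> B < \<infinity>" for A B
    proof -
      let ?A = "(\<lambda>y. a + y) -` A" and ?B = "(\<lambda>y. b + y) -` B"
      have A': "?A \<in> sets borel" "emeasure \<gamma> ?A < \<infinity>" using A G(6)[of a A] by (auto intro!: borel_translate)
      have B': "?B \<in> sets borel" "emeasure \<eta> ?B < \<infinity>" using B H(6)[of b B] by (auto intro!: borel_translate)
      have eq: "(\<lambda>y. x + y) -` (A \<times> B) = ?A \<times> ?B" unfolding ab by (rule vimage_translate_Times)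
      have "\<bar>measure \<mu> (A \<times> B) - measure \<mu> (?A \<times> ?B)\<bar> \<le> e" if e: "e > 0" for e
      proof -
        have e2: "e / 2 > 0" using e by simp
        obtain W1 where W1: "open W1" "0 \<in> W1"
          "\<And>w. w \<in> W1 \<Longrightarrow> emeasure \<gamma> (((\<lambda>y. w + y) -` A - A) \<union> (A - (\<lambda>y. w + y) -` A)) < ennreal (e/2)"
          using haar_translation_continuous[OF lcG \<gamma> A e2] by metis
        obtain W2 where W2: "open W2" "0 \<in> W2"
          "\<And>w. w \<in> W2 \<Longrightarrow> emeasure \<eta> (((\<lambda>y. w + y) -` B - B) \<union> (B - (\<lambda>y. w + y) -` B)) < ennreal (e/2)"
          using haar_translation_continuous[OF lcH \<eta> B e2] by metis
        \<comment> \<open>The points \<open>p\<close> with \<open>p + - a\<close> in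
          \<open>W1\<close>: replacing the translation by \<open>a\<close> with that by
          \<open>p\<close> changes the translate of \<open>A\<close> by little in measure. Likewise
          for \<open>b\<close> and \<open>B\<close>.\<close>
        let ?U1 = "(\<lambda>y. y + - a) -` W1" and ?U2 = "(\<lambda>y. y + - b) -` W2"
        have oU: "open ?U1" "open ?U2" "a \<in> ?U1" "b \<in> ?U2"
          using W1 W2 by (auto intro!: open_vimage continuous_intros)
        obtain V1 C1 where V1: "open V1" "compact C1" "a \<in> V1" "V1 \<subseteq> C1" "C1 \<subseteq> ?U1"
          by (rule lc_nbhd[OF lcG oU(1,3)])
        obtain V2 C2 where V2: "open V2" "compact C2" "b \<in> V2" "V2 \<subseteq> C2" "C2 \<subseteq> ?U2"
          by (rule lc_nbhd[OF lcH oU(2,4)])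
        have Vf: "emeasure \<gamma> V1 < \<infinity>" "emeasure \<eta> V2 < \<infinity>"
          using compact_finite_subset_compact[OF G(1) V1(2,4)] compact_finite_subset_compact[OF H(1) V2(2,4)] by auto
        have "emeasure \<mu> (V1 \<times> V2) \<noteq> 0"
          using x V1 V2 unfolding support_def ab by (auto simp: open_Times)
        moreover have "emeasure \<mu> (V1 \<times> V2) < \<infinity>"
          using dominated_marginals_rect(1)[OF \<mu>(1), of V1 V2] V1(1) V2(1) Vf(1) by (auto intro: le_less_trans)
        ultimately have "measure \<mu> (V1 \<times> V2) > 0"
          by (simp add: measure_def enn2real_positive_iff zero_less_iff_neq_zero)
        \<comment> \<open>Positive mass near \<open>x\<close> in the limit forces positive mass near
          \<open>x\<close> for \<open>M j\<close>, eventually along \<open>F\<close>, so the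
          subgroup carrying \<open>M j\<close> contains a point \<open>(p, q)\<close> close to
          \<open>x\<close>.\<close>
        then have ev: "eventually (\<lambda>j. measure (M j) (V1 \<times> V2) > 0) F"
          using conv[of V1 V2] V1(1) V2(1) Vf by (intro order_tendstoD(1)) auto
        have step: "\<bar>measure (M j) (A \<times> B) - measure (M j) (?A \<times> ?B)\<bar> \<le> e" if j: "measure (M j) (V1 \<times> V2) > 0" for j
        proof -
          have ne: "emeasure (M j) (V1 \<times> V2) \<noteq> 0" using j by (auto simp: measure_def)
          have mV: "V1 \<times> V2 \<in> sets (M j)" using V1(1) V2(1) D(1) by (auto simp: borel_Times)
          have "emeasure (M j) (V1 \<times> V2) \<le> emeasure (M j) UNIV" using D(1) by (intro emeasure_mono) auto
          then have "emeasure (M j) UNIV \<noteq> 0" using ne by auto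
          then obtain R where R: "R \<in> sets borel" "haar_on R (M j)" using M(2) by blast
          note Rj = haar_onD[OF R(2)]
          have "R \<inter> (V1 \<times> V2) \<noteq> {}"
          proof
            assume "R \<inter> (V1 \<times> V2) = {}"
            then have "emeasure (M j) (V1 \<times> V2) \<le> emeasure (M j) (- R)"
              using R(1) D(1) by (intro emeasure_mono) auto
            then show False using ne Rj(4) by simp
          qed
          then obtain p q where pq: "(p, q) \<in> R" "p \<in> V1" "q \<in> V2" by blast
          let ?A' = "(\<lambda>y. p + y) -` A" and ?B' = "(\<lambda>y. q + y) -` B"
          have m': "?A' \<in> sets borel" "?B' \<in> sets borel" using A B by (auto intro!: borel_translate)
          \<comment> \<open>Under \<open>(p, q)\<close> the invariance is exact; the passage from
            \<open>(p, q)\<close> to \<open>(a, b)\<close> is then estimated in the two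
            marginals.\<close>
          have "measure (M j) (A \<times> B) = measure (M j) (?A' \<times> ?B')"
            using Rj(6)[OF pq(1), of "A \<times> B"] A B unfolding vimage_translate_Times measure_def by (simp add: borel_Times)
          moreover have "\<bar>measure (M j) (?A' \<times> ?B') - measure (M j) (?A \<times> ?B)\<bar> \<le> e"
          proof -
            define w1 where "w1 = p + - a"
            define w2 where "w2 = q + - b"
            have w: "w1 \<in> W1" "w2 \<in> W2" using pq V1 V2 by (auto simp: w1_def w2_def)
            let ?X = "((\<lambda>y. w1 + y) -` A - A) \<union> (A - (\<lambda>y. w1 + y) -` A)"
            let ?Y = "((\<lambda>y. w2 + y) -` B - B) \<union> (B - (\<lambda>y. w2 + y) -` B)"
            have mX: "?X \<in> sets borel" "?Y \<in> sets borel" using A B by (auto intro!: borel_translate)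
            have pw: "p = w1 + a" "q = w2 + b" by (simp_all add: w1_def w2_def add.assoc)
            let ?Z = "((\<lambda>y. a + y) -` ?X) \<times> UNIV \<union> UNIV \<times> ((\<lambda>y. b + y) -` ?Y)"
            have mZ: "((\<lambda>y. a + y) -` ?X) \<times> UNIV \<in> sets (M j)" "UNIV \<times> ((\<lambda>y. b + y) -` ?Y) \<in> sets (M j)"
              unfolding D(1) by (intro borel_Times borel_translate(1) mX sets.top; simp)+
            show ?thesis
            proof (rule measure_diff_le_sym_diff[where Z = ?Z])
              show "(?A' \<times> ?B' - ?A \<times> ?B) \<union> (?A \<times> ?B - ?A' \<times> ?B') \<subseteq> ?Z"
                unfolding pw by (auto simp: add.assoc)
              show "?Z \<in> sets (M j)" using mZ by auto
              have "emeasure (M j) ?Z \<le> emeasure (M j) (((\<lambda>y. a + y) -` ?X) \<times> UNIV) + emeasure (M j) (UNIV \<times> ((\<lambda>y. b + y) -` ?Y))"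
                using mZ by (rule emeasure_subadditive)
              also have "\<dots> \<le> emeasure \<gamma> ((\<lambda>y. a + y) -` ?X) + emeasure \<eta> ((\<lambda>y. b + y) -` ?Y)"
                using mX by (intro add_mono D borel_translate)
              also have "\<dots> = emeasure \<gamma> ?X + emeasure \<eta> ?Y" using G(6)[of a ?X] H(6)[of b ?Y] mX by simp
              also have "\<dots> \<le> ennreal (e/2) + ennreal (e/2)" using W1(3)[OF w(1)] W2(3)[OF w(2)] by (intro add_mono) auto
              also have "\<dots> = ennreal e" using e by (simp flip: ennreal_plus)
              finally show "emeasure (M j) ?Z \<le> ennreal e" .
              show "emeasure (M j) (?A \<times> ?B) < \<infinity>"
                using dominated_marginals_rect(1)[OF M(1) A'(1) B'(1), of j] A'(2) by (rule le_less_trans)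
              show "emeasure (M j) (?A' \<times> ?B') < \<infinity>"
                using dominated_marginals_rect(1)[OF M(1) m', of j] G(6)[of p A] A by (auto intro: le_less_trans)
              show "?A' \<times> ?B' \<in> sets (M j)" "?A \<times> ?B \<in> sets (M j)" using m' A' B' by (auto simp: D(1) borel_Times)
            qed (use e in simp)
          qed
          ultimately show ?thesis by simp
        qed
        have "((\<lambda>j. \<bar>measure (M j) (A \<times> B) - measure (M j) (?A \<times> ?B)\<bar>) \<longlongrightarrow> \<bar>measure \<mu> (A \<times> B) - measure \<mu> (?A \<times> ?B)\<bar>) F"
          by (intro tendsto_rabs tendsto_diff conv A B A' B')
        then show ?thesis
          by (rule tendsto_upperbound[OF _ _ F]) (use ev step in \<open>auto elim: eventually_mono\<close>)
      qed
      then have "\<bar>measure \<mu> (A \<times> B) - measure \<mu> (?A \<times> ?B)\<bar> \<le> 0" by (rule field_le_epsilon) simp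
      then show ?thesis unfolding eq by simp
    qed
    let ?f = "\<lambda>y. x + y"
    have cf: "continuous_on UNIV ?f" by (intro continuous_intros)
    have "\<mu> = distr \<mu> borel ?f"
    proof (rule finite_rect_measure_eqI[OF lcG lcH G(1) H(1) \<mu>(1)])
      fix A :: "'g set" and B :: "'h set"
      assume AB: "A \<in> sets borel" "B \<in> sets borel" "emeasure \<gamma> A < \<infinity>" "emeasure \<eta> B < \<infinity>"
      have f1: "emeasure \<mu> (A \<times> B) < \<infinity>" using dominated_marginals_rect(1)[OF \<mu>(1) AB(1,2)] AB(3) by (rule le_less_trans)
      have "emeasure \<mu> (?f -` (A \<times> B)) \<le> emeasure \<gamma> ((\<lambda>y. a + y) -` A)"
        unfolding ab vimage_translate_Times using AB by (intro dominated_marginals_rect(1)[OF \<mu>(1)] borel_translate)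
      also have "\<dots> < \<infinity>" using G(6)[of a A] AB by simp
      finally have f2: "emeasure \<mu> (?f -` (A \<times> B)) < \<infinity>" .
      have "emeasure \<mu> (A \<times> B) = emeasure \<mu> (?f -` (A \<times> B))"
        using f1 f2 rect_inv[OF AB(1,3,2,4)] by (metis emeasure_eq_ennreal_measure less_irrefl infinity_ennreal_def)
      then show "emeasure \<mu> (A \<times> B) = emeasure (distr \<mu> borel ?f) (A \<times> B)"
        using AB by (simp add: emeasure_distr_borel[OF D\<mu>(1) cf] borel_Times)
    qed simp
    then show ?thesis unfolding inv_def using emeasure_distr_borel[OF D\<mu>(1) cf] by metis
  qed
  have inv_minus: "inv (- x)" if "inv x" for x
    unfolding inv_def
  proof (intro ballI)
    fix E :: "('g \<times> 'h) set" assume E: "E \<in> sets borel"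
    have "(\<lambda>y. x + y) -` ((\<lambda>y. - x + y) -` E) = E" by (simp add: vimage_def add.assoc[symmetric])
    then show "emeasure \<mu> ((\<lambda>y. - x + y) -` E) = emeasure \<mu> E"
      using that borel_translate(1)[OF E, of "- x"] unfolding inv_def by metis
  qed
  have inv_supp: "x + s \<in> support \<mu>" if "inv x" "s \<in> support \<mu>" for x s
    unfolding support_def
  proof (intro CollectI allI impI, elim conjE)
    fix U assume U: "open U" "x + s \<in> U"
    have "open ((\<lambda>y. x + y) -` U)" by (intro open_vimage U continuous_intros)
    then have "emeasure \<mu> ((\<lambda>y. x + y) -` U) \<noteq> 0" using that(2) U(2) unfolding support_def by simp
    then show "emeasure \<mu> U \<noteq> 0" using that(1) U(1) unfolding inv_def by auto
  qed
  have null: "emeasure \<mu> (- support \<mu>) = 0"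
    by (rule null_of_locally_null[OF D\<mu>(1)]) (auto simp: support_def intro!: borel_open closed_support[unfolded support_def, THEN open_Compl])
  have "support \<mu> \<noteq> {}" using null \<mu>(2) by auto
  then obtain s where s: "s \<in> support \<mu>" by blast
  \<comment> \<open>Translation by \<open>- s\<close> preserves the measure, hence its support, and
    takes \<open>s\<close> to 0. The same device then gives the inverses.\<close>
  have z: "0 \<in> support \<mu>" using inv_supp[OF inv_minus[OF supp_inv[OF s]] s] by simp
  have "add_subgroup (support \<mu>)"
    unfolding add_subgroup_def using z inv_supp supp_inv inv_supp[OF inv_minus[OF supp_inv] z] by auto
  moreover have "haar_on (support \<mu>) \<mu>"
    unfolding haar_on_def using cf\<mu> null \<mu>(2) supp_inv unfolding inv_def by blast
  ultimately have "poly_haar \<gamma> \<eta> (support \<mu>) \<mu>"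
    unfolding poly_haar_def using closed_support \<mu>(1) by blast
  then show ?thesis by blast
qed

section \<open>Continuity of translations in the mean\<close>

lemma haar_integral_left:
  fixes \<eta> :: "'a::{topological_group_add,t2_space,second_countable_topology} measure" and u :: "'a \<Rightarrow> real"
  assumes \<eta>: "haar_on UNIV \<eta>"
  shows "integrable \<eta> u \<Longrightarrow> integrable \<eta> (\<lambda>h. u (w + h))" "u \<in> borel_measurable borel \<Longrightarrow> (\<integral>h. u (w + h) \<partial>\<eta>) = (\<integral>h. u h \<partial>\<eta>)"
proof -
  note H = haar_onD[OF \<eta>]
  have m: "(\<lambda>y. w + y) \<in> measurable \<eta> \<eta>"
    using H(2) by (subst measurable_cong_sets[OF H(2) H(2)]) (intro borel_measurable_continuous_onI continuous_intros)
  have d: "distr \<eta> \<eta> (\<lambda>y. w + y) = \<eta>"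
    by (rule measure_eqI) (use H in \<open>auto simp: emeasure_distr[OF m]\<close>)
  show "integrable \<eta> u \<Longrightarrow> integrable \<eta> (\<lambda>h. u (w + h))"
    using integrable_distr[OF m, of u] d by simp
  show "(\<integral>h. u (w + h) \<partial>\<eta>) = (\<integral>h. u h \<partial>\<eta>)" if "u \<in> borel_measurable borel"
  proof -
    have "u \<in> borel_measurable \<eta>" unfolding measurable_cong_sets[OF H(2) refl] by (rule that)
    from integral_distr[OF m this] show ?thesis unfolding d ..
  qed
qed

text \<open>The functions with this property form a linear space that contains the indicators of
  sets of finite measure. Translation is an isometry of \<open>L\<^sup>1(\<eta>)\<close>, so the
  property passes to limits in the mean with three errors of \<open>e / 3\<close>.\<close>

lemma haar_L1_translation_continuous:
  fixes \<eta> :: "'a::{topological_group_add,t2_space,second_countable_topology} measure" and u :: "'a \<Rightarrow> real"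
  assumes lc: "locally compact (UNIV :: 'a set)" and \<eta>: "haar_on UNIV \<eta>" and u: "integrable \<eta> u" and e: "e > 0"
  shows "\<exists>W. open W \<and> 0 \<in> W \<and> (\<forall>w\<in>W. (\<integral>h. \<bar>u (w + h) - u h\<bar> \<partial>\<eta>) < e)"
proof -
  note H = haar_onD[OF \<eta>]
  have mb: "f \<in> borel_measurable borel" if "integrable \<eta> f" for f :: "'a \<Rightarrow> real"
    using borel_measurable_integrable[OF that] unfolding measurable_cong_sets[OF H(2) refl] .
  define D where "D = {u :: 'a \<Rightarrow> real. integrable \<eta> u \<and> (\<forall>e>0. \<exists>W. open W \<and> 0 \<in> W \<and> (\<forall>w\<in>W. (\<integral>h. \<bar>u (w + h) - u h\<bar> \<partial>\<eta>) < e))}"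
  have tri: "(\<integral>h. \<bar>f h + g h\<bar> \<partial>\<eta>) \<le> (\<integral>h. \<bar>f h\<bar> \<partial>\<eta>) + (\<integral>h. \<bar>g h\<bar> \<partial>\<eta>)" if "integrable \<eta> f" "integrable \<eta> g" for f g :: "'a \<Rightarrow> real"
  proof -
    have "(\<integral>h. \<bar>f h + g h\<bar> \<partial>\<eta>) \<le> (\<integral>h. \<bar>f h\<bar> + \<bar>g h\<bar> \<partial>\<eta>)" using that by (intro integral_mono) auto
    also have "\<dots> = (\<integral>h. \<bar>f h\<bar> \<partial>\<eta>) + (\<integral>h. \<bar>g h\<bar> \<partial>\<eta>)" using that by (intro Bochner_Integration.integral_add) auto
    finally show ?thesis .
  qed
  have Dint: "integrable \<eta> d" if "d \<in> D" for d using that by (simp add: D_def)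
  have DW: "\<exists>W. open W \<and> 0 \<in> W \<and> (\<forall>w\<in>W. (\<integral>h. \<bar>d (w + h) - d h\<bar> \<partial>\<eta>) < e)" if "d \<in> D" "e > 0" for d e
    using that by (simp add: D_def)
  have e3: "e / 3 > 0" using e by simp
  have "\<exists>d\<in>D. (\<integral>x. \<bar>u x - d x\<bar> \<partial>\<eta>) < e / 3"
  proof (rule integrable_L1_dense[OF Dint _ _ _ u e3])
    fix d d' assume dd: "d \<in> D" "d' \<in> D"
    show "(\<lambda>x. d x + d' x) \<in> D" unfolding D_def
    proof (intro CollectI conjI allI impI)
      show "integrable \<eta> (\<lambda>x. d x + d' x)" using dd Dint by auto
      fix e :: real assume "e > 0"
      then have e2: "e / 2 > 0" by simp
      obtain W where W: "open W" "0 \<in> W" "\<And>w. w \<in> W \<Longrightarrow> (\<integral>h. \<bar>d (w + h) - d h\<bar>  \<partial>\<eta>) < e/2"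
        using DW[OF dd(1) e2] by blast
      obtain W' where W': "open W'" "0 \<in> W'" "\<And>w. w \<in> W' \<Longrightarrow> (\<integral>h. \<bar>d' (w + h) - d' h\<bar> \<partial>\<eta>) < e/2"
        using DW[OF dd(2) e2] by blast
      show "\<exists>W. open W \<and> 0 \<in> W \<and> (\<forall>w\<in>W. (\<integral>h. \<bar>d (w + h) + d' (w + h) - (d h + d' h)\<bar> \<partial>\<eta>) < e)"
      proof (intro exI[of _ "W \<inter> W'"] conjI ballI)
        fix w assume w: "w \<in> W \<inter> W'"
        have "(\<integral>h. \<bar>(d (w + h) - d h) + (d' (w + h) - d' h)\<bar> \<partial>\<eta>) \<le> (\<integral>h. \<bar>d (w + h) - d h\<bar> \<partial>\<eta>) + (\<integral>h. \<bar>d' (w + h) - d' h\<bar> \<partial>\<eta>)"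
          using dd Dint haar_integral_left(1)[OF \<eta>] by (intro tri) auto
        also have "\<dots> < e" using W(3)[of w] W'(3)[of w] w by simp
        finally show "(\<integral>h. \<bar>d (w + h) + d' (w + h) - (d h + d' h)\<bar> \<partial>\<eta>) < e" by (simp add: algebra_simps)
      qed (use W W' in auto)
    qed
  next
    fix d and c :: real assume d: "d \<in> D"
    show "(\<lambda>x. c * d x) \<in> D" unfolding D_def
    proof (intro CollectI conjI allI impI)
      show "integrable \<eta> (\<lambda>x. c * d x)" using d Dint by auto
      fix e :: real assume "e > 0"
      then have e2: "e / (\<bar>c\<bar> + 1) > 0" by simp
      obtain W where W: "open W" "0 \<in> W" "\<And>w. w \<in> W \<Longrightarrow> (\<integral>h. \<bar>d (w + h) - d h\<bar> \<partial>\<eta>) < e / (\<bar>c\<bar> + 1)"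
        using DW[OF d e2] by blast
      show "\<exists>W. open W \<and> 0 \<in> W \<and> (\<forall>w\<in>W. (\<integral>h. \<bar>c * d (w + h) - c * d h\<bar> \<partial>\<eta>) < e)"
      proof (intro exI[of _ W] conjI ballI)
        fix w assume w: "w \<in> W"
        have "(\<integral>h. \<bar>c * d (w + h) - c * d h\<bar> \<partial>\<eta>) = (\<integral>h. \<bar>c\<bar> * \<bar>d (w + h) - d h\<bar> \<partial>\<eta>)"
          by (simp add: abs_mult[symmetric] right_diff_distrib)
        also have "\<dots> = \<bar>c\<bar> * (\<integral>h. \<bar>d (w + h) - d h\<bar> \<partial>\<eta>)" by simp
        also have "\<dots> \<le> \<bar>c\<bar> * (e / (\<bar>c\<bar> + 1))" using W(3)[OF w] by (intro mult_left_mono) auto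
        also have "\<dots> < e" using \<open>e > 0\<close> by (simp add: field_simps)
        finally show "(\<integral>h. \<bar>c * d (w + h) - c * d h\<bar> \<partial>\<eta>) < e" .
      qed (use W in auto)
    qed
  next
    fix A and e :: real assume A: "A \<in> sets \<eta>" "emeasure \<eta> A < \<infinity>" and e: "e > 0"
    have Ab: "A \<in> sets borel" using A H(2) by simp
    have "indicat_real A \<in> D" unfolding D_def
    proof (intro CollectI conjI allI impI)
      show "integrable \<eta> (indicat_real A)" using A by auto
      fix e :: real assume e: "e > 0"
      obtain W where W: "open W" "0 \<in> W"
        "\<And>w. w \<in> W \<Longrightarrow> emeasure \<eta> (((\<lambda>y. w + y) -` A - A) \<union> (A - (\<lambda>y. w + y) -` A)) < ennreal e"
        using haar_translation_continuous[OF lc \<eta> Ab A(2) e] by metis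
      show "\<exists>W. open W \<and> 0 \<in> W \<and> (\<forall>w\<in>W. (\<integral>h. \<bar>indicat_real A (w + h) - indicat_real A h\<bar> \<partial>\<eta>) < e)"
      proof (intro exI[of _ W] conjI ballI)
        fix w assume w: "w \<in> W"
        let ?X = "((\<lambda>y. w + y) -` A - A) \<union> (A - (\<lambda>y. w + y) -` A)"
        have "(\<integral>h. \<bar>indicat_real A (w + h) - indicat_real A h\<bar> \<partial>\<eta>) = (\<integral>h. indicat_real ?X h \<partial>\<eta>)"
          by (intro Bochner_Integration.integral_cong) (auto simp: indicator_def)
        also have "\<dots> = measure \<eta> ?X" using borel_translate(1)[OF Ab, of w] Ab H(2) by (simp add: H(3))
        also have "\<dots> < e" using W(3)[OF w] e by (subst measure_def, subst enn2real_less_iff) (auto intro: less_trans)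
        finally show "(\<integral>h. \<bar>indicat_real A (w + h) - indicat_real A h\<bar> \<partial>\<eta>) < e" .
      qed (use W in auto)
    qed
    then show "\<exists>d\<in>D. (\<integral>x. \<bar>indicat_real A x - d x\<bar> \<partial>\<eta>) < e" using e by (intro bexI[of _ "indicat_real A"]) auto
  qed
  then obtain d where d: "d \<in> D" "(\<integral>x. \<bar>u x - d x\<bar> \<partial>\<eta>) < e / 3" by blast
  obtain W where W: "open W" "0 \<in> W" "\<And>w. w \<in> W \<Longrightarrow> (\<integral>h. \<bar>d (w + h) - d h\<bar> \<partial>\<eta>) < e / 3"
    using DW[OF d(1) e3] by blast
  have "(\<integral>h. \<bar>u (w + h) - u h\<bar> \<partial>\<eta>) < e" if w: "w \<in> W" for w
  proof -
    have i: "integrable \<eta> (\<lambda>h. u (w + h))" "integrable \<eta> (\<lambda>h. d (w + h))" "integrable \<eta> d"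
      using haar_integral_left(1)[OF \<eta>] u Dint[OF d(1)] by auto
    have "(\<integral>h. \<bar>u (w + h) - u h\<bar> \<partial>\<eta>) = (\<integral>h. \<bar>(u (w + h) - d (w + h)) + ((d (w + h) - d h) + (d h - u h))\<bar> \<partial>\<eta>)"
      by (intro Bochner_Integration.integral_cong) auto
    also have "\<dots> \<le> (\<integral>h. \<bar>u (w + h) - d (w + h)\<bar> \<partial>\<eta>) + (\<integral>h. \<bar>(d (w + h) - d h) + (d h - u h)\<bar> \<partial>\<eta>)"
      using i u by (intro tri) auto
    also have "\<dots> \<le> (\<integral>h. \<bar>u (w + h) - d (w + h)\<bar> \<partial>\<eta>) + ((\<integral>h. \<bar>d (w + h) - d h\<bar> \<partial>\<eta>) + (\<integral>h. \<bar>d h - u h\<bar> \<partial>\<eta>))"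
      using i u by (intro add_left_mono tri) auto
    also have "(\<integral>h. \<bar>u (w + h) - d (w + h)\<bar> \<partial>\<eta>) = (\<integral>h. \<bar>u h - d h\<bar> \<partial>\<eta>)"
      using haar_integral_left(2)[OF \<eta>, of "\<lambda>h. \<bar>u h - d h\<bar>" w] mb[OF u] mb[OF i(3)] by simp
    also have "(\<integral>h. \<bar>d h - u h\<bar> \<partial>\<eta>) = (\<integral>h. \<bar>u h - d h\<bar> \<partial>\<eta>)" by (simp add: abs_minus_commute)
    finally show ?thesis using d(2) W(3)[OF w] by linarith
  qed
  then show ?thesis using W by blast
qed

section \<open>Composition of measures with dominated marginals\<close>

text \<open>The function \<open>v\<close> tells how \<open>\<rho>\<close> spreads the mass over
  \<open>A\<close> along the second group. Domination by \<open>\<eta>\<close> allows a version with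
  values between 0 and 1 everywhere, which makes it a bounded test function.\<close>

definition slice_density ::
  "'h::topological_space measure \<Rightarrow> ('g \<times> 'h) measure \<Rightarrow> 'g set \<Rightarrow> ('h \<Rightarrow> real) \<Rightarrow> bool" where
  "slice_density \<eta> \<rho> A v \<longleftrightarrow> v \<in> borel_measurable borel \<and> (\<forall>h. 0 \<le> v h \<and> v h \<le> 1) \<and>
     (\<forall>E\<in>sets borel. emeasure \<rho> (A \<times> E) = (\<integral>\<^sup>+h. ennreal (v h) * indicator E h \<partial>\<eta>))"

text \<open>A Radon-Nikodym density \<open>f\<close> exceeds 1 only on a null set: on
  \<open>f > 1\<close> the two measures agree, so the integral of \<open>f - 1\<close> over this set
  is zero, finiteness of \<open>\<nu>\<close> permitting the subtraction. Cutting \<open>f\<close>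
  at 1 therefore changes none of the integrals.\<close>

lemma dominated_density:
  assumes "sigma_finite_measure \<eta>" "sets \<nu> = sets \<eta>" "\<And>E. E \<in> sets \<eta> \<Longrightarrow> emeasure \<nu> E \<le> emeasure \<eta> E"
    and fin: "emeasure \<nu> (space \<eta>) < \<infinity>"
  shows "\<exists>v. v \<in> borel_measurable \<eta> \<and> (\<forall>h. 0 \<le> v h \<and> v h \<le> 1) \<and>
    (\<forall>E\<in>sets \<eta>. emeasure \<nu> E = (\<integral>\<^sup>+h. ennreal (v h) * indicator E h \<partial>\<eta>))"
proof -
  interpret sigma_finite_measure \<eta> by fact
  have "absolutely_continuous \<eta> \<nu>"
    unfolding absolutely_continuous_def null_sets_def using assms(2,3) by (auto) (metis le_zero_eq)
  then obtain f where f: "f \<in> borel_measurable \<eta>" "density \<eta> f = \<nu>"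
    using Radon_Nikodym[OF _ assms(2)] by blast
  note [measurable] = f(1)
  have em: "emeasure \<nu> E = (\<integral>\<^sup>+h. f h * indicator E h \<partial>\<eta>)" if "E \<in> sets \<eta>" for E
    using emeasure_density[OF f(1) that] f(2) by simp
  let ?N = "{h \<in> space \<eta>. f h > 1}"
  have N: "?N \<in> sets \<eta>" by measurable
  have "emeasure \<nu> ?N \<le> emeasure \<nu> (space \<eta>)" using N assms(2) sets.sets_into_space by (intro emeasure_mono) auto
  then have fN: "emeasure \<nu> ?N < \<infinity>" using fin by (rule le_less_trans)
  have "emeasure \<eta> ?N = (\<integral>\<^sup>+h. indicator ?N h \<partial>\<eta>)" using N by simp
  also have "\<dots> \<le> emeasure \<nu> ?N"
    unfolding em[OF N] by (intro nn_integral_mono) (auto simp: indicator_def)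
  finally have eq: "emeasure \<eta> ?N = emeasure \<nu> ?N" using assms(3)[OF N] by simp
  have "(\<integral>\<^sup>+h. (f h - 1) * indicator ?N h \<partial>\<eta>) + emeasure \<eta> ?N = (\<integral>\<^sup>+h. (f h - 1) * indicator ?N h + indicator ?N h \<partial>\<eta>)"
    using N by (subst nn_integral_add) auto
  also have "\<dots> = (\<integral>\<^sup>+h. f h * indicator ?N h \<partial>\<eta>)"
    by (intro nn_integral_cong) (auto simp: indicator_def diff_add_cancel_ennreal)
  also have "\<dots> = emeasure \<eta> ?N" using em[OF N] eq by simp
  finally have "(\<integral>\<^sup>+h. (f h - 1) * indicator ?N h \<partial>\<eta>) = 0"
    using fN eq ennreal_add_left_cancel[of "emeasure \<eta> ?N" _ 0] by (auto simp: add.commute)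
  then have "AE h in \<eta>. (f h - 1) * indicator ?N h = 0"
    by (subst (asm) nn_integral_0_iff_AE) measurable
  then have ae: "AE h in \<eta>. f h = ennreal (enn2real (min 1 (f h)))"
  proof (rule AE_mp, intro AE_I2 impI)
    fix h assume h: "h \<in> space \<eta>" "(f h - 1) * indicator ?N h = 0"
    have "f h \<le> 1"
    proof (rule ccontr)
      assume "\<not> f h \<le> 1"
      then have "f h - 1 = 0" "1 < f h" using h by (auto simp: indicator_def)
      then show False using diff_gt_0_iff_gt_ennreal[of "f h" 1] by simp
    qed
    then show "f h = ennreal (enn2real (min 1 (f h)))"
      using le_less_trans[OF _ ennreal_one_less_top, of "f h"] by (simp add: min.absorb2)
  qed
  show ?thesis
  proof (intro exI[of _ "\<lambda>h. enn2real (min 1 (f h))"] conjI allI ballI)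
    show "enn2real (min 1 (f h)) \<le> 1" for h by (intro enn2real_leI) auto
    fix E assume E: "E \<in> sets \<eta>"
    show "emeasure \<nu> E = (\<integral>\<^sup>+h. ennreal (enn2real (min 1 (f h))) * indicator E h \<partial>\<eta>)"
      unfolding em[OF E] by (rule nn_integral_cong_AE) (use ae in auto)
  qed auto
qed

lemma slice_density_exists:
  fixes \<gamma> :: "'g::{t2_space,second_countable_topology} measure" and \<eta> :: "'h::{t2_space,second_countable_topology} measure"
  assumes lcH: "locally compact (UNIV :: 'h set)" and \<eta>: "compact_finite \<eta>"
    and \<rho>: "dominated_marginals \<gamma> \<eta> \<rho>" and A: "A \<in> sets borel" "emeasure \<gamma> A < \<infinity>"
  shows "\<exists>v. slice_density \<eta> \<rho> A v"
proof -
  note D = dominated_marginalsD[OF \<rho>] and s\<eta> = compact_finite_sets[OF \<eta>] compact_finite_space[OF \<eta>]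
  let ?\<rho>A = "density \<rho> (indicator (A \<times> UNIV))"
  let ?\<nu> = "distr ?\<rho>A borel snd"
  have AU: "A \<times> UNIV \<in> sets \<rho>" using A D(1) by (simp add: borel_Times)
  have cs: "continuous_on UNIV (snd :: 'g \<times> 'h \<Rightarrow> 'h)" by (intro continuous_intros)
  have em: "emeasure ?\<nu> E = emeasure \<rho> (A \<times> E)" if E: "E \<in> sets borel" for E
  proof -
    have "emeasure ?\<nu> E = emeasure ?\<rho>A (snd -` E)"
      by (rule emeasure_distr_borel[OF _ cs E]) (simp add: D(1))
    also have "\<dots> = emeasure \<rho> ((A \<times> UNIV) \<inter> snd -` E)"
      using AU measurable_sets[OF borel_measurable_continuous_onI[OF cs] E]
      by (subst emeasure_density) (auto simp: D(1) intro!: borel_measurable_indicator simp flip: indicator_inter_arith)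
    also have "(A \<times> UNIV) \<inter> snd -` E = A \<times> E" by auto
    finally show ?thesis .
  qed
  have "\<exists>v. v \<in> borel_measurable \<eta> \<and> (\<forall>h. 0 \<le> v h \<and> v h \<le> 1) \<and> (\<forall>E\<in>sets \<eta>. emeasure ?\<nu> E = (\<integral>\<^sup>+h. ennreal (v h) * indicator E h \<partial>\<eta>))"
  proof (rule dominated_density[OF compact_finite_sigma_finite[OF lcH \<eta>]])
    show "emeasure ?\<nu> E \<le> emeasure \<eta> E" if "E \<in> sets \<eta>" for E
      using that dominated_marginals_rect(2)[OF \<rho> A(1), of E] em by (simp add: s\<eta>)
    show "emeasure ?\<nu> (space \<eta>) < \<infinity>"
      using dominated_marginals_rect(1)[OF \<rho> A(1), of UNIV] em[of UNIV] A(2) by (simp add: s\<eta>)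
  qed (simp add: s\<eta>)
  then show ?thesis
    unfolding slice_density_def using em s\<eta> measurable_cong_sets[OF s\<eta>(1) refl, of borel] by auto
qed

lemma slice_density_measure_eq:
  fixes \<rho> :: "('g::{t2_space,second_countable_topology} \<times> 'h::{t2_space,second_countable_topology}) measure"
  assumes v: "slice_density \<eta> \<rho> A v" and s: "sets \<rho> = sets borel" "sets \<eta> = sets borel" and A: "A \<in> sets borel"
  shows "distr (density \<rho> (\<lambda>z. indicator A (fst z))) borel snd = density \<eta> (\<lambda>h. ennreal (v h))"
    "(\<lambda>z. indicator A (fst z) :: ennreal) \<in> borel_measurable \<rho>" "(\<lambda>h. ennreal (v h)) \<in> borel_measurable \<eta>"
    "snd \<in> measurable \<rho> borel"
proof -
  have cs: "continuous_on UNIV (snd :: 'g \<times> 'h \<Rightarrow> 'h)" "continuous_on UNIV (fst :: 'g \<times> 'h \<Rightarrow> 'g)"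
    by (intro continuous_intros)+
  show m: "(\<lambda>z. indicator A (fst z) :: ennreal) \<in> borel_measurable \<rho>"
    unfolding measurable_cong_sets[OF s(1) refl]
    by (rule measurable_compose[OF borel_measurable_continuous_onI[OF cs(2)] borel_measurable_indicator[OF A]])
  have vb: "v \<in> borel_measurable borel" using v by (simp add: slice_density_def)
  show mv: "(\<lambda>h. ennreal (v h)) \<in> borel_measurable \<eta>"
    unfolding measurable_cong_sets[OF s(2) refl] using vb by simp
  show "snd \<in> measurable \<rho> borel"
    unfolding measurable_cong_sets[OF s(1) refl] by (rule borel_measurable_continuous_onI[OF cs(1)])
  show "distr (density \<rho> (\<lambda>z. indicator A (fst z))) borel snd = density \<eta> (\<lambda>h. ennreal (v h))"
  proof (rule measure_eqI)
    fix E assume "E \<in> sets (distr (density \<rho> (\<lambda>z. indicator A (fst z))) borel snd)"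
    then have E: "E \<in> sets borel" by simp
    have mE: "snd -` E \<in> sets \<rho>" using measurable_sets[OF borel_measurable_continuous_onI[OF cs(1)] E] s(1) by simp
    have "emeasure (distr (density \<rho> (\<lambda>z. indicator A (fst z))) borel snd) E = emeasure (density \<rho> (\<lambda>z. indicator A (fst z))) (snd -` E)"
      by (rule emeasure_distr_borel[OF _ cs(1) E]) (simp add: s)
    also have "\<dots> = (\<integral>\<^sup>+z. indicator A (fst z) * indicator (snd -` E) z \<partial>\<rho>)"
      by (rule emeasure_density[OF m mE])
    also have "\<dots> = (\<integral>\<^sup>+z. indicator (A \<times> E) z \<partial>\<rho>)"
      by (intro nn_integral_cong) (auto simp: indicator_def)
    also have "\<dots> = emeasure \<rho> (A \<times> E)" using A E s(1) by (simp add: borel_Times)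
    also have "\<dots> = emeasure (density \<eta> (\<lambda>h. ennreal (v h))) E"
      using v E s(2) mv by (simp add: slice_density_def emeasure_density)
    finally show "emeasure (distr (density \<rho> (\<lambda>z. indicator A (fst z))) borel snd) E = emeasure (density \<eta> (\<lambda>h. ennreal (v h))) E" .
  qed (simp add: s)
qed

lemma slice_density_nn_integral:
  fixes \<rho> :: "('g::{t2_space,second_countable_topology} \<times> 'h::{t2_space,second_countable_topology}) measure"
  assumes v: "slice_density \<eta> \<rho> A v" and s: "sets \<rho> = sets borel" "sets \<eta> = sets borel" and A: "A \<in> sets borel"
    and f: "f \<in> borel_measurable borel"
  shows "(\<integral>\<^sup>+z. indicator A (fst z) * f (snd z) \<partial>\<rho>) = (\<integral>\<^sup>+h. ennreal (v h) * f h \<partial>\<eta>)"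
proof -
  note * = slice_density_measure_eq[OF v s A]
  have f': "f \<in> borel_measurable \<eta>" unfolding measurable_cong_sets[OF s(2) refl] by (rule f)
  have "(\<integral>\<^sup>+z. indicator A (fst z) * f (snd z) \<partial>\<rho>) = (\<integral>\<^sup>+z. f (snd z) \<partial>density \<rho> (\<lambda>z. indicator A (fst z)))"
    using *(2) measurable_compose[OF *(4) f] by (simp add: nn_integral_density)
  also have "\<dots> = (\<integral>\<^sup>+h. f h \<partial>distr (density \<rho> (\<lambda>z. indicator A (fst z))) borel snd)"
    using *(4) f by (simp add: nn_integral_distr)
  also have "\<dots> = (\<integral>\<^sup>+h. ennreal (v h) * f h \<partial>\<eta>)"
    unfolding *(1) using *(3) f' by (rule nn_integral_density)
  finally show ?thesis .
qed

lemma slice_density_integrable: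
  fixes \<rho> :: "('g::{t2_space,second_countable_topology} \<times> 'h::{t2_space,second_countable_topology}) measure"
  assumes v: "slice_density \<eta> \<rho> A v" and \<eta>: "compact_finite \<eta>" and \<rho>: "dominated_marginals \<gamma> \<eta> \<rho>"
    and A: "A \<in> sets borel" "emeasure \<gamma> A < \<infinity>"
  shows "integrable \<eta> v"
proof -
  have vb: "v \<in> borel_measurable borel" "\<And>h. 0 \<le> v h" using v by (auto simp: slice_density_def)
  have "(\<integral>\<^sup>+h. ennreal (v h) \<partial>\<eta>) = emeasure \<rho> (A \<times> UNIV)" using v by (simp add: slice_density_def)
  also have "\<dots> \<le> emeasure \<gamma> A" using A by (intro dominated_marginalsD(3)[OF \<rho>])
  finally have "(\<integral>\<^sup>+h. ennreal (v h) \<partial>\<eta>) < \<infinity>" using A(2) by (rule le_less_trans)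
  moreover have "v \<in> borel_measurable \<eta>"
    using vb(1) unfolding measurable_cong_sets[OF compact_finite_sets[OF \<eta>] refl] .
  ultimately show ?thesis using vb(2) by (simp add: integrable_iff_bounded)
qed

text \<open>The formula is the composition of transition kernels, written through their densities.
  It is required for all versions \<open>v\<close>, \<open>u\<close> of the densities, so that any
  convenient version may be used, and it is symmetric in the two factors.\<close>

definition composed ::
  "'g::topological_space measure \<Rightarrow> 'h::topological_space measure \<Rightarrow> 'k::topological_space measure
    \<Rightarrow> ('g \<times> 'h) measure \<Rightarrow> ('h \<times> 'k) measure \<Rightarrow> ('g \<times> 'k) measure \<Rightarrow> bool" where
  "composed \<gamma> \<eta> \<kappa> \<rho> \<tau> \<sigma> \<longleftrightarrow> dominated_marginals \<gamma> \<kappa> \<sigma> \<and>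
     (\<forall>A B v u. A \<in> sets borel \<and> B \<in> sets borel \<and> emeasure \<gamma> A < \<infinity> \<and> emeasure \<kappa> B < \<infinity> \<and>
        slice_density \<eta> \<rho> A v \<and> slice_density \<eta> (converse_measure \<tau>) B u \<longrightarrow>
        emeasure \<sigma> (A \<times> B) = (\<integral>\<^sup>+h. ennreal (v h) * ennreal (u h) \<partial>\<eta>))"

lemma composed_converse:
  assumes "composed \<gamma> \<eta> \<kappa> \<rho> \<tau> \<sigma>" "sets \<rho> = sets borel" "sets \<tau> = sets borel"
  shows "composed \<kappa> \<eta> \<gamma> (converse_measure \<tau>) (converse_measure \<rho>) (converse_measure \<sigma>)"
  unfolding composed_def
proof (rule conjI)
  have d: "dominated_marginals \<gamma> \<kappa> \<sigma>" using assms(1) by (simp add: composed_def)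
  then show "dominated_marginals \<kappa> \<gamma> (converse_measure \<sigma>)" by (rule dominated_marginals_converse)
  show "\<forall>A B v u. A \<in> sets borel \<and> B \<in> sets borel \<and> emeasure \<kappa> A < \<infinity> \<and> emeasure \<gamma> B < \<infinity> \<and>
     slice_density \<eta> (converse_measure \<tau>) A v \<and> slice_density \<eta> (converse_measure (converse_measure \<rho>)) B u \<longrightarrow>
     emeasure (converse_measure \<sigma>) (A \<times> B) = (\<integral>\<^sup>+h. ennreal (v h) * ennreal (u h) \<partial>\<eta>)"
  proof (intro allI impI, elim conjE)
    fix A B v u assume *: "A \<in> sets borel" "B \<in> sets borel" "emeasure \<kappa> A < \<infinity>" "emeasure \<gamma> B < \<infinity>"
      "slice_density \<eta> (converse_measure \<tau>) A v" "slice_density \<eta> (converse_measure (converse_measure \<rho>)) B u"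
    have "emeasure \<sigma> (B \<times> A) = (\<integral>\<^sup>+h. ennreal (u h) * ennreal (v h) \<partial>\<eta>)"
      using assms(1)[unfolded composed_def, THEN conjunct2, rule_format, of B A u v]
        *(1-5) *(6)[unfolded converse_converse[OF assms(2)]] by simp
    then show "emeasure (converse_measure \<sigma>) (A \<times> B) = (\<integral>\<^sup>+h. ennreal (v h) * ennreal (u h) \<partial>\<eta>)"
      using * d by (simp add: emeasure_converse_rect dominated_marginals_def mult.commute)
  qed
qed

text \<open>The half of unimodularity that \<open>haar_on\<close> does not contain.\<close>

definition right_invariant :: "'a::{group_add, topological_space} measure \<Rightarrow> bool" where
  "right_invariant \<eta> \<longleftrightarrow> (\<forall>x. \<forall>A\<in>sets borel. emeasure \<eta> ((\<lambda>y. y + x) -` A) = emeasure \<eta> A)"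

lemma right_invariantD:
  "right_invariant \<eta> \<Longrightarrow> A \<in> sets borel \<Longrightarrow> emeasure \<eta> ((\<lambda>y. y + x) -` A) = emeasure \<eta> A"
  by (simp add: right_invariant_def)

lemma haar_nn_integral_right:
  fixes \<eta> :: "'a::{topological_group_add,t2_space,second_countable_topology} measure"
  assumes s: "sets \<eta> = sets borel" and inv: "right_invariant \<eta>"
    and f: "f \<in> borel_measurable borel"
  shows "(\<integral>\<^sup>+y. f (y + x) \<partial>\<eta>) = (\<integral>\<^sup>+y. f y \<partial>\<eta>)"
proof -
  have c: "continuous_on UNIV (\<lambda>y. y + x)" by (intro continuous_intros)
  have m: "(\<lambda>y. y + x) \<in> measurable \<eta> borel"
    unfolding measurable_cong_sets[OF s refl] by (rule borel_measurable_continuous_onI[OF c])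
  have "distr \<eta> borel (\<lambda>y. y + x) = \<eta>"
    by (rule measure_eqI) (use right_invariantD[OF inv] s in \<open>auto simp: emeasure_distr_borel[OF s c]\<close>)
  then have "(\<integral>\<^sup>+y. f y \<partial>\<eta>) = (\<integral>\<^sup>+y. f y \<partial>distr \<eta> borel (\<lambda>y. y + x))" by simp
  also have "\<dots> = (\<integral>\<^sup>+y. f (y + x) \<partial>\<eta>)" using f by (simp add: nn_integral_distr[OF m])
  finally show ?thesis ..
qed

text \<open>Composition thickened by a symmetric neighbourhood \<open>U\<close> of zero in the middle group:
  the pairs \<open>(g, h)\<close> and \<open>(h', k)\<close> are matched when \<open>h' - h \<in> U\<close>.\<close>

definition thick_composition ::
  "'h::{group_add,topological_space} measure \<Rightarrow> ('g::topological_space \<times> 'h) measure \<Rightarrow> ('h \<times> 'k::topological_space) measure \<Rightarrow> 'h set \<Rightarrow> ('g \<times> 'k) measure" where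
  "thick_composition \<eta> \<rho> \<tau> U =
     distr (density (\<rho> \<Otimes>\<^sub>M \<tau>) (\<lambda>z. indicator U (fst (snd z) + - snd (fst z)) / emeasure \<eta> U)) borel (\<lambda>z. (fst (fst z), snd (snd z)))"

context
  fixes \<gamma> :: "'g::{topological_group_add,t2_space,second_countable_topology} measure"
    and \<eta> :: "'h::{topological_group_add,t2_space,second_countable_topology} measure"
    and \<kappa> :: "'k::{topological_group_add,t2_space,second_countable_topology} measure"
    and \<rho> :: "('g \<times> 'h) measure" and \<tau> :: "('h \<times> 'k) measure"
  assumes lcG: "locally compact (UNIV :: 'g set)" and lcH: "locally compact (UNIV :: 'h set)" and lcK: "locally compact (UNIV :: 'k set)"
    and \<gamma>: "haar_on UNIV \<gamma>" and \<eta>: "haar_on UNIV \<eta>" and \<kappa>: "haar_on UNIV \<kappa>"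
    and rinv: "right_invariant \<eta>"
    and \<rho>: "dominated_marginals \<gamma> \<eta> \<rho>" and \<tau>: "dominated_marginals \<eta> \<kappa> \<tau>"
begin

lemma sigma_finite_factors: "sigma_finite_measure \<rho>" "sigma_finite_measure \<tau>" "sigma_finite_measure \<eta>"
  using compact_finite_sigma_finite[OF lc_prod[OF lcG lcH] dominated_marginals_compact_finite[OF \<rho> haar_onD(1)[OF \<gamma>]]]
    compact_finite_sigma_finite[OF lc_prod[OF lcH lcK] dominated_marginals_compact_finite[OF \<tau> haar_onD(1)[OF \<eta>]]]
    compact_finite_sigma_finite[OF lcH haar_onD(1)[OF \<eta>]] by auto

lemma sets_pair_factors: "sets (\<rho> \<Otimes>\<^sub>M \<tau>) = sets borel"
  using sets_pair_measure_cong[OF dominated_marginalsD(1)[OF \<rho>] dominated_marginalsD(1)[OF \<tau>]] unfolding borel_prod .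

text \<open>Both orders of integration are recorded because each marginal is estimated by
  integrating out the opposite factor first.\<close>

lemma emeasure_thick_rect:
  assumes U: "open U" and A: "A \<in> sets borel" and B: "B \<in> sets borel"
  shows "emeasure (thick_composition \<eta> \<rho> \<tau> U) (A \<times> B) =
      (\<integral>\<^sup>+x. \<integral>\<^sup>+y. indicator A (fst x) * indicator B (snd y) * indicator U (fst y + - snd x) / emeasure \<eta> U \<partial>\<tau> \<partial>\<rho>)"
    "emeasure (thick_composition \<eta> \<rho> \<tau> U) (A \<times> B) =
      (\<integral>\<^sup>+y. \<integral>\<^sup>+x. indicator A (fst x) * indicator B (snd y) * indicator U (fst y + - snd x) / emeasure \<eta> U \<partial>\<rho> \<partial>\<tau>)"
proof -
  interpret S: sigma_finite_measure \<rho> by (rule sigma_finite_factors)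
  interpret T: sigma_finite_measure \<tau> by (rule sigma_finite_factors)
  interpret pair_sigma_finite \<rho> \<tau> ..
  note s = sets_pair_factors
  have c1: "continuous_on UNIV (\<lambda>z::('g \<times> 'h) \<times> ('h \<times> 'k). fst (snd z) + - snd (fst z))"
    and c2: "continuous_on UNIV (\<lambda>z::('g \<times> 'h) \<times> ('h \<times> 'k). (fst (fst z), snd (snd z)))"
    and c3: "continuous_on UNIV (\<lambda>z::('g \<times> 'h) \<times> ('h \<times> 'k). fst (fst z))"
    and c4: "continuous_on UNIV (\<lambda>z::('g \<times> 'h) \<times> ('h \<times> 'k). snd (snd z))"
    by (intro continuous_intros)+
  have [measurable]: "(\<lambda>z. indicator U (fst (snd z) + - snd (fst z)) :: ennreal) \<in> borel_measurable (\<rho> \<Otimes>\<^sub>M \<tau>)"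
    "(\<lambda>z. indicator A (fst (fst z)) :: ennreal) \<in> borel_measurable (\<rho> \<Otimes>\<^sub>M \<tau>)"
    "(\<lambda>z. indicator B (snd (snd z)) :: ennreal) \<in> borel_measurable (\<rho> \<Otimes>\<^sub>M \<tau>)"
    unfolding measurable_cong_sets[OF s refl]
    using measurable_compose[OF borel_measurable_continuous_onI[OF c1] borel_measurable_indicator[OF borel_open[OF U]]]
      measurable_compose[OF borel_measurable_continuous_onI[OF c3] borel_measurable_indicator[OF A]]
      measurable_compose[OF borel_measurable_continuous_onI[OF c4] borel_measurable_indicator[OF B]] by auto
  let ?d = "\<lambda>z. indicator U (fst (snd z) + - snd (fst z)) / emeasure \<eta> U"
  let ?f = "\<lambda>z. indicator A (fst (fst z)) * indicator B (snd (snd z)) * indicator U (fst (snd z) + - snd (fst z)) / emeasure \<eta> U"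
  have dm: "?d \<in> borel_measurable (\<rho> \<Otimes>\<^sub>M \<tau>)" by measurable
  have fm: "?f \<in> borel_measurable (\<rho> \<Otimes>\<^sub>M \<tau>)" by measurable
  have AB: "A \<times> B \<in> sets borel" using A B by (rule borel_Times)
  have "emeasure (thick_composition \<eta> \<rho> \<tau> U) (A \<times> B) = emeasure (density (\<rho> \<Otimes>\<^sub>M \<tau>) ?d) ((\<lambda>z. (fst (fst z), snd (snd z))) -` (A \<times> B))"
    unfolding thick_composition_def by (rule emeasure_distr_borel[OF _ c2 AB]) (simp add: s)
  also have "\<dots> = (\<integral>\<^sup>+z. ?d z * indicator ((\<lambda>z. (fst (fst z), snd (snd z))) -` (A \<times> B)) z \<partial>(\<rho> \<Otimes>\<^sub>M \<tau>))"
    using measurable_sets[OF borel_measurable_continuous_onI[OF c2] AB] s by (intro emeasure_density dm) simp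
  also have "\<dots> = (\<integral>\<^sup>+z. ?f z \<partial>(\<rho> \<Otimes>\<^sub>M \<tau>))"
    by (intro nn_integral_cong) (auto simp: indicator_def)
  finally have e: "emeasure (thick_composition \<eta> \<rho> \<tau> U) (A \<times> B) = (\<integral>\<^sup>+z. ?f z \<partial>(\<rho> \<Otimes>\<^sub>M \<tau>))" .
  show "emeasure (thick_composition \<eta> \<rho> \<tau> U) (A \<times> B) =
      (\<integral>\<^sup>+x. \<integral>\<^sup>+y. indicator A (fst x) * indicator B (snd y) * indicator U (fst y + - snd x) / emeasure \<eta> U \<partial>\<tau> \<partial>\<rho>)"
    unfolding e using T.nn_integral_fst[OF fm] by simp
  show "emeasure (thick_composition \<eta> \<rho> \<tau> U) (A \<times> B) =
      (\<integral>\<^sup>+y. \<integral>\<^sup>+x. indicator A (fst x) * indicator B (snd y) * indicator U (fst y + - snd x) / emeasure \<eta> U \<partial>\<rho> \<partial>\<tau>)"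
    unfolding e using nn_integral_snd[OF fm] by simp
qed

text \<open>For fixed \<open>x\<close> the admissible middle coordinates of \<open>y\<close> form
  the right translate of \<open>U\<close> by \<open>snd x\<close>, whose mass is that of
  \<open>U\<close> by right invariance; the division in the density cancels it. Symmetry of
  \<open>U\<close> gives the same picture with the two factors interchanged.\<close>

lemma thick_dominated:
  assumes U: "open U" "uminus -` U = U" and fin: "emeasure \<eta> U < \<infinity>" "emeasure \<eta> U \<noteq> 0"
  shows "dominated_marginals \<gamma> \<kappa> (thick_composition \<eta> \<rho> \<tau> U)"
  unfolding dominated_marginals_def
proof (intro conjI ballI)
  note R = dominated_marginalsD[OF \<rho>] and T = dominated_marginalsD[OF \<tau>]
  have c1: "emeasure \<eta> U / emeasure \<eta> U = 1" using fin by (intro ennreal_divide_self) auto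
  show "sets (thick_composition \<eta> \<rho> \<tau> U) = sets borel" by (simp add: thick_composition_def)
  fix A :: "'g set" assume A: "A \<in> sets borel"
  have "emeasure (thick_composition \<eta> \<rho> \<tau> U) (A \<times> UNIV) =
     (\<integral>\<^sup>+x. \<integral>\<^sup>+y. indicator A (fst x) * indicator UNIV (snd y) * indicator U (fst y + - snd x) / emeasure \<eta> U \<partial>\<tau> \<partial>\<rho>)"
    by (rule emeasure_thick_rect(1)[OF U(1) A]) simp
  also have "\<dots> \<le> (\<integral>\<^sup>+x. indicator (A \<times> UNIV) x \<partial>\<rho>)"
  proof (rule nn_integral_mono)
    fix x :: "'g \<times> 'h"
    let ?E = "(\<lambda>h'. h' + - snd x) -` U"
    have mE: "?E \<in> sets borel" using U(1) by (intro borel_translate) simp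
    have "(\<integral>\<^sup>+y. indicator A (fst x) * indicator UNIV (snd y) * indicator U (fst y + - snd x) / emeasure \<eta> U \<partial>\<tau>)
       = (\<integral>\<^sup>+y. (indicator A (fst x) / emeasure \<eta> U) * indicator (?E \<times> UNIV) y \<partial>\<tau>)"
      by (intro nn_integral_cong) (auto simp: indicator_def)
    also have "\<dots> = (indicator A (fst x) / emeasure \<eta> U) * emeasure \<tau> (?E \<times> UNIV)"
      using mE T(1) by (simp add: nn_integral_cmult_indicator borel_Times)
    also have "\<dots> \<le> (indicator A (fst x) / emeasure \<eta> U) * emeasure \<eta> ?E"
      by (intro mult_left_mono T(3) mE) simp
    also have "emeasure \<eta> ?E = emeasure \<eta> U" using U(1) by (intro right_invariantD[OF rinv]) simp
    also have "(indicator A (fst x) / emeasure \<eta> U) * emeasure \<eta> U = indicator A (fst x) * (emeasure \<eta> U / emeasure \<eta> U)"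
      by (simp add: ennreal_times_divide mult.commute)
    also have "\<dots> = indicator (A \<times> UNIV) x" unfolding c1 by (auto simp: indicator_def mem_Times_iff)
    finally show "(\<integral>\<^sup>+y. indicator A (fst x) * indicator UNIV (snd y) * indicator U (fst y + - snd x) / emeasure \<eta> U \<partial>\<tau>) \<le> indicator (A \<times> UNIV) x" .
  qed
  also have "\<dots> = emeasure \<rho> (A \<times> UNIV)" using A R(1) by (simp add: borel_Times)
  also have "\<dots> \<le> emeasure \<gamma> A" using A by (rule R(3))
  finally show "emeasure (thick_composition \<eta> \<rho> \<tau> U) (A \<times> UNIV) \<le> emeasure \<gamma> A" .
next
  note R = dominated_marginalsD[OF \<rho>] and T = dominated_marginalsD[OF \<tau>]
  have c1: "emeasure \<eta> U / emeasure \<eta> U = 1" using fin by (intro ennreal_divide_self) auto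
  fix B :: "'k set" assume B: "B \<in> sets borel"
  have "emeasure (thick_composition \<eta> \<rho> \<tau> U) (UNIV \<times> B) =
     (\<integral>\<^sup>+y. \<integral>\<^sup>+x. indicator UNIV (fst x) * indicator B (snd y) * indicator U (fst y + - snd x) / emeasure \<eta> U \<partial>\<rho> \<partial>\<tau>)"
    by (rule emeasure_thick_rect(2)[OF U(1) _ B]) simp
  also have "\<dots> \<le> (\<integral>\<^sup>+y. indicator (UNIV \<times> B) y \<partial>\<tau>)"
  proof (rule nn_integral_mono)
    fix y :: "'h \<times> 'k"
    let ?E = "(\<lambda>h. h + - fst y) -` U"
    have mE: "?E \<in> sets borel" using U(1) by (intro borel_translate) simp
    have sym: "fst y + - h \<in> U \<longleftrightarrow> h + - fst y \<in> U" for h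
    proof -
      have "fst y + - h \<in> U \<longleftrightarrow> - (fst y + - h) \<in> U" using U(2) by auto
      then show ?thesis by (simp add: minus_add)
    qed
    have "(\<integral>\<^sup>+x. indicator UNIV (fst x) * indicator B (snd y) * indicator U (fst y + - snd x) / emeasure \<eta> U \<partial>\<rho>)
       = (\<integral>\<^sup>+x. (indicator B (snd y) / emeasure \<eta> U) * indicator (UNIV \<times> ?E) x \<partial>\<rho>)"
      using sym by (intro nn_integral_cong) (auto simp: indicator_def)
    also have "\<dots> = (indicator B (snd y) / emeasure \<eta> U) * emeasure \<rho> (UNIV \<times> ?E)"
      using mE R(1) by (simp add: nn_integral_cmult_indicator borel_Times)
    also have "\<dots> \<le> (indicator B (snd y) / emeasure \<eta> U) * emeasure \<eta> ?E"
      by (intro mult_left_mono R(4) mE) simp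
    also have "emeasure \<eta> ?E = emeasure \<eta> U" using U(1) by (intro right_invariantD[OF rinv]) simp
    also have "(indicator B (snd y) / emeasure \<eta> U) * emeasure \<eta> U = indicator B (snd y) * (emeasure \<eta> U / emeasure \<eta> U)"
      by (simp add: ennreal_times_divide mult.commute)
    also have "\<dots> = indicator (UNIV \<times> B) y" unfolding c1 by (auto simp: indicator_def mem_Times_iff)
    finally show "(\<integral>\<^sup>+x. indicator UNIV (fst x) * indicator B (snd y) * indicator U (fst y + - snd x) / emeasure \<eta> U \<partial>\<rho>) \<le> indicator (UNIV \<times> B) y" .
  qed
  also have "\<dots> = emeasure \<tau> (UNIV \<times> B)" using B T(1) by (simp add: borel_Times)
  also have "\<dots> \<le> emeasure \<kappa> B" using B by (rule T(4))
  finally show "emeasure (thick_composition \<eta> \<rho> \<tau> U) (UNIV \<times> B) \<le> emeasure \<kappa> B" .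
qed

text \<open>The middle coordinate of the second factor is written as \<open>w + h\<close>, with
  \<open>h\<close> that of the first; then \<open>w\<close> ranges over \<open>U\<close>, and right
  invariance removes the shift by \<open>h\<close>. So the thickened mass is an average over
  \<open>U\<close> of the correlation of \<open>v\<close> with the translates of
  \<open>u\<close>.\<close>

lemma thick_slices:
  assumes U: "open U" and A: "A \<in> sets borel" and B: "B \<in> sets borel"
    and v: "slice_density \<eta> \<rho> A v" and u: "slice_density \<eta> (converse_measure \<tau>) B u"
  shows "emeasure (thick_composition \<eta> \<rho> \<tau> U) (A \<times> B) =
    (\<integral>\<^sup>+w. indicator U w * (\<integral>\<^sup>+h. ennreal (v h) * ennreal (u (w + h)) \<partial>\<eta>) \<partial>\<eta>) / emeasure \<eta> U"
proof -
  note s = dominated_marginalsD(1)[OF \<rho>] dominated_marginalsD(1)[OF \<tau>] haar_onD(2)[OF \<eta>]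
  interpret H: sigma_finite_measure \<eta> by (rule sigma_finite_factors)
  interpret HH: pair_sigma_finite \<eta> \<eta> ..
  have vb[measurable]: "v \<in> borel_measurable borel" and ub[measurable]: "u \<in> borel_measurable borel"
    using u v by (auto simp: slice_density_def)
  have sHH: "sets (\<eta> \<Otimes>\<^sub>M \<eta>) = sets borel"
    using sets_pair_measure_cong[OF s(3) s(3)] unfolding borel_prod .
  have mU: "(indicator U :: 'h \<Rightarrow> ennreal) \<in> borel_measurable borel" using U by simp
  let ?\<Phi> = "\<lambda>h. \<integral>\<^sup>+w. ennreal (u (w + h)) * indicator U w \<partial>\<eta>"
  have inner: "(\<integral>\<^sup>+y. indicator B (snd y) * indicator U (fst y + - h) \<partial>\<tau>) = ?\<Phi> h" for h
  proof -
    have ch: "(\<lambda>h'. h' + - h) \<in> borel_measurable borel"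
      by (intro borel_measurable_continuous_onI continuous_intros)
    have m: "(\<lambda>h'. indicator U (h' + - h) :: ennreal) \<in> borel_measurable borel"
      by (rule measurable_compose[OF ch mU])
    have cs: "continuous_on UNIV (fst :: 'k \<times> 'h \<Rightarrow> 'k)" "continuous_on UNIV (snd :: 'k \<times> 'h \<Rightarrow> 'h)"
      by (intro continuous_intros)+
    have m2: "(\<lambda>z :: 'k \<times> 'h. indicator B (fst z) * indicator U (snd z + - h) :: ennreal) \<in> borel_measurable borel"
      by (intro borel_measurable_times_ennreal measurable_compose[OF borel_measurable_continuous_onI[OF cs(1)] borel_measurable_indicator[OF B]]
        measurable_compose[OF borel_measurable_continuous_onI[OF cs(2)] m])
    have "(\<integral>\<^sup>+y. indicator B (snd y) * indicator U (fst y + - h) \<partial>\<tau>) = (\<integral>\<^sup>+z. indicator B (fst z) * indicator U (snd z + - h) \<partial>converse_measure \<tau>)"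
      using m2 by (simp add: nn_integral_distr[OF swap_measurable[OF s(2)]])
    also have "\<dots> = (\<integral>\<^sup>+h'. ennreal (u h') * indicator U (h' + - h) \<partial>\<eta>)"
      by (rule slice_density_nn_integral[OF u _ s(3) B m]) simp
    also have "\<dots> = (\<integral>\<^sup>+w. ennreal (u (w + h)) * indicator U (w + h + - h) \<partial>\<eta>)"
      by (rule haar_nn_integral_right[OF s(3) rinv, symmetric])
        (intro borel_measurable_times_ennreal measurable_compose[OF ub measurable_ennreal] m)
    finally show ?thesis by (simp add: add.assoc)
  qed
  have c: "continuous_on UNIV (\<lambda>z::'h \<times> 'h. fst z + snd z)" "continuous_on UNIV (\<lambda>z::'h \<times> 'h. snd z + fst z)"
    "continuous_on UNIV (fst :: 'h \<times> 'h \<Rightarrow> 'h)" "continuous_on UNIV (snd :: 'h \<times> 'h \<Rightarrow> 'h)"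
    by (intro continuous_intros)+
  note ci = c[THEN borel_measurable_continuous_onI]
  have m1: "(\<lambda>z::'h \<times> 'h. ennreal (v (fst z)) * ennreal (u (snd z + fst z)) * indicator U (snd z)) \<in> borel_measurable (\<eta> \<Otimes>\<^sub>M \<eta>)"
    unfolding measurable_cong_sets[OF sHH refl]
    using measurable_compose[OF ci(3) vb] measurable_compose[OF ci(2) ub] measurable_compose[OF ci(4) mU] by measurable
  have m2: "(\<lambda>z::'h \<times> 'h. ennreal (u (snd z + fst z)) * indicator U (snd z)) \<in> borel_measurable (\<eta> \<Otimes>\<^sub>M \<eta>)"
    unfolding measurable_cong_sets[OF sHH refl]
    using measurable_compose[OF ci(2) ub] measurable_compose[OF ci(4) mU] by measurable
  have "?\<Phi> \<in> borel_measurable \<eta>"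
    using H.borel_measurable_nn_integral_fst[OF m2] by simp
  then have \<Phi>: "?\<Phi> \<in> borel_measurable borel" unfolding measurable_cong_sets[OF s(3) refl] .
  have swap: "(\<integral>\<^sup>+h. \<integral>\<^sup>+w. ennreal (v h) * ennreal (u (w + h)) * indicator U w \<partial>\<eta> \<partial>\<eta>)
    = (\<integral>\<^sup>+w. \<integral>\<^sup>+h. ennreal (v h) * ennreal (u (w + h)) * indicator U w \<partial>\<eta> \<partial>\<eta>)"
    using HH.Fubini'[of "\<lambda>h w. ennreal (v h) * ennreal (u (w + h)) * indicator U w"] m1 by (simp add: case_prod_beta')
  have m\<tau>: "(\<lambda>y. indicator B (snd y) * indicator U (fst y + - h) :: ennreal) \<in> borel_measurable \<tau>" for h
  proof -
    have cs: "continuous_on UNIV (\<lambda>y::'h \<times> 'k. fst y + - h)" "continuous_on UNIV (snd :: 'h \<times> 'k \<Rightarrow> 'k)"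
      by (intro continuous_intros)+
    show ?thesis unfolding measurable_cong_sets[OF s(2) refl]
      by (intro borel_measurable_times_ennreal measurable_compose[OF borel_measurable_continuous_onI[OF cs(2)] borel_measurable_indicator[OF B]]
        measurable_compose[OF borel_measurable_continuous_onI[OF cs(1)] mU])
  qed
  have mu_h: "(\<lambda>w. ennreal (u (w + h)) * indicator U w) \<in> borel_measurable \<eta>" for h
  proof -
    have "(\<lambda>w. w + h) \<in> borel_measurable borel" by (intro borel_measurable_continuous_onI continuous_intros)
    from measurable_compose[OF this ub] show ?thesis
      unfolding measurable_cong_sets[OF s(3) refl] using mU by measurable
  qed
  have mv_w: "(\<lambda>h. ennreal (v h) * ennreal (u (w + h))) \<in> borel_measurable \<eta>" for w
  proof -
    have "(\<lambda>h. w + h) \<in> borel_measurable borel" by (intro borel_measurable_continuous_onI continuous_intros)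
    from measurable_compose[OF this ub] show ?thesis
      unfolding measurable_cong_sets[OF s(3) refl] by measurable
  qed
  have "emeasure (thick_composition \<eta> \<rho> \<tau> U) (A \<times> B)
      = (\<integral>\<^sup>+x. (\<integral>\<^sup>+y. (indicator A (fst x) / emeasure \<eta> U) * (indicator B (snd y) * indicator U (fst y + - snd x)) \<partial>\<tau>) \<partial>\<rho>)"
    unfolding emeasure_thick_rect(1)[OF U A B]
    by (intro nn_integral_cong) (auto simp: indicator_def)
  also have "\<dots> = (\<integral>\<^sup>+x. indicator A (fst x) * (?\<Phi> (snd x) / emeasure \<eta> U) \<partial>\<rho>)"
    unfolding nn_integral_cmult[OF m\<tau>] inner by (simp only: ennreal_divide_times)
  also have "\<dots> = (\<integral>\<^sup>+h. ennreal (v h) * (?\<Phi> h / emeasure \<eta> U) \<partial>\<eta>)"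
    by (rule slice_density_nn_integral[OF v s(1,3) A]) (use \<Phi> in measurable)
  also have "\<dots> = (\<integral>\<^sup>+h. (\<integral>\<^sup>+w. ennreal (v h) * ennreal (u (w + h)) * indicator U w \<partial>\<eta>) / emeasure \<eta> U \<partial>\<eta>)"
    by (intro nn_integral_cong) (simp add: ennreal_times_divide nn_integral_cmult[OF mu_h] mult.assoc)
  also have "\<dots> = (\<integral>\<^sup>+h. \<integral>\<^sup>+w. ennreal (v h) * ennreal (u (w + h)) * indicator U w \<partial>\<eta> \<partial>\<eta>) / emeasure \<eta> U"
    using H.borel_measurable_nn_integral_fst[OF m1] by (simp add: nn_integral_divide)
  also have "\<dots> = (\<integral>\<^sup>+w. indicator U w * (\<integral>\<^sup>+h. ennreal (v h) * ennreal (u (w + h)) \<partial>\<eta>) \<partial>\<eta>) / emeasure \<eta> U"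
    unfolding swap nn_integral_multc[OF mv_w] by (simp only: mult.commute)
  finally show ?thesis .
qed

end

section \<open>Existence and first properties of the composed measure\<close>

lemma nn_integral_average_between:
  fixes q :: "'a \<Rightarrow> real"
  assumes U: "U \<in> sets \<eta>" "emeasure \<eta> U < \<infinity>" "emeasure \<eta> U \<noteq> 0"
    and q: "\<And>w. w \<in> U \<Longrightarrow> \<bar>q w - I\<bar> \<le> e" "0 \<le> I" "0 \<le> e"
  shows "\<bar>enn2real ((\<integral>\<^sup>+w. indicator U w * ennreal (q w) \<partial>\<eta>) / emeasure \<eta> U) - I\<bar> \<le> e"
proof -
  let ?J = "(\<integral>\<^sup>+w. indicator U w * ennreal (q w) \<partial>\<eta>) / emeasure \<eta> U"
  have c: "ennreal c * emeasure \<eta> U / emeasure \<eta> U = ennreal c" for c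
    using U(2,3) by (simp add: ennreal_mult_divide_eq)
  have "?J \<le> (\<integral>\<^sup>+w. ennreal (I + e) * indicator U w \<partial>\<eta>) / emeasure \<eta> U"
  proof (intro divide_right_mono_ennreal nn_integral_mono)
    show "indicator U w * ennreal (q w) \<le> ennreal (I + e) * indicator U w" for w
      using q(1)[of w] by (cases "w \<in> U") (auto intro!: ennreal_leI)
  qed
  also have "\<dots> = ennreal (I + e)" using U(1) c by (simp add: nn_integral_cmult_indicator)
  finally have up: "?J \<le> ennreal (I + e)" .
  have "ennreal (I - e) = (\<integral>\<^sup>+w. ennreal (I - e) * indicator U w \<partial>\<eta>) / emeasure \<eta> U"
    using U(1) c by (simp add: nn_integral_cmult_indicator)
  also have "\<dots> \<le> ?J"
  proof (intro divide_right_mono_ennreal nn_integral_mono)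
    show "ennreal (I - e) * indicator U w \<le> indicator U w * ennreal (q w)" for w
      using q(1)[of w] by (cases "w \<in> U") (auto intro!: ennreal_leI)
  qed
  finally have low: "ennreal (I - e) \<le> ?J" .
  have "?J < \<infinity>" using up by (auto intro: le_less_trans)
  then obtain r where r: "?J = ennreal r" "0 \<le> r" by (metis ennreal_cases infinity_ennreal_def less_irrefl)
  have "r \<le> I + e" using up q(2,3) unfolding r(1) by (simp add: ennreal_le_iff del: ennreal_plus)
  \<comment> \<open>A negative \<open>I - e\<close> is truncated to 0 by \<open>ennreal\<close>; the
    bound then holds because \<open>r\<close> is nonnegative.\<close>
  moreover have "I - e \<le> r" using low r(2) unfolding r(1) by (simp add: ennreal_le_iff)
  ultimately show ?thesis unfolding r(1) using r(2) by (simp add: abs_le_iff)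
qed

context
  fixes \<gamma> :: "'g::{topological_group_add,t2_space,second_countable_topology} measure"
    and \<eta> :: "'h::{topological_group_add,t2_space,second_countable_topology} measure"
    and \<kappa> :: "'k::{topological_group_add,t2_space,second_countable_topology} measure"
    and \<rho> :: "('g \<times> 'h) measure" and \<tau> :: "('h \<times> 'k) measure"
  assumes lcG: "locally compact (UNIV :: 'g set)" and lcH: "locally compact (UNIV :: 'h set)" and lcK: "locally compact (UNIV :: 'k set)"
    and \<gamma>: "haar_on UNIV \<gamma>" and \<eta>: "haar_on UNIV \<eta>" and \<kappa>: "haar_on UNIV \<kappa>"
    and rinv: "right_invariant \<eta>"
    and \<rho>: "dominated_marginals \<gamma> \<eta> \<rho>" and \<tau>: "dominated_marginals \<eta> \<kappa> \<tau>"
begin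

text \<open>For neighbourhoods \<open>U i\<close> shrinking to 0 the averages in
  \<open>thick_slices\<close> converge to the value of the correlation at 0, where it is continuous.
  A cluster point of the thickened measures, which exists by domination, therefore satisfies the
  defining formula for all rectangles at once.\<close>

theorem composed_exists: "\<exists>\<sigma>. composed \<gamma> \<eta> \<kappa> \<rho> \<tau> \<sigma>"
proof -
  note G = haar_onD[OF \<gamma>] and H = haar_onD[OF \<eta>] and K = haar_onD[OF \<kappa>]
  obtain V C where VC: "open V" "compact C" "0 \<in> V" "V \<subseteq> C" "C \<subseteq> (UNIV :: 'h set)"
    by (rule lc_nbhd[OF lcH open_UNIV UNIV_I])
  obtain N :: "nat \<Rightarrow> 'h set" where N: "\<And>i. open (N i)" "\<And>i. 0 \<in> N i"
    "\<And>S. open S \<Longrightarrow> 0 \<in> S \<Longrightarrow> eventually (\<lambda>i. N i \<subseteq> S) sequentially"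
    using countable_basis_at_decseq[of "0::'h"] by metis
  \<comment> \<open>Cut down by \<open>V\<close> for finite mass and made symmetric, as
    \<open>thick_dominated\<close> demands.\<close>
  define U where "U i = (N i \<inter> V) \<inter> uminus -` (N i \<inter> V)" for i
  have U: "open (U i)" "uminus -` U i = U i" "0 \<in> U i" "U i \<subseteq> N i" for i
    using N(1,2) VC(1,3) by (auto simp: U_def intro!: open_Int open_translate)
  have "U i \<subseteq> C" for i using VC(4) by (auto simp: U_def)
  then have Uf: "emeasure \<eta> (U i) < \<infinity>" for i
    using compact_finite_subset_compact[OF H(1) VC(2)] by blast
  have "emeasure \<eta> (U i) > 0" for i
    by (rule haar_open_pos[OF lcH add_subgroup_UNIV _ \<eta> U(1,3)]) auto
  then have U0: "emeasure \<eta> (U i) \<noteq> 0" for i by (metis less_irrefl)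
  let ?M = "\<lambda>i. thick_composition \<eta> \<rho> \<tau> (U i)"
  have dM: "dominated_marginals \<gamma> \<kappa> (?M i)" for i
    by (rule thick_dominated[OF lcG lcH lcK \<gamma> \<eta> \<kappa> rinv \<rho> \<tau> U(1,2) Uf U0])
  obtain F \<sigma> where F: "F \<noteq> bot" "F \<le> sequentially" and \<sigma>: "dominated_marginals \<gamma> \<kappa> \<sigma>"
    and conv: "\<And>A B. A \<in> sets borel \<Longrightarrow> B \<in> sets borel \<Longrightarrow> emeasure \<gamma> A < \<infinity> \<Longrightarrow> emeasure \<kappa> B < \<infinity> \<Longrightarrow>
       ((\<lambda>j. measure (?M j) (A \<times> B)) \<longlongrightarrow> measure \<sigma> (A \<times> B)) F"
    by (rule dominated_marginals_cluster[where M = ?M, OF lcG lcK G(1) K(1) dM]) blast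
  have "composed \<gamma> \<eta> \<kappa> \<rho> \<tau> \<sigma>"
    unfolding composed_def
  proof (rule conjI[OF \<sigma>], intro allI impI, elim conjE)
    fix A B v u assume A: "A \<in> sets borel" "emeasure \<gamma> A < \<infinity>" and B: "B \<in> sets borel" "emeasure \<kappa> B < \<infinity>"
      and v: "slice_density \<eta> \<rho> A v" and u: "slice_density \<eta> (converse_measure \<tau>) B u"
    have iu: "integrable \<eta> u"
      by (rule slice_density_integrable[OF u H(1) dominated_marginals_converse[OF \<tau>] B])
    have vb: "v \<in> borel_measurable \<eta>" "\<And>h. 0 \<le> v h" "\<And>h. v h \<le> 1"
      using v unfolding measurable_cong_sets[OF H(2) refl] slice_density_def by auto
    have u0: "\<And>h. 0 \<le> u h" using u by (auto simp: slice_density_def)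
    have iuw: "integrable \<eta> (\<lambda>h. u (w + h))" for w by (rule haar_integral_left(1)[OF \<eta> iu])
    have ivu: "integrable \<eta> (\<lambda>h. v h * u (w + h))" for w
      by (rule Bochner_Integration.integrable_bound[OF iuw[of w]])
        (use vb borel_measurable_integrable[OF iuw[of w]] u0 in \<open>auto simp: abs_mult intro!: mult_left_le_one_le\<close>)
    define q where "q w = (\<integral>h. v h * u (w + h) \<partial>\<eta>)" for w
    have q: "(\<integral>\<^sup>+h. ennreal (v h) * ennreal (u (w + h)) \<partial>\<eta>) = ennreal (q w)" for w
    proof -
      have "(\<integral>\<^sup>+h. ennreal (v h) * ennreal (u (w + h)) \<partial>\<eta>) = (\<integral>\<^sup>+h. ennreal (v h * u (w + h)) \<partial>\<eta>)"
        using vb u0 by (intro nn_integral_cong) (simp add: ennreal_mult)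
      also have "\<dots> = ennreal (q w)"
        unfolding q_def using vb u0 by (intro nn_integral_eq_integral ivu) auto
      finally show ?thesis .
    qed
    have q0: "0 \<le> q w" for w unfolding q_def using vb u0 by (intro integral_nonneg_AE) auto
    \<comment> \<open>Since \<open>v\<close> lies between 0 and 1, the correlation varies no more
      than the translates of \<open>u\<close> do in the mean.\<close>
    have qc: "\<bar>q w - q 0\<bar> \<le> (\<integral>h. \<bar>u (w + h) - u h\<bar> \<partial>\<eta>)" for w
    proof -
      have "q w - q 0 = (\<integral>h. v h * (u (w + h) - u h) \<partial>\<eta>)"
        unfolding q_def using ivu[of w] ivu[of 0]
        by (subst Bochner_Integration.integral_diff[symmetric]) (auto simp: right_diff_distrib)
      also have "\<bar>\<dots>\<bar> \<le> (\<integral>h. \<bar>v h * (u (w + h) - u h)\<bar> \<partial>\<eta>)" by (rule integral_abs_bound)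
      also have "\<dots> \<le> (\<integral>h. \<bar>u (w + h) - u h\<bar> \<partial>\<eta>)"
      proof (rule integral_mono)
        show "integrable \<eta> (\<lambda>h. \<bar>v h * (u (w + h) - u h)\<bar>)"
          using ivu[of w] ivu[of 0] by (intro integrable_abs) (auto simp: right_diff_distrib)
        show "integrable \<eta> (\<lambda>h. \<bar>u (w + h) - u h\<bar>)" using iuw iu by auto
        show "\<bar>v h * (u (w + h) - u h)\<bar> \<le> \<bar>u (w + h) - u h\<bar>" for h
          using vb(2,3)[of h] by (simp add: abs_mult mult_left_le_one_le)
      qed
      finally show ?thesis .
    qed
    have "(\<lambda>i. measure (?M i) (A \<times> B)) \<longlonglongrightarrow> q 0"
    proof (rule tendstoI)
      fix e :: real assume e: "e > 0"
      then have e2: "e / 2 > 0" by simp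
      obtain W where W: "open W" "0 \<in> W" "\<And>w. w \<in> W \<Longrightarrow> (\<integral>h. \<bar>u (w + h) - u h\<bar> \<partial>\<eta>) < e / 2"
        using haar_L1_translation_continuous[OF lcH \<eta> iu e2] by blast
      show "eventually (\<lambda>i. dist (measure (?M i) (A \<times> B)) (q 0) < e) sequentially"
        using N(3)[OF W(1,2)]
      proof (rule eventually_mono)
        fix i assume i: "N i \<subseteq> W"
        have "measure (?M i) (A \<times> B) = enn2real ((\<integral>\<^sup>+w. indicator (U i) w * ennreal (q w) \<partial>\<eta>) / emeasure \<eta> (U i))"
          using thick_slices[OF lcG lcH lcK \<gamma> \<eta> \<kappa> rinv \<rho> \<tau> U(1)[of i] A(1) B(1) v u]
          unfolding measure_def q by simp
        moreover have "\<bar>enn2real ((\<integral>\<^sup>+w. indicator (U i) w * ennreal (q w) \<partial>\<eta>) / emeasure \<eta> (U i)) - q 0\<bar> \<le> e / 2"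
        proof (rule nn_integral_average_between)
          show "\<bar>q w - q 0\<bar> \<le> e / 2" if "w \<in> U i" for w
            using qc[of w] W(3)[of w] i U(4)[of i] that by force
        qed (use U Uf U0 H(2) q0 e in auto)
        ultimately show "dist (measure (?M i) (A \<times> B)) (q 0) < e" using e by (simp add: dist_real_def)
      qed
    qed
    then have "((\<lambda>i. measure (?M i) (A \<times> B)) \<longlongrightarrow> q 0) F" using F(2) by (rule filterlim_mono[OF _ order_refl])
    then have "measure \<sigma> (A \<times> B) = q 0" using tendsto_unique[OF F(1) conv[OF A(1) B(1) A(2) B(2)]] by blast
    moreover have "emeasure \<sigma> (A \<times> B) < \<infinity>"
      using dominated_marginals_rect(1)[OF \<sigma> A(1) B(1)] A(2) by (rule le_less_trans)
    ultimately have "emeasure \<sigma> (A \<times> B) = ennreal (q 0)" by (simp add: emeasure_eq_ennreal_measure less_top)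
    then show "emeasure \<sigma> (A \<times> B) = (\<integral>\<^sup>+h. ennreal (v h) * ennreal (u h) \<partial>\<eta>)" using q[of 0] by simp
  qed
  then show ?thesis by blast
qed

context
  fixes \<sigma> assumes \<sigma>: "composed \<gamma> \<eta> \<kappa> \<rho> \<tau> \<sigma>"
begin

lemma composed_dominated: "dominated_marginals \<gamma> \<kappa> \<sigma>"
  using \<sigma> by (simp add: composed_def)

lemma composed_rect:
  assumes "A \<in> sets borel" "B \<in> sets borel" "emeasure \<gamma> A < \<infinity>" "emeasure \<kappa> B < \<infinity>"
    "slice_density \<eta> \<rho> A v" "slice_density \<eta> (converse_measure \<tau>) B u"
  shows "emeasure \<sigma> (A \<times> B) = (\<integral>\<^sup>+h. ennreal (v h) * ennreal (u h) \<partial>\<eta>)"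
  using \<sigma> assms by (simp add: composed_def)

lemma slices_exist:
  "A \<in> sets borel \<Longrightarrow> emeasure \<gamma> A < \<infinity> \<Longrightarrow> \<exists>v. slice_density \<eta> \<rho> A v"
  "B \<in> sets borel \<Longrightarrow> emeasure \<kappa> B < \<infinity> \<Longrightarrow> \<exists>u. slice_density \<eta> (converse_measure \<tau>) B u"
  using slice_density_exists[OF lcH haar_onD(1)[OF \<eta>] \<rho>] slice_density_exists[OF lcH haar_onD(1)[OF \<eta>] dominated_marginals_converse[OF \<tau>]]
  by blast+

lemma composed_rect_left:
  assumes A: "A \<in> sets borel" "emeasure \<gamma> A < \<infinity>" and B: "B \<in> sets borel" "emeasure \<kappa> B < \<infinity>"
    and u: "slice_density \<eta> (converse_measure \<tau>) B u"
  shows "emeasure \<sigma> (A \<times> B) = (\<integral>\<^sup>+z. indicator A (fst z) * ennreal (u (snd z)) \<partial>\<rho>)"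
proof -
  obtain v where v: "slice_density \<eta> \<rho> A v" using slices_exist(1)[OF A] by blast
  have "u \<in> borel_measurable borel" using u by (simp add: slice_density_def)
  then have "(\<lambda>h. ennreal (u h)) \<in> borel_measurable borel" by simp
  from slice_density_nn_integral[OF v dominated_marginalsD(1)[OF \<rho>] haar_onD(2)[OF \<eta>] A(1) this]
  show ?thesis using composed_rect[OF A(1) B(1) A(2) B(2) v u] by simp
qed

lemma composed_rect_right:
  assumes A: "A \<in> sets borel" "emeasure \<gamma> A < \<infinity>" and B: "B \<in> sets borel" "emeasure \<kappa> B < \<infinity>"
    and v: "slice_density \<eta> \<rho> A v"
  shows "emeasure \<sigma> (A \<times> B) = (\<integral>\<^sup>+z. ennreal (v (fst z)) * indicator B (snd z) \<partial>\<tau>)"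
proof -
  note s = dominated_marginalsD(1)[OF \<tau>] haar_onD(2)[OF \<eta>]
  obtain u where u: "slice_density \<eta> (converse_measure \<tau>) B u" using slices_exist(2)[OF B] by blast
  have vb: "v \<in> borel_measurable borel" using v by (simp add: slice_density_def)
  then have m: "(\<lambda>h. ennreal (v h)) \<in> borel_measurable borel" by simp
  have cs: "continuous_on UNIV (fst :: 'k \<times> 'h \<Rightarrow> 'k)" "continuous_on UNIV (snd :: 'k \<times> 'h \<Rightarrow> 'h)"
    by (intro continuous_intros)+
  have m2: "(\<lambda>z :: 'k \<times> 'h. indicator B (fst z) * ennreal (v (snd z))) \<in> borel_measurable borel"
    by (intro borel_measurable_times_ennreal measurable_compose[OF borel_measurable_continuous_onI[OF cs(1)] borel_measurable_indicator[OF B(1)]]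
      measurable_compose[OF borel_measurable_continuous_onI[OF cs(2)] m])
  have "emeasure \<sigma> (A \<times> B) = (\<integral>\<^sup>+h. ennreal (u h) * ennreal (v h) \<partial>\<eta>)"
    using composed_rect[OF A(1) B(1) A(2) B(2) v u] by (simp add: mult.commute)
  also have "\<dots> = (\<integral>\<^sup>+z. indicator B (fst z) * ennreal (v (snd z)) \<partial>converse_measure \<tau>)"
    by (rule slice_density_nn_integral[OF u _ s(2) B(1) m, symmetric]) simp
  also have "\<dots> = (\<integral>\<^sup>+z. indicator B (snd z) * ennreal (v (fst z)) \<partial>\<tau>)"
    using m2 by (simp add: nn_integral_distr[OF swap_measurable[OF s(1)]])
  finally show ?thesis by (simp add: mult.commute)
qed

end

end

section \<open>The product of polyhomomorphisms\<close>

text \<open>Translation by \<open>(a, b)\<close> in \<open>R\<close> preserves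
  \<open>\<rho>\<close>, so moving the slice by \<open>a\<close> moves its density by
  \<open>b\<close>.\<close>

lemma slice_density_translate:
  fixes \<eta> :: "'h::{topological_group_add,t2_space,second_countable_topology} measure"
    and \<rho> :: "('g::{topological_group_add,t2_space,second_countable_topology} \<times> 'h) measure"
  assumes lcH: "locally compact (UNIV :: 'h set)" and \<eta>: "haar_on UNIV \<eta>" and \<rho>: "haar_on R \<rho>" and ab: "(a, b) \<in> R"
    and A: "A \<in> sets borel" and v: "slice_density \<eta> \<rho> A v"
  shows "slice_density \<eta> \<rho> ((\<lambda>y. a + y) -` A) (\<lambda>h. v (b + h))"
proof -
  have vb: "v \<in> borel_measurable borel" using v by (simp add: slice_density_def)
  have cb: "(\<lambda>h. x + h) \<in> borel_measurable borel" for x :: 'h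
    by (intro borel_measurable_continuous_onI continuous_intros)
  have "emeasure \<rho> ((\<lambda>y. a + y) -` A \<times> E) = (\<integral>\<^sup>+h. ennreal (v (b + h)) * indicator E h \<partial>\<eta>)" if E: "E \<in> sets borel" for E
  proof -
    let ?E = "(\<lambda>h. - b + h) -` E"
    have mE: "?E \<in> sets borel" by (rule borel_translate(1)[OF E])
    have eq: "(\<lambda>y. a + y) -` A \<times> E = (\<lambda>z. (a, b) + z) -` (A \<times> ?E)"
      by (auto simp: add.assoc[symmetric])
    have "emeasure \<rho> ((\<lambda>y. a + y) -` A \<times> E) = emeasure \<rho> (A \<times> ?E)"
      unfolding eq by (rule haar_onD(6)[OF \<rho> ab]) (use A mE in \<open>simp add: borel_Times\<close>)
    also have "\<dots> = (\<integral>\<^sup>+h. ennreal (v h) * indicator ?E h \<partial>\<eta>)" using v mE by (simp add: slice_density_def)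
    also have "\<dots> = (\<integral>\<^sup>+h. ennreal (v (b + h)) * indicator ?E (b + h) \<partial>\<eta>)"
      by (rule haar_nn_integral_left[OF lcH add_subgroup_UNIV _ \<eta>, symmetric])
        (use mE in \<open>auto intro!: borel_measurable_times_ennreal measurable_compose[OF vb measurable_ennreal] borel_measurable_indicator\<close>)
    also have "\<dots> = (\<integral>\<^sup>+h. ennreal (v (b + h)) * indicator E h \<partial>\<eta>)"
      by (intro nn_integral_cong) (simp add: indicator_def add.assoc[symmetric])
    finally show ?thesis .
  qed
  moreover have "(\<lambda>h. v (b + h)) \<in> borel_measurable borel" by (rule measurable_compose[OF cb vb])
  ultimately show ?thesis using v by (simp add: slice_density_def)
qed

text \<open>Cosets of \<open>N \<inter> D\<close> in \<open>N\<close> correspond to the translates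
  of the open set \<open>D\<close> by elements of \<open>N\<close>; distinct ones are disjoint, and
  compactness of \<open>N\<close> leaves finitely many. The \<open>SOME\<close> terms fix one
  representative per coset, and the conclusions are the facts on representatives that the counting
  in \<open>index_marginal\<close> needs.\<close>

lemma subgroup_index_finite:
  fixes N D :: "'h::{topological_group_add,t2_space} set"
  assumes N: "add_subgroup N" "compact N" and D: "add_subgroup D" "open D"
  defines "C \<equiv> (\<lambda>x. (\<lambda>y. x + y) ` (N \<inter> D)) ` N"
  shows "finite C" "C \<noteq> {}" "disjoint_family_on (\<lambda>c. (\<lambda>h. - (SOME x. x \<in> N \<and> c = (\<lambda>y. x + y) ` (N \<inter> D)) + h) -` D) C"
    "x' \<in> N \<Longrightarrow> \<exists>c\<in>C. - (SOME x. x \<in> N \<and> c = (\<lambda>y. x + y) ` (N \<inter> D)) + x' \<in> N \<inter> D"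
    "c \<in> C \<Longrightarrow> (SOME x. x \<in> N \<and> c = (\<lambda>y. x + y) ` (N \<inter> D)) \<in> N"
proof -
  note n = add_subgroupD[OF N(1)] and d = add_subgroupD[OF D(1)]
  define r where "r c = (SOME x. x \<in> N \<and> c = (\<lambda>y. x + y) ` (N \<inter> D))" for c
  have r: "r c \<in> N" "c = (\<lambda>y. r c + y) ` (N \<inter> D)" if "c \<in> C" for c
  proof -
    have "\<exists>x. x \<in> N \<and> c = (\<lambda>y. x + y) ` (N \<inter> D)" using that by (auto simp: C_def)
    from someI_ex[OF this] show "r c \<in> N" "c = (\<lambda>y. r c + y) ` (N \<inter> D)" unfolding r_def by auto
  qed
  have same: "(\<lambda>y. x + y) ` (N \<inter> D) = (\<lambda>y. x' + y) ` (N \<inter> D)" if "x \<in> N" "x' \<in> N" "- x + x' \<in> D" for x x'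
  proof -
    have sub: "(\<lambda>y. p + y) ` (N \<inter> D) \<subseteq> (\<lambda>y. q + y) ` (N \<inter> D)" if "p \<in> N" "q \<in> N" "- q + p \<in> D" for p q
    proof
      fix z assume "z \<in> (\<lambda>y. p + y) ` (N \<inter> D)"
      then obtain y where y: "y \<in> N" "y \<in> D" "z = p + y" by auto
      have "- q + p + y \<in> N \<inter> D" using y that n(2,4) d(2) by blast
      moreover have "z = q + (- q + p + y)" unfolding y(3) by (simp add: add.assoc[symmetric])
      ultimately show "z \<in> (\<lambda>y. q + y) ` (N \<inter> D)" by blast
    qed
    have "- (- x + x') \<in> D" using that(3) d(3) by blast
    then have "- x' + x \<in> D" by (simp add: minus_add)
    then show ?thesis using sub[of x x'] sub[of x' x] that by blast
  qed
  have "\<exists>X\<subseteq>N. finite X \<and> N \<subseteq> (\<Union>x\<in>X. (\<lambda>h. - x + h) -` D)"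
  proof -
    have "N \<subseteq> (\<Union>x\<in>N. (\<lambda>h. - x + h) -` D)" using d(1) by auto
    moreover have "open ((\<lambda>h. - x + h) -` D)" for x by (intro open_vimage D(2) continuous_intros)
    ultimately show ?thesis using compactE_image[OF N(2), of N "\<lambda>x. (\<lambda>h. - x + h) -` D"] by metis
  qed
  then obtain X where X: "X \<subseteq> N" "finite X" "N \<subseteq> (\<Union>x\<in>X. (\<lambda>h. - x + h) -` D)" by blast
  have "C \<subseteq> (\<lambda>x. (\<lambda>y. x + y) ` (N \<inter> D)) ` X"
  proof
    fix c assume "c \<in> C"
    then obtain x where x: "x \<in> N" "c = (\<lambda>y. x + y) ` (N \<inter> D)" by (auto simp: C_def)
    then obtain p where p: "p \<in> X" "- p + x \<in> D" using X(3) by blast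
    then show "c \<in> (\<lambda>x. (\<lambda>y. x + y) ` (N \<inter> D)) ` X" using same[of p x] x X(1) by blast
  qed
  then show "finite C" using X(2) by (meson finite_imageI finite_subset)
  show "C \<noteq> {}" using n(1) by (auto simp: C_def)
  have "disjoint_family_on (\<lambda>c. (\<lambda>h. - r c + h) -` D) C"
    unfolding disjoint_family_on_def
  proof (intro ballI impI)
    fix c c' assume c: "c \<in> C" "c' \<in> C" "c \<noteq> c'"
    show "(\<lambda>h. - r c + h) -` D \<inter> (\<lambda>h. - r c' + h) -` D = {}"
    proof (rule ccontr)
      assume "\<not> ?thesis"
      then obtain h where h: "- r c + h \<in> D" "- r c' + h \<in> D" by blast
      have "(- r c + h) + - (- r c' + h) \<in> D" using h d(2,3) by blast
      moreover have "(- r c + h) + - (- r c' + h) = - r c + r c'" by (simp add: minus_add add.assoc[symmetric])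
      ultimately have "- r c + r c' \<in> D" by simp
      then show False using same[OF r(1)[OF c(1)] r(1)[OF c(2)]] r(2)[OF c(1)] r(2)[OF c(2)] c(3) by metis
    qed
  qed
  then show "disjoint_family_on (\<lambda>c. (\<lambda>h. - (SOME x. x \<in> N \<and> c = (\<lambda>y. x + y) ` (N \<inter> D)) + h) -` D) C"
    unfolding r_def .
  show "\<exists>c\<in>C. - (SOME x. x \<in> N \<and> c = (\<lambda>y. x + y) ` (N \<inter> D)) + x' \<in> N \<inter> D" if x': "x' \<in> N"
  proof -
    define c0 where "c0 = (\<lambda>y. x' + y) ` (N \<inter> D)"
    have c: "c0 \<in> C" using x' by (simp add: C_def c0_def)
    have "x' \<in> c0" unfolding c0_def using n(1) d(1) by (intro image_eqI[of _ _ 0]) auto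
    then have "x' \<in> (\<lambda>y. r c0 + y) ` (N \<inter> D)" unfolding r(2)[OF c, symmetric] .
    then obtain y where y: "y \<in> N \<inter> D" "r c0 + y = x'" by (auto simp del: add_uminus_conv_diff)
    have "- r c0 + x' = y" unfolding y(2)[symmetric] by (simp add: add.assoc[symmetric])
    then have "- r c0 + x' \<in> N \<inter> D" using y(1) by simp
    then show ?thesis using c unfolding r_def by (intro bexI[of _ c0])
  qed
  show "c \<in> C \<Longrightarrow> (SOME x. x \<in> N \<and> c = (\<lambda>y. x + y) ` (N \<inter> D)) \<in> N" using r(1) unfolding r_def .
qed

text \<open>Above \<open>E\<close>, the points of \<open>R\<close> whose first coordinate is related
  to some element of \<open>D\<close> split into \<open>n\<close> pieces, one per coset. Each is the
  translate of the part in \<open>E \<times> D\<close> by some \<open>(0, r)\<close> with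
  \<open>r\<close> in \<open>indef_rel R\<close>, and so has the same mass.\<close>

lemma index_marginal:
  fixes \<gamma> :: "'g::{topological_group_add,t2_space,second_countable_topology} measure"
    and \<eta> :: "'h::{topological_group_add,t2_space,second_countable_topology} measure"
  assumes lcG: "locally compact (UNIV :: 'g set)" and lcH: "locally compact (UNIV :: 'h set)"
    and \<gamma>: "haar_on UNIV \<gamma>" and R: "poly_haar \<gamma> \<eta> R \<rho>" and D: "add_subgroup D" "open D"
  defines "n \<equiv> subgroup_index (indef_rel R) (indef_rel R \<inter> D)"
  shows "n > 0"
    "E \<in> sets borel \<Longrightarrow> {g. \<exists>h\<in>D. (g, h) \<in> R} \<in> sets borel \<Longrightarrow>
      emeasure \<rho> ((E \<inter> {g. \<exists>h\<in>D. (g, h) \<in> R}) \<times> UNIV) = of_nat n * emeasure \<rho> (E \<times> D)"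
proof -
  note P = poly_haarD[OF lcG lcH \<gamma> R]
  note S = add_subgroupD[OF P(2)] and H = haar_onD[OF P(3)] and d = add_subgroupD[OF D(1)]
  let ?N = "indef_rel R"
  have "?N = R `` {0}" by (auto simp: indef_rel_def)
  then have cN: "compact ?N" using poly_haar_compact_Image[OF lcG lcH \<gamma> R, of "{0}"] by simp
  have sN: "add_subgroup ?N"
    unfolding add_subgroup_def indef_rel_def
  proof (intro conjI ballI; unfold mem_Collect_eq)
    show "(0, 0) \<in> R" using S(1) by (simp add: zero_prod_def)
    show "(0, x + y) \<in> R" if "(0, x) \<in> R" "(0, y) \<in> R" for x y
      using S(2)[of "(0, x)" "(0, y)"] that by simp
    show "(0, - x) \<in> R" if "(0, x) \<in> R" for x
      using S(3)[of "(0, x)"] that by simp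
  qed
  define C where "C = (\<lambda>x. (\<lambda>y. x + y) ` (?N \<inter> D)) ` ?N"
  define r where "r c = (SOME x. x \<in> ?N \<and> c = (\<lambda>y. x + y) ` (?N \<inter> D))" for c
  note I = subgroup_index_finite[OF sN cN D, folded C_def, folded r_def]
  have n: "n = card C" unfolding n_def subgroup_index_def C_def ..
  then show "n > 0" using I(1,2) by (simp add: card_gt_0_iff)
  let ?S = "{g. \<exists>h\<in>D. (g, h) \<in> R}"
  assume E: "E \<in> sets borel" and mS: "?S \<in> sets borel"
  let ?Z = "\<lambda>c. E \<times> ((\<lambda>h. - r c + h) -` D)"
  have mZ: "?Z c \<in> sets \<rho>" for c
    using E D(2) H(2) by (auto intro!: borel_Times borel_translate)
  have eZ: "emeasure \<rho> (?Z c) = emeasure \<rho> (E \<times> D)" if "c \<in> C" for c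
  proof -
    have "(0, r c) \<in> R" using I(5)[OF that] by (simp add: indef_rel_def)
    then have "(0, - r c) \<in> R" using S(3)[of "(0, r c)"] by simp
    moreover have "?Z c = (\<lambda>z. (0, - r c) + z) -` (E \<times> D)" by auto
    ultimately show ?thesis using H(6)[of "(0, - r c)" "E \<times> D"] E D(2) by (simp add: borel_Times)
  qed
  have dj: "disjoint_family_on ?Z C"
    using I(3) unfolding disjoint_family_on_def by blast
  have sub: "R \<inter> (\<Union>c\<in>C. ?Z c) = R \<inter> ((E \<inter> ?S) \<times> UNIV)"
  proof (intro equalityI subsetI)
    fix z assume z: "z \<in> R \<inter> (\<Union>c\<in>C. ?Z c)"
    then obtain c where c: "c \<in> C" "fst z \<in> E" "- r c + snd z \<in> D" by auto
    have "(0, - r c) \<in> R" using I(5)[OF c(1)] S(3)[of "(0, r c)"] by (simp add: indef_rel_def)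
    then have "(0, - r c) + z \<in> R" using z S(2) by blast
    then have "(fst z, - r c + snd z) \<in> R" by (cases z) simp
    then show "z \<in> R \<inter> ((E \<inter> ?S) \<times> UNIV)" using c z by (cases z) auto
  next
    fix z assume z: "z \<in> R \<inter> ((E \<inter> ?S) \<times> UNIV)"
    then obtain g h e where g: "z = (g, h)" "(g, h) \<in> R" "g \<in> E" "e \<in> D" "(g, e) \<in> R" by auto
    \<comment> \<open>Two points of \<open>R\<close> with the same first coordinate differ by an
      element of \<open>indef_rel R\<close>.\<close>
    have "(g, h) + - (g, e) \<in> R" using g S(2,3) by blast
    then have "h + - e \<in> ?N" by (simp add: indef_rel_def)
    then obtain c where c: "c \<in> C" "- r c + (h + - e) \<in> D" using I(4) by blast
    have "- r c + (h + - e) + e \<in> D" using c(2) g(4) by (rule d(2))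
    then have "- r c + h \<in> D" by (simp add: add.assoc)
    then show "z \<in> R \<inter> (\<Union>c\<in>C. ?Z c)" using c(1) g by auto
  qed
  have inR: "emeasure \<rho> X = emeasure \<rho> (R \<inter> X)" if "X \<in> sets borel" for X
  proof -
    have "emeasure \<rho> (X - - R) = emeasure \<rho> X"
      using that P(5) H(2,4) by (intro emeasure_Diff_null_set) (auto simp: null_sets_def)
    moreover have "X - - R = R \<inter> X" by auto
    ultimately show ?thesis by simp
  qed
  have "of_nat n * emeasure \<rho> (E \<times> D) = (\<Sum>c\<in>C. emeasure \<rho> (?Z c))" using eZ n by simp
  also have "\<dots> = emeasure \<rho> (\<Union>c\<in>C. ?Z c)"
    using mZ by (intro sum_emeasure dj I(1)) blast
  also have "\<dots> = emeasure \<rho> ((E \<inter> ?S) \<times> UNIV)"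
    using inR[of "\<Union>c\<in>C. ?Z c"] inR[of "(E \<inter> ?S) \<times> UNIV"] sub mZ H(2) I(1) E mS by (simp add: borel_Times sets.finite_UN)
  finally show "emeasure \<rho> ((E \<inter> ?S) \<times> UNIV) = of_nat n * emeasure \<rho> (E \<times> D)" ..
qed

lemma UN_Times_right: "(\<Union>n. A \<times> B n) = A \<times> (\<Union>n. B n)"
  and UN_Times_left: "(\<Union>n. B n \<times> A) = (\<Union>n. B n) \<times> A"
  by auto

context
  fixes \<gamma> :: "'g::{topological_group_add,t2_space,second_countable_topology} measure"
    and \<eta> :: "'h::{topological_group_add,t2_space,second_countable_topology} measure"
    and \<kappa> :: "'k::{topological_group_add,t2_space,second_countable_topology} measure"
    and R \<rho> T \<tau>
  assumes lcG: "locally compact (UNIV :: 'g set)" and lcH: "locally compact (UNIV :: 'h set)" and lcK: "locally compact (UNIV :: 'k set)"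
    and \<gamma>: "haar_on UNIV \<gamma>" and \<eta>: "haar_on UNIV \<eta>" and \<kappa>: "haar_on UNIV \<kappa>"
    and rinv: "right_invariant \<eta>"
    and R: "poly_haar \<gamma> \<eta> R \<rho>" and T: "poly_haar \<eta> \<kappa> T \<tau>"
begin

lemmas left_factor = poly_haarD[OF lcG lcH \<gamma> R] and right_factor = poly_haarD[OF lcH lcK \<eta> T]

lemma relcomp_subgroup: "add_subgroup (R O T)"
proof -
  note r = add_subgroupD[OF left_factor(2)] and t = add_subgroupD[OF right_factor(2)]
  show ?thesis unfolding add_subgroup_def
  proof (intro conjI ballI)
    show "0 \<in> R O T" using r(1) t(1) by (auto simp: zero_prod_def)
    fix x assume "x \<in> R O T"
    then obtain a b c where x: "x = (a, c)" "(a, b) \<in> R" "(b, c) \<in> T" by auto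
    show "- x \<in> R O T" using r(3)[OF x(2)] t(3)[OF x(3)] x(1) by auto
    fix y assume "y \<in> R O T"
    then obtain a' b' c' where y: "y = (a', c')" "(a', b') \<in> R" "(b', c') \<in> T" by auto
    show "x + y \<in> R O T" using r(2)[OF x(2) y(2)] t(2)[OF x(3) y(3)] x(1) y(1) by auto
  qed
qed

text \<open>When the first coordinate stays in a compact set \<open>C1\<close>, properness confines
  the middle coordinate to the compact image of \<open>C1\<close> under \<open>R\<close>. Over
  compact boxes the composition is then a projection of a compact set, and closedness is a local
  property.\<close>

lemma relcomp_closed: "closed (R O T)"
proof -
  have cl: "closed ((R O T) \<inter> (C1 \<times> C2))" if C: "compact C1" "compact C2" for C1 C2
  proof -
    let ?K = "R `` C1"
    let ?P = "{w :: 'g \<times> 'h \<times> 'k. (fst w, fst (snd w)) \<in> R} \<inter> {w. (fst (snd w), snd (snd w)) \<in> T}"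
    have cK: "compact ?K" by (rule poly_haar_compact_Image[OF lcG lcH \<gamma> R C(1)])
    have "closed ((\<lambda>w :: 'g \<times> 'h \<times> 'k. (fst w, fst (snd w))) -` R)" "closed ((\<lambda>w :: 'g \<times> 'h \<times> 'k. (fst (snd w), snd (snd w))) -` T)"
      by (intro closed_vimage left_factor(1) right_factor(1) continuous_intros)+
    then have "closed ?P" by (auto simp: vimage_def)
    then have "compact ((C1 \<times> (?K \<times> C2)) \<inter> ?P)" by (intro compact_Int_closed compact_Times C cK)
    then have "compact ((\<lambda>w. (fst w, snd (snd w))) ` ((C1 \<times> (?K \<times> C2)) \<inter> ?P))"
      by (rule compact_continuous_image[rotated]) (intro continuous_intros)
    moreover have "(\<lambda>w. (fst w, snd (snd w))) ` ((C1 \<times> (?K \<times> C2)) \<inter> ?P) = (R O T) \<inter> (C1 \<times> C2)"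
      by (force simp: image_iff)
    ultimately show ?thesis by (simp add: compact_imp_closed)
  qed
  have "open (- (R O T))"
  proof (subst open_subopen, intro ballI)
    fix z assume z: "z \<in> - (R O T)"
    obtain g k where gk: "z = (g, k)" by (cases z)
    obtain V1 C1 where 1: "open V1" "compact C1" "g \<in> V1" "V1 \<subseteq> C1" "C1 \<subseteq> (UNIV :: 'g set)"
      by (rule lc_nbhd[OF lcG open_UNIV UNIV_I])
    obtain V2 C2 where 2: "open V2" "compact C2" "k \<in> V2" "V2 \<subseteq> C2" "C2 \<subseteq> (UNIV :: 'k set)"
      by (rule lc_nbhd[OF lcK open_UNIV UNIV_I])
    show "\<exists>W. open W \<and> z \<in> W \<and> W \<subseteq> - (R O T)"
    proof (intro exI[of _ "V1 \<times> V2 - (R O T) \<inter> (C1 \<times> C2)"] conjI)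
      show "open (V1 \<times> V2 - (R O T) \<inter> (C1 \<times> C2))" using 1 2 cl by (intro open_Diff open_Times)
      show "z \<in> V1 \<times> V2 - (R O T) \<inter> (C1 \<times> C2)" using z gk 1 2 by auto
      show "V1 \<times> V2 - (R O T) \<inter> (C1 \<times> C2) \<subseteq> - (R O T)" using 1(4) 2(4) by blast
    qed
  qed
  then show ?thesis by (simp add: closed_def)
qed

context
  fixes \<sigma> assumes \<sigma>: "composed \<gamma> \<eta> \<kappa> \<rho> \<tau> \<sigma>"
begin

lemmas composed_context = lcG lcH lcK \<gamma> \<eta> \<kappa> rinv left_factor(4) right_factor(4) \<sigma>

text \<open>For \<open>(a, b)\<close> in \<open>R\<close> and \<open>(b, c)\<close> in
  \<open>T\<close>, translating the rectangle by \<open>(a, c)\<close> shifts both slice densities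
  by the same \<open>b\<close>, and left invariance of \<open>\<eta>\<close> removes this shift from
  the integral.\<close>

lemma composed_invariant:
  assumes x: "x \<in> R O T" and E: "E \<in> sets borel"
  shows "emeasure \<sigma> ((\<lambda>y. x + y) -` E) = emeasure \<sigma> E"
proof -
  note d = composed_dominated[OF composed_context] and rect = composed_rect[OF composed_context] and ex = slices_exist[OF composed_context]
  note G = haar_onD[OF \<gamma>] and H = haar_onD[OF \<eta>] and K = haar_onD[OF \<kappa>]
  note Tc = poly_haar_converse[OF T]
  obtain a b c where abc: "x = (a, c)" "(a, b) \<in> R" "(b, c) \<in> T" using x by auto
  have cf: "continuous_on UNIV (\<lambda>y. x + y)" by (intro continuous_intros)
  have "\<sigma> = distr \<sigma> borel (\<lambda>y. x + y)"
  proof (rule finite_rect_measure_eqI[OF lcG lcK G(1) K(1) d])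
    fix A :: "'g set" and B :: "'k set" assume AB: "A \<in> sets borel" "B \<in> sets borel" "emeasure \<gamma> A < \<infinity>" "emeasure \<kappa> B < \<infinity>"
    obtain v where v: "slice_density \<eta> \<rho> A v" using ex(1)[OF AB(1,3)] by blast
    obtain u where u: "slice_density \<eta> (converse_measure \<tau>) B u" using ex(2)[OF AB(2,4)] by blast
    have v': "slice_density \<eta> \<rho> ((\<lambda>y. a + y) -` A) (\<lambda>h. v (b + h))"
      by (rule slice_density_translate[OF lcH \<eta> left_factor(3) abc(2) AB(1) v])
    have u': "slice_density \<eta> (converse_measure \<tau>) ((\<lambda>y. c + y) -` B) (\<lambda>h. u (b + h))"
      by (rule slice_density_translate[OF lcH \<eta> _ _ AB(2) u, of "T\<inverse>"]) (use Tc abc(3) in \<open>auto simp: poly_haar_def\<close>)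
    have vu: "v \<in> borel_measurable borel" "u \<in> borel_measurable borel" using v u by (auto simp: slice_density_def)
    have "emeasure (distr \<sigma> borel (\<lambda>y. x + y)) (A \<times> B) = emeasure \<sigma> (((\<lambda>y. a + y) -` A) \<times> ((\<lambda>y. c + y) -` B))"
      using emeasure_distr_borel[OF dominated_marginalsD(1)[OF d] cf borel_Times[OF AB(1,2)]]
      unfolding abc(1) vimage_translate_Times .
    also have "\<dots> = (\<integral>\<^sup>+h. ennreal (v (b + h)) * ennreal (u (b + h)) \<partial>\<eta>)"
      using G(6)[of a A] K(6)[of c B] AB by (intro rect v' u' borel_translate) auto
    also have "\<dots> = (\<integral>\<^sup>+h. ennreal (v h) * ennreal (u h) \<partial>\<eta>)"
      by (rule haar_nn_integral_left[OF lcH add_subgroup_UNIV _ \<eta>]) (use vu in auto)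
    also have "\<dots> = emeasure \<sigma> (A \<times> B)" by (rule rect[OF AB(1,2,3,4) v u, symmetric])
    finally show "emeasure \<sigma> (A \<times> B) = emeasure (distr \<sigma> borel (\<lambda>y. x + y)) (A \<times> B)" ..
  qed simp
  then show ?thesis using emeasure_distr_borel[OF dominated_marginalsD(1)[OF d] cf E] by simp
qed

text \<open>On a compact rectangle \<open>C1 \<times> C2\<close> that misses \<open>R O T\<close>,
  the density \<open>v\<close> vanishes almost everywhere off the image of \<open>C1\<close> under
  \<open>R\<close>, and \<open>u\<close> off the preimage of \<open>C2\<close> under
  \<open>T\<close>. These two sets are disjoint, so the product of the densities is zero almost
  everywhere.\<close>

lemma composed_supported: "emeasure \<sigma> (- (R O T)) = 0"
proof (rule null_of_locally_null)
  note d = composed_dominated[OF composed_context] and rect = composed_rect[OF composed_context] and ex = slices_exist[OF composed_context]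
  note G = haar_onD[OF \<gamma>] and H = haar_onD[OF \<eta>] and K = haar_onD[OF \<kappa>]
  note Tc = poly_haar_converse[OF T]
  show "sets \<sigma> = sets borel" using d by (simp add: dominated_marginals_def)
  show "- (R O T) \<in> sets borel" using relcomp_closed by auto
  fix z assume z: "z \<in> - (R O T)"
  have "open (- (R O T))" using relcomp_closed by auto
  then obtain A B where AB: "open A" "open B" "z \<in> A \<times> B" "A \<times> B \<subseteq> - (R O T)"
    using z by (metis open_prod_elim)
  obtain g k where gk: "z = (g, k)" "g \<in> A" "k \<in> B" using AB(3) by auto
  obtain V1 C1 where 1: "open V1" "compact C1" "g \<in> V1" "V1 \<subseteq> C1" "C1 \<subseteq> A" by (rule lc_nbhd[OF lcG AB(1) gk(2)])
  obtain V2 C2 where 2: "open V2" "compact C2" "k \<in> V2" "V2 \<subseteq> C2" "C2 \<subseteq> B" by (rule lc_nbhd[OF lcK AB(2) gk(3)])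
  let ?P = "R `` C1" and ?Q = "T\<inverse> `` C2"
  have cPQ: "closed ?P" "closed ?Q"
    using poly_haar_compact_Image[OF lcG lcH \<gamma> R 1(2)] poly_haar_compact_Image[OF lcK lcH \<kappa> Tc 2(2)]
    by (auto intro: compact_imp_closed)
  have disj: "?P \<inter> ?Q = {}" using AB(4) 1(5) 2(5) by blast
  have mC: "C1 \<in> sets borel" "C2 \<in> sets borel" using 1(2) 2(2) by (auto intro: borel_compact)
  have fC: "emeasure \<gamma> C1 < \<infinity>" "emeasure \<kappa> C2 < \<infinity>" using 1(2) 2(2) G(1) K(1) by (auto simp: compact_finite_def)
  obtain v where v: "slice_density \<eta> \<rho> C1 v" using ex(1)[OF mC(1) fC(1)] by blast
  obtain u where u: "slice_density \<eta> (converse_measure \<tau>) C2 u" using ex(2)[OF mC(2) fC(2)] by blast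
  have null: "AE h in \<eta>. h \<in> P \<or> f h = 0"
    if f: "slice_density \<eta> \<rho>' C f" and P: "closed P" and zero: "emeasure \<rho>' (C \<times> (- P)) = 0" for \<rho>' :: "('z::topological_space \<times> 'h) measure" and C f P
  proof -
    have fb: "f \<in> borel_measurable borel" "\<And>h. 0 \<le> f h" using f by (auto simp: slice_density_def)
    have m: "(\<lambda>h. ennreal (f h) * indicator (- P) h) \<in> borel_measurable \<eta>"
      unfolding measurable_cong_sets[OF H(2) refl] using fb(1) P
      by (intro borel_measurable_times_ennreal borel_measurable_indicator) auto
    have "(\<integral>\<^sup>+h. ennreal (f h) * indicator (- P) h \<partial>\<eta>) = 0"
      using f P zero by (auto simp: slice_density_def)
    then have "AE h in \<eta>. ennreal (f h) * indicator (- P) h = 0" using nn_integral_0_iff_AE[OF m] by simp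
    then show ?thesis by eventually_elim (use fb(2) in \<open>auto simp: indicator_def antisym split: if_splits\<close>)
  qed
  have z1: "emeasure \<rho> (C1 \<times> (- ?P)) = 0"
  proof -
    have "emeasure \<rho> (C1 \<times> (- ?P)) \<le> emeasure \<rho> (- R)"
      using haar_onD(2)[OF left_factor(3)] left_factor(5) by (intro emeasure_mono) auto
    then show ?thesis using haar_onD(4)[OF left_factor(3)] by simp
  qed
  have z2: "emeasure (converse_measure \<tau>) (C2 \<times> (- ?Q)) = 0"
  proof -
    have "emeasure (converse_measure \<tau>) (C2 \<times> (- ?Q)) \<le> emeasure (converse_measure \<tau>) (- T\<inverse>)"
      using Tc by (intro emeasure_mono) (auto simp: poly_haar_def)
    then show ?thesis using Tc haar_onD(4)[of "T\<inverse>" "converse_measure \<tau>"] by (auto simp: poly_haar_def)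
  qed
  have "AE h in \<eta>. ennreal (v h) * ennreal (u h) = 0"
    using null[OF v cPQ(1) z1] null[OF u cPQ(2) z2] by eventually_elim (use disj in auto)
  then have "(\<integral>\<^sup>+h. ennreal (v h) * ennreal (u h) \<partial>\<eta>) = (\<integral>\<^sup>+h. 0 \<partial>\<eta>)" by (rule nn_integral_cong_AE)
  then have "emeasure \<sigma> (C1 \<times> C2) = 0"
    unfolding rect[OF mC fC v u] by simp
  moreover have "emeasure \<sigma> (V1 \<times> V2) \<le> emeasure \<sigma> (C1 \<times> C2)"
    using 1 2 mC d by (intro emeasure_mono) (auto simp: dominated_marginals_def borel_Times)
  ultimately show "\<exists>U. open U \<and> z \<in> U \<and> emeasure \<sigma> U = 0"
    using 1 2 gk by (intro exI[of _ "V1 \<times> V2"]) (auto simp: open_Times)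
qed

text \<open>Letting the second side exhaust the third group turns the mass of a rectangle into the
  integral of \<open>v\<close> against the first marginal of \<open>\<tau>\<close>, which is
  \<open>a\<close> times the restriction of \<open>\<eta>\<close> to
  \<open>Domain T\<close>.\<close>

lemma composed_marginal:
  assumes a: "\<And>E. E \<in> sets borel \<Longrightarrow> emeasure \<tau> (E \<times> UNIV) = ennreal a * emeasure \<eta> (Domain T \<inter> E)"
    and A: "A \<in> sets borel"
  shows "emeasure \<sigma> (A \<times> UNIV) = ennreal a * emeasure \<rho> (A \<times> Domain T)"
proof -
  note d = composed_dominated[OF composed_context] and ex = slices_exist[OF composed_context]
  note s\<sigma> = dominated_marginalsD(1)[OF d]
  note G = haar_onD[OF \<gamma>] and H = haar_onD[OF \<eta>] and K = haar_onD[OF \<kappa>] and Rh = haar_onD[OF left_factor(3)] and Th = haar_onD[OF right_factor(3)]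
  have oD: "open (Domain T)" by (rule poly_haar_open_Domain[OF lcH lcK \<eta> T])
  then have mD: "Domain T \<in> sets borel" by simp
  obtain W :: "nat \<Rightarrow> 'g set" where W: "\<And>n. open (W n)" "\<And>n. emeasure \<gamma> (W n) < \<infinity>" "incseq W" "(\<Union>n. W n) = UNIV"
    by (rule compact_finite_exhaustion[OF lcG G(1)]) blast
  obtain W' :: "nat \<Rightarrow> 'k set" where W': "\<And>n. open (W' n)" "\<And>n. emeasure \<kappa> (W' n) < \<infinity>" "incseq W'" "(\<Union>n. W' n) = UNIV"
    by (rule compact_finite_exhaustion[OF lcK K(1)]) blast
  note Wf = W(2) W'(2)
  \<comment> \<open>Slice densities are available for sets of finite measure only; the general case
    follows by exhausting the first group.\<close>
  have fin: "emeasure \<sigma> (A \<times> UNIV) = ennreal a * emeasure \<rho> (A \<times> Domain T)"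
    if A: "A \<in> sets borel" "emeasure \<gamma> A < \<infinity>" for A
  proof -
    obtain v where v: "slice_density \<eta> \<rho> A v" using ex(1)[OF A] by blast
    have vb: "v \<in> borel_measurable borel" using v by (simp add: slice_density_def)
    have cf: "continuous_on UNIV (fst :: 'h \<times> 'k \<Rightarrow> 'h)" by (intro continuous_intros)
    have mf: "fst \<in> measurable \<tau> borel"
      unfolding measurable_cong_sets[OF Th(2) refl] by (rule borel_measurable_continuous_onI[OF cf])
    have m: "(\<lambda>z. ennreal (v (fst z))) \<in> borel_measurable \<tau>"
      by (rule measurable_compose[OF measurable_compose[OF mf vb] measurable_ennreal])
    let ?\<tau>v = "density \<tau> (\<lambda>z. ennreal (v (fst z)))"
    have "emeasure \<sigma> (A \<times> W' n) = emeasure ?\<tau>v (UNIV \<times> W' n)" for n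
    proof -
      have "emeasure \<sigma> (A \<times> W' n) = (\<integral>\<^sup>+z. ennreal (v (fst z)) * indicator (W' n) (snd z) \<partial>\<tau>)"
        using W'(1) Wf(2) by (intro composed_rect_right[OF composed_context A _ _ v]) auto
      also have "\<dots> = (\<integral>\<^sup>+z. ennreal (v (fst z)) * indicator (UNIV \<times> W' n) z \<partial>\<tau>)"
        by (intro nn_integral_cong) (auto simp: indicator_def)
      also have "\<dots> = emeasure ?\<tau>v (UNIV \<times> W' n)"
        using W'(1) Th(2) by (intro emeasure_density[symmetric] m) (simp add: borel_Times)
      finally show ?thesis .
    qed
    moreover have "(\<lambda>n. emeasure \<sigma> (A \<times> W' n)) \<longlonglongrightarrow> emeasure \<sigma> (\<Union>n. A \<times> W' n)"
      by (rule Lim_emeasure_incseq)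
        (use A W'(1) s\<sigma> in \<open>auto simp: borel_Times\<close>, use W'(3) in \<open>force simp: incseq_def\<close>)
    moreover have "(\<lambda>n. emeasure ?\<tau>v (UNIV \<times> W' n)) \<longlonglongrightarrow> emeasure ?\<tau>v (\<Union>n. UNIV \<times> W' n)"
      by (rule Lim_emeasure_incseq)
        (use W'(1) Th(2) in \<open>auto simp: borel_Times\<close>, use W'(3) in \<open>force simp: incseq_def\<close>)
    moreover have "(\<Union>n. A \<times> W' n) = A \<times> UNIV" "(\<Union>n. (UNIV :: 'h set) \<times> W' n) = UNIV"
      using W'(4) by (simp_all add: UN_Times_right)
    ultimately have "emeasure \<sigma> (A \<times> UNIV) = emeasure ?\<tau>v UNIV" using LIMSEQ_unique by simp
    also have "\<dots> = (\<integral>\<^sup>+z. ennreal (v (fst z)) \<partial>\<tau>)"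
      using emeasure_density[OF m, of UNIV] Th(2) by simp
    also have "\<dots> = (\<integral>\<^sup>+h. ennreal (v h) \<partial>distr \<tau> borel fst)"
      using vb by (simp add: nn_integral_distr[OF mf])
    also have "distr \<tau> borel fst = density \<eta> (\<lambda>h. ennreal a * indicator (Domain T) h)"
    proof (rule measure_eqI)
      fix E assume "E \<in> sets (distr \<tau> borel fst)"
      then have E: "E \<in> sets borel" by simp
      have "emeasure (distr \<tau> borel fst) E = ennreal a * emeasure \<eta> (Domain T \<inter> E)"
        using emeasure_marginal[OF lcH lcK \<eta> T E] a[OF E] by simp
      also have "\<dots> = (\<integral>\<^sup>+h. ennreal a * indicator (Domain T \<inter> E) h \<partial>\<eta>)"
        using mD E H(2) by (simp add: nn_integral_cmult_indicator)
      also have "\<dots> = (\<integral>\<^sup>+h. ennreal a * indicator (Domain T) h * indicator E h \<partial>\<eta>)"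
        by (intro nn_integral_cong) (auto simp: indicator_def)
      also have "\<dots> = emeasure (density \<eta> (\<lambda>h. ennreal a * indicator (Domain T) h)) E"
        using mD E H(2) by (subst emeasure_density) auto
      finally show "emeasure (distr \<tau> borel fst) E = emeasure (density \<eta> (\<lambda>h. ennreal a * indicator (Domain T) h)) E" .
    qed (simp add: H(2))
    also have "(\<integral>\<^sup>+h. ennreal (v h) \<partial>density \<eta> (\<lambda>h. ennreal a * indicator (Domain T) h)) = (\<integral>\<^sup>+h. ennreal a * (ennreal (v h) * indicator (Domain T) h) \<partial>\<eta>)"
    proof (subst nn_integral_density)
      show "(\<lambda>h. ennreal (v h)) \<in> borel_measurable \<eta>"
        unfolding measurable_cong_sets[OF H(2) refl] using vb by simp
    qed (use mD H(2) in \<open>auto intro!: nn_integral_cong simp: ac_simps\<close>)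
    also have "\<dots> = ennreal a * (\<integral>\<^sup>+h. ennreal (v h) * indicator (Domain T) h \<partial>\<eta>)"
    proof (rule nn_integral_cmult)
      show "(\<lambda>h. ennreal (v h) * indicator (Domain T) h) \<in> borel_measurable \<eta>"
        unfolding measurable_cong_sets[OF H(2) refl] using vb mD
        by (intro borel_measurable_times_ennreal borel_measurable_indicator) auto
    qed
    also have "(\<integral>\<^sup>+h. ennreal (v h) * indicator (Domain T) h \<partial>\<eta>) = emeasure \<rho> (A \<times> Domain T)"
      using v mD by (simp add: slice_density_def)
    finally show ?thesis .
  qed
  have "emeasure \<sigma> ((A \<inter> W n) \<times> UNIV) = ennreal a * emeasure \<rho> ((A \<inter> W n) \<times> Domain T)" for n
  proof (rule fin)
    show "A \<inter> W n \<in> sets borel" using A W(1) by simp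
    have "emeasure \<gamma> (A \<inter> W n) \<le> emeasure \<gamma> (W n)" using W(1) A G(2) by (intro emeasure_mono) auto
    then show "emeasure \<gamma> (A \<inter> W n) < \<infinity>" using Wf(1) by (rule le_less_trans)
  qed
  moreover have "(\<lambda>n. emeasure \<sigma> ((A \<inter> W n) \<times> UNIV)) \<longlonglongrightarrow> emeasure \<sigma> (\<Union>n. (A \<inter> W n) \<times> UNIV)"
    by (rule Lim_emeasure_incseq)
      (use A W(1) s\<sigma> in \<open>auto simp: borel_Times\<close>, use W(3) in \<open>force simp: incseq_def\<close>)
  moreover have "(\<lambda>n. emeasure \<rho> ((A \<inter> W n) \<times> Domain T)) \<longlonglongrightarrow> emeasure \<rho> (\<Union>n. (A \<inter> W n) \<times> Domain T)"
    by (rule Lim_emeasure_incseq)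
      (use A W(1) Rh(2) mD in \<open>auto simp: borel_Times\<close>, use W(3) in \<open>force simp: incseq_def\<close>)
  moreover have "(\<Union>n. (A \<inter> W n) \<times> (UNIV :: 'k set)) = A \<times> UNIV" "(\<Union>n. (A \<inter> W n) \<times> Domain T) = A \<times> Domain T"
    using W(4) unfolding UN_Times_left by (simp_all flip: Int_UN_distrib)
  ultimately have "(\<lambda>n. emeasure \<sigma> ((A \<inter> W n) \<times> UNIV)) \<longlonglongrightarrow> emeasure \<sigma> (A \<times> UNIV)"
    "(\<lambda>n. emeasure \<sigma> ((A \<inter> W n) \<times> UNIV)) \<longlonglongrightarrow> ennreal a * emeasure \<rho> (A \<times> Domain T)"
    by (simp_all add: ennreal_tendsto_cmult)
  then show ?thesis by (rule LIMSEQ_unique)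
qed

text \<open>What remains is that the measure is not zero. The marginal formula gives the total mass
  as \<open>a\<close> times the mass of \<open>UNIV \<times> Domain T\<close> under
  \<open>\<rho>\<close>, which is positive because this set is an open neighbourhood of 0.\<close>

theorem composed_poly_haar: "poly_haar \<gamma> \<kappa> (R O T) \<sigma>"
proof -
  note d = composed_dominated[OF composed_context]
  obtain a where a: "a > 0" "\<And>E. E \<in> sets borel \<Longrightarrow> emeasure \<tau> (E \<times> UNIV) = ennreal a * emeasure \<eta> (Domain T \<inter> E)"
    using marginal_proportional[OF lcH lcK \<eta> T] by blast
  have oD: "open (Domain T)" by (rule poly_haar_open_Domain[OF lcH lcK \<eta> T])
  have "0 \<in> Domain T" using add_subgroupD(1)[OF add_subgroup_Domain[OF lcH lcK \<eta> T]] .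
  then have "emeasure \<rho> (UNIV \<times> Domain T) > 0"
    using haar_open_pos[OF lc_prod[OF lcG lcH] left_factor(2,5,3), of "UNIV \<times> Domain T" 0] oD add_subgroupD(1)[OF left_factor(2)]
    by (auto simp: open_Times zero_prod_def)
  moreover have "emeasure \<sigma> UNIV = ennreal a * emeasure \<rho> (UNIV \<times> Domain T)"
    using composed_marginal[OF a(2), of UNIV] by simp
  ultimately have "emeasure \<sigma> UNIV \<noteq> 0" using a(1) by auto
  then have "haar_on (R O T) \<sigma>"
    unfolding haar_on_def
    using dominated_marginals_compact_finite[OF d haar_onD(1)[OF \<gamma>]] composed_supported composed_invariant by blast
  then show ?thesis unfolding poly_haar_def using relcomp_closed relcomp_subgroup d by blast
qed

end

end

section \<open>From measures back to polyhomomorphisms\<close>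

lemma unimodular_haar:
  fixes \<gamma> :: "'a::{topological_group_add,t2_space,second_countable_topology} measure"
  assumes "unimodular_haar_measure \<gamma>"
  shows "haar_on UNIV \<gamma>" "right_invariant \<gamma>"
proof -
  have s: "sets \<gamma> = sets borel"
    using assms by (simp add: unimodular_haar_measure_def haar_measure_on_def sets_restrict_space)
  have l: "emeasure \<gamma> ((\<lambda>y. x + y) -` A) = emeasure \<gamma> A" if "A \<in> sets borel" for x A
  proof -
    have "(\<lambda>y. x + y) -` A = (\<lambda>y. - x + y) ` A" by (simp add: translate_image_eq_vimage)
    then show ?thesis using assms that s by (simp add: unimodular_haar_measure_def haar_measure_on_def)
  qed
  show "right_invariant \<gamma>" unfolding right_invariant_def
  proof (intro allI ballI)
    fix x and A :: "'a set" assume "A \<in> sets borel"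
    have "(\<lambda>y. y + x) -` A = (\<lambda>y. y + - x) ` A" unfolding translate_image_eq_vimage(2) by simp
    then show "emeasure \<gamma> ((\<lambda>y. y + x) -` A) = emeasure \<gamma> A"
      using assms \<open>A \<in> sets borel\<close> s by (simp only: unimodular_haar_measure_def)
  qed
  show "haar_on UNIV \<gamma>"
    unfolding haar_on_def compact_finite_def
    using assms s l by (simp add: unimodular_haar_measure_def haar_measure_on_def)
qed

lemma closed_restrict_measure:
  fixes R :: "'a::topological_space set"
  assumes R: "closed R" and s: "sets \<rho> = sets (restrict_space borel R)"
  shows "space \<rho> = R" "(\<lambda>z. z) \<in> measurable \<rho> borel"
    "A \<in> sets borel \<Longrightarrow> emeasure (distr \<rho> borel (\<lambda>z. z)) A = emeasure \<rho> (A \<inter> R)"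
    "restrict_space (distr \<rho> borel (\<lambda>z. z)) R = \<rho>"
    "E \<in> sets \<rho> \<longleftrightarrow> E \<in> sets borel \<and> E \<subseteq> R"
proof -
  have Rb: "R \<inter> space borel \<in> sets (borel :: 'a measure)" using R by simp
  show sp: "space \<rho> = R" using sets_eq_imp_space_eq[OF s] by (simp add: space_restrict_space)
  show E: "E \<in> sets \<rho> \<longleftrightarrow> E \<in> sets borel \<and> E \<subseteq> R" for E
    unfolding s using sets_restrict_space_iff[OF Rb, of E] by auto
  show m: "(\<lambda>z. z) \<in> measurable \<rho> borel"
  proof (rule measurableI)
    fix A assume "A \<in> sets (borel :: 'a measure)"
    then show "(\<lambda>z. z) -` A \<inter> space \<rho> \<in> sets \<rho>" using R E sp by auto
  qed auto
  show em: "emeasure (distr \<rho> borel (\<lambda>z. z)) A = emeasure \<rho> (A \<inter> R)" if "A \<in> sets borel" for A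
    using that m sp by (simp add: emeasure_distr)
  show "restrict_space (distr \<rho> borel (\<lambda>z. z)) R = \<rho>"
  proof (rule measure_eqI)
    show ss: "sets (restrict_space (distr \<rho> borel (\<lambda>z. z)) R) = sets \<rho>"
      unfolding s by (simp add: sets_restrict_space)
    fix A assume "A \<in> sets (restrict_space (distr \<rho> borel (\<lambda>z. z)) R)"
    then have A: "A \<in> sets borel" "A \<subseteq> R" using ss E by auto
    then show "emeasure (restrict_space (distr \<rho> borel (\<lambda>z. z)) R) A = emeasure \<rho> A"
      using R em[OF A(1)] by (simp add: emeasure_restrict_space inf.absorb1)
  qed
qed

lemma restrict_haar:
  fixes R :: "'a::topological_group_add set"
  assumes R: "closed R" and \<mu>: "haar_on R \<mu>"
  shows "sets (restrict_space \<mu> R) = sets (restrict_space borel R)"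
    "A \<in> sets borel \<Longrightarrow> emeasure (restrict_space \<mu> R) (A \<inter> R) = emeasure \<mu> A"
    "distr (restrict_space \<mu> R) borel (\<lambda>z. z) = \<mu>"
proof -
  note D = haar_onD[OF \<mu>]
  have Rb: "R \<in> sets borel" using R by simp
  show s: "sets (restrict_space \<mu> R) = sets (restrict_space borel R)"
    using D(2) by (simp add: sets_restrict_space)
  show em: "emeasure (restrict_space \<mu> R) (A \<inter> R) = emeasure \<mu> A" if A: "A \<in> sets borel" for A
  proof -
    have "emeasure (restrict_space \<mu> R) (A \<inter> R) = emeasure \<mu> (A \<inter> R)"
      using Rb D(2,3) by (intro emeasure_restrict_space) auto
    also have "\<dots> = emeasure \<mu> (A - - R)" by (simp add: Diff_eq)
    also have "emeasure \<mu> (A - - R) = emeasure \<mu> A"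
      using A Rb D(2,4) by (intro emeasure_Diff_null_set) (auto simp: null_sets_def)
    finally show ?thesis .
  qed
  show "distr (restrict_space \<mu> R) borel (\<lambda>z. z) = \<mu>"
    by (rule measure_eqI) (use closed_restrict_measure(3)[OF R s] em D(2) in auto)
qed

text \<open>The measures of the definition live on the space \<open>R\<close>. This exchanges them
  for Borel measures on the ambient group that vanish off \<open>R\<close>, to which the preceding
  results apply.\<close>

lemma haar_measure_on_iff:
  fixes R :: "'a::{topological_group_add,t2_space} set"
  assumes R: "closed R" "add_subgroup R"
  shows "haar_measure_on R \<rho> \<longleftrightarrow> (\<exists>\<mu>. haar_on R \<mu> \<and> \<rho> = restrict_space \<mu> R)"
proof
  assume h: "haar_measure_on R \<rho>"
  then have s: "sets \<rho> = sets (restrict_space borel R)" by (simp add: haar_measure_on_def)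
  note C = closed_restrict_measure[OF R(1) s]
  let ?\<mu> = "distr \<rho> borel (\<lambda>z. z)"
  have Rb: "R \<in> sets borel" using R by simp
  have "haar_on R ?\<mu>"
    unfolding haar_on_def compact_finite_def
  proof (intro conjI allI impI ballI)
    fix K :: "'a set" assume "compact K"
    then show "emeasure ?\<mu> K < \<infinity>"
      using h R(1) compact_Int_closed[of K R] by (simp add: C(3) borel_compact haar_measure_on_def)
  next
    show "emeasure ?\<mu> (- R) = 0" using Rb C(3)[of "- R"] by auto
    show "emeasure ?\<mu> UNIV \<noteq> 0" using h C(3)[of UNIV] by (simp add: haar_measure_on_def)
    fix x A assume x: "x \<in> R" and A: "A \<in> sets (borel :: 'a measure)"
    have mx: "- x \<in> R" by (rule add_subgroupD(3)[OF R(2) x])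
    have "(\<lambda>y. x + y) -` A \<inter> R = (\<lambda>y. x + y) -` (A \<inter> R)"
    proof -
      have "y \<in> R \<longleftrightarrow> x + y \<in> R" for y
        using add_subgroupD(2)[OF R(2) x] add_subgroupD(4)[OF R(2) x, of "x + y"] by (auto simp: add.assoc[symmetric])
      then show ?thesis by auto
    qed
    also have "\<dots> = (\<lambda>y. - x + y) ` (A \<inter> R)" by (simp add: translate_image_eq_vimage)
    finally have eq: "(\<lambda>y. x + y) -` A \<inter> R = (\<lambda>y. - x + y) ` (A \<inter> R)" .
    have "emeasure \<rho> ((\<lambda>y. - x + y) ` (A \<inter> R)) = emeasure \<rho> (A \<inter> R)"
      using h mx A Rb C(5) unfolding haar_measure_on_def by blast
    then show "emeasure ?\<mu> ((\<lambda>y. x + y) -` A) = emeasure ?\<mu> A"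
      using C(3)[OF A] C(3)[OF borel_translate(1)[OF A, of x]] eq by simp
  qed simp
  then show "\<exists>\<mu>. haar_on R \<mu> \<and> \<rho> = restrict_space \<mu> R" using C(4) by metis
next
  assume "\<exists>\<mu>. haar_on R \<mu> \<and> \<rho> = restrict_space \<mu> R"
  then obtain \<mu> where \<mu>: "haar_on R \<mu>" and \<rho>: "\<rho> = restrict_space \<mu> R" by blast
  note D = haar_onD[OF \<mu>] and H = restrict_haar[OF R(1) \<mu>, folded \<rho>]
  note C = closed_restrict_measure[OF R(1) H(1)]
  have em: "emeasure \<rho> A = emeasure \<mu> A" if "A \<in> sets borel" "A \<subseteq> R" for A
    using H(2)[OF that(1)] that(2) by (simp add: inf.absorb1)
  show "haar_measure_on R \<rho>"
    unfolding haar_measure_on_def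
  proof (intro conjI allI impI ballI)
    show "sets \<rho> = sets (restrict_space borel R)" by (rule H(1))
    show "emeasure \<rho> R \<noteq> 0" using H(2)[of UNIV] D(5) by simp
    show "emeasure \<rho> K < \<infinity>" if "compact K \<and> K \<subseteq> R" for K
      using that em[of K] D(1) by (auto simp: compact_finite_def borel_compact)
    fix x A assume x: "x \<in> R" and "A \<in> sets \<rho>"
    then have A: "A \<in> sets borel" "A \<subseteq> R" using C(5) by auto
    have eq: "(\<lambda>y. x + y) ` A = (\<lambda>y. - x + y) -` A" by (rule translate_image_eq_vimage)
    have "(\<lambda>y. x + y) ` A \<subseteq> R" using A(2) x add_subgroupD(2)[OF R(2)] by blast
    then have "emeasure \<rho> ((\<lambda>y. x + y) ` A) = emeasure \<mu> ((\<lambda>y. - x + y) -` A)"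
      unfolding eq by (intro em borel_translate A)
    also have "\<dots> = emeasure \<mu> A" by (rule D(6)[OF add_subgroupD(3)[OF R(2) x] A(1)])
    also have "\<dots> = emeasure \<rho> A" using em[OF A] by simp
    finally show "emeasure \<rho> ((\<lambda>y. x + y) ` A) = emeasure \<rho> A" .
  qed
qed

lemma Polh_iff:
  fixes \<gamma> :: "'g::{topological_group_add,t2_space,second_countable_topology} measure"
    and \<eta> :: "'h::{topological_group_add,t2_space,second_countable_topology} measure"
  shows "P \<in> Polh \<gamma> \<eta> \<longleftrightarrow> P = Zero \<or> (\<exists>R \<mu>. poly_haar \<gamma> \<eta> R \<mu> \<and> P = Poly R (restrict_space \<mu> R))"
proof -
  have "(closed R \<and> add_subgroup R \<and> haar_measure_on R \<rho> \<and>
       (\<forall>A\<in>sets borel. emeasure \<rho> (R \<inter> (A \<times> UNIV)) \<le> emeasure \<gamma> A) \<and>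
       (\<forall>B\<in>sets borel. emeasure \<rho> (R \<inter> (UNIV \<times> B)) \<le> emeasure \<eta> B))
     \<longleftrightarrow> (\<exists>\<mu>. poly_haar \<gamma> \<eta> R \<mu> \<and> \<rho> = restrict_space \<mu> R)" for R :: "('g \<times> 'h) set" and \<rho>
  proof (cases "closed R \<and> add_subgroup R")
    case True
    have "(\<forall>A\<in>sets borel. emeasure (restrict_space \<mu> R) (R \<inter> (A \<times> UNIV)) \<le> emeasure \<gamma> A) \<and>
       (\<forall>B\<in>sets borel. emeasure (restrict_space \<mu> R) (R \<inter> (UNIV \<times> B)) \<le> emeasure \<eta> B)
      \<longleftrightarrow> dominated_marginals \<gamma> \<eta> \<mu>" if "haar_on R \<mu>" for \<mu>
      using restrict_haar(2)[OF _ that] True haar_onD(2)[OF that]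
      by (simp add: dominated_marginals_def Int_commute[of R] borel_Times)
    then show ?thesis
      using True haar_measure_on_iff[of R \<rho>] unfolding poly_haar_def by metis
  qed (auto simp: poly_haar_def)
  then show ?thesis unfolding Polh_def by auto
qed

lemma polyhom_measure_restrict:
  fixes \<gamma> :: "'g::{topological_group_add,t2_space,second_countable_topology} measure"
    and \<eta> :: "'h::{topological_group_add,t2_space,second_countable_topology} measure"
  shows "poly_haar \<gamma> \<eta> R \<mu> \<Longrightarrow> polyhom_measure (Poly R (restrict_space \<mu> R)) = \<mu>"
  using restrict_haar(3)[of R \<mu>] by (simp add: poly_haar_def)

lemma Polh_dominated:
  fixes \<gamma> :: "'g::{topological_group_add,t2_space,second_countable_topology} measure"
    and \<eta> :: "'h::{topological_group_add,t2_space,second_countable_topology} measure"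
  assumes "P \<in> Polh \<gamma> \<eta>"
  shows "dominated_marginals \<gamma> \<eta> (polyhom_measure P)"
proof (cases "P = Zero")
  case True
  then show ?thesis by (simp add: dominated_marginals_def)
next
  case False
  then show ?thesis using assms polyhom_measure_restrict unfolding Polh_iff poly_haar_def by metis
qed

text \<open>A point of \<open>R\<close> outside \<open>S\<close> would have the open neighbourhood
  \<open>- S\<close>, of positive mass because it meets \<open>R\<close>, and of mass zero because
  the measure is carried by \<open>S\<close>. So the measure determines the subgroup.\<close>

lemma haar_on_closed_unique:
  fixes \<mu> :: "'a::{topological_group_add,t2_space,second_countable_topology} measure"
  assumes lc: "locally compact (UNIV :: 'a set)"
    and R: "closed R" "add_subgroup R" "haar_on R \<mu>" and S: "closed S" "add_subgroup S" "haar_on S \<mu>"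
  shows "R = S"
proof -
  have "R \<subseteq> S" if R: "closed R" "add_subgroup R" "haar_on R \<mu>" and S: "closed S" "haar_on S \<mu>" for R S
  proof (rule ccontr)
    assume "\<not> R \<subseteq> S"
    then obtain x where x: "x \<in> R" "x \<in> - S" by blast
    have "emeasure \<mu> (- S) > 0"
      by (rule haar_open_pos[OF lc R(2) _ R(3) _ x(2,1)]) (use R(1) S(1) in auto)
    then show False using haar_onD(4)[OF S(2)] by simp
  qed
  then show ?thesis using R S by blast
qed

lemma polyhom_measure_inject:
  fixes \<gamma> :: "'g::{topological_group_add,t2_space,second_countable_topology} measure"
    and \<eta> :: "'h::{topological_group_add,t2_space,second_countable_topology} measure"
  assumes lcG: "locally compact (UNIV :: 'g set)" and lcH: "locally compact (UNIV :: 'h set)"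
    and P: "P \<in> Polh \<gamma> \<eta>" "Q \<in> Polh \<gamma> \<eta>" and eq: "polyhom_measure P = polyhom_measure Q"
  shows "P = Q"
proof -
  have nz: "emeasure (polyhom_measure P) UNIV \<noteq> 0" if "poly_haar \<gamma> \<eta> R \<mu>" "P = Poly R (restrict_space \<mu> R)" for P R \<mu>
    using that polyhom_measure_restrict[OF that(1)] haar_onD(5)[of R \<mu>] unfolding poly_haar_def by auto
  have z: "emeasure (polyhom_measure Zero) UNIV = 0" by simp
  consider "P = Zero" "Q = Zero" | R \<mu> S \<nu> where "poly_haar \<gamma> \<eta> R \<mu>" "P = Poly R (restrict_space \<mu> R)"
    "poly_haar \<gamma> \<eta> S \<nu>" "Q = Poly S (restrict_space \<nu> S)"
    using P nz z eq unfolding Polh_iff by metis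
  then show ?thesis
  proof cases
    case 2
    then have "\<mu> = \<nu>" using eq polyhom_measure_restrict by metis
    moreover have "R = S"
      by (rule haar_on_closed_unique[OF lc_prod[OF lcG lcH], of R \<mu> S]) (use 2 \<open>\<mu> = \<nu>\<close> in \<open>auto simp: poly_haar_def\<close>)
    ultimately show ?thesis using 2 by simp
  qed simp
qed

text \<open>A relatively compact neighbourhood of 0 in \<open>D\<close> has positive finite mass, so
  the factor can be read off from it. This evaluates the definite descriptions in
  \<open>alpha\<close> and \<open>beta\<close>.\<close>

lemma the_proportionality_constant:
  fixes \<gamma> :: "'g::{topological_group_add,t2_space,second_countable_topology} measure"
  assumes lcG: "locally compact (UNIV :: 'g set)" and \<gamma>: "haar_on UNIV \<gamma>" and D: "open D" "0 \<in> D"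
    and \<nu>: "sets \<nu> = sets borel" and a: "a > 0" "\<And>A. A \<in> sets borel \<Longrightarrow> emeasure \<nu> A = ennreal a * emeasure \<gamma> (D \<inter> A)"
  shows "(THE a. 0 < a \<and> \<nu> = scale_measure (ennreal a) (density \<gamma> (indicator D))) = a"
proof (rule the_equality)
  note G = haar_onD[OF \<gamma>]
  have d: "emeasure (scale_measure (ennreal b) (density \<gamma> (indicator D))) A = ennreal b * emeasure \<gamma> (D \<inter> A)"
    if "A \<in> sets borel" for A b
  proof -
    have "emeasure (density \<gamma> (indicator D)) A = emeasure \<gamma> (D \<inter> A)"
      using that D(1) by (subst emeasure_density)
        (auto simp: G(2) intro!: borel_measurable_indicator simp flip: indicator_inter_arith)
    then show ?thesis by simp
  qed
  show "0 < a \<and> \<nu> = scale_measure (ennreal a) (density \<gamma> (indicator D))"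
    by (intro conjI a(1) measure_eqI) (use a(2) d \<nu> in \<open>auto simp: G(2)\<close>)
  fix b assume b: "0 < b \<and> \<nu> = scale_measure (ennreal b) (density \<gamma> (indicator D))"
  obtain V K where VK: "open V" "compact K" "0 \<in> V" "V \<subseteq> K" "K \<subseteq> D"
    by (rule lc_nbhd[OF lcG D])
  have pos: "emeasure \<gamma> V > 0" by (rule haar_open_pos[OF lcG add_subgroup_UNIV _ \<gamma> VK(1,3)]) auto
  have fin: "emeasure \<gamma> V < \<infinity>" using compact_finite_subset_compact[OF G(1) VK(2,4)] .
  have "D \<inter> V = V" using VK by blast
  then have "ennreal a * emeasure \<gamma> V = ennreal b * emeasure \<gamma> V"
    using a(2)[of V] d[of V b] b VK(1) by simp
  then have "ennreal a = ennreal b"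
    using pos fin by (metis ennreal_mult_cancel_left mult.commute less_irrefl infinity_ennreal_def)
  then show "b = a" using a(1) b by simp
qed

lemma alpha_eq:
  fixes \<gamma> :: "'g::{topological_group_add,t2_space,second_countable_topology} measure"
    and \<mu> :: "('g \<times> 'h::{topological_group_add,t2_space,second_countable_topology}) measure"
  assumes lc: "locally compact (UNIV :: 'g set)" and \<gamma>: "haar_on UNIV \<gamma>"
    and R: "closed R" "add_subgroup R" "haar_on R \<mu>" "open (Domain R)"
    and a: "a > 0" "\<And>A. A \<in> sets borel \<Longrightarrow> emeasure \<mu> (A \<times> UNIV) = ennreal a * emeasure \<gamma> (Domain R \<inter> A)"
  shows "alpha \<gamma> R (restrict_space \<mu> R) = a"
  unfolding alpha_def
proof (rule the_proportionality_constant[OF lc \<gamma> R(4) _ _ a(1)])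
  note H = restrict_haar[OF R(1,3)]
  note C = closed_restrict_measure[OF R(1) H(1)]
  show "0 \<in> Domain R" using add_subgroupD(1)[OF R(2)] by (auto simp: zero_prod_def)
  have "continuous_on UNIV (fst :: 'g \<times> 'h \<Rightarrow> 'g)" by (intro continuous_intros)
  then have m: "fst \<in> measurable (restrict_space \<mu> R) borel"
    using measurable_compose[OF C(2) borel_measurable_continuous_onI] by blast
  fix A :: "'g set" assume A: "A \<in> sets borel"
  have "fst -` A \<inter> space (restrict_space \<mu> R) = (A \<times> UNIV) \<inter> R" using C(1) by auto
  then have "emeasure (distr (restrict_space \<mu> R) borel fst) A = emeasure \<mu> (A \<times> UNIV)"
    using A m H(2)[of "A \<times> UNIV"] by (simp add: emeasure_distr borel_Times)
  then show "emeasure (distr (restrict_space \<mu> R) borel fst) A = ennreal a * emeasure \<gamma> (Domain R \<inter> A)"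
    using a(2)[OF A] by simp
qed simp

lemma beta_eq:
  fixes \<eta> :: "'h::{topological_group_add,t2_space,second_countable_topology} measure"
    and \<mu> :: "('g::{topological_group_add,t2_space,second_countable_topology} \<times> 'h) measure"
  assumes lc: "locally compact (UNIV :: 'h set)" and \<eta>: "haar_on UNIV \<eta>"
    and R: "closed R" "add_subgroup R" "haar_on R \<mu>" "open (Range R)"
    and a: "a > 0" "\<And>A. A \<in> sets borel \<Longrightarrow> emeasure \<mu> (UNIV \<times> A) = ennreal a * emeasure \<eta> (Range R \<inter> A)"
  shows "beta \<eta> R (restrict_space \<mu> R) = a"
  unfolding beta_def
proof (rule the_proportionality_constant[OF lc \<eta> R(4) _ _ a(1)])
  note H = restrict_haar[OF R(1,3)]
  note C = closed_restrict_measure[OF R(1) H(1)]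
  show "0 \<in> Range R" using add_subgroupD(1)[OF R(2)] by (auto simp: zero_prod_def)
  have "continuous_on UNIV (snd :: 'g \<times> 'h \<Rightarrow> 'h)" by (intro continuous_intros)
  then have m: "snd \<in> measurable (restrict_space \<mu> R) borel"
    using measurable_compose[OF C(2) borel_measurable_continuous_onI] by blast
  fix A :: "'h set" assume A: "A \<in> sets borel"
  have "snd -` A \<inter> space (restrict_space \<mu> R) = (UNIV \<times> A) \<inter> R" using C(1) by auto
  then have "emeasure (distr (restrict_space \<mu> R) borel snd) A = emeasure \<mu> (UNIV \<times> A)"
    using A m H(2)[of "UNIV \<times> A"] by (simp add: emeasure_distr borel_Times)
  then show "emeasure (distr (restrict_space \<mu> R) borel snd) A = ennreal a * emeasure \<eta> (Range R \<inter> A)"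
    using a(2)[OF A] by simp
qed simp

text \<open>The marginal of \<open>\<sigma>\<close> is \<open>b\<close> times the mass that
  \<open>\<rho>\<close> gives to \<open>E \<times> Domain T\<close>. By
  \<open>index_marginal\<close>, this mass times the index is the mass above
  \<open>E \<inter> Domain (R O T)\<close>, which \<open>a\<close> converts into a value of
  \<open>\<gamma>\<close>.\<close>

lemma composed_marginal_const:
  fixes \<gamma> :: "'g::{topological_group_add,t2_space,second_countable_topology} measure"
    and \<eta> :: "'h::{topological_group_add,t2_space,second_countable_topology} measure"
    and \<kappa> :: "'k::{topological_group_add,t2_space,second_countable_topology} measure"
  assumes lcG: "locally compact (UNIV :: 'g set)" and lcH: "locally compact (UNIV :: 'h set)" and lcK: "locally compact (UNIV :: 'k set)"
    and \<gamma>: "haar_on UNIV \<gamma>" and \<eta>: "haar_on UNIV \<eta>" and \<kappa>: "haar_on UNIV \<kappa>" and rinv: "right_invariant \<eta>"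
    and R: "poly_haar \<gamma> \<eta> R \<rho>" and T: "poly_haar \<eta> \<kappa> T \<tau>" and \<sigma>: "composed \<gamma> \<eta> \<kappa> \<rho> \<tau> \<sigma>"
    and a: "a > 0" "\<And>E. E \<in> sets borel \<Longrightarrow> emeasure \<rho> (E \<times> UNIV) = ennreal a * emeasure \<gamma> (Domain R \<inter> E)"
    and b: "b > 0" "\<And>E. E \<in> sets borel \<Longrightarrow> emeasure \<tau> (E \<times> UNIV) = ennreal b * emeasure \<eta> (Domain T \<inter> E)"
    and E: "E \<in> sets borel"
  defines "c \<equiv> a * b / real (subgroup_index (indef_rel R) (indef_rel R \<inter> Domain T))"
  shows "c > 0" "emeasure \<sigma> (E \<times> UNIV) = ennreal c * emeasure \<gamma> (Domain (R O T) \<inter> E)"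
proof -
  let ?n = "subgroup_index (indef_rel R) (indef_rel R \<inter> Domain T)"
  have D: "add_subgroup (Domain T)" "open (Domain T)"
    by (rule add_subgroup_Domain[OF lcH lcK \<eta> T], rule poly_haar_open_Domain[OF lcH lcK \<eta> T])
  note I = index_marginal[OF lcG lcH \<gamma> R D]
  have S: "poly_haar \<gamma> \<kappa> (R O T) \<sigma>"
    by (rule composed_poly_haar[OF lcG lcH lcK \<gamma> \<eta> \<kappa> rinv R T \<sigma>])
  have dS: "{g. \<exists>h\<in>Domain T. (g, h) \<in> R} = Domain (R O T)" by auto
  have mS: "Domain (R O T) \<in> sets borel" using poly_haar_open_Domain[OF lcG lcK \<gamma> S] by simp
  have n: "real ?n > 0" using I(1) by simp
  show "c > 0" unfolding c_def using a b n by simp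
  have sub: "Domain R \<inter> (E \<inter> Domain (R O T)) = Domain (R O T) \<inter> E" by auto
  have "of_nat ?n * emeasure \<rho> (E \<times> Domain T) = emeasure \<rho> ((E \<inter> Domain (R O T)) \<times> UNIV)"
    using I(2)[OF E] mS unfolding dS by simp
  also have "\<dots> = ennreal a * emeasure \<gamma> (Domain (R O T) \<inter> E)"
    using a(2)[of "E \<inter> Domain (R O T)"] E mS unfolding sub by simp
  finally have 1: "ennreal (real ?n) * emeasure \<rho> (E \<times> Domain T) = ennreal a * emeasure \<gamma> (Domain (R O T) \<inter> E)"
    by (simp add: ennreal_of_nat_eq_real_of_nat)
  have "emeasure \<rho> (E \<times> Domain T) = ennreal (1 / real ?n) * (ennreal (real ?n) * emeasure \<rho> (E \<times> Domain T))"
    using n by (simp add: mult.assoc[symmetric] ennreal_mult[symmetric])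
  also have "\<dots> = ennreal (a / real ?n) * emeasure \<gamma> (Domain (R O T) \<inter> E)"
    unfolding 1 using n a(1) by (simp add: mult.assoc[symmetric] ennreal_mult[symmetric])
  finally have 2: "emeasure \<rho> (E \<times> Domain T) = ennreal (a / real ?n) * emeasure \<gamma> (Domain (R O T) \<inter> E)" .
  have "emeasure \<sigma> (E \<times> UNIV) = ennreal b * emeasure \<rho> (E \<times> Domain T)"
    by (rule composed_marginal[OF lcG lcH lcK \<gamma> \<eta> \<kappa> rinv R T \<sigma> b(2) E])
  also have "\<dots> = ennreal c * emeasure \<gamma> (Domain (R O T) \<inter> E)"
  proof -
    have "ennreal b * ennreal (a / real ?n) = ennreal c"
      unfolding c_def using a(1) b(1) n by (simp add: ennreal_mult[symmetric] mult.commute)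
    then show ?thesis unfolding 2 by (simp only: mult.assoc[symmetric])
  qed
  finally show "emeasure \<sigma> (E \<times> UNIV) = ennreal c * emeasure \<gamma> (Domain (R O T) \<inter> E)" .
qed

text \<open>The composed measure has the prescribed \<alpha> and, by the same computation for the
  converses, the prescribed \<beta>. Every Haar measure of \<open>R O T\<close> is a multiple of it,
  and \<alpha> fixes the factor.\<close>

lemma polyhom_prod_Poly:
  fixes \<gamma> :: "'g::{topological_group_add,t2_space,second_countable_topology} measure"
    and \<eta> :: "'h::{topological_group_add,t2_space,second_countable_topology} measure"
    and \<kappa> :: "'k::{topological_group_add,t2_space,second_countable_topology} measure"
  assumes lcG: "locally compact (UNIV :: 'g set)" and lcH: "locally compact (UNIV :: 'h set)" and lcK: "locally compact (UNIV :: 'k set)"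
    and \<gamma>: "haar_on UNIV \<gamma>" and \<eta>: "haar_on UNIV \<eta>" and \<kappa>: "haar_on UNIV \<kappa>" and rinv: "right_invariant \<eta>"
    and R: "poly_haar \<gamma> \<eta> R \<rho>" and T: "poly_haar \<eta> \<kappa> T \<tau>"
  shows "\<exists>\<sigma>. composed \<gamma> \<eta> \<kappa> \<rho> \<tau> \<sigma> \<and> poly_haar \<gamma> \<kappa> (R O T) \<sigma> \<and>
    polyhom_prod \<gamma> \<eta> \<kappa> (Poly T (restrict_space \<tau> T)) (Poly R (restrict_space \<rho> R)) = Poly (R O T) (restrict_space \<sigma> (R O T))"
proof -
  note Rp = poly_haarD[OF lcG lcH \<gamma> R] and Tp = poly_haarD[OF lcH lcK \<eta> T]
  obtain \<sigma> where \<sigma>: "composed \<gamma> \<eta> \<kappa> \<rho> \<tau> \<sigma>"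
    using composed_exists[OF lcG lcH lcK \<gamma> \<eta> \<kappa> rinv Rp(4) Tp(4)] by blast
  have S: "poly_haar \<gamma> \<kappa> (R O T) \<sigma>"
    by (rule composed_poly_haar[OF lcG lcH lcK \<gamma> \<eta> \<kappa> rinv R T \<sigma>])
  note Sp = poly_haarD[OF lcG lcK \<gamma> S]
  have s: "sets \<rho> = sets borel" "sets \<tau> = sets borel" "sets \<sigma> = sets borel"
    using Rp(4) Tp(4) Sp(4) by (auto simp: dominated_marginals_def)
  note Rc = poly_haar_converse[OF R] and Tc = poly_haar_converse[OF T] and Sc = poly_haar_converse[OF S]
  note \<sigma>c = composed_converse[OF \<sigma> s(1,2)]
  obtain a where a: "a > 0" "\<And>E. E \<in> sets borel \<Longrightarrow> emeasure \<rho> (E \<times> UNIV) = ennreal a * emeasure \<gamma> (Domain R \<inter> E)"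
    using marginal_proportional[OF lcG lcH \<gamma> R] by blast
  obtain b where b: "b > 0" "\<And>E. E \<in> sets borel \<Longrightarrow> emeasure \<tau> (E \<times> UNIV) = ennreal b * emeasure \<eta> (Domain T \<inter> E)"
    using marginal_proportional[OF lcH lcK \<eta> T] by blast
  obtain a' where a': "a' > 0" "\<And>E. E \<in> sets borel \<Longrightarrow> emeasure (converse_measure \<rho>) (E \<times> UNIV) = ennreal a' * emeasure \<eta> (Domain (R\<inverse>) \<inter> E)"
    using marginal_proportional[OF lcH lcG \<eta> Rc] by blast
  obtain b' where b': "b' > 0" "\<And>E. E \<in> sets borel \<Longrightarrow> emeasure (converse_measure \<tau>) (E \<times> UNIV) = ennreal b' * emeasure \<kappa> (Domain (T\<inverse>) \<inter> E)"
    using marginal_proportional[OF lcK lcH \<kappa> Tc] by blast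
  define c where "c = a * b / real (subgroup_index (indef_rel R) (indef_rel R \<inter> Domain T))"
  define c' where "c' = a' * b' / real (subgroup_index (ker_rel T) (ker_rel T \<inter> Range R))"
  have c: "c > 0" "\<And>E. E \<in> sets borel \<Longrightarrow> emeasure \<sigma> (E \<times> UNIV) = ennreal c * emeasure \<gamma> (Domain (R O T) \<inter> E)"
    using composed_marginal_const[OF lcG lcH lcK \<gamma> \<eta> \<kappa> rinv R T \<sigma> a b] unfolding c_def by auto
  have ind: "indef_rel (T\<inverse>) = ker_rel T" by (auto simp: indef_rel_def ker_rel_def)
  have conv: "T\<inverse> O R\<inverse> = (R O T)\<inverse>" by auto
  have c': "c' > 0" "\<And>E. E \<in> sets borel \<Longrightarrow> emeasure \<sigma> (UNIV \<times> E) = ennreal c' * emeasure \<kappa> (Range (R O T) \<inter> E)"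
  proof -
    \<comment> \<open>The converses of \<open>T\<close> and \<open>R\<close> take the roles of
      \<open>R\<close> and \<open>T\<close>; the group \<open>indef_rel\<close> of the converse of
      \<open>T\<close> is \<open>ker_rel T\<close>, which gives the second index.\<close>
    have k: "c' > 0" "\<And>E. E \<in> sets borel \<Longrightarrow> emeasure (converse_measure \<sigma>) (E \<times> UNIV) = ennreal c' * emeasure \<kappa> (Range (R O T) \<inter> E)"
      using composed_marginal_const[OF lcK lcH lcG \<kappa> \<eta> \<gamma> rinv Tc Rc \<sigma>c b' a']
      unfolding ind conv Domain_converse c'_def mult.commute[of a' b'] by auto
    show "c' > 0" by (rule k(1))
    fix E :: "'k set" assume E: "E \<in> sets borel"
    show "emeasure \<sigma> (UNIV \<times> E) = ennreal c' * emeasure \<kappa> (Range (R O T) \<inter> E)"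
      using k(2)[OF E] emeasure_converse_rect[OF s(3) _ E, of UNIV] by simp
  qed
  have oD: "open (Domain R)" "open (Domain T)" "open (Domain (R O T))"
    using poly_haar_open_Domain[OF lcG lcH \<gamma> R] poly_haar_open_Domain[OF lcH lcK \<eta> T] poly_haar_open_Domain[OF lcG lcK \<gamma> S] by auto
  have oR: "open (Range R)" "open (Range T)" "open (Range (R O T))"
    using poly_haar_open_Domain[OF lcH lcG \<eta> Rc] poly_haar_open_Domain[OF lcK lcH \<kappa> Tc] poly_haar_open_Domain[OF lcK lcG \<kappa> Sc]
    by (auto simp: Domain_converse)
  have alR: "alpha \<gamma> R (restrict_space \<rho> R) = a" by (rule alpha_eq[OF lcG \<gamma> Rp(1-3) oD(1) a])
  have alT: "alpha \<eta> T (restrict_space \<tau> T) = b" by (rule alpha_eq[OF lcH \<eta> Tp(1-3) oD(2) b])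
  have beR: "beta \<eta> R (restrict_space \<rho> R) = a'"
    by (rule beta_eq[OF lcH \<eta> Rp(1-3) oR(1) a'(1)])
      (use a'(2) emeasure_converse_rect[OF s(1), of UNIV] in \<open>simp add: Domain_converse\<close>)
  have beT: "beta \<kappa> T (restrict_space \<tau> T) = b'"
    by (rule beta_eq[OF lcK \<kappa> Tp(1-3) oR(2) b'(1)])
      (use b'(2) emeasure_converse_rect[OF s(2), of UNIV] in \<open>simp add: Domain_converse\<close>)
  let ?P = "\<lambda>\<nu>. haar_measure_on (R O T) \<nu> \<and> alpha \<gamma> (R O T) \<nu> = c \<and> beta \<kappa> (R O T) \<nu> = c'"
  have "(THE \<nu>. ?P \<nu>) = restrict_space \<sigma> (R O T)"
  proof (rule the_equality)
    have "haar_measure_on (R O T) (restrict_space \<sigma> (R O T))"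
      using haar_measure_on_iff[OF Sp(1,2)] Sp(3) by blast
    moreover have "alpha \<gamma> (R O T) (restrict_space \<sigma> (R O T)) = c"
      by (rule alpha_eq[OF lcG \<gamma> Sp(1-3) oD(3) c])
    moreover have "beta \<kappa> (R O T) (restrict_space \<sigma> (R O T)) = c'"
      by (rule beta_eq[OF lcK \<kappa> Sp(1-3) oR(3) c'])
    ultimately show "?P (restrict_space \<sigma> (R O T))" by blast
    fix \<nu> assume \<nu>: "?P \<nu>"
    then obtain \<mu> where \<mu>: "haar_on (R O T) \<mu>" "\<nu> = restrict_space \<mu> (R O T)"
      using haar_measure_on_iff[OF Sp(1,2)] by blast
    obtain t where t: "t > 0" "\<And>A. A \<in> sets borel \<Longrightarrow> emeasure \<mu> A = ennreal t * emeasure \<sigma> A"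
      using haar_unique[OF lc_prod[OF lcG lcK] Sp(2,5,3) \<mu>(1)] by blast
    have "alpha \<gamma> (R O T) (restrict_space \<mu> (R O T)) = t * c"
    proof (rule alpha_eq[OF lcG \<gamma> Sp(1,2) \<mu>(1) oD(3)])
      show "0 < t * c" using t c by simp
      fix A :: "'g set" assume A: "A \<in> sets borel"
      show "emeasure \<mu> (A \<times> UNIV) = ennreal (t * c) * emeasure \<gamma> (Domain (R O T) \<inter> A)"
        using t c(2)[OF A] c(1) A by (simp add: borel_Times ennreal_mult mult.assoc)
    qed
    then have "t = 1" using \<nu> \<mu>(2) c(1) by simp
    then have "\<mu> = \<sigma>" using t haar_onD(2)[OF \<mu>(1)] s(3) by (intro measure_eqI) auto
    then show "\<nu> = restrict_space \<sigma> (R O T)" using \<mu>(2) by simp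
  qed
  then have "polyhom_prod \<gamma> \<eta> \<kappa> (Poly T (restrict_space \<tau> T)) (Poly R (restrict_space \<rho> R)) = Poly (R O T) (restrict_space \<sigma> (R O T))"
    by (simp add: alR alT beR beT c_def c'_def)
  then show ?thesis using \<sigma> S by blast
qed

text \<open>If one factor is zero, so is the integral of one of the two densities, and the other
  density is at most 1.\<close>

lemma composed_null:
  assumes "\<rho> = null_measure borel \<or> \<tau> = null_measure borel"
  shows "composed \<gamma> \<eta> \<kappa> \<rho> \<tau> (null_measure borel)"
  unfolding composed_def
proof (rule conjI)
  show "dominated_marginals \<gamma> \<kappa> (null_measure borel)" by (simp add: dominated_marginals_def)
  show "\<forall>A B v u. A \<in> sets borel \<and> B \<in> sets borel \<and> emeasure \<gamma> A < \<infinity> \<and> emeasure \<kappa> B < \<infinity> \<and>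
        slice_density \<eta> \<rho> A v \<and> slice_density \<eta> (converse_measure \<tau>) B u \<longrightarrow>
        emeasure (null_measure borel) (A \<times> B) = (\<integral>\<^sup>+h. ennreal (v h) * ennreal (u h) \<partial>\<eta>)"
  proof (intro allI impI, elim conjE)
    fix A B v u assume vu: "A \<in> sets borel" "B \<in> sets borel" "slice_density \<eta> \<rho> A v" "slice_density \<eta> (converse_measure \<tau>) B u"
    have le: "ennreal (v h) \<le> 1" "ennreal (u h) \<le> 1" for h using vu by (auto simp: slice_density_def)
    have "(\<integral>\<^sup>+h. ennreal (v h) * ennreal (u h) \<partial>\<eta>) \<le> (\<integral>\<^sup>+h. ennreal (v h) \<partial>\<eta>)"
      using mult_left_mono[OF le(2)] by (intro nn_integral_mono) simp
    moreover have "(\<integral>\<^sup>+h. ennreal (v h) * ennreal (u h) \<partial>\<eta>) \<le> (\<integral>\<^sup>+h. ennreal (u h) \<partial>\<eta>)"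
      using mult_right_mono[OF le(1)] by (intro nn_integral_mono) simp
    moreover have "(\<integral>\<^sup>+h. ennreal (v h) \<partial>\<eta>) = emeasure \<rho> (A \<times> UNIV)" "(\<integral>\<^sup>+h. ennreal (u h) \<partial>\<eta>) = emeasure (converse_measure \<tau>) (B \<times> UNIV)"
      using vu by (simp_all add: slice_density_def)
    moreover have "emeasure (converse_measure \<tau>) (B \<times> UNIV) = 0" if "\<tau> = null_measure borel"
      using emeasure_converse_rect[of \<tau> UNIV B] vu(2) that by simp
    ultimately have "(\<integral>\<^sup>+h. ennreal (v h) * ennreal (u h) \<partial>\<eta>) = 0" using assms by auto
    then show "emeasure (null_measure borel) (A \<times> B) = (\<integral>\<^sup>+h. ennreal (v h) * ennreal (u h) \<partial>\<eta>)" by simp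
  qed
qed

lemma polyhom_prod_composed:
  fixes \<gamma> :: "'g::{topological_group_add,t2_space,second_countable_topology} measure"
    and \<eta> :: "'h::{topological_group_add,t2_space,second_countable_topology} measure"
    and \<kappa> :: "'k::{topological_group_add,t2_space,second_countable_topology} measure"
  assumes lcG: "locally compact (UNIV :: 'g set)" and lcH: "locally compact (UNIV :: 'h set)" and lcK: "locally compact (UNIV :: 'k set)"
    and \<gamma>: "haar_on UNIV \<gamma>" and \<eta>: "haar_on UNIV \<eta>" and \<kappa>: "haar_on UNIV \<kappa>" and rinv: "right_invariant \<eta>"
    and P: "P \<in> Polh \<gamma> \<eta>" and Q: "Q \<in> Polh \<eta> \<kappa>"
  shows "polyhom_prod \<gamma> \<eta> \<kappa> Q P \<in> Polh \<gamma> \<kappa>"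
    "composed \<gamma> \<eta> \<kappa> (polyhom_measure P) (polyhom_measure Q) (polyhom_measure (polyhom_prod \<gamma> \<eta> \<kappa> Q P))"
proof -
  have "polyhom_prod \<gamma> \<eta> \<kappa> Q P \<in> Polh \<gamma> \<kappa> \<and>
    composed \<gamma> \<eta> \<kappa> (polyhom_measure P) (polyhom_measure Q) (polyhom_measure (polyhom_prod \<gamma> \<eta> \<kappa> Q P))"
  proof (cases "P = Zero \<or> Q = Zero")
    case True
    then have "polyhom_prod \<gamma> \<eta> \<kappa> Q P = Zero" by (cases Q) auto
    moreover have "polyhom_measure P = null_measure borel \<or> polyhom_measure Q = null_measure borel" using True by auto
    ultimately show ?thesis using composed_null by (simp add: Polh_def)
  next
    case False
    obtain R \<rho> where R: "poly_haar \<gamma> \<eta> R \<rho>" "P = Poly R (restrict_space \<rho> R)" using P False unfolding Polh_iff by blast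
    obtain T \<tau> where T: "poly_haar \<eta> \<kappa> T \<tau>" "Q = Poly T (restrict_space \<tau> T)" using Q False unfolding Polh_iff by blast
    obtain \<sigma> where \<sigma>: "composed \<gamma> \<eta> \<kappa> \<rho> \<tau> \<sigma>" "poly_haar \<gamma> \<kappa> (R O T) \<sigma>"
      "polyhom_prod \<gamma> \<eta> \<kappa> Q P = Poly (R O T) (restrict_space \<sigma> (R O T))"
      using polyhom_prod_Poly[OF lcG lcH lcK \<gamma> \<eta> \<kappa> rinv R(1) T(1)] R(2) T(2) by blast
    have "polyhom_measure P = \<rho>" "polyhom_measure Q = \<tau>" "polyhom_measure (polyhom_prod \<gamma> \<eta> \<kappa> Q P) = \<sigma>"
      unfolding R(2) T(2) \<sigma>(3)[unfolded R(2) T(2)]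
      by (rule polyhom_measure_restrict[OF R(1)] polyhom_measure_restrict[OF T(1)] polyhom_measure_restrict[OF \<sigma>(2)])+
    then show ?thesis using \<sigma> unfolding Polh_iff by metis
  qed
  then show "polyhom_prod \<gamma> \<eta> \<kappa> Q P \<in> Polh \<gamma> \<kappa>"
    "composed \<gamma> \<eta> \<kappa> (polyhom_measure P) (polyhom_measure Q) (polyhom_measure (polyhom_prod \<gamma> \<eta> \<kappa> Q P))" by auto
qed

section \<open>Continuity, metrizability and compactness\<close>

context
  fixes \<gamma> :: "'g::{topological_group_add,t2_space,second_countable_topology} measure"
    and \<eta> :: "'h::{topological_group_add,t2_space,second_countable_topology} measure"
  assumes lcG: "locally compact (UNIV :: 'g set)" and lcH: "locally compact (UNIV :: 'h set)"
    and \<gamma>: "haar_on UNIV \<gamma>" and \<eta>: "haar_on UNIV \<eta>"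
begin

text \<open>Convergence tested on \<open>Cc\<close> extends to slice densities and indicators, the
  test functions that arise from products.\<close>

lemma polyhom_converges_tensor:
  fixes f :: "'g \<Rightarrow> real" and g :: "'h \<Rightarrow> real"
  assumes X: "\<And>j. X j \<in> Polh \<gamma> \<eta>" and L: "L \<in> Polh \<gamma> \<eta>" and conv: "polyhom_converges X L"
    and f: "integrable \<gamma> f" and g: "integrable \<eta> g" "\<And>x. \<bar>g x\<bar> \<le> C"
  shows "(\<lambda>j. \<integral>z. f (fst z) * g (snd z) \<partial>polyhom_measure (X j)) \<longlonglongrightarrow> (\<integral>z. f (fst z) * g (snd z) \<partial>polyhom_measure L)"
proof -
  obtain B1 :: "nat \<Rightarrow> 'g set" where b1: "base_sequence B1"
    by (rule lc_base_sequence[OF lcG])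
  note B1 = base_sequenceD[OF b1]
  obtain B2 :: "nat \<Rightarrow> 'h set" where b2: "base_sequence B2"
    by (rule lc_base_sequence[OF lcH])
  note B2 = base_sequenceD[OF b2]
  show ?thesis
    using vague_iff_rectangles(2)[where F = sequentially and M = "\<lambda>j. polyhom_measure (X j)" and f = f and g = g and C = C, OF lcG lcH haar_onD(1)[OF \<gamma>] haar_onD(1)[OF \<eta>]
        Polh_dominated[OF X] Polh_dominated[OF L] b1 b2] conv f g
    unfolding polyhom_converges_def by blast
qed

lemma polyhom_convergesI:
  assumes X: "\<And>j. X j \<in> Polh \<gamma> \<eta>" and L: "L \<in> Polh \<gamma> \<eta>"
    and conv: "\<And>A B. A \<in> sets borel \<Longrightarrow> B \<in> sets borel \<Longrightarrow> emeasure \<gamma> A < \<infinity> \<Longrightarrow> emeasure \<eta> B < \<infinity> \<Longrightarrow>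
      (\<lambda>j. measure (polyhom_measure (X j)) (A \<times> B)) \<longlonglongrightarrow> measure (polyhom_measure L) (A \<times> B)"
  shows "polyhom_converges X L"
proof -
  note G = haar_onD[OF \<gamma>] and H = haar_onD[OF \<eta>]
  obtain B1 :: "nat \<Rightarrow> 'g set" where b1: "base_sequence B1"
    by (rule lc_base_sequence[OF lcG])
  note B1 = base_sequenceD[OF b1]
  obtain B2 :: "nat \<Rightarrow> 'h set" where b2: "base_sequence B2"
    by (rule lc_base_sequence[OF lcH])
  note B2 = base_sequenceD[OF b2]
  have "emeasure \<gamma> (B1 n) < \<infinity>" "emeasure \<eta> (B2 n) < \<infinity>" for n
    using compact_finite_subset_compact[OF G(1) B1(2) closure_subset] compact_finite_subset_compact[OF H(1) B2(2) closure_subset] by auto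
  then have "\<forall>m n. (\<lambda>j. measure (polyhom_measure (X j)) (B1 m \<times> B2 n)) \<longlonglongrightarrow> measure (polyhom_measure L) (B1 m \<times> B2 n)"
    using B1(1) B2(1) by (intro allI conv) auto
  then show ?thesis
    using vague_iff_rectangles(1)[where F = sequentially and M = "\<lambda>j. polyhom_measure (X j)", OF lcG lcH G(1) H(1) Polh_dominated[OF X] Polh_dominated[OF L] b1 b2]
    unfolding polyhom_converges_def by blast
qed

text \<open>The masses of the base rectangles embed \<open>Polh \<gamma> \<eta>\<close> into a
  compact cube in the space of real sequences, and the metric is pulled back from there. Compactness
  requires that limits of coordinate sequences come from \<open>Polh \<gamma> \<eta>\<close>; they
  are identified through a cluster measure, which is again zero or a Haar measure.\<close>

lemma polyhom_metrizable_compact: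
  "\<exists>d. Metric_space (Polh \<gamma> \<eta>) d \<and>
      (\<forall>X L. (\<forall>j. X j \<in> Polh \<gamma> \<eta>) \<and> L \<in> Polh \<gamma> \<eta> \<longrightarrow>
         (polyhom_converges X L \<longleftrightarrow> limitin (Metric_space.mtopology (Polh \<gamma> \<eta>) d) X L sequentially)) \<and>
      compact_space (Metric_space.mtopology (Polh \<gamma> \<eta>) d)"
proof -
  note G = haar_onD[OF \<gamma>] and H = haar_onD[OF \<eta>]
  obtain B1 :: "nat \<Rightarrow> 'g set" where b1: "base_sequence B1"
    by (rule lc_base_sequence[OF lcG])
  note B1 = base_sequenceD[OF b1]
  obtain B2 :: "nat \<Rightarrow> 'h set" where b2: "base_sequence B2"
    by (rule lc_base_sequence[OF lcH])
  note B2 = base_sequenceD[OF b2]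
  have Bf: "emeasure \<gamma> (B1 n) < \<infinity>" "emeasure \<eta> (B2 n) < \<infinity>" for n
    using compact_finite_subset_compact[OF G(1) B1(2) closure_subset] compact_finite_subset_compact[OF H(1) B2(2) closure_subset] by auto
  have Bb: "B1 n \<in> sets borel" "B2 n \<in> sets borel" for n using B1(1) B2(1) by auto
  \<comment> \<open>\<open>prod_decode\<close> enumerates the pairs of indices, giving one
    coordinate for each base rectangle.\<close>
  define coord :: "('g, 'h) polyhom \<Rightarrow> nat \<Rightarrow> real"
    where "coord P n = measure (polyhom_measure P) (B1 (fst (prod_decode n)) \<times> B2 (snd (prod_decode n)))" for P n
  define d where "d P Q = dist (coord P) (coord Q)" for P Q
  have coord_tendsto: "(\<lambda>j. coord (X j)) \<longlonglongrightarrow> v \<longleftrightarrow> (\<forall>n. (\<lambda>j. coord (X j) n) \<longlonglongrightarrow> v n)" for X v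
    using limitin_componentwise[of "\<lambda>i. euclidean :: real topology" "UNIV :: nat set" "\<lambda>j. coord (X j)" v sequentially]
    by (simp add: euclidean_product_topology)
  have rects: "(\<forall>n. (\<lambda>j. coord (X j) n) \<longlonglongrightarrow> coord L n) \<longleftrightarrow>
      (\<forall>m n. (\<lambda>j. measure (polyhom_measure (X j)) (B1 m \<times> B2 n)) \<longlonglongrightarrow> measure (polyhom_measure L) (B1 m \<times> B2 n))" for X L
    unfolding coord_def by (metis prod_encode_inverse fst_conv snd_conv)
  have conv_iff: "polyhom_converges X L \<longleftrightarrow> (\<lambda>j. coord (X j)) \<longlonglongrightarrow> coord L"
    if "\<And>j. X j \<in> Polh \<gamma> \<eta>" "L \<in> Polh \<gamma> \<eta>" for X L
    unfolding coord_tendsto rects polyhom_converges_def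
    using vague_iff_rectangles(1)[where F = sequentially and M = "\<lambda>j. polyhom_measure (X j)",
        OF lcG lcH G(1) H(1) Polh_dominated[OF that(1)] Polh_dominated[OF that(2)] b1 b2] by blast
  have inj: "P = Q" if PQ: "P \<in> Polh \<gamma> \<eta>" "Q \<in> Polh \<gamma> \<eta>" and eq: "coord P = coord Q" for P Q
  proof (rule polyhom_measure_inject[OF lcG lcH PQ])
    note dP = Polh_dominated[OF PQ(1)] and dQ = Polh_dominated[OF PQ(2)]
    \<comment> \<open>Equal coordinates mean that the constant sequence \<open>P\<close> converges
      to \<open>Q\<close>; the integrals against all admissible test functions therefore agree,
      including the indicators of finite rectangles.\<close>
    have c: "polyhom_converges (\<lambda>_. P) Q"
      using conv_iff[of "\<lambda>_. P" Q] PQ eq by simp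
    show "polyhom_measure P = polyhom_measure Q"
    proof (rule finite_rect_measure_eqI[OF lcG lcH G(1) H(1) dP dominated_marginalsD(1)[OF dQ]])
      fix A :: "'g set" and B :: "'h set"
      assume AB: "A \<in> sets borel" "B \<in> sets borel" "emeasure \<gamma> A < \<infinity>" "emeasure \<eta> B < \<infinity>"
      have "(\<lambda>j::nat. \<integral>z. indicat_real A (fst z) * indicat_real B (snd z) \<partial>polyhom_measure P) \<longlonglongrightarrow>
          (\<integral>z. indicat_real A (fst z) * indicat_real B (snd z) \<partial>polyhom_measure Q)"
      proof (rule polyhom_converges_tensor[OF PQ c, where C = 1])
        show "integrable \<gamma> (indicat_real A)" "integrable \<eta> (indicat_real B)" using AB G(2) H(2) by auto
      qed (simp add: indicator_def)
      then have "measure (polyhom_measure P) (A \<times> B) = measure (polyhom_measure Q) (A \<times> B)"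
        using tensor_indicator[OF AB(1,2) dominated_marginalsD(1)[OF dP]] tensor_indicator[OF AB(1,2) dominated_marginalsD(1)[OF dQ]]
        by (simp add: LIMSEQ_const_iff)
      moreover have "emeasure (polyhom_measure P) (A \<times> B) < \<infinity>" "emeasure (polyhom_measure Q) (A \<times> B) < \<infinity>"
        using dominated_marginals_rect(1)[OF dP AB(1,2)] dominated_marginals_rect(1)[OF dQ AB(1,2)] AB(3) by (auto intro: le_less_trans)
      ultimately show "emeasure (polyhom_measure P) (A \<times> B) = emeasure (polyhom_measure Q) (A \<times> B)"
        by (simp add: emeasure_eq_ennreal_measure less_top)
    qed
  qed
  interpret Metric_space "Polh \<gamma> \<eta>" d
    by unfold_locales (use inj in \<open>auto simp: d_def dist_commute dist_triangle\<close>)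
  have lim: "limitin mtopology X L sequentially \<longleftrightarrow> (\<lambda>j. coord (X j)) \<longlonglongrightarrow> coord L"
    if "\<And>j. X j \<in> Polh \<gamma> \<eta>" "L \<in> Polh \<gamma> \<eta>" for X L
    unfolding limit_metric_sequentially lim_sequentially d_def using that by auto
  have "compact_space mtopology"
    unfolding compact_space_sequentially
  proof (intro allI impI)
    fix X :: "nat \<Rightarrow> ('g, 'h) polyhom" assume "range X \<subseteq> Polh \<gamma> \<eta>"
    then have X: "X j \<in> Polh \<gamma> \<eta>" for j by blast
    let ?b = "\<lambda>n. measure \<gamma> (B1 (fst (prod_decode n)))"
    have "coord P n \<in> {0..?b n}" if "P \<in> Polh \<gamma> \<eta>" for P n
    proof -
      have "emeasure (polyhom_measure P) (B1 (fst (prod_decode n)) \<times> B2 (snd (prod_decode n))) \<le> emeasure \<gamma> (B1 (fst (prod_decode n)))"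
        by (rule dominated_marginals_rect(1)[OF Polh_dominated[OF that] Bb])
      then show ?thesis unfolding coord_def measure_def using Bf(1)[of "fst (prod_decode n)"] by (auto intro: enn2real_mono)
    qed
    then have inb: "coord (X j) \<in> PiE UNIV (\<lambda>n. {0..?b n})" for j using X by (auto simp: PiE_iff)
    have "compactin (product_topology (\<lambda>i. euclidean) UNIV) (PiE UNIV (\<lambda>n. {0..?b n}))"
      unfolding compactin_PiE by auto
    then have "compact (PiE UNIV (\<lambda>n. {0..?b n}))" by (simp add: euclidean_product_topology)
    then have "seq_compact (PiE UNIV (\<lambda>n. {0..?b n}))" by (rule compact_imp_seq_compact)
    \<comment> \<open>The subsequence is chosen in the cube, before any limit measure is
      known.\<close>
    then obtain v r where v: "strict_mono r" "((\<lambda>j. coord (X j)) \<circ> r) \<longlonglongrightarrow> v"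
      using inb by (metis seq_compactE)
    let ?M = "\<lambda>j. polyhom_measure (X (r j))"
    have dM: "dominated_marginals \<gamma> \<eta> (?M j)" for j by (rule Polh_dominated[OF X])
    obtain F \<mu> where F: "F \<noteq> bot" "F \<le> sequentially" and \<mu>: "dominated_marginals \<gamma> \<eta> \<mu>"
      and conv: "\<And>A B. A \<in> sets borel \<Longrightarrow> B \<in> sets borel \<Longrightarrow> emeasure \<gamma> A < \<infinity> \<Longrightarrow> emeasure \<eta> B < \<infinity> \<Longrightarrow>
         ((\<lambda>j. measure (?M j) (A \<times> B)) \<longlongrightarrow> measure \<mu> (A \<times> B)) F"
      by (rule dominated_marginals_cluster[where M = ?M, OF lcG lcH G(1) H(1) dM]) blast
    \<comment> \<open>A cluster measure without mass is the measure of \<open>Zero\<close>;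
      otherwise \<open>haar_limit\<close> applies along the filter.\<close>
    have "\<exists>L\<in>Polh \<gamma> \<eta>. polyhom_measure L = \<mu>"
    proof (cases "emeasure \<mu> UNIV = 0")
      case True
      note s = dominated_marginalsD(1)[OF \<mu>]
      have "null_measure borel = \<mu>"
      proof (rule measure_eqI)
        fix A :: "('g \<times> 'h) set" assume "A \<in> sets (null_measure borel)"
        then have "emeasure \<mu> A \<le> emeasure \<mu> UNIV" using s by (intro emeasure_mono) auto
        then show "emeasure (null_measure borel) A = emeasure \<mu> A" using True by simp
      qed (simp add: s)
      then show ?thesis by (intro bexI[of _ Zero]) (auto simp: Polh_def)
    next
      case False
      have "\<exists>S. poly_haar \<gamma> \<eta> S \<mu>"
      proof (rule haar_limit[OF lcG lcH \<gamma> \<eta> F(1) dM _ \<mu> False conv])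
        fix j assume nz: "emeasure (?M j) UNIV \<noteq> 0"
        then have "X (r j) \<noteq> Zero" by auto
        then obtain R \<nu> where R: "poly_haar \<gamma> \<eta> R \<nu>" "X (r j) = Poly R (restrict_space \<nu> R)"
          using X[of "r j"] unfolding Polh_iff by blast
        have "?M j = \<nu>" unfolding R(2) by (rule polyhom_measure_restrict[OF R(1)])
        then show "\<exists>R. R \<in> sets borel \<and> haar_on R (?M j)" using R(1) by (auto simp: poly_haar_def intro!: exI[of _ R])
      qed
      then obtain S where S: "poly_haar \<gamma> \<eta> S \<mu>" by blast
      then show ?thesis using polyhom_measure_restrict[OF S] Polh_iff by blast
    qed
    then obtain L where L: "L \<in> Polh \<gamma> \<eta>" "polyhom_measure L = \<mu>" by blast
    \<comment> \<open>Along the subsequence the coordinates converge to \<open>v\<close>, and along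
      the finer filter \<open>F\<close> to those of \<open>L\<close>. The limits agree, so the
      subsequence itself converges to \<open>L\<close>.\<close>
    have "v n = coord L n" for n
    proof (rule tendsto_unique[OF F(1)])
      have "(\<lambda>j. coord (X (r j)) n) \<longlonglongrightarrow> v n"
        using v(2) coord_tendsto[of "\<lambda>j. X (r j)" v] by (simp add: comp_def)
      then show "((\<lambda>j. coord (X (r j)) n) \<longlongrightarrow> v n) F" using F(2) by (rule filterlim_mono[OF _ order_refl])
      show "((\<lambda>j. coord (X (r j)) n) \<longlongrightarrow> coord L n) F"
        unfolding coord_def L(2) by (rule conv[OF Bb Bf])
    qed
    then have "v = coord L" by blast
    then have "limitin mtopology (X \<circ> r) L sequentially"
      using lim[of "X \<circ> r" L] X L(1) v(2) by (simp add: comp_def)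
    then show "\<exists>L r. L \<in> Polh \<gamma> \<eta> \<and> strict_mono r \<and> limitin mtopology (X \<circ> r) L sequentially"
      using L(1) v(1) by blast
  qed
  then show ?thesis using Metric_space_axioms lim conv_iff by blast
qed

end

lemma composed_measure_integral:
  fixes \<rho> :: "('g::{t2_space,second_countable_topology} \<times> 'h::{t2_space,second_countable_topology}) measure"
  assumes s: "sets \<rho> = sets borel" and f: "f \<in> borel_measurable borel" "\<And>x. 0 \<le> f x"
    and g: "g \<in> borel_measurable borel" "\<And>y. 0 \<le> g y"
    and e: "emeasure \<sigma> C = (\<integral>\<^sup>+z. ennreal (f (fst z)) * ennreal (g (snd z)) \<partial>\<rho>)"
  shows "measure \<sigma> C = (\<integral>z. f (fst z) * g (snd z) \<partial>\<rho>)"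
proof -
  have c: "continuous_on UNIV (fst :: 'g \<times> 'h \<Rightarrow> 'g)" "continuous_on UNIV (snd :: 'g \<times> 'h \<Rightarrow> 'h)"
    by (intro continuous_intros)+
  have "(\<lambda>z. f (fst z) * g (snd z)) \<in> borel_measurable \<rho>"
    unfolding measurable_cong_sets[OF s refl]
    by (intro borel_measurable_times measurable_compose[OF borel_measurable_continuous_onI[OF c(1)] f(1)]
      measurable_compose[OF borel_measurable_continuous_onI[OF c(2)] g(1)])
  then have "(\<integral>z. f (fst z) * g (snd z) \<partial>\<rho>) = enn2real (\<integral>\<^sup>+z. ennreal (f (fst z) * g (snd z)) \<partial>\<rho>)"
    using f(2) g(2) by (intro integral_eq_nn_integral) auto
  then show ?thesis unfolding measure_def e using f(2) g(2) by (simp add: ennreal_mult)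
qed

lemma polyhom_prod_continuous:
  fixes \<gamma> :: "'g::{topological_group_add,t2_space,second_countable_topology} measure"
    and \<eta> :: "'h::{topological_group_add,t2_space,second_countable_topology} measure"
    and \<kappa> :: "'k::{topological_group_add,t2_space,second_countable_topology} measure"
  assumes lcG: "locally compact (UNIV :: 'g set)" and lcH: "locally compact (UNIV :: 'h set)" and lcK: "locally compact (UNIV :: 'k set)"
    and \<gamma>: "haar_on UNIV \<gamma>" and \<eta>: "haar_on UNIV \<eta>" and \<kappa>: "haar_on UNIV \<kappa>" and rinv: "right_invariant \<eta>"
  shows "Q \<in> Polh \<eta> \<kappa> \<Longrightarrow> (\<And>j. X j \<in> Polh \<gamma> \<eta>) \<Longrightarrow> L \<in> Polh \<gamma> \<eta> \<Longrightarrow> polyhom_converges X L \<Longrightarrow>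
      polyhom_converges (\<lambda>j. polyhom_prod \<gamma> \<eta> \<kappa> Q (X j)) (polyhom_prod \<gamma> \<eta> \<kappa> Q L)"
    "P \<in> Polh \<gamma> \<eta> \<Longrightarrow> (\<And>j. Y j \<in> Polh \<eta> \<kappa>) \<Longrightarrow> L' \<in> Polh \<eta> \<kappa> \<Longrightarrow> polyhom_converges Y L' \<Longrightarrow>
      polyhom_converges (\<lambda>j. polyhom_prod \<gamma> \<eta> \<kappa> (Y j) P) (polyhom_prod \<gamma> \<eta> \<kappa> L' P)"
proof -
  note G = haar_onD[OF \<gamma>] and H = haar_onD[OF \<eta>] and K = haar_onD[OF \<kappa>]
  note prodP = polyhom_prod_composed[OF lcG lcH lcK \<gamma> \<eta> \<kappa> rinv]
  {
    assume Q: "Q \<in> Polh \<eta> \<kappa>" and X: "\<And>j. X j \<in> Polh \<gamma> \<eta>" and L: "L \<in> Polh \<gamma> \<eta>" and c: "polyhom_converges X L"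
    show "polyhom_converges (\<lambda>j. polyhom_prod \<gamma> \<eta> \<kappa> Q (X j)) (polyhom_prod \<gamma> \<eta> \<kappa> Q L)"
    proof (rule polyhom_convergesI[OF lcG lcK \<gamma> \<kappa> prodP(1)[OF X Q] prodP(1)[OF L Q]])
      fix A :: "'g set" and B :: "'k set"
      assume AB: "A \<in> sets borel" "B \<in> sets borel" "emeasure \<gamma> A < \<infinity>" "emeasure \<kappa> B < \<infinity>"
      note dQ = Polh_dominated[OF Q]
      \<comment> \<open>The density \<open>u\<close> depends on \<open>Q\<close> and
        \<open>B\<close> only, so the masses for all \<open>X j\<close> are integrals of one fixed
        test function; its bound 1 admits it as the bounded factor in
        \<open>polyhom_converges_tensor\<close>.\<close>
      obtain u where u: "slice_density \<eta> (converse_measure (polyhom_measure Q)) B u"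
        using slice_density_exists[OF lcH H(1) dominated_marginals_converse[OF dQ] AB(2,4)] by blast
      have iu: "integrable \<eta> u"
        by (rule slice_density_integrable[OF u H(1) dominated_marginals_converse[OF dQ] AB(2,4)])
      have ub: "u \<in> borel_measurable borel" "\<And>h. 0 \<le> u h" "\<And>h. \<bar>u h\<bar> \<le> 1" using u by (auto simp: slice_density_def)
      have eq: "measure (polyhom_measure (polyhom_prod \<gamma> \<eta> \<kappa> Q P)) (A \<times> B) = (\<integral>z. indicat_real A (fst z) * u (snd z) \<partial>polyhom_measure P)"
        if P: "P \<in> Polh \<gamma> \<eta>" for P
      proof (rule composed_measure_integral[OF dominated_marginalsD(1)[OF Polh_dominated[OF P]] _ _ ub(1,2)])
        show "emeasure (polyhom_measure (polyhom_prod \<gamma> \<eta> \<kappa> Q P)) (A \<times> B) = (\<integral>\<^sup>+z. ennreal (indicat_real A (fst z)) * ennreal (u (snd z)) \<partial>polyhom_measure P)"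
          unfolding composed_rect_left[OF lcG lcH lcK \<gamma> \<eta> \<kappa> rinv Polh_dominated[OF P] dQ prodP(2)[OF P Q] AB(1,3,2,4) u]
          by (intro nn_integral_cong) (simp add: indicator_def)
      qed (use AB(1) in auto)
      have "(\<lambda>j. \<integral>z. indicat_real A (fst z) * u (snd z) \<partial>polyhom_measure (X j)) \<longlonglongrightarrow> (\<integral>z. indicat_real A (fst z) * u (snd z) \<partial>polyhom_measure L)"
        by (rule polyhom_converges_tensor[OF lcG lcH \<gamma> \<eta> X L c _ iu ub(3)]) (use AB G(2) in auto)
      then show "(\<lambda>j. measure (polyhom_measure (polyhom_prod \<gamma> \<eta> \<kappa> Q (X j))) (A \<times> B)) \<longlonglongrightarrow> measure (polyhom_measure (polyhom_prod \<gamma> \<eta> \<kappa> Q L)) (A \<times> B)"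
        by (simp add: eq X L)
    qed
  }
  {
    assume P: "P \<in> Polh \<gamma> \<eta>" and Y: "\<And>j. Y j \<in> Polh \<eta> \<kappa>" and L: "L' \<in> Polh \<eta> \<kappa>" and c: "polyhom_converges Y L'"
    show "polyhom_converges (\<lambda>j. polyhom_prod \<gamma> \<eta> \<kappa> (Y j) P) (polyhom_prod \<gamma> \<eta> \<kappa> L' P)"
    proof (rule polyhom_convergesI[OF lcG lcK \<gamma> \<kappa> prodP(1)[OF P Y] prodP(1)[OF P L]])
      fix A :: "'g set" and B :: "'k set"
      assume AB: "A \<in> sets borel" "B \<in> sets borel" "emeasure \<gamma> A < \<infinity>" "emeasure \<kappa> B < \<infinity>"
      note dP = Polh_dominated[OF P]
      \<comment> \<open>Here the density is the first factor of the test function, and the indicator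
        of \<open>B\<close> is the bounded one.\<close>
      obtain v where v: "slice_density \<eta> (polyhom_measure P) A v"
        using slice_density_exists[OF lcH H(1) dP AB(1,3)] by blast
      have iv: "integrable \<eta> v" by (rule slice_density_integrable[OF v H(1) dP AB(1,3)])
      have vb: "v \<in> borel_measurable borel" "\<And>h. 0 \<le> v h" using v by (auto simp: slice_density_def)
      have eq: "measure (polyhom_measure (polyhom_prod \<gamma> \<eta> \<kappa> Q P)) (A \<times> B) = (\<integral>z. v (fst z) * indicat_real B (snd z) \<partial>polyhom_measure Q)"
        if Q: "Q \<in> Polh \<eta> \<kappa>" for Q
      proof (rule composed_measure_integral[OF dominated_marginalsD(1)[OF Polh_dominated[OF Q]] vb])
        show "emeasure (polyhom_measure (polyhom_prod \<gamma> \<eta> \<kappa> Q P)) (A \<times> B) = (\<integral>\<^sup>+z. ennreal (v (fst z)) * ennreal (indicat_real B (snd z)) \<partial>polyhom_measure Q)"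
          unfolding composed_rect_right[OF lcG lcH lcK \<gamma> \<eta> \<kappa> rinv dP Polh_dominated[OF Q] prodP(2)[OF P Q] AB(1,3,2,4) v]
          by (intro nn_integral_cong) (simp add: indicator_def)
      qed (use AB(2) in auto)
      have "(\<lambda>j. \<integral>z. v (fst z) * indicat_real B (snd z) \<partial>polyhom_measure (Y j)) \<longlonglongrightarrow> (\<integral>z. v (fst z) * indicat_real B (snd z) \<partial>polyhom_measure L')"
      proof (rule polyhom_converges_tensor[OF lcH lcK \<eta> \<kappa> Y L c iv, where C = 1])
        show "integrable \<kappa> (indicat_real B)" using AB K(2) by auto
      qed (simp add: indicator_def)
      then show "(\<lambda>j. measure (polyhom_measure (polyhom_prod \<gamma> \<eta> \<kappa> (Y j) P)) (A \<times> B)) \<longlonglongrightarrow> measure (polyhom_measure (polyhom_prod \<gamma> \<eta> \<kappa> L' P)) (A \<times> B)"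
        by (simp add: eq Y L)
    qed
  }
qed

theorem proposition1p4:
  fixes \<gamma> :: "'g::{topological_group_add, t2_space, second_countable_topology} measure"
    and \<eta> :: "'h::{topological_group_add, t2_space, second_countable_topology} measure"
    and \<kappa> :: "'k::{topological_group_add, t2_space, second_countable_topology} measure"
  assumes "locally compact (UNIV :: 'g set)"
    and "locally compact (UNIV :: 'h set)"
    and "locally compact (UNIV :: 'k set)"
    and "unimodular_haar_measure \<gamma>"
    and "unimodular_haar_measure \<eta>"
    and "unimodular_haar_measure \<kappa>"
  shows
    "(\<exists>d. Metric_space (Polh \<gamma> \<eta>) d \<and>
          (\<forall>X L. (\<forall>j. X j \<in> Polh \<gamma> \<eta>) \<and> L \<in> Polh \<gamma> \<eta> \<longrightarrow>
             (polyhom_converges X L \<longleftrightarrow>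
              limitin (Metric_space.mtopology (Polh \<gamma> \<eta>) d) X L sequentially)) \<and>
          compact_space (Metric_space.mtopology (Polh \<gamma> \<eta>) d))
     \<and>
     (\<forall>R\<in>Polh \<gamma> \<eta>. \<forall>T\<in>Polh \<eta> \<kappa>. polyhom_prod \<gamma> \<eta> \<kappa> T R \<in> Polh \<gamma> \<kappa>) \<and>
     (\<forall>T\<in>Polh \<eta> \<kappa>. \<forall>X L. (\<forall>j. X j \<in> Polh \<gamma> \<eta>) \<and> L \<in> Polh \<gamma> \<eta> \<and> polyhom_converges X L \<longrightarrow>
        polyhom_converges (\<lambda>j. polyhom_prod \<gamma> \<eta> \<kappa> T (X j)) (polyhom_prod \<gamma> \<eta> \<kappa> T L)) \<and>
     (\<forall>R\<in>Polh \<gamma> \<eta>. \<forall>X L. (\<forall>j. X j \<in> Polh \<eta> \<kappa>) \<and> L \<in> Polh \<eta> \<kappa> \<and> polyhom_converges X L \<longrightarrow>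
        polyhom_converges (\<lambda>j. polyhom_prod \<gamma> \<eta> \<kappa> (X j) R) (polyhom_prod \<gamma> \<eta> \<kappa> L R))"
proof -
  note h = unimodular_haar[OF assms(4)] unimodular_haar[OF assms(5)] unimodular_haar[OF assms(6)]
  note facts = assms(1-3) h(1,3,5,4)
  show ?thesis
  proof (intro conjI ballI allI impI)
    show "\<exists>d. Metric_space (Polh \<gamma> \<eta>) d \<and>
          (\<forall>X L. (\<forall>j. X j \<in> Polh \<gamma> \<eta>) \<and> L \<in> Polh \<gamma> \<eta> \<longrightarrow>
             (polyhom_converges X L \<longleftrightarrow> limitin (Metric_space.mtopology (Polh \<gamma> \<eta>) d) X L sequentially)) \<and>
          compact_space (Metric_space.mtopology (Polh \<gamma> \<eta>) d)"
      by (rule polyhom_metrizable_compact[OF assms(1,2) h(1,3)])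
  next
    fix R T assume "R \<in> Polh \<gamma> \<eta>" "T \<in> Polh \<eta> \<kappa>"
    then show "polyhom_prod \<gamma> \<eta> \<kappa> T R \<in> Polh \<gamma> \<kappa>" by (rule polyhom_prod_composed(1)[OF facts])
  next
    fix T X L assume "T \<in> Polh \<eta> \<kappa>" "(\<forall>j. X j \<in> Polh \<gamma> \<eta>) \<and> L \<in> Polh \<gamma> \<eta> \<and> polyhom_converges X L"
    then show "polyhom_converges (\<lambda>j. polyhom_prod \<gamma> \<eta> \<kappa> T (X j)) (polyhom_prod \<gamma> \<eta> \<kappa> T L)"
      by (intro polyhom_prod_continuous(1)[OF facts]) auto
  next
    fix R X L assume "R \<in> Polh \<gamma> \<eta>" "(\<forall>j. X j \<in> Polh \<eta> \<kappa>) \<and> L \<in> Polh \<eta> \<kappa> \<and> polyhom_converges X L"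
    then show "polyhom_converges (\<lambda>j. polyhom_prod \<gamma> \<eta> \<kappa> (X j) R) (polyhom_prod \<gamma> \<eta> \<kappa> L R)"
      by (intro polyhom_prod_continuous(2)[OF facts]) auto
  qed
qed

end
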